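(* Every travelling wave solution of the Benjamin-Ono equation on $\mathbb{T}$ is orbitally stable in $H^{-s}_r$ for any $0\le s<1/2$. That is, if $v_0$ is the initial data of a travelling wave solution and $0\le s<1/2$, then for any $\varepsilon>0$ there exists $\delta>0$ so that for any $w_0\in H^{-s}_r$ with $\|w_0-v_0\|_{-s}<\delta$, one has $$\sup_{t\in\mathbb{R}}\inf_{\tau\in\mathbb{R}}\|\mathcal{S}(t,w_0)-v_0(\cdot+\tau)\|_{-s}<\varepsilon.$$
   Context: Let $\mathbb{T} = \mathbb{R}/2\pi\mathbb{Z}$, $\widehat f(n) = \frac{1}{2\pi}\int_0^{2\pi} f(x)e^{-inx}dx$ (extended to distributions), $\langle n\rangle = \max\{1,|n|\}$. For $\sigma\in\mathbb{R}$, $H^\sigma_r = H^\sigma(\mathbb{T},\mathbb{R})$ is the Sobolev space of real valued distributions with norm $\|v\|_\sigma = (\sum_{n\in\mathbb{Z}} \langle n\rangle^{2\sigma}|\widehat v(n)|^2)^{1/2}$. The Benjamin-Ono (BO) equation on $\mathbb{T}$ is $\partial_t v = H\partial_x^2 v - \partial_x(v^2)$ with $v(t,x)$ real valued, where $Hf(x) = \sum_{n\in\mathbb{Z}} -i\,\mathrm{sign}(n)\widehat f(n)e^{inx}$, $\mathrm{sign}(0)=0$. For $\sigma>3/2$ and $v_0\in H^\sigma_r$ there is a unique (classical) solution $\mathcal{S}(\cdot,v_0)\in C(\mathbb{R},H^\sigma_r)\cap C^1(\mathbb{R},H^{\sigma-2}_r)$ of the BO equation with initial data $v_0$. For $0\le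 s<1/2$ and $v_0\in H^{-s}_r$, $\mathcal{S}(\cdot,v_0)$ denotes the global in time solution, i.e. the continuous curve $\gamma:\mathbb{R}\to H^{-s}_r$ with $\gamma(0)=v_0$ such that for any sequence $(v_0^{(k)})_{k\ge1}$ in $H^\sigma_r$ with $\sigma>3/2$ converging to $v_0$ in $H^{-s}_r$, the classical solutions $\mathcal{S}(\cdot,v_0^{(k)})$ converge to $\gamma$ in $C(\mathbb{R},H^{-s}_r)$ (uniformly on compact time intervals). Such a solution exists for every $v_0 \in H^{-s}_r$. A travelling wave solution is a classical solution of the form $v(t,x)=v_0(x+\kappa t)$ for some $\kappa\in\mathbb{R}$. *)

theory Defs
  imports "HOL-Analysis.Analysis"
begin

section \<open>Test functions on the torus\<close>

definition smooth :: "(real \<Rightarrow> complex) \<Rightarrow> bool" where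
  "smooth f \<longleftrightarrow>
    (\<exists>D :: nat \<Rightarrow> real \<Rightarrow> complex. D 0 = f \<and> (\<forall>j x. (D j has_vector_derivative D (Suc j) x) (at x)))"

definition periodic :: "(real \<Rightarrow> complex) \<Rightarrow> bool" where
  "periodic f \<longleftrightarrow> (\<forall>x. f (x + 2 * pi) = f x)"

text \<open>Functions on \<open>\<real> / 2\<pi>\<int>\<close> are \<open>2\<pi>\<close>-periodic functions on \<open>\<real>\<close>.\<close>

typedef test_fun = "{f. smooth f \<and> periodic f}"
  morphisms tfun Abs_test_fun
proof
  show "(\<lambda>_. 0) \<in> {f. smooth f \<and> periodic f}"
    by (auto simp: smooth_def periodic_def intro!: exI[of _ "\<lambda>_ _. 0"])
qed

setup_lifting type_definition_test_fun

lift_definition test_add :: "test_fun \<Rightarrow> test_fun \<Rightarrow> test_fun" is "\<lambda>f g x. f x + g x"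
proof -
  fix f g :: "real \<Rightarrow> complex"
  assume f: "smooth f \<and> periodic f" and g: "smooth g \<and> periodic g"
  obtain D E where "D 0 = f" "\<And>j x. (D j has_vector_derivative D (Suc j) x) (at x)"
    "E 0 = g" "\<And>j x. (E j has_vector_derivative E (Suc j) x) (at x)"
    using f g unfolding smooth_def by metis
  then have "smooth (\<lambda>x. f x + g x)"
    unfolding smooth_def
    by (intro exI[of _ "\<lambda>j x. D j x + E j x"]) (auto intro!: derivative_intros)
  then show "smooth (\<lambda>x. f x + g x) \<and> periodic (\<lambda>x. f x + g x)"
    using f g by (simp add: periodic_def)
qed

lift_definition test_scale :: "complex \<Rightarrow> test_fun \<Rightarrow> test_fun" is "\<lambda>c f x. c * f x"
proof -
  fix c and f :: "real \<Rightarrow> complex"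
  assume f: "smooth f \<and> periodic f"
  obtain D where "D 0 = f" "\<And>j x. (D j has_vector_derivative D (Suc j) x) (at x)"
    using f unfolding smooth_def by blast
  then have "smooth (\<lambda>x. c * f x)"
    unfolding smooth_def
    by (intro exI[of _ "\<lambda>j x. c * D j x"]) (auto intro!: has_vector_derivative_mult_right)
  then show "smooth (\<lambda>x. c * f x) \<and> periodic (\<lambda>x. c * f x)"
    using f by (simp add: periodic_def)
qed

lift_definition test_deriv :: "test_fun \<Rightarrow> test_fun" is "\<lambda>f x. vector_derivative f (at x)"
proof -
  fix f :: "real \<Rightarrow> complex"
  assume f: "smooth f \<and> periodic f"
  obtain D where D: "D 0 = f" "\<And>j x. (D j has_vector_derivative D (Suc j) x) (at x)"
    using f unfolding smooth_def by blast
  have d: "(\<lambda>x. vector_derivative f (at x)) = D 1"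
    using D(2)[of 0] D(1) by (auto intro!: ext vector_derivative_at)
  have "smooth (D 1)"
    unfolding smooth_def by (intro exI[of _ "\<lambda>j. D (Suc j)"]) (use D in auto)
  moreover have "D 1 (x + 2 * pi) = D 1 x" for x
  proof -
    have "((D 0 \<circ> (\<lambda>x. x + 2 * pi)) has_vector_derivative 1 *\<^sub>R D 1 (x + 2 * pi)) (at x)"
      by (rule vector_diff_chain_at) (use D(2)[of 0 "x + 2 * pi"] in \<open>auto intro!: derivative_eq_intros\<close>)
    moreover have "D 0 \<circ> (\<lambda>x. x + 2 * pi) = D 0"
      using f D(1) by (auto simp: periodic_def)
    ultimately have "(D 0 has_vector_derivative D 1 (x + 2 * pi)) (at x)"
      by simp
    then show ?thesis
      using D(2)[of 0 x] by (simp add: vector_derivative_unique_at)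
  qed
  ultimately show "smooth (\<lambda>x. vector_derivative f (at x)) \<and> periodic (\<lambda>x. vector_derivative f (at x))"
    unfolding d by (simp add: periodic_def)
qed

lift_definition test_shift :: "real \<Rightarrow> test_fun \<Rightarrow> test_fun" is "\<lambda>\<tau> f x. f (x + \<tau>)"
proof -
  fix \<tau> and f :: "real \<Rightarrow> complex"
  assume f: "smooth f \<and> periodic f"
  obtain D where D: "D 0 = f" "\<And>j x. (D j has_vector_derivative D (Suc j) x) (at x)"
    using f unfolding smooth_def by blast
  have "((D j \<circ> (\<lambda>x. x + \<tau>)) has_vector_derivative 1 *\<^sub>R D (Suc j) (x + \<tau>)) (at x)" for j x
    by (rule vector_diff_chain_at) (use D(2)[of j "x + \<tau>"] in \<open>auto intro!: derivative_eq_intros\<close>)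
  then have "smooth (\<lambda>x. f (x + \<tau>))"
    unfolding smooth_def
    by (intro exI[of _ "\<lambda>j x. D j (x + \<tau>)"]) (use D(1) in \<open>auto simp: o_def\<close>)
  moreover have "f (x + 2 * pi + \<tau>) = f (x + \<tau>)" for x
    using f unfolding periodic_def by (metis add.assoc add.commute)
  ultimately show "smooth (\<lambda>x. f (x + \<tau>)) \<and> periodic (\<lambda>x. f (x + \<tau>))"
    by (simp add: periodic_def)
qed

lift_definition test_exp :: "int \<Rightarrow> test_fun" is "\<lambda>n x. exp (\<i> * of_int n * of_real x)"
proof -
  fix n :: int
  have "((\<lambda>x. (\<i> * of_int n) ^ j * exp (\<i> * of_int n * of_real x)) has_vector_derivative
      (\<i> * of_int n) ^ Suc j * exp (\<i> * of_int n * of_real x)) (at x)" for j and x :: real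
    by (rule has_vector_derivative_real_field) (auto intro!: derivative_eq_intros)
  then have "smooth (\<lambda>x. exp (\<i> * of_int n * of_real x))"
    unfolding smooth_def
    by (intro exI[of _ "\<lambda>j x. (\<i> * of_int n) ^ j * exp (\<i> * of_int n * of_real x)"]) auto
  moreover have "exp (\<i> * of_int n * of_real (x + 2 * pi)) = exp (\<i> * of_int n * of_real x)" for x :: real
  proof -
    have "\<i> * of_int n * of_real (x + 2 * pi) = \<i> * of_int n * of_real x + (2 * of_int n * pi) * \<i>"
      by (simp add: algebra_simps)
    then show ?thesis
      by (simp only: exp_add exp_integer_2pi[OF Ints_of_int] mult_1_right)
  qed
  ultimately show "smooth (\<lambda>x. exp (\<i> * of_int n * of_real x)) \<and>
      periodic (\<lambda>x. exp (\<i> * of_int n * of_real x))"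
    by (simp add: periodic_def)
qed


section \<open>Distributions on the torus\<close>

text \<open>
  Operations are defined on arbitrary functionals; being a distribution is a predicate. A functional
  is continuous for the Frechet topology of the test functions iff it is bounded by finitely many of
  the seminorms \<open>sup |\<phi>\<^sup>(\<^sup>j\<^sup>)|\<close>. The pairing is bilinear: a function \<open>f\<close> acts by
  \<open>\<phi> \<mapsto> \<integral> f \<phi>\<close> over one period.
\<close>

type_synonym functional = "test_fun \<Rightarrow> complex"

definition distribution :: "functional \<Rightarrow> bool" where
  "distribution u \<longleftrightarrow>
    (\<forall>\<phi> \<psi>. u (test_add \<phi> \<psi>) = u \<phi> + u \<psi>) \<and>
    (\<forall>c \<phi>. u (test_scale c \<phi>) = c * u \<phi>) \<and>
    (\<exists>C N. \<forall>\<phi>. cmod (u \<phi>) \<le> C * (\<Sum>j\<le>(N::nat). SUP x. cmod (tfun ((test_deriv ^^ j) \<phi>) x)))"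

definition real_valued :: "functional \<Rightarrow> bool" where
  "real_valued u \<longleftrightarrow> (\<forall>\<phi>. (\<forall>x. tfun \<phi> x \<in> \<real>) \<longrightarrow> u \<phi> \<in> \<real>)"

definition dist_of :: "(real \<Rightarrow> complex) \<Rightarrow> functional" where
  "dist_of f \<phi> = integral {0..2 * pi} (\<lambda>x. f x * tfun \<phi> x)"

definition fourier :: "functional \<Rightarrow> int \<Rightarrow> complex" where
  "fourier u n = u (test_exp (- n)) / (2 * pi)"

definition dderiv :: "functional \<Rightarrow> functional" where
  "dderiv u \<phi> = - u (test_deriv \<phi>)"

text \<open>\<open>dshift \<tau> u\<close> is \<open>u(\<cdot> + \<tau>)\<close>; on the test function the shift is by \<open>-\<tau>\<close>.\<close>

definition dshift :: "real \<Rightarrow> functional \<Rightarrow> functional" where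
  "dshift \<tau> u \<phi> = u (test_shift (- \<tau>) \<phi>)"

definition hilbert :: "functional \<Rightarrow> functional" where
  "hilbert u \<phi> = (\<Sum>\<^sub>\<infinity>n\<in>UNIV. - \<i> * of_int (sgn n) * fourier u n * dist_of (tfun (test_exp n)) \<phi>)"

text \<open>
  The square of a distribution is only used in \<open>H\<^sup>\<sigma>\<close> with \<open>\<sigma> > 3/2\<close>, where, by the Sobolev
  embedding, every distribution has a unique continuous representative.
\<close>

definition cont_rep :: "functional \<Rightarrow> real \<Rightarrow> complex" where
  "cont_rep u = (THE f. continuous_on UNIV f \<and> periodic f \<and> dist_of f = u)"

definition dsquare :: "functional \<Rightarrow> functional" where
  "dsquare u = dist_of (\<lambda>x. (cont_rep u x)\<^sup>2)"


section \<open>Sobolev spaces of real valued distributions\<close>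

definition jbracket :: "int \<Rightarrow> real" where
  "jbracket n = max 1 \<bar>of_int n\<bar>"

definition sobolev :: "real \<Rightarrow> functional set" where
  "sobolev \<sigma> = {u. distribution u \<and> real_valued u \<and>
    (\<lambda>n. jbracket n powr (2 * \<sigma>) * (cmod (fourier u n))\<^sup>2) summable_on UNIV}"

definition sobolev_norm :: "real \<Rightarrow> functional \<Rightarrow> real" where
  "sobolev_norm \<sigma> u = sqrt (\<Sum>\<^sub>\<infinity>n\<in>UNIV. jbracket n powr (2 * \<sigma>) * (cmod (fourier u n))\<^sup>2)"

definition sobolev_curve :: "real \<Rightarrow> (real \<Rightarrow> functional) \<Rightarrow> bool" where
  "sobolev_curve \<sigma> u \<longleftrightarrow>
    (\<forall>t. u t \<in> sobolev \<sigma>) \<and> (\<forall>t. ((\<lambda>r. sobolev_norm \<sigma> (u r - u t)) \<longlongrightarrow> 0) (at t))"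

definition has_sobolev_derivative ::
    "real \<Rightarrow> (real \<Rightarrow> functional) \<Rightarrow> functional \<Rightarrow> real \<Rightarrow> bool" where
  "has_sobolev_derivative \<sigma> u d t \<longleftrightarrow>
    ((\<lambda>h. sobolev_norm \<sigma> (\<lambda>\<phi>. (u (t + h) \<phi> - u t \<phi>) / of_real h - d \<phi>)) \<longlongrightarrow> 0) (at 0)"


section \<open>The Benjamin-Ono equation\<close>

definition bo_classical_solution :: "real \<Rightarrow> functional \<Rightarrow> (real \<Rightarrow> functional) \<Rightarrow> bool" where
  "bo_classical_solution \<sigma> v\<^sub>0 v \<longleftrightarrow>
    sobolev_curve \<sigma> v \<and> v 0 = v\<^sub>0 \<and>
    (\<exists>v'. sobolev_curve (\<sigma> - 2) v' \<and>
      (\<forall>t. has_sobolev_derivative (\<sigma> - 2) v (v' t) t \<and>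
        v' t = hilbert (dderiv (dderiv (v t))) - dderiv (dsquare (v t))))"

text \<open>
  \<open>bo_global_solution s v\<^sub>0 \<gamma>\<close> says that \<open>\<gamma>\<close> is \<open>S(\<cdot>, v\<^sub>0)\<close> in \<open>H\<^sup>-\<^sup>s\<close>. Classical solutions
  are unique, so \<open>v k\<close> below is the classical solution with initial data \<open>v\<^sub>0\<^sub>k k\<close>.
\<close>

definition bo_global_solution :: "real \<Rightarrow> functional \<Rightarrow> (real \<Rightarrow> functional) \<Rightarrow> bool" where
  "bo_global_solution s v\<^sub>0 \<gamma> \<longleftrightarrow>
    sobolev_curve (- s) \<gamma> \<and> \<gamma> 0 = v\<^sub>0 \<and>
    (\<forall>\<sigma> > 3/2. \<forall>v\<^sub>0\<^sub>k :: nat \<Rightarrow> functional.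
      (\<forall>k. v\<^sub>0\<^sub>k k \<in> sobolev \<sigma>) \<and> (\<lambda>k. sobolev_norm (- s) (v\<^sub>0\<^sub>k k - v\<^sub>0)) \<longlonglongrightarrow> 0 \<longrightarrow>
      (\<exists>v. (\<forall>k. bo_classical_solution \<sigma> (v\<^sub>0\<^sub>k k) (v k)) \<and>
        (\<forall>K. compact K \<longrightarrow>
          uniform_limit K (\<lambda>k t. sobolev_norm (- s) (v k t - \<gamma> t)) (\<lambda>_. 0) sequentially)))"

definition travelling_wave_data :: "functional \<Rightarrow> bool" where
  "travelling_wave_data v\<^sub>0 \<longleftrightarrow>
    (\<exists>\<sigma> > 3/2. \<exists>\<kappa>. bo_classical_solution \<sigma> v\<^sub>0 (\<lambda>t. dshift (\<kappa> * t) v\<^sub>0))"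

end

theory Submission
  imports Defs "HOL-Computational_Algebra.Fundamental_Theorem_Algebra"
begin

text \<open>
  Everything is done on Fourier coefficients. Let \<open>L\<^sub>u = D - \<Pi> u\<close> be the Lax operator on the Hardy space,
  understood as a quadratic form for \<open>u \<in> H\<^sup>-\<^sup>s\<close>, \<open>s < 1/2\<close>. The function
  \<open>\<H>(u, k) = \<langle>(L\<^sub>u + k)\<^sup>-\<^sup>1 1, 1\<rangle>\<close>, \<open>k\<close> large, is continuous in \<open>u \<in> H\<^sup>-\<^sup>s\<close> and is conserved by classical
  solutions. Its leading term for large \<open>k\<close> controls \<open>\<langle>(D + k)\<^sup>-\<^sup>1 \<Pi>u, \<Pi>u\<rangle>\<close>; this bounds orbits in \<open>H\<^sup>-\<^sup>s\<close> and
  keeps them tight at high frequencies, so if the initial data converge in \<open>H\<^sup>-\<^sup>s\<close> to a travelling wave \<open>v\<close>,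
  then arbitrary time slices have a subsequence converging to some \<open>u\<close>, with \<open>\<H>(u, k) = \<H>(v, k)\<close> for all
  large \<open>k\<close>. (For \<open>s = 0\<close> the limit is first taken in \<open>H\<^sup>-\<^sup>1\<^sup>/\<^sup>4\<close>; convergence in \<open>L\<^sup>2\<close> follows because the norm
  does not increase.)

  For a travelling wave the constant function \<open>1\<close> is a sum of at most two eigenvectors of \<open>L\<^sub>v\<close>. Since
  \<open>\<H>(u, \<cdot>)\<close> determines the Gram matrix of the vectors \<open>(L\<^sub>u + k)\<^sup>-\<^sup>1 1\<close>, the same holds for \<open>u\<close>, with the same
  eigenvalues and weights. A potential of this kind is determined up to translation by these data, because
  the zero of \<open>\<langle>(L\<^sub>u - \<mu>)\<^sup>-\<^sup>1 1, 1\<rangle>\<close> yields a vector that is a shifted multiple of the first eigenvector.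
  So \<open>u\<close> is a translate of \<open>v\<close>, and stability follows by contradiction.
\<close>

section \<open>Square summable families\<close>

text \<open>The restriction s < 1/2 enters through one inequality: relative to the form of D + k,
  multiplication by u is Hilbert-Schmidt with norm at most \<open>eps s k * neg_norm s k u\<close>,
  and \<open>eps s k\<close> tends to 0 as k grows. Resolvents thus exist by a Neumann series once k
  is large, and no spectral theory of unbounded operators is used: all that is learnt about the
  limit potential comes from resolvents at large real k. A spectral decomposition of 1 into two
  parts is visible there as a linear relation between 1 and two resolvent vectors.

  How large k must be depends on a bound for the orbit, which itself comes from conservation; a
  continuity argument closes this circle. Conservation is proved for H^3 solutions, so a
  contradicting orbit is first replaced by a classical one that is close to it at time 0 and at the
  bad time.

  The number two comes from a quadratic: for a travelling wave \<open>hank v\<close> equals - L^2 +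
  c L - C on the cyclic space of 1, and each zero mu of the resolvent function, between two
  eigenvalues, must have an eigenvalue l < mu with l + mu = c. Three eigenvalues would give two
  zeros and no partner for the second.\<close>

definition l2 :: "('a \<Rightarrow> 'b::real_normed_vector) \<Rightarrow> bool" where
  "l2 x \<longleftrightarrow> (\<lambda>n. (norm (x n))\<^sup>2) summable_on UNIV"

text \<open>A family that is not summable has the sum 0, so a bound on \<open>nrm\<close> carries
  information only together with \<open>l2\<close>.\<close>

definition nrm :: "('a \<Rightarrow> 'b::real_normed_vector) \<Rightarrow> real" where
  "nrm x = sqrt (\<Sum>\<^sub>\<infinity>n. (norm (x n))\<^sup>2)"

definition ip :: "('a \<Rightarrow> complex) \<Rightarrow> ('a \<Rightarrow> complex) \<Rightarrow> complex" where
  "ip x y = (\<Sum>\<^sub>\<infinity>n. x n * cnj (y n))"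

definition unit_vec :: "'a \<Rightarrow> 'a \<Rightarrow> complex" where
  "unit_vec a n = (if n = a then 1 else 0)"

lemma nrm_nonneg [simp]: "nrm x \<ge> 0"
  by (simp add: nrm_def infsum_nonneg)

lemma nrm_power2: "(nrm x)\<^sup>2 = (\<Sum>\<^sub>\<infinity>n. (norm (x n))\<^sup>2)"
  by (simp add: nrm_def infsum_nonneg)

lemma L2_set_le_nrm:
  assumes "l2 x" "finite F"
  shows "L2_set (\<lambda>n. norm (x n)) F \<le> nrm x"
  unfolding L2_set_def nrm_def
  using finite_sum_le_infsum[of "\<lambda>n. (norm (x n))\<^sup>2" UNIV F] assms by (simp add: l2_def)

text \<open>The terms are nonnegative, so a uniform bound on finite pieces gives summability and the
  norm bound at once. Later passages to a pointwise limit are of this Fatou type.\<close>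

lemma l2_bddI:
  assumes "\<And>F. finite F \<Longrightarrow> L2_set (\<lambda>n. norm (x n)) F \<le> C"
  shows "l2 x" "nrm x \<le> C"
proof -
  have C: "C \<ge> 0"
    using assms[of "{}"] by simp
  have *: "(\<Sum>n\<in>F. (norm (x n))\<^sup>2) \<le> C\<^sup>2" if "finite F" for F
    using assms[OF that] C unfolding L2_set_def by (metis real_sqrt_le_iff real_sqrt_unique)
  show l: "l2 x"
    unfolding l2_def using * by (intro nonneg_bdd_above_summable_on) (auto simp: bdd_above_def)
  show "nrm x \<le> C"
    using l * C unfolding nrm_def l2_def
    by (intro real_le_lsqrt infsum_le_finite_sums) (auto simp: infsum_nonneg)
qed

lemma l2_mono:
  assumes "l2 y" "\<And>n. norm (x n) \<le> norm (y n)"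
  shows "l2 x" "nrm x \<le> nrm y"
proof -
  have "L2_set (\<lambda>n. norm (x n)) F \<le> nrm y" if "finite F" for F
    using L2_set_mono[of F "\<lambda>n. norm (x n)" "\<lambda>n. norm (y n)"] L2_set_le_nrm[OF assms(1) that] assms(2)
    by simp
  then show "l2 x" "nrm x \<le> nrm y"
    by (auto intro: l2_bddI)
qed

lemma l2_cong_norm:
  assumes "\<And>n. norm (x n) = norm (y n)"
  shows "l2 x \<longleftrightarrow> l2 y" "nrm x = nrm y"
  using assms by (simp_all add: l2_def nrm_def)

lemma l2_norm [simp]: "l2 (\<lambda>n. norm (x n)) \<longleftrightarrow> l2 x" "nrm (\<lambda>n. norm (x n)) = nrm x"
  by (simp_all add: l2_def nrm_def)

lemma norm_le_nrm: "l2 x \<Longrightarrow> norm (x n) \<le> nrm x"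
  using L2_set_le_nrm[of x "{n}"] by (simp add: L2_set_def)

lemma nrm_eq_0: "l2 x \<Longrightarrow> nrm x = 0 \<Longrightarrow> x n = 0"
  using norm_le_nrm[of x n] by simp

lemma l2_add [intro]:
  assumes "l2 x" "l2 y"
  shows "l2 (\<lambda>n. x n + y n)" and nrm_triangle: "nrm (\<lambda>n. x n + y n) \<le> nrm x + nrm y"
proof -
  have "L2_set (\<lambda>n. norm (x n + y n)) F \<le> nrm x + nrm y" if "finite F" for F
  proof -
    have "L2_set (\<lambda>n. norm (x n + y n)) F \<le> L2_set (\<lambda>n. norm (x n) + norm (y n)) F"
      by (intro L2_set_mono) (auto intro: norm_triangle_ineq)
    also have "\<dots> \<le> L2_set (\<lambda>n. norm (x n)) F + L2_set (\<lambda>n. norm (y n)) F"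
      by (rule L2_set_triangle_ineq)
    finally show ?thesis
      using L2_set_le_nrm[OF assms(1) that] L2_set_le_nrm[OF assms(2) that] by linarith
  qed
  then show "l2 (\<lambda>n. x n + y n)" "nrm (\<lambda>n. x n + y n) \<le> nrm x + nrm y"
    by (auto intro: l2_bddI)
qed

lemma l2_uminus [intro]: "l2 x \<Longrightarrow> l2 (\<lambda>n. - x n)"
  by (simp add: l2_def)

lemma l2_diff [intro]:
  assumes "l2 x" "l2 y"
  shows "l2 (\<lambda>n. x n - y n)" and nrm_triangle_diff: "nrm (\<lambda>n. x n - y n) \<le> nrm x + nrm y"
  using l2_add[OF assms(1), of "\<lambda>n. - y n"] nrm_triangle[OF assms(1), of "\<lambda>n. - y n"] assms(2)
  by (auto simp: l2_def nrm_def)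

lemma l2_0 [intro, simp]: "l2 (\<lambda>n. 0)"
  by (simp add: l2_def)

lemma nrm_0 [simp]: "nrm (\<lambda>n. 0) = 0"
  by (simp add: nrm_def)

lemma l2_scale [intro]: "l2 x \<Longrightarrow> l2 (\<lambda>n. (c::'b::real_normed_field) * x n)"
  by (auto simp: l2_def norm_mult power_mult_distrib intro: summable_on_cmult_right)

lemma nrm_scale: "nrm (\<lambda>n. (c::'b::real_normed_field) * x n) = norm c * nrm x"
proof -
  have "nrm (\<lambda>n. c * x n) = sqrt ((norm c)\<^sup>2 * (\<Sum>\<^sub>\<infinity>n. (norm (x n))\<^sup>2))"
    by (simp add: nrm_def norm_mult power_mult_distrib infsum_cmult_right')
  then show ?thesis
    by (simp add: real_sqrt_mult nrm_def)
qed

lemma l2_finite_support: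
  assumes "finite F" "\<And>n. n \<notin> F \<Longrightarrow> x n = 0"
  shows "l2 x"
  unfolding l2_def
  by (rule summable_on_cong_neutral[THEN iffD1, of _ F _ "\<lambda>n. (norm (x n))\<^sup>2"])
    (use assms in auto)

lemma l2_unit_vec [intro, simp]: "l2 (unit_vec a)"
  by (rule l2_finite_support[of "{a}"]) (auto simp: unit_vec_def)

lemma l2_reindex:
  assumes "bij f"
  shows "l2 (\<lambda>n. x (f n)) \<longleftrightarrow> l2 x" "nrm (\<lambda>n. x (f n)) = nrm x"
  using summable_on_reindex_bij_betw[OF assms, of "\<lambda>n. (norm (x n))\<^sup>2"]
    infsum_reindex_bij_betw[OF assms, of "\<lambda>n. (norm (x n))\<^sup>2"]
  by (simp_all add: l2_def nrm_def)

lemma infsum_reindex_bij: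
  assumes "bij f"
  shows "(\<Sum>\<^sub>\<infinity>n. x (f n)) = infsum x UNIV"
  using infsum_reindex_bij_betw[OF assms] .

lemma Cauchy_Schwarz_summable:
  assumes "l2 x" "l2 y"
  shows "(\<lambda>n. norm (x n) * norm (y n)) summable_on UNIV"
    and Cauchy_Schwarz_infsum: "(\<Sum>\<^sub>\<infinity>n. norm (x n) * norm (y n)) \<le> nrm x * nrm y"
proof -
  have *: "(\<Sum>n\<in>F. norm (x n) * norm (y n)) \<le> nrm x * nrm y" if "finite F" for F
  proof -
    have "(\<Sum>n\<in>F. norm (x n) * norm (y n))
        \<le> L2_set (\<lambda>n. norm (x n)) F * L2_set (\<lambda>n. norm (y n)) F"
      using L2_set_mult_ineq[of "\<lambda>n. norm (x n)" "\<lambda>n. norm (y n)" F] by simp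
    also have "\<dots> \<le> nrm x * nrm y"
      using L2_set_le_nrm[OF assms(1) that] L2_set_le_nrm[OF assms(2) that]
      by (intro mult_mono) auto
    finally show ?thesis .
  qed
  show s: "(\<lambda>n. norm (x n) * norm (y n)) summable_on UNIV"
    using * by (intro nonneg_bdd_above_summable_on) (auto simp: bdd_above_def)
  show "(\<Sum>\<^sub>\<infinity>n. norm (x n) * norm (y n)) \<le> nrm x * nrm y"
    using * s by (intro infsum_le_finite_sums) auto
qed

lemma ip_abs_summable:
  assumes "l2 x" "l2 y"
  shows "(\<lambda>n. norm (x n * cnj (y n))) summable_on UNIV"
  using Cauchy_Schwarz_summable[OF assms] by (simp add: norm_mult)

lemma ip_summable:
  assumes "l2 x" "l2 y"
  shows "(\<lambda>n. x n * cnj (y n)) summable_on UNIV"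
  using ip_abs_summable[OF assms] by (rule abs_summable_summable)

lemma norm_ip_le:
  assumes "l2 x" "l2 y"
  shows "norm (ip x y) \<le> nrm x * nrm y"
proof -
  have "norm (ip x y) \<le> (\<Sum>\<^sub>\<infinity>n. norm (x n * cnj (y n)))"
    unfolding ip_def using ip_abs_summable[OF assms] by (rule norm_infsum_bound)
  then show ?thesis
    using Cauchy_Schwarz_infsum[OF assms] by (simp add: norm_mult)
qed

lemma ip_add_left: "l2 x \<Longrightarrow> l2 y \<Longrightarrow> l2 z \<Longrightarrow> ip (\<lambda>n. x n + y n) z = ip x z + ip y z"
  unfolding ip_def by (simp add: ring_distribs infsum_add ip_summable)

lemma ip_cnj: "cnj (ip x y) = ip y x"
  unfolding ip_def by (simp flip: infsum_cnj add: mult.commute)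

lemma ip_scale_left: "ip (\<lambda>n. c * x n) y = c * ip x y"
  unfolding ip_def by (simp add: mult.assoc infsum_cmult_right')

lemma ip_scale_right: "ip x (\<lambda>n. c * y n) = cnj c * ip x y"
  unfolding ip_cnj[of _ x, symmetric] by (simp add: ip_scale_left)

lemma ip_add_right: "l2 x \<Longrightarrow> l2 y \<Longrightarrow> l2 z \<Longrightarrow> ip z (\<lambda>n. x n + y n) = ip z x + ip z y"
  unfolding ip_cnj[of _ z, symmetric] by (simp add: ip_add_left)

lemma ip_uminus_left: "ip (\<lambda>n. - x n) y = - ip x y"
  using ip_scale_left[of "-1" x y] by simp

lemma ip_uminus_right: "ip x (\<lambda>n. - y n) = - ip x y"
  using ip_scale_right[of x "-1" y] by simp

lemma ip_diff_left: "l2 x \<Longrightarrow> l2 y \<Longrightarrow> l2 z \<Longrightarrow> ip (\<lambda>n. x n - y n) z = ip x z - ip y z"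
  using ip_add_left[of x "\<lambda>n. - y n" z] by (simp add: ip_uminus_left l2_uminus)

lemma ip_diff_right: "l2 x \<Longrightarrow> l2 y \<Longrightarrow> l2 z \<Longrightarrow> ip z (\<lambda>n. x n - y n) = ip z x - ip z y"
  using ip_add_right[of x "\<lambda>n. - y n" z] by (simp add: ip_uminus_right l2_uminus)

lemmas ip_linear = ip_add_left ip_add_right ip_diff_left ip_diff_right ip_uminus_left
  ip_uminus_right ip_scale_left ip_scale_right

lemma ip_0 [simp]: "ip (\<lambda>n. 0) y = 0" "ip x (\<lambda>n. 0) = 0"
  by (simp_all add: ip_def)

lemma ip_self:
  assumes "l2 x"
  shows "ip x x = of_real ((nrm x)\<^sup>2)"
proof -
  have "((\<lambda>n. complex_of_real ((norm (x n))\<^sup>2)) has_sum of_real ((nrm x)\<^sup>2)) UNIV"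
    using assms unfolding nrm_power2 l2_def by (intro has_sum_of_real has_sum_infsum)
  then show ?thesis
    unfolding ip_def complex_norm_square by (rule infsumI)
qed

lemma ip_unit_vec_right [simp]: "ip x (unit_vec a) = x a"
proof -
  have "ip x (unit_vec a) = (\<Sum>\<^sub>\<infinity>n\<in>{a}. x n)"
    unfolding ip_def by (rule infsum_cong_neutral) (auto simp: unit_vec_def)
  then show ?thesis by simp
qed

lemma ip_unit_vec_left [simp]: "ip (unit_vec a) x = cnj (x a)"
  by (metis ip_cnj ip_unit_vec_right)

lemma l2_sum [intro]: "(\<And>i. i \<in> I \<Longrightarrow> l2 (x i)) \<Longrightarrow> l2 (\<lambda>n. \<Sum>i\<in>I. x i n)"
  by (induction I rule: infinite_finite_induct) (auto intro!: l2_add)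

lemma ip_sum_left:
  "(\<And>i. i \<in> I \<Longrightarrow> l2 (x i)) \<Longrightarrow> l2 y \<Longrightarrow> ip (\<lambda>n. \<Sum>i\<in>I. x i n) y = (\<Sum>i\<in>I. ip (x i) y)"
  by (induction I rule: infinite_finite_induct) (auto simp: ip_add_left l2_sum)

lemma ip_sum_right:
  "(\<And>i. i \<in> I \<Longrightarrow> l2 (x i)) \<Longrightarrow> l2 y \<Longrightarrow> ip y (\<lambda>n. \<Sum>i\<in>I. x i n) = (\<Sum>i\<in>I. ip y (x i))"
  by (induction I rule: infinite_finite_induct) (auto simp: ip_add_right l2_sum)

section \<open>Convolution of Fourier sequences\<close>

definition conv :: "(int \<Rightarrow> complex) \<Rightarrow> (int \<Rightarrow> complex) \<Rightarrow> int \<Rightarrow> complex" where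
  "conv w x n = (\<Sum>\<^sub>\<infinity>m. w (n - m) * x m)"

text \<open>\<open>conv\<close> silently takes the value 0 at an index where its series is not
  summable; additivity therefore carries this side condition.\<close>

definition convable :: "(int \<Rightarrow> complex) \<Rightarrow> (int \<Rightarrow> complex) \<Rightarrow> bool" where
  "convable w x \<longleftrightarrow> (\<forall>n. (\<lambda>m. w (n - m) * x m) summable_on UNIV)"

definition l1 :: "(int \<Rightarrow> complex) \<Rightarrow> bool" where
  "l1 w \<longleftrightarrow> (\<lambda>n. norm (w n)) summable_on UNIV"

definition herm :: "(int \<Rightarrow> complex) \<Rightarrow> bool" where
  "herm u \<longleftrightarrow> (\<forall>n. u (- n) = cnj (u n))"

text \<open>For a rough potential \<open>w\<close> the sequence \<open>conv w x\<close> need not be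
  square summable. Absolute convergence of the double sum \<open>tf\<close> still gives a meaning to
  its pairing with \<open>y\<close> and permits Fubini.\<close>

definition pairable :: "(int \<Rightarrow> complex) \<Rightarrow> (int \<Rightarrow> complex) \<Rightarrow> (int \<Rightarrow> complex) \<Rightarrow> bool" where
  "pairable w x y \<longleftrightarrow> (\<lambda>(n, m). norm (w (n - m)) * norm (x m) * norm (y n)) summable_on UNIV"

definition tf :: "(int \<Rightarrow> complex) \<Rightarrow> (int \<Rightarrow> complex) \<Rightarrow> (int \<Rightarrow> complex) \<Rightarrow> complex" where
  "tf w x y = (\<Sum>\<^sub>\<infinity>(n, m). w (n - m) * x m * cnj (y n))"

text \<open>This is -i d/dx on the Fourier side; \<open>abs_dd\<close> below is its modulus, which
  is H d/dx.\<close>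

definition dd :: "(int \<Rightarrow> complex) \<Rightarrow> int \<Rightarrow> complex" where
  "dd x n = of_int n * x n"

definition abs_dd :: "(int \<Rightarrow> complex) \<Rightarrow> int \<Rightarrow> complex" where
  "abs_dd x n = of_int \<bar>n\<bar> * x n"

section \<open>Double sums and the trilinear pairing\<close>

lemma bij_reflect [simp]: "bij (\<lambda>m :: int. n - m)"
  by (rule o_bij[of "\<lambda>m. n - m"]) auto

lemma summable_on_Sigma_nonneg:
  fixes f :: "'a \<times> 'b \<Rightarrow> real"
  assumes "\<And>p. f p \<ge> 0" "\<And>n. (\<lambda>m. f (n, m)) summable_on UNIV"
    "(\<lambda>n. \<Sum>\<^sub>\<infinity>m. f (n, m)) summable_on UNIV"
  shows "f summable_on UNIV"
    and infsum_Sigma_nonneg: "(\<Sum>\<^sub>\<infinity>p. f p) = (\<Sum>\<^sub>\<infinity>n. \<Sum>\<^sub>\<infinity>m. f (n, m))"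
proof -
  have "(\<lambda>p. norm (f p)) summable_on Sigma UNIV (\<lambda>_. UNIV)"
    unfolding Infinite_Sum.abs_summable_on_Sigma_iff using assms by (auto simp: infsum_nonneg)
  then show s: "f summable_on UNIV"
    using assms(1) by simp
  then show "(\<Sum>\<^sub>\<infinity>p. f p) = (\<Sum>\<^sub>\<infinity>n. \<Sum>\<^sub>\<infinity>m. f (n, m))"
    using infsum_Sigma_banach[of f UNIV "\<lambda>_. UNIV"] by simp
qed

lemma Fubini_UNIV:
  fixes f :: "'a \<times> 'b \<Rightarrow> complex"
  assumes "(\<lambda>p. norm (f p)) summable_on UNIV"
  shows "(\<Sum>\<^sub>\<infinity>n. \<Sum>\<^sub>\<infinity>m. f (n, m)) = infsum f UNIV"
    and Fubini_UNIV_summable: "(\<lambda>n. \<Sum>\<^sub>\<infinity>m. f (n, m)) summable_on UNIV"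
    and Fubini_UNIV_row: "(\<lambda>m. f (n, m)) summable_on UNIV"
proof -
  have s: "f summable_on Sigma UNIV (\<lambda>_. UNIV)"
    using abs_summable_summable[OF assms] by simp
  show "(\<Sum>\<^sub>\<infinity>n. \<Sum>\<^sub>\<infinity>m. f (n, m)) = infsum f UNIV"
    using infsum_Sigma_banach[OF s] by simp
  show "(\<lambda>n. \<Sum>\<^sub>\<infinity>m. f (n, m)) summable_on UNIV"
    using summable_on_Sigma_banach[of "\<lambda>n m. f (n, m)"] s by simp
  show "(\<lambda>m. f (n, m)) summable_on UNIV"
    using summable_on_SigmaD1[of "\<lambda>n m. f (n, m)" UNIV "\<lambda>_. UNIV" n] s by simp
qed

lemma Fubini_swap:
  fixes f :: "'a \<times> 'b \<Rightarrow> complex"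
  assumes "(\<lambda>p. norm (f p)) summable_on UNIV"
  shows "(\<Sum>\<^sub>\<infinity>n. \<Sum>\<^sub>\<infinity>m. f (n, m)) = (\<Sum>\<^sub>\<infinity>m. \<Sum>\<^sub>\<infinity>n. f (n, m))"
  using infsum_swap_banach[of "\<lambda>n m. f (n, m)" UNIV UNIV] abs_summable_summable[OF assms] by simp

lemma pairable_norm:
  "pairable w x y \<longleftrightarrow> (\<lambda>p. norm ((\<lambda>(n, m). w (n - m) * x m * cnj (y n)) p)) summable_on UNIV"
  by (simp add: pairable_def case_prod_unfold norm_mult)

lemma pairable_ip:
  assumes "pairable w x y"
  shows "ip (conv w x) y = tf w x y"
    and pairable_summable: "(\<lambda>n. conv w x n * cnj (y n)) summable_on UNIV"
  using Fubini_UNIV[OF assms[unfolded pairable_norm]] Fubini_UNIV_summable[OF assms[unfolded pairable_norm]]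
  by (simp_all add: ip_def tf_def conv_def infsum_cmult_left')

lemma pairable_swap:
  assumes "herm w" "pairable w x y"
  shows "pairable w y x" and tf_swap: "tf w y x = cnj (tf w x y)"
proof -
  have h: "norm (w (m - n)) = norm (w (n - m))" "w (m - n) = cnj (w (n - m))" for m n
    using assms(1) unfolding herm_def by (metis complex_mod_cnj minus_diff_eq)+
  have b: "bij prod.swap"
    by (rule bij_swap)
  have e1: "(\<lambda>(n, m). norm (w (n - m)) * norm (y m) * norm (x n))
      = (\<lambda>p. (\<lambda>(n, m). norm (w (n - m)) * norm (x m) * norm (y n)) (prod.swap p))"
    (is "?l = ?r")
  proof
    fix p :: "int \<times> int"
    show "?l p = ?r p"
      using h(1)[of "fst p" "snd p"] by (cases p) simp
  qed
  show "pairable w y x"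
    using assms(2) unfolding pairable_def e1
    using summable_on_reindex_bij_betw[OF b, of "\<lambda>(n, m). norm (w (n - m)) * norm (x m) * norm (y n)"]
    by blast
  have e2: "(\<lambda>(n, m). w (n - m) * y m * cnj (x n))
      = (\<lambda>p. (\<lambda>(n, m). cnj (w (n - m) * x m * cnj (y n))) (prod.swap p))"
    (is "?l = ?r")
  proof
    fix p :: "int \<times> int"
    show "?l p = ?r p"
      using h(2)[of "fst p" "snd p"] by (cases p) simp
  qed
  have "tf w y x = infsum (\<lambda>p. cnj ((\<lambda>(n, m). w (n - m) * x m * cnj (y n)) p)) UNIV"
    unfolding tf_def e2
    using infsum_reindex_bij[OF b, of "\<lambda>(n, m). cnj (w (n - m) * x m * cnj (y n))"]
    by (simp add: case_prod_unfold)
  then show "tf w y x = cnj (tf w x y)"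
    unfolding tf_def infsum_cnj .
qed

lemma ip_conv_herm:
  assumes "herm w" "pairable w x y"
  shows "ip (conv w x) y = ip x (conv w y)"
  using pairable_ip[OF assms(2)] pairable_ip[OF pairable_swap(1)[OF assms]] tf_swap[OF assms]
  by (metis ip_cnj complex_cnj_cnj)

text \<open>After the substitution of \<open>(n - m, m)\<close> for \<open>(n, m)\<close>, each
  fixed difference contributes a Cauchy-Schwarz product of \<open>x\<close> with a translate of
  \<open>y\<close>, and translates have the same norm. This is Young's inequality tested against
  \<open>y\<close>.\<close>

lemma l1_pairable:
  assumes "l1 w" "l2 x" "l2 y"
  shows "pairable w x y"
    and l1_pairing_bound: "(\<Sum>\<^sub>\<infinity>(n, m). norm (w (n - m)) * norm (x m) * norm (y n))
      \<le> (\<Sum>\<^sub>\<infinity>n. norm (w n)) * nrm x * nrm y"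
proof -
  define f where "f = (\<lambda>(k, m). norm (w k) * (norm (x m) * norm (y (k + m))))"
  have y: "l2 (\<lambda>m. y (k + m))" "nrm (\<lambda>m. y (k + m)) = nrm y" for k
    using l2_reindex[of "\<lambda>m. k + m" y] assms(3) by (auto simp: bij_plus_right add.commute)
  have row: "(\<lambda>m. f (k, m)) summable_on UNIV"
    and le: "(\<Sum>\<^sub>\<infinity>m. f (k, m)) \<le> norm (w k) * (nrm x * nrm y)" for k
    using Cauchy_Schwarz_summable[OF assms(2) y(1)[of k]] Cauchy_Schwarz_infsum[OF assms(2) y(1)[of k]]
    by (auto simp: f_def y(2) infsum_cmult_right' intro!: summable_on_cmult_right mult_left_mono)
  have sw: "(\<lambda>k. norm (w k) * (nrm x * nrm y)) summable_on UNIV"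
    using assms(1) unfolding l1_def by (rule summable_on_cmult_left)
  have f0: "f p \<ge> 0" for p
    by (auto simp: f_def split: prod.split)
  have tot: "(\<lambda>k. \<Sum>\<^sub>\<infinity>m. f (k, m)) summable_on UNIV"
    by (rule summable_on_comparison_test[OF sw]) (use le f0 in \<open>auto intro!: infsum_nonneg\<close>)
  have b: "bij (\<lambda>(n, m). (n - m, m :: int))"
    by (rule o_bij[of "\<lambda>(k, m). (k + m, m)"]) auto
  have eq: "(\<lambda>(n, m). norm (w (n - m)) * norm (x m) * norm (y n)) = (\<lambda>p. f ((\<lambda>(n, m). (n - m, m)) p))"
    by (auto simp: f_def fun_eq_iff)
  have s: "f summable_on UNIV"
    by (rule summable_on_Sigma_nonneg[OF f0 row tot])
  then show "pairable w x y"
    unfolding pairable_def eq using summable_on_reindex_bij_betw[OF b, of f] by simp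
  have "(\<Sum>\<^sub>\<infinity>(n, m). norm (w (n - m)) * norm (x m) * norm (y n)) = infsum f UNIV"
    unfolding eq by (rule infsum_reindex_bij[OF b])
  also have "\<dots> = (\<Sum>\<^sub>\<infinity>k. \<Sum>\<^sub>\<infinity>m. f (k, m))"
    by (rule infsum_Sigma_nonneg[OF f0 row tot])
  also have "\<dots> \<le> (\<Sum>\<^sub>\<infinity>k. norm (w k) * (nrm x * nrm y))"
    by (rule infsum_mono[OF tot sw]) (rule le)
  also have "\<dots> = (\<Sum>\<^sub>\<infinity>n. norm (w n)) * nrm x * nrm y"
    by (simp add: infsum_cmult_left')
  finally show "(\<Sum>\<^sub>\<infinity>(n, m). norm (w (n - m)) * norm (x m) * norm (y n))
      \<le> (\<Sum>\<^sub>\<infinity>n. norm (w n)) * nrm x * nrm y" .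
qed

lemma norm_tf_le_infsum:
  assumes "pairable w x y"
  shows "norm (tf w x y) \<le> (\<Sum>\<^sub>\<infinity>(n, m). norm (w (n - m)) * norm (x m) * norm (y n))"
  using norm_infsum_bound[OF assms[unfolded pairable_norm]]
  by (simp add: tf_def case_prod_unfold norm_mult)

lemma pairable_convable:
  assumes "\<And>n. pairable w x (unit_vec n)"
  shows "convable w x"
  unfolding convable_def
proof
  fix n
  show "(\<lambda>m. w (n - m) * x m) summable_on UNIV"
    using Fubini_UNIV_row[OF assms[of n, unfolded pairable_norm], of n] by (simp add: unit_vec_def)
qed

lemma l1_convable:
  assumes "l1 w" "l2 x"
  shows "convable w x"
  by (intro pairable_convable l1_pairable assms l2_unit_vec)

text \<open>Testing against the truncations of \<open>x\<close> itself is enough, so only finitely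
  supported \<open>y\<close> occur. In this way an operator given by a bounded form can be estimated
  before its values are known to be square summable.\<close>

lemma l2_dualityI:
  assumes "C \<ge> 0" and bd: "\<And>y. finite {n. y n \<noteq> 0} \<Longrightarrow> norm (ip x y) \<le> C * nrm y"
  shows "l2 x" "nrm x \<le> C"
proof -
  have "L2_set (\<lambda>n. norm (x n)) F \<le> C" if "finite F" for F
  proof -
    define y where "y = (\<lambda>n. if n \<in> F then x n else 0)"
    have fin: "finite {n. y n \<noteq> 0}"
      by (rule finite_subset[OF _ that]) (auto simp: y_def)
    have l: "l2 y"
      by (rule l2_finite_support[OF that]) (auto simp: y_def)
    have "ip x y = ip y y"
      unfolding ip_def by (rule infsum_cong) (simp add: y_def)
    then have "(nrm y)\<^sup>2 \<le> C * nrm y"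
      using bd[OF fin] by (simp add: ip_self[OF l] norm_power)
    then have "nrm y \<le> C"
      using \<open>C \<ge> 0\<close> nrm_nonneg[of y] by (cases "nrm y = 0") (auto simp: power2_eq_square)
    moreover have "L2_set (\<lambda>n. norm (x n)) F = L2_set (\<lambda>n. norm (y n)) F"
      by (rule L2_set_cong) (auto simp: y_def)
    ultimately show ?thesis
      using L2_set_le_nrm[OF l that] by linarith
  qed
  then show "l2 x" "nrm x \<le> C"
    using l2_bddI[of x C] by blast+
qed

lemma l2_conv:
  assumes "l1 w" "l2 x"
  shows "l2 (conv w x)" and nrm_conv_le: "nrm (conv w x) \<le> (\<Sum>\<^sub>\<infinity>n. norm (w n)) * nrm x"
proof -
  have "norm (ip (conv w x) y) \<le> (\<Sum>\<^sub>\<infinity>n. norm (w n)) * nrm x * nrm y" if "finite {n. y n \<noteq> 0}" for y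
  proof -
    have "l2 y"
      by (rule l2_finite_support[OF that]) auto
    note p = l1_pairable(1)[OF assms this]
    show ?thesis
      using l1_pairing_bound[OF assms \<open>l2 y\<close>] norm_tf_le_infsum[OF p] pairable_ip[OF p] by simp
  qed
  moreover have "0 \<le> (\<Sum>\<^sub>\<infinity>n. norm (w n)) * nrm x"
    by (simp add: infsum_nonneg)
  ultimately show "l2 (conv w x)" "nrm (conv w x) \<le> (\<Sum>\<^sub>\<infinity>n. norm (w n)) * nrm x"
    using l2_dualityI[of _ "conv w x"] by blast+
qed

lemma ip_conv_swap: "l1 w \<Longrightarrow> herm w \<Longrightarrow> l2 x \<Longrightarrow> l2 y \<Longrightarrow> ip (conv w x) y = ip x (conv w y)"
  by (intro ip_conv_herm l1_pairable)

lemma conv_commute: "conv w u = conv u w"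
proof
  fix n :: int
  from infsum_reindex_bij[OF bij_reflect[of n], of "\<lambda>m. u (n - m) * w m"] show "conv w u n = conv u w n"
    unfolding conv_def by (simp add: mult.commute)
qed

lemma convable_commute:
  assumes "convable w u" shows "convable u w"
  unfolding convable_def
proof
  fix n :: int
  show "(\<lambda>m. u (n - m) * w m) summable_on UNIV"
    using summable_on_reindex_bij_betw[OF bij_reflect[of n], of "\<lambda>m. u (n - m) * w m"] assms
    unfolding convable_def by (simp add: mult.commute)
qed

lemma l1_imp_l2:
  assumes "l1 w" shows "l2 w"
proof -
  have b: "norm (w n) \<le> (\<Sum>\<^sub>\<infinity>n. norm (w n))" for n
    using finite_sum_le_infsum[of "\<lambda>n. norm (w n)" UNIV "{n}"] assms by (simp add: l1_def)
  have "(\<lambda>n. (\<Sum>\<^sub>\<infinity>n. norm (w n)) * norm (w n)) summable_on UNIV"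
    using assms by (auto simp: l1_def intro: summable_on_cmult_right)
  then show ?thesis
    unfolding l2_def
    by (rule summable_on_comparison_test) (use b in \<open>auto simp: power2_eq_square intro!: mult_right_mono\<close>)
qed

lemma l1_conv:
  assumes "l1 w" "l1 u" shows "l1 (conv w u)"
proof -
  define f where "f = (\<lambda>(m, n). norm (u m) * norm (w (n - m)))"
  have b: "bij (\<lambda>n. n - m)" for m :: int
    by (rule o_bij[of "\<lambda>n. n + m"]) auto
  have 1: "(\<lambda>n. f (m, n)) summable_on UNIV" for m
    using assms(1) summable_on_reindex_bij_betw[OF b[of m], of "\<lambda>n. norm (w n)"]
    by (auto simp: f_def l1_def intro: summable_on_cmult_right)
  have 2: "(\<Sum>\<^sub>\<infinity>n. f (m, n)) = norm (u m) * (\<Sum>\<^sub>\<infinity>n. norm (w n))" for m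
    using infsum_reindex_bij[OF b[of m], of "\<lambda>n. norm (w n)"] by (simp add: f_def infsum_cmult_right')
  have "f summable_on UNIV"
    by (rule summable_on_Sigma_nonneg(1)[OF _ 1])
      (use assms(2) in \<open>auto simp: f_def 2[unfolded f_def, simplified] l1_def intro: summable_on_cmult_left split: prod.split\<close>)
  then have "(\<lambda>p. f (prod.swap p)) summable_on UNIV"
    using summable_on_reindex_bij_betw[OF bij_swap, of f] by simp
  then have s: "(\<lambda>p. norm ((\<lambda>(n, m). w (n - m) * u m) p)) summable_on UNIV"
    by (simp add: f_def case_prod_unfold norm_mult mult.commute)
  have s': "(\<lambda>(n, m). norm (w (n - m)) * norm (u m)) summable_on Sigma UNIV (\<lambda>_. UNIV)"
    using s by (simp add: case_prod_unfold norm_mult)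
  have "(\<lambda>n. \<Sum>\<^sub>\<infinity>m. norm (w (n - m)) * norm (u m)) summable_on UNIV"
    using summable_on_Sigma_banach[OF s'] by simp
  moreover have "norm (conv w u n) \<le> (\<Sum>\<^sub>\<infinity>m. norm (w (n - m)) * norm (u m))" for n
  proof -
    have "(\<lambda>m. norm (w (n - m) * u m)) summable_on UNIV"
      using summable_on_SigmaD1[OF s', of n] by (simp add: norm_mult)
    from norm_infsum_bound[OF this] show ?thesis
      by (simp add: conv_def norm_mult)
  qed
  ultimately show ?thesis
    unfolding l1_def by (rule summable_on_comparison_test) auto
qed

text \<open>The absolute convergence that Fubini requires comes from the same bound applied to
  moduli: the convolution of the moduli of \<open>u\<close> and \<open>x\<close> is square summable,
  and so is the reflected \<open>w\<close>.\<close>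

lemma conv_assoc:
  assumes "l1 w" "l1 u" "l2 x"
  shows "conv w (conv u x) = conv (conv w u) x"
proof
  fix n :: int
  let ?u = "\<lambda>k. complex_of_real (norm (u k))" and ?x = "\<lambda>k. complex_of_real (norm (x k))"
  have lu: "l1 ?u" and lx: "l2 ?x"
    using assms by (auto simp: l1_def l2_def)
  define f where "f = (\<lambda>(m, j). w (n - m) * u (m - j) * x j)"
  have row: "(\<lambda>j. norm (u (m - j)) * norm (x j)) summable_on UNIV" for m
  proof -
    have "(\<lambda>j. ?u (m - j) * ?x j) summable_on UNIV"
      using l1_convable[OF lu lx] unfolding convable_def by blast
    from summable_on_Re[OF this] show ?thesis
      by simp
  qed
  have sumrow: "conv ?u ?x m = of_real (\<Sum>\<^sub>\<infinity>j. norm (u (m - j)) * norm (x j))" for m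
    unfolding conv_def
    using infsumI[OF has_sum_of_real[OF has_sum_infsum[OF row[of m]], where 'a = complex]] by simp
  have lw: "l2 (\<lambda>m. w (n - m))"
    using l2_reindex(1)[OF bij_reflect, of w n] l1_imp_l2[OF assms(1)] by simp
  have "(\<lambda>p. norm (f p)) summable_on UNIV"
  proof (rule summable_on_Sigma_nonneg(1))
    show "(\<lambda>j. norm (f (m, j))) summable_on UNIV" for m
      using row[of m] by (auto simp: f_def norm_mult mult.assoc intro: summable_on_cmult_right)
    have "(\<lambda>m. norm (w (n - m)) * norm (conv ?u ?x m)) summable_on UNIV"
      by (rule Cauchy_Schwarz_summable[OF lw l2_conv(1)[OF lu lx]])
    then show "(\<lambda>m. \<Sum>\<^sub>\<infinity>j. norm (f (m, j))) summable_on UNIV"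
      by (simp add: f_def norm_mult mult.assoc infsum_cmult_right' sumrow infsum_nonneg)
  qed auto
  from Fubini_swap[OF this]
  have "conv w (conv u x) n = (\<Sum>\<^sub>\<infinity>j. \<Sum>\<^sub>\<infinity>m. w (n - m) * u (m - j) * x j)"
    by (simp add: conv_def f_def infsum_cmult_right' mult.assoc)
  also have "\<dots> = (\<Sum>\<^sub>\<infinity>j. conv w u (n - j) * x j)"
  proof (rule infsum_cong)
    fix j :: int
    have b: "bij (\<lambda>m. m - j)"
      by (rule o_bij[of "\<lambda>n. n + j"]) auto
    show "(\<Sum>\<^sub>\<infinity>m. w (n - m) * u (m - j) * x j) = conv w u (n - j) * x j"
      using infsum_reindex_bij[OF b, of "\<lambda>m. w (n - j - m) * u m"]
      by (simp add: conv_def infsum_cmult_left')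
  qed
  finally show "conv w (conv u x) n = conv (conv w u) x n"
    by (simp add: conv_def)
qed

lemma conv_add_right: "convable w x \<Longrightarrow> convable w y \<Longrightarrow> conv w (\<lambda>n. x n + y n) = (\<lambda>n. conv w x n + conv w y n)"
  by (auto simp: conv_def convable_def ring_distribs infsum_add)

lemma conv_diff_right: "convable w x \<Longrightarrow> convable w y \<Longrightarrow> conv w (\<lambda>n. x n - y n) = (\<lambda>n. conv w x n - conv w y n)"
  using infsum_add[of "\<lambda>m. w (_ - m) * x m" UNIV "\<lambda>m. - (w (_ - m) * y m)"]
  by (auto simp: conv_def convable_def ring_distribs summable_on_uminus infsum_uminus)

lemma conv_scale_right: "conv w (\<lambda>n. c * x n) = (\<lambda>n. c * conv w x n)"
  by (auto simp: conv_def infsum_cmult_right' mult.left_commute)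

lemma conv_add_left: "convable w x \<Longrightarrow> convable u x \<Longrightarrow> conv (\<lambda>n. w n + u n) x = (\<lambda>n. conv w x n + conv u x n)"
  by (auto simp: conv_def convable_def ring_distribs infsum_add)

lemma conv_diff_left: "convable w x \<Longrightarrow> convable u x \<Longrightarrow> conv (\<lambda>n. w n - u n) x = (\<lambda>n. conv w x n - conv u x n)"
  by (metis conv_commute conv_diff_right convable_commute)

lemma conv_scale_left: "conv (\<lambda>n. c * w n) x = (\<lambda>n. c * conv w x n)"
  by (metis conv_commute conv_scale_right)

lemma conv_unit_vec: "conv w (unit_vec 0) = w"
proof
  fix n
  have "conv w (unit_vec 0) n = (\<Sum>\<^sub>\<infinity>m\<in>{0}. w (n - m))"
    unfolding conv_def by (rule infsum_cong_neutral) (auto simp: unit_vec_def)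
  then show "conv w (unit_vec 0) n = w n" by simp
qed

lemma dd_conv:
  assumes "convable (dd w) x" "convable w (dd x)"
  shows "dd (conv w x) = (\<lambda>n. conv (dd w) x n + conv w (dd x) n)"
proof
  fix n
  have "dd (conv w x) n = (\<Sum>\<^sub>\<infinity>m. of_int n * (w (n - m) * x m))"
    by (simp add: dd_def conv_def infsum_cmult_right')
  also have "\<dots> = (\<Sum>\<^sub>\<infinity>m. dd w (n - m) * x m + w (n - m) * dd x m)"
    by (rule infsum_cong) (simp add: dd_def algebra_simps)
  also have "\<dots> = conv (dd w) x n + conv w (dd x) n"
    using assms by (simp add: conv_def convable_def infsum_add)
  finally show "dd (conv w x) n = conv (dd w) x n + conv w (dd x) n" .
qed

lemma herm_conv:
  assumes "herm w" "herm u" shows "herm (conv w u)"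
  unfolding herm_def
proof
  fix n :: int
  have b: "bij (\<lambda>m :: int. - m)"
    by (rule o_bij[of uminus]) auto
  have "conv w u (- n) = (\<Sum>\<^sub>\<infinity>m. w (- n - - m) * u (- m))"
    using infsum_reindex_bij[OF b, of "\<lambda>m. w (- n - m) * u m"] by (simp add: conv_def)
  also have "\<dots> = (\<Sum>\<^sub>\<infinity>m. cnj (w (n - m) * u m))"
    using assms unfolding herm_def by (intro infsum_cong) (metis complex_cnj_mult minus_diff_eq diff_minus_eq_add uminus_add_conv_diff)
  finally show "conv w u (- n) = cnj (conv w u n)"
    by (simp only: infsum_cnj conv_def)
qed

section \<open>The Lax operator as a quadratic form\<close>

definition hardy :: "(int \<Rightarrow> complex) \<Rightarrow> bool" where
  "hardy x \<longleftrightarrow> (\<forall>n<0. x n = 0)"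

text \<open>The spectral parameter sits inside the weight. Thus \<open>nk k\<close> below is exactly
  the form norm of D + k on the Hardy space, and the relative size of the potential decreases as
  \<open>k\<close> grows.\<close>

definition wgt :: "real \<Rightarrow> real \<Rightarrow> (int \<Rightarrow> complex) \<Rightarrow> int \<Rightarrow> complex" where
  "wgt s k u n = of_real ((real_of_int \<bar>n\<bar> + k) powr s) * u n"

definition nk :: "real \<Rightarrow> (int \<Rightarrow> complex) \<Rightarrow> real" where
  "nk k x = nrm (wgt (1/2) k x)"

text \<open>The form domain of the Lax operator: the Hardy space intersected with H^(1/2).\<close>

definition hh :: "(int \<Rightarrow> complex) \<Rightarrow> bool" where
  "hh x \<longleftrightarrow> hardy x \<and> l2 (wgt (1/2) 1 x)"

definition hs :: "real \<Rightarrow> (int \<Rightarrow> complex) \<Rightarrow> bool" where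
  "hs s u \<longleftrightarrow> l2 (wgt s 1 u)"

definition neg_norm :: "real \<Rightarrow> real \<Rightarrow> (int \<Rightarrow> complex) \<Rightarrow> real" where
  "neg_norm s k u = nrm (wgt (- s) k u)"

text \<open>The l2 norm of the sequence (p + k)^(s - 1), which remains when the kernel of the
  potential term is split in \<open>kernel_weight\<close>. For s < 1/2 the exponent 2 s - 2 is below
  -1.\<close>

definition eps :: "real \<Rightarrow> real \<Rightarrow> real" where
  "eps s k = sqrt (\<Sum>\<^sub>\<infinity>p. (real p + k) powr (2 * s - 2))"

definition lax :: "(int \<Rightarrow> complex) \<Rightarrow> (int \<Rightarrow> complex) \<Rightarrow> int \<Rightarrow> complex" where
  "lax u x n = (if n \<ge> 0 then of_int n * x n - conv u x n else 0)"

text \<open>The equation (L + k) x = b for a form-domain vector \<open>x\<close>. The right-hand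
  side matters only at nonnegative indices and need not be square summable, so that \<open>b\<close>
  may itself be a rough potential applied to a vector. Any real \<open>k\<close> is allowed;
  eigenvectors use a negated eigenvalue.\<close>

definition solves ::
    "(int \<Rightarrow> complex) \<Rightarrow> real \<Rightarrow> (int \<Rightarrow> complex) \<Rightarrow> (int \<Rightarrow> complex) \<Rightarrow> bool" where
  "solves u k x b \<longleftrightarrow> hh x \<and> (\<forall>n\<ge>0. (of_int n + of_real k) * x n - conv u x n = b n)"

definition qf :: "real \<Rightarrow> (int \<Rightarrow> complex) \<Rightarrow> (int \<Rightarrow> complex) \<Rightarrow> complex" where
  "qf k x y = ip (wgt (1/2) k x) (wgt (1/2) k y)"

section \<open>Weighted norms and the form domain\<close>

lemma hardy_hh: "hh x \<Longrightarrow> hardy x"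
  by (simp add: hh_def)

lemma norm_wgt: "norm (wgt s k u n) = (real_of_int \<bar>n\<bar> + k) powr s * norm (u n)"
  by (simp add: wgt_def norm_mult)

lemma wgt_linear:
  "wgt s k (\<lambda>n. x n + y n) = (\<lambda>n. wgt s k x n + wgt s k y n)"
  "wgt s k (\<lambda>n. x n - y n) = (\<lambda>n. wgt s k x n - wgt s k y n)"
  "wgt s k (\<lambda>n. c * x n) = (\<lambda>n. c * wgt s k x n)"
  by (auto simp: wgt_def algebra_simps)

lemma weight_compare:
  assumes "k \<ge> 1"
  shows "(real_of_int \<bar>n\<bar> + k) powr s \<le> (k powr \<bar>s\<bar>) * (real_of_int \<bar>n\<bar> + 1) powr s"
    and "(real_of_int \<bar>n\<bar> + 1) powr s \<le> (k powr \<bar>s\<bar>) * (real_of_int \<bar>n\<bar> + k) powr s"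
proof -
  let ?a = "real_of_int \<bar>n\<bar> + 1" and ?b = "real_of_int \<bar>n\<bar> + k"
  have a: "?a \<ge> 1" and ab: "?a \<le> ?b" and ba: "?b \<le> k * ?a"
    using assms mult_right_mono[OF assms, of "real_of_int \<bar>n\<bar>"] by (auto simp: algebra_simps)
  have k1: "k powr \<bar>s\<bar> \<ge> 1"
    using assms by (simp add: ge_one_powr_ge_zero)
  show "?b powr s \<le> (k powr \<bar>s\<bar>) * ?a powr s"
  proof (cases "s \<ge> 0")
    case True
    then show ?thesis
      using powr_mono2[of s ?b "k * ?a"] ba assms a by (simp add: powr_mult)
  next
    case False
    then have "?b powr s \<le> ?a powr s"
      using powr_mono2'[of s ?a ?b] ab a by auto
    also have "\<dots> \<le> (k powr \<bar>s\<bar>) * ?a powr s"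
      using k1 by (simp add: mult_le_cancel_right1)
    finally show ?thesis .
  qed
  show "?a powr s \<le> (k powr \<bar>s\<bar>) * ?b powr s"
  proof (cases "s \<ge> 0")
    case True
    then have "?a powr s \<le> ?b powr s"
      using powr_mono2[of s ?a ?b] ab a by auto
    also have "\<dots> \<le> (k powr \<bar>s\<bar>) * ?b powr s"
      using k1 by (simp add: mult_le_cancel_right1)
    finally show ?thesis .
  next
    case False
    then have "(k * ?a) powr s \<le> ?b powr s"
      using powr_mono2'[of s ?b "k * ?a"] ba ab a by auto
    then have "k powr (-s) * (k powr s * ?a powr s) \<le> k powr (-s) * ?b powr s"
      using assms a by (intro mult_left_mono) (auto simp: powr_mult)
    then show ?thesis
      using False assms by (simp add: mult.assoc[symmetric] powr_add[symmetric])
  qed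
qed

lemma l2_wgt_change:
  assumes "k \<ge> 1"
  shows "l2 (wgt s k u) \<longleftrightarrow> l2 (wgt s 1 u)"
    and nrm_wgt_le: "l2 (wgt s 1 u) \<Longrightarrow> nrm (wgt s k u) \<le> k powr \<bar>s\<bar> * nrm (wgt s 1 u)"
    and nrm_wgt_ge: "l2 (wgt s 1 u) \<Longrightarrow> nrm (wgt s 1 u) \<le> k powr \<bar>s\<bar> * nrm (wgt s k u)"
proof -
  let ?c = "complex_of_real (k powr \<bar>s\<bar>)"
  have 1: "norm (wgt s k u n) \<le> norm (?c * wgt s 1 u n)"
    and 2: "norm (wgt s 1 u n) \<le> norm (?c * wgt s k u n)" for n
    using mult_right_mono[OF weight_compare(1)[OF assms, of n s], of "norm (u n)"]
      mult_right_mono[OF weight_compare(2)[OF assms, of n s], of "norm (u n)"]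
    by (simp_all add: norm_wgt norm_mult mult.assoc)
  show *: "l2 (wgt s k u) \<longleftrightarrow> l2 (wgt s 1 u)"
    using l2_mono(1)[OF l2_scale[of "wgt s 1 u" ?c] 1] l2_mono(1)[OF l2_scale[of "wgt s k u" ?c] 2]
    by (rule iffI[rotated])
  show "l2 (wgt s 1 u) \<Longrightarrow> nrm (wgt s k u) \<le> k powr \<bar>s\<bar> * nrm (wgt s 1 u)"
    using l2_mono(2)[OF _ 1] l2_scale[of "wgt s 1 u" ?c] by (simp add: nrm_scale)
  show "l2 (wgt s 1 u) \<Longrightarrow> nrm (wgt s 1 u) \<le> k powr \<bar>s\<bar> * nrm (wgt s k u)"
    using l2_mono(2)[OF _ 2] l2_scale[of "wgt s k u" ?c] * by (simp add: nrm_scale)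
qed

lemma hh_l2_wgt: "hh x \<Longrightarrow> k \<ge> 1 \<Longrightarrow> l2 (wgt (1/2) k x)"
  using l2_wgt_change(1)[of k] by (simp add: hh_def)

lemma hs_l2_wgt: "hs s x \<Longrightarrow> k \<ge> 1 \<Longrightarrow> l2 (wgt s k x)"
  using l2_wgt_change(1)[of k] by (simp add: hs_def)

lemma hh_l2:
  assumes "hh x" shows "l2 x"
proof (rule l2_mono(1))
  show "l2 (wgt (1/2) 1 x)"
    using assms by (simp add: hh_def)
  show "norm (x n) \<le> norm (wgt (1/2) 1 x n)" for n
    using ge_one_powr_ge_zero[of "real_of_int \<bar>n\<bar> + 1" "1/2"]
    by (simp add: norm_wgt mult_le_cancel_right1)
qed

lemma hh_add: "hh x \<Longrightarrow> hh y \<Longrightarrow> hh (\<lambda>n. x n + y n)"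
  by (auto simp: hh_def hardy_def wgt_linear)

lemma hh_diff: "hh x \<Longrightarrow> hh y \<Longrightarrow> hh (\<lambda>n. x n - y n)"
  by (auto simp: hh_def hardy_def wgt_linear)

lemma hh_scale: "hh x \<Longrightarrow> hh (\<lambda>n. c * x n)"
  by (auto simp: hh_def hardy_def wgt_linear)

lemma hh_0: "hh (\<lambda>n. 0)"
  by (auto simp: hh_def hardy_def wgt_def intro!: l2_finite_support[of "{}"])

lemma hh_sum: "(\<And>i. i \<in> I \<Longrightarrow> hh (x i)) \<Longrightarrow> hh (\<lambda>n. \<Sum>i\<in>I. x i n)"
  by (induction I rule: infinite_finite_induct) (auto simp: hh_0 hh_add)

lemma hs_diff: "hs s x \<Longrightarrow> hs s y \<Longrightarrow> hs s (\<lambda>n. x n - y n)"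
  by (auto simp: hs_def wgt_linear)

lemma hh_unit_vec: "a \<ge> 0 \<Longrightarrow> hh (unit_vec a)"
  unfolding hh_def hardy_def
  by (auto simp: unit_vec_def wgt_def intro!: l2_finite_support[of "{a}"] split: if_splits)

section \<open>The Hilbert-Schmidt bound for the potential term\<close>

lemma l2_tensor:
  assumes "l2 (a :: 'a \<Rightarrow> complex)" "l2 (b :: 'b \<Rightarrow> complex)"
  shows "l2 (\<lambda>(n, m). a n * b m)" and nrm_tensor: "nrm (\<lambda>(n, m). a n * b m) = nrm a * nrm b"
proof -
  define f where "f = (\<lambda>p. (norm ((\<lambda>(n, m). a n * b m) p))\<^sup>2)"
  have row: "(\<lambda>m. f (n, m)) summable_on UNIV" for n
    using assms(2) by (auto simp: f_def l2_def norm_mult power_mult_distrib intro: summable_on_cmult_right)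
  have sums: "(\<Sum>\<^sub>\<infinity>m. f (n, m)) = (norm (a n))\<^sup>2 * (nrm b)\<^sup>2" for n
    by (simp add: f_def norm_mult power_mult_distrib infsum_cmult_right' nrm_power2)
  have tot: "(\<lambda>n. \<Sum>\<^sub>\<infinity>m. f (n, m)) summable_on UNIV"
    using assms(1) unfolding sums l2_def by (rule summable_on_cmult_left)
  have f0: "f p \<ge> 0" for p
    by (simp add: f_def)
  have s: "f summable_on UNIV"
    by (rule summable_on_Sigma_nonneg(1)[OF f0 row tot])
  then show "l2 (\<lambda>(n, m). a n * b m)"
    by (simp add: l2_def f_def)
  have "infsum f UNIV = (nrm a * nrm b)\<^sup>2"
    unfolding infsum_Sigma_nonneg[OF f0 row tot] sums
    by (simp add: infsum_cmult_left' nrm_power2 power_mult_distrib)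
  then show "nrm (\<lambda>(n, m). a n * b m) = nrm a * nrm b"
    by (simp add: nrm_def[of "\<lambda>(n, m). a n * b m"] f_def)
qed

lemma summable_powr_shift:
  assumes "k \<ge> 1" "a < -1"
  shows "(\<lambda>p. (real p + k) powr a) summable_on UNIV"
proof -
  have "summable (\<lambda>p. real (Suc p) powr a)"
    using assms(2) by (subst summable_Suc_iff) (simp add: summable_real_powr_iff)
  then have "(\<lambda>p. real (Suc p) powr a) summable_on UNIV"
    by (intro summable_nonneg_imp_summable_on) auto
  then show ?thesis
    by (rule summable_on_comparison_test) (use assms in \<open>auto intro!: powr_mono2'\<close>)
qed

lemma eps_summable:
  assumes "k \<ge> 1" "s < 1/2"
  shows "(\<lambda>p. (real p + k) powr (2 * s - 2)) summable_on UNIV"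
  using assms by (intro summable_powr_shift) auto

lemma eps_nonneg: "eps s k \<ge> 0"
  by (simp add: eps_def infsum_nonneg)

text \<open>A factor k^(-eta) is split off the summand with eta = 1/2 - s; the remaining exponent 2
  s - 2 + eta = s - 3/2 is still below -1.\<close>

lemma eps_tendsto_0:
  assumes "s < 1/2"
  shows "(eps s \<longlongrightarrow> 0) at_top"
proof -
  define \<eta> where "\<eta> = (1/2 - s)"
  have \<eta>: "\<eta> > 0" "2 * s - 2 + \<eta> < -1"
    using assms by (auto simp: \<eta>_def)
  define C where "C = (\<Sum>\<^sub>\<infinity>p. (real p + 1) powr (2 * s - 2 + \<eta>))"
  have "eps s k \<le> sqrt (k powr (- \<eta>) * C)" if k: "k \<ge> 1" for k
    unfolding eps_def
  proof (rule real_sqrt_le_mono)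
    have "(\<Sum>\<^sub>\<infinity>p. (real p + k) powr (2 * s - 2))
        \<le> (\<Sum>\<^sub>\<infinity>p. k powr (- \<eta>) * (real p + 1) powr (2 * s - 2 + \<eta>))"
    proof (rule infsum_mono)
      show "(\<lambda>p. (real p + k) powr (2 * s - 2)) summable_on UNIV"
        by (rule eps_summable[OF k assms])
      show "(\<lambda>p. k powr (- \<eta>) * (real p + 1) powr (2 * s - 2 + \<eta>)) summable_on UNIV"
        by (intro summable_on_cmult_right summable_powr_shift) (use \<eta> in auto)
      fix p :: nat
      have "(real p + k) powr (2 * s - 2) = (real p + k) powr (- \<eta>) * (real p + k) powr (2 * s - 2 + \<eta>)"
        by (simp add: powr_add[symmetric])
      also have "\<dots> \<le> k powr (- \<eta>) * (real p + 1) powr (2 * s - 2 + \<eta>)"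
        using k \<eta> by (intro mult_mono powr_mono2') auto
      finally show "(real p + k) powr (2 * s - 2) \<le> k powr (- \<eta>) * (real p + 1) powr (2 * s - 2 + \<eta>)" .
    qed
    then show "(\<Sum>\<^sub>\<infinity>p. (real p + k) powr (2 * s - 2)) \<le> k powr (- \<eta>) * C"
      by (simp add: infsum_cmult_right' C_def)
  qed
  then have ev: "\<forall>\<^sub>F k in at_top. eps s k \<le> sqrt (k powr (- \<eta>) * C)"
    using eventually_ge_at_top[of 1] by (rule eventually_mono[rotated])
  have "((\<lambda>k. sqrt (k powr (- \<eta>) * C)) \<longlongrightarrow> sqrt (0 * C)) at_top"
    using \<eta> by (intro tendsto_intros tendsto_neg_powr filterlim_ident) auto
  then have "((\<lambda>k. sqrt (k powr (- \<eta>) * C)) \<longlongrightarrow> 0) at_top"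
    by simp
  then show ?thesis
    using tendsto_sandwich[OF _ ev tendsto_const] by (simp add: eps_nonneg)
qed

text \<open>With \<open>p = min n m\<close>, the larger of \<open>n, m\<close> is \<open>p + \<bar>n - m\<bar>\<close>; splitting its weight between
  \<open>\<bar>n - m\<bar> + k\<close> and \<open>p + k\<close> makes the kernel Hilbert-Schmidt.\<close>

lemma kernel_weight:
  fixes n m :: int
  assumes "k \<ge> 1" "0 \<le> s" "s < 1/2" "n \<ge> 0" "m \<ge> 0"
  shows "(real_of_int n + k) powr (-1/2) * (real_of_int m + k) powr (-1/2)
    \<le> (real_of_int \<bar>n - m\<bar> + k) powr (- s) * (real (nat (min n m)) + k) powr (s - 1)"
proof -
  define p d where "p = real_of_int (min n m)" and "d = real_of_int \<bar>n - m\<bar>"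
  have pd: "p \<ge> 0" "d \<ge> 0" using assms by (auto simp: p_def d_def)
  have "(real_of_int n + k) powr (-1/2) * (real_of_int m + k) powr (-1/2)
      = (p + k) powr (-1/2) * (p + d + k) powr (-1/2)"
    by (cases "n \<le> m") (auto simp: p_def d_def min_def)
  also have "(p + d + k) powr (-1/2) = (p + d + k) powr (- s) * (p + d + k) powr (s - 1/2)"
    by (simp add: powr_add[symmetric])
  also have "(p + k) powr (-1/2) * ((p + d + k) powr (- s) * (p + d + k) powr (s - 1/2))
      \<le> (p + k) powr (-1/2) * ((d + k) powr (- s) * (p + k) powr (s - 1/2))"
    using assms pd by (intro mult_left_mono mult_mono powr_mono2') auto
  also have "\<dots> = (d + k) powr (- s) * (p + k) powr (s - 1)"
    by (simp add: powr_add[symmetric])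
  finally show ?thesis
    using assms by (simp add: p_def d_def)
qed

text \<open>The pairing is the product of a kernel \<open>Y\<close>, which carries both half weights
  inverted, with the tensor product \<open>X\<close> of the weighted vectors. On the quadrant of
  nonnegative indices the map \<open>\<phi>\<close> to difference and minimum is injective and
  \<open>Y\<close> is dominated by \<open>g \<circ> \<phi>\<close>, where \<open>g\<close> is a
  tensor product of the weighted \<open>h\<close> with the sequence \<open>e\<close>; so
  \<open>Y\<close> is Hilbert-Schmidt. Off the quadrant the Hardy condition makes the summand
  0.\<close>

lemma form_bound:
  assumes k: "k \<ge> 1" and s: "0 \<le> s" "s < 1/2" and h: "hs (- s) h" and x: "hh x" and y: "hh y"
  shows "pairable h x y"
    and form_bound_infsum: "(\<Sum>\<^sub>\<infinity>(n, m). norm (h (n - m)) * norm (x m) * norm (y n))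
      \<le> eps s k * neg_norm s k h * nk k x * nk k y"
proof -
  define X where "X = (\<lambda>(n, m). wgt (1/2) k y n * wgt (1/2) k x m)"
  have X: "l2 X" "nrm X = nk k y * nk k x"
    unfolding X_def nk_def using l2_tensor nrm_tensor hh_l2_wgt[OF x k] hh_l2_wgt[OF y k] by blast+
  define e :: "nat \<Rightarrow> complex" where "e p = of_real ((real p + k) powr (s - 1))" for p
  have e: "l2 e" "nrm e = eps s k"
  proof -
    have *: "(norm (e p))\<^sup>2 = (real p + k) powr (2 * s - 2)" for p
      using k by (simp add: e_def power2_eq_square powr_add[symmetric] algebra_simps)
    show "l2 e" "nrm e = eps s k"
      using eps_summable[OF k s(2)] by (simp_all add: l2_def nrm_def eps_def *)
  qed
  define g where "g = (\<lambda>(d, p). wgt (- s) k h d * e p)"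
  have g: "l2 g" "nrm g = neg_norm s k h * eps s k"
    unfolding g_def using l2_tensor nrm_tensor hs_l2_wgt[OF h k] e unfolding neg_norm_def by metis+
  define Y :: "int \<times> int \<Rightarrow> real" where "Y = (\<lambda>(n, m). if n \<ge> 0 \<and> m \<ge> 0
      then norm (h (n - m)) * ((real_of_int n + k) powr (-1/2) * (real_of_int m + k) powr (-1/2)) else 0)"
  define \<phi> where "\<phi> = (\<lambda>(n :: int, m). (n - m, nat (min n m)))"
  let ?P = "{(n :: int, m :: int). n \<ge> 0 \<and> m \<ge> 0}"
  have inj: "inj_on \<phi> ?P"
    by (auto simp: inj_on_def \<phi>_def min_def split: if_splits)
  have Yg: "\<bar>Y p\<bar> \<le> norm (g (\<phi> p))" if pP: "p \<in> ?P" for p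
  proof -
    obtain n m where p: "p = (n, m)" and nm: "n \<ge> 0" "m \<ge> 0"
      using pP by (cases p) auto
    show ?thesis
      using mult_left_mono[OF kernel_weight[OF k s nm] norm_ge_zero[of "h (n - m)"]] nm
      by (simp add: p Y_def g_def \<phi>_def norm_mult norm_wgt e_def mult_ac)
  qed
  have "L2_set (\<lambda>p. norm (Y p)) F \<le> neg_norm s k h * eps s k" if F: "finite F" for F
  proof -
    have "(\<Sum>p\<in>F. (norm (Y p))\<^sup>2) = (\<Sum>p\<in>F \<inter> ?P. (norm (Y p))\<^sup>2)"
      by (rule sum.mono_neutral_right) (auto simp: F Y_def split: if_splits)
    also have "\<dots> \<le> (\<Sum>p\<in>F \<inter> ?P. (norm (g (\<phi> p)))\<^sup>2)"
      using Yg by (intro sum_mono power_mono) auto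
    also have "\<dots> = (\<Sum>q\<in>\<phi> ` (F \<inter> ?P). (norm (g q))\<^sup>2)"
      using inj by (subst sum.reindex) (auto intro: inj_on_subset)
    finally have "L2_set (\<lambda>p. norm (Y p)) F \<le> L2_set (\<lambda>q. norm (g q)) (\<phi> ` (F \<inter> ?P))"
      unfolding L2_set_def by (rule real_sqrt_le_mono)
    then show ?thesis
      using L2_set_le_nrm[OF g(1), of "\<phi> ` (F \<inter> ?P)"] F g(2) by simp
  qed
  note Y = l2_bddI[of Y, OF this]
  have eq: "(\<lambda>(n, m). norm (h (n - m)) * norm (x m) * norm (y n)) = (\<lambda>p. norm (Y p) * norm (X p))"
  proof
    fix p :: "int \<times> int"
    obtain n m where p: "p = (n, m)" by fastforce
    show "(\<lambda>(n, m). norm (h (n - m)) * norm (x m) * norm (y n)) p = norm (Y p) * norm (X p)"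
    proof (cases "n \<ge> 0 \<and> m \<ge> 0")
      case True
      have pos: "real_of_int n + k > 0" "real_of_int m + k > 0"
        using True k by auto
      have *: "a powr (-1/2) * a powr (1/2) = 1" if "a > 0" for a :: real
        using that by (simp add: powr_add[symmetric])
      have "norm (Y p) * norm (X p) = norm (h (n - m)) * norm (x m) * norm (y n)
          * ((real_of_int n + k) powr (-1/2) * (real_of_int n + k) powr (1/2))
          * ((real_of_int m + k) powr (-1/2) * (real_of_int m + k) powr (1/2))"
        using True by (simp add: p Y_def X_def norm_mult norm_wgt mult_ac)
      then show ?thesis
        using *[OF pos(1)] *[OF pos(2)] by (simp add: p)
    next
      case False
      then have "x m = 0 \<or> y n = 0"
        using x y unfolding hh_def hardy_def by force
      then show ?thesis
        using False by (auto simp: p Y_def)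
    qed
  qed
  show "pairable h x y"
    unfolding pairable_def eq by (rule Cauchy_Schwarz_summable[OF Y(1) X(1)])
  have "(\<Sum>\<^sub>\<infinity>(n, m). norm (h (n - m)) * norm (x m) * norm (y n)) \<le> nrm Y * nrm X"
    unfolding eq by (rule Cauchy_Schwarz_infsum[OF Y(1) X(1)])
  also have "\<dots> \<le> (neg_norm s k h * eps s k) * (nk k y * nk k x)"
    unfolding X(2) using Y(2) by (intro mult_right_mono) (auto simp: nk_def)
  finally show "(\<Sum>\<^sub>\<infinity>(n, m). norm (h (n - m)) * norm (x m) * norm (y n))
      \<le> eps s k * neg_norm s k h * nk k x * nk k y"
    by (simp add: mult_ac)
qed

lemma norm_tf_le:
  assumes "k \<ge> 1" "0 \<le> s" "s < 1/2" "hs (- s) h" "hh x" "hh y"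
  shows "norm (tf h x y) \<le> eps s k * neg_norm s k h * nk k x * nk k y"
  using norm_tf_le_infsum[OF form_bound(1)[OF assms]] form_bound_infsum[OF assms] by linarith

lemma nk_nonneg [simp]: "nk k x \<ge> 0"
  by (simp add: nk_def)

lemma neg_norm_nonneg [simp]: "neg_norm s k x \<ge> 0"
  by (simp add: neg_norm_def)

lemma norm_le_nk:
  assumes "k \<ge> 1" "hh x" shows "norm (x n) \<le> nk k x"
proof -
  have "norm (x n) \<le> norm (wgt (1/2) k x n)"
    using ge_one_powr_ge_zero[of "real_of_int \<bar>n\<bar> + k" "1/2"] assms(1)
    by (simp add: norm_wgt mult_le_cancel_right1)
  then show ?thesis
    using norm_le_nrm[OF hh_l2_wgt[OF assms(2,1)], of n] by (simp add: nk_def)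
qed

lemma nk_eq_0: "k \<ge> 1 \<Longrightarrow> hh x \<Longrightarrow> nk k x = 0 \<Longrightarrow> x = (\<lambda>n. 0)"
  using norm_le_nk[of k x] by auto

lemma nk_triangle: "k \<ge> 1 \<Longrightarrow> hh x \<Longrightarrow> hh y \<Longrightarrow> nk k (\<lambda>n. x n + y n) \<le> nk k x + nk k y"
  unfolding nk_def wgt_linear by (intro nrm_triangle hh_l2_wgt)

lemma nk_diff_le: "k \<ge> 1 \<Longrightarrow> hh x \<Longrightarrow> hh y \<Longrightarrow> nk k (\<lambda>n. x n - y n) \<le> nk k x + nk k y"
  unfolding nk_def wgt_linear by (intro nrm_triangle_diff hh_l2_wgt)

lemma nk_scale: "nk k (\<lambda>n. c * x n) = norm c * nk k x"
  unfolding nk_def wgt_linear by (rule nrm_scale)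

lemma powr_half_half: "a \<ge> 0 \<Longrightarrow> (a :: real) powr (1/2) * a powr (1/2) = a"
  by (simp add: powr_half_sqrt)

section \<open>Weak formulation of the resolvent equation\<close>

lemma qf_summand:
  assumes "k \<ge> 1" "hardy x"
  shows "wgt (1/2) k x n * cnj (wgt (1/2) k y n) = (of_int n + of_real k) * x n * cnj (y n)"
proof (cases "n \<ge> 0")
  case True
  have "wgt (1/2) k x n * cnj (wgt (1/2) k y n)
      = of_real ((real_of_int n + k) powr (1/2) * (real_of_int n + k) powr (1/2)) * x n * cnj (y n)"
    using True by (simp add: wgt_def mult_ac)
  then show ?thesis
    using True assms(1) by (simp add: powr_half_half)
next
  case False
  then show ?thesis
    using assms(2) by (simp add: hardy_def wgt_def)
qed

lemma qf_eq:
  assumes "k \<ge> 1" "hh x" "hh y"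
  shows "qf k x y = (\<Sum>\<^sub>\<infinity>n. (of_int n + of_real k) * x n * cnj (y n))"
    and qf_summable: "(\<lambda>n. (of_int n + of_real k) * x n * cnj (y n)) summable_on UNIV"
  using ip_summable[OF hh_l2_wgt[OF assms(2,1)] hh_l2_wgt[OF assms(3,1)]]
  unfolding qf_def ip_def qf_summand[OF assms(1) hardy_hh[OF assms(2)]] by simp_all

lemma qf_self: "k \<ge> 1 \<Longrightarrow> hh x \<Longrightarrow> qf k x x = of_real ((nk k x)\<^sup>2)"
  unfolding qf_def nk_def by (intro ip_self hh_l2_wgt)

lemma qf_cnj: "cnj (qf k x y) = qf k y x"
  unfolding qf_def by (rule ip_cnj)

lemma hh_convable:
  assumes "0 \<le> s" "s < 1/2" "hs (- s) u" "hh x" "n \<ge> 0"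
  shows "(\<lambda>m. u (n - m) * x m) summable_on UNIV"
  using Fubini_UNIV_row[OF form_bound(1)[OF order_refl assms(1-4) hh_unit_vec[OF assms(5)], unfolded pairable_norm], of n]
  by (simp add: unit_vec_def)

lemma solves_ip:
  assumes "k \<ge> 1" "0 \<le> s" "s < 1/2" "hs (- s) u" "solves u k x b" "hh y"
  shows "ip b y = qf k x y - tf u x y"
proof -
  have x: "hh x" and eq: "\<And>n. n \<ge> 0 \<Longrightarrow> (of_int n + of_real k) * x n - conv u x n = b n"
    using assms(5) by (auto simp: solves_def)
  note p = form_bound(1)[OF assms(1-4) x assms(6)]
  have y: "y n = 0" if "n < 0" for n
    using that assms(6) by (simp add: hh_def hardy_def)
  have "b n * cnj (y n) = (of_int n + of_real k) * x n * cnj (y n) + - (conv u x n * cnj (y n))" for n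
    by (cases "n \<ge> 0") (auto simp: y simp flip: eq, simp add: algebra_simps)
  then have "ip b y = (\<Sum>\<^sub>\<infinity>n. (of_int n + of_real k) * x n * cnj (y n) + - (conv u x n * cnj (y n)))"
    by (simp add: ip_def)
  also have "\<dots> = qf k x y + - ip (conv u x) y"
    using qf_summable[OF assms(1) x assms(6)] pairable_summable[OF p]
    by (subst infsum_add) (auto simp: summable_on_uminus infsum_uminus qf_eq[OF assms(1) x assms(6)] ip_def)
  finally show ?thesis
    by (simp add: pairable_ip[OF p])
qed

lemma tf_diff_left:
  assumes "pairable u x y" "pairable w x y"
  shows "tf (\<lambda>n. u n - w n) x y = tf u x y - tf w x y"
proof -
  have "tf (\<lambda>n. u n - w n) x y
      = (\<Sum>\<^sub>\<infinity>p. (\<lambda>(n, m). u (n - m) * x m * cnj (y n)) p + - (\<lambda>(n, m). w (n - m) * x m * cnj (y n)) p)"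
    unfolding tf_def by (rule infsum_cong) (auto simp: algebra_simps)
  also have "\<dots> = tf u x y + - tf w x y"
    unfolding tf_def
    using abs_summable_summable[OF assms(1)[unfolded pairable_norm]]
      abs_summable_summable[OF assms(2)[unfolded pairable_norm]]
    by (subst infsum_add) (auto simp: summable_on_uminus infsum_uminus)
  finally show ?thesis by simp
qed

lemma tf_diff_mid:
  assumes "pairable u x z" "pairable u y z"
  shows "tf u (\<lambda>n. x n - y n) z = tf u x z - tf u y z"
proof -
  have "tf u (\<lambda>n. x n - y n) z
      = (\<Sum>\<^sub>\<infinity>p. (\<lambda>(n, m). u (n - m) * x m * cnj (z n)) p + - (\<lambda>(n, m). u (n - m) * y m * cnj (z n)) p)"
    unfolding tf_def by (rule infsum_cong) (auto simp: algebra_simps)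
  also have "\<dots> = tf u x z + - tf u y z"
    unfolding tf_def
    using abs_summable_summable[OF assms(1)[unfolded pairable_norm]]
      abs_summable_summable[OF assms(2)[unfolded pairable_norm]]
    by (subst infsum_add) (auto simp: summable_on_uminus infsum_uminus)
  finally show ?thesis by simp
qed

lemma tf_scale_left: "tf (\<lambda>n. c * u n) x y = c * tf u x y"
  unfolding tf_def by (simp add: case_prod_unfold mult.assoc infsum_cmult_right')

text \<open>The second resolvent identity in weak form: the hermitian form \<open>qf k x y\<close>
  occurs on both sides and cancels, and the difference of the potentials remains.\<close>

lemma solves_pair:
  assumes "k \<ge> 1" "0 \<le> s" "s < 1/2" "hs (- s) u" "hs (- s) w" "herm w"
    "solves u k x b" "solves w k y c"
  shows "ip b y - ip x c = tf (\<lambda>n. w n - u n) x y"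
proof -
  have x: "hh x" and y: "hh y"
    using assms by (auto simp: solves_def)
  note p = form_bound(1)[OF assms(1-3)]
  have "ip x c = cnj (qf k y x - tf w y x)"
    using solves_ip[OF assms(1-3) assms(5,8) x] by (metis ip_cnj)
  then show ?thesis
    using solves_ip[OF assms(1-4) assms(7) y] tf_swap[OF assms(6) p[OF assms(5) y x]]
      tf_diff_left[OF p[OF assms(5) x y] p[OF assms(4) x y]]
    by (simp add: qf_cnj)
qed

text \<open>Moves the spectral parameter into the right-hand side, which makes estimates for
  \<open>k \<ge> 1\<close> available to eigenvalue equations.\<close>

lemma solves_shift: "solves u k x b \<longleftrightarrow> solves u k' x (\<lambda>n. b n + of_real (k' - k) * x n)"
  by (auto simp: solves_def algebra_simps)

lemma ip_add_multiple:
  assumes "(\<lambda>n. b n * cnj (y n)) summable_on UNIV" "l2 x" "l2 y"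
  shows "ip (\<lambda>n. b n + c * x n) y = ip b y + c * ip x y"
proof -
  have "ip (\<lambda>n. b n + c * x n) y = (\<Sum>\<^sub>\<infinity>n. b n * cnj (y n) + c * (x n * cnj (y n)))"
    by (simp add: ip_def algebra_simps)
  also have "\<dots> = ip b y + c * ip x y"
    unfolding ip_def infsum_cmult_right'[symmetric]
    by (intro infsum_add assms(1) summable_on_cmult_right ip_summable assms)
  finally show ?thesis .
qed

lemma solves_summable:
  assumes "0 \<le> s" "s < 1/2" "hs (- s) u" "solves u k x b" "hh y"
  shows "(\<lambda>n. b n * cnj (y n)) summable_on UNIV"
proof -
  have x: "hh x"
    using assms by (auto simp: solves_def)
  have eq: "b n * cnj (y n) = (of_int n + of_real 1) * x n * cnj (y n) + - (conv u x n * cnj (y n))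
      + of_real (k - 1) * (x n * cnj (y n))" for n
  proof (cases "n \<ge> 0")
    case True
    then have b: "b n = (of_int n + of_real k) * x n - conv u x n"
      using assms(4) by (simp add: solves_def)
    show ?thesis
      unfolding b by (simp add: algebra_simps)
  next
    case False
    then show ?thesis
      using hardy_hh[OF assms(5)] by (simp add: hardy_def)
  qed
  show ?thesis
    unfolding eq
    by (intro summable_on_add summable_on_uminus[THEN iffD2] qf_summable[OF order_refl x assms(5)]
        pairable_summable form_bound(1)[OF order_refl assms(1-3) x assms(5)]
        summable_on_cmult_right ip_summable hh_l2 x assms(5))
qed

text \<open>Symmetry of L + k for every real \<open>k\<close>: the shift to parameter 1, where the
  form bound applies, adds the same multiple of \<open>ip x y\<close> to both sides.\<close>

lemma solves_sym:
  assumes "0 \<le> s" "s < 1/2" "hs (- s) u" "herm u" "solves u k x b" "solves u k y c"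
  shows "ip b y = ip x c"
proof -
  have x: "hh x" and y: "hh y"
    using assms by (auto simp: solves_def)
  define b' c' where "b' = (\<lambda>n. b n + of_real (1 - k) * x n)" and "c' = (\<lambda>n. c n + of_real (1 - k) * y n)"
  have bc: "solves u 1 x b'" "solves u 1 y c'"
    using solves_shift[of u k _ _ 1] assms(5,6) by (auto simp: b'_def c'_def)
  have "ip b' y = ip b y + of_real (1 - k) * ip x y"
    unfolding b'_def
    by (intro ip_add_multiple solves_summable[OF assms(1-3,5) y] hh_l2 x y)
  moreover have "ip c' x = ip c x + of_real (1 - k) * ip y x"
    unfolding c'_def
    by (intro ip_add_multiple solves_summable[OF assms(1-3,6) x] hh_l2 x y)
  then have "ip x c' = ip x c + of_real (1 - k) * ip x y"
    unfolding ip_cnj[of _ x, symmetric] by (simp add: ip_cnj)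
  moreover have "ip b' y = ip x c'"
    using solves_pair[OF order_refl assms(1-3) assms(3,4) bc] by (simp add: tf_def case_prod_unfold)
  ultimately show ?thesis
    by simp
qed

section \<open>The resolvent: coercivity, Neumann series, dependence on the potential\<close>

lemma solves_coercive:
  assumes "k \<ge> 1" "0 \<le> s" "s < 1/2" "hs (- s) u" "solves u k x b" "eps s k * neg_norm s k u \<le> e"
  shows "(1 - e) * (nk k x)\<^sup>2 \<le> norm (ip b x)"
proof -
  have x: "hh x"
    using assms by (auto simp: solves_def)
  have "norm (tf u x x) \<le> e * (nk k x)\<^sup>2"
    using norm_tf_le[OF assms(1-4) x x] mult_right_mono[OF assms(6), of "(nk k x)\<^sup>2"]
    by (simp add: power2_eq_square mult.assoc)
  moreover have "norm (qf k x x) = (nk k x)\<^sup>2"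
    by (simp add: qf_self[OF assms(1) x] norm_power)
  moreover have "norm (qf k x x) - norm (tf u x x) \<le> norm (ip b x)"
    using solves_ip[OF assms(1-5) x] norm_triangle_ineq2 by metis
  ultimately show ?thesis
    by (simp add: algebra_simps)
qed

lemma solves_diff:
  assumes "0 \<le> s" "s < 1/2" "hs (- s) u" "solves u k x b" "solves u k y c"
  shows "solves u k (\<lambda>n. x n - y n) (\<lambda>n. b n - c n)"
proof -
  have x: "hh x" and y: "hh y"
    using assms by (auto simp: solves_def)
  have "conv u (\<lambda>n. x n - y n) n = conv u x n - conv u y n" if "n \<ge> 0" for n
    using infsum_add[OF hh_convable[OF assms(1-3) x that] summable_on_uminus[THEN iffD2, OF hh_convable[OF assms(1-3) y that]]]
    by (simp add: conv_def ring_distribs infsum_uminus)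
  then show ?thesis
    using assms hh_diff[OF x y] by (auto simp: solves_def algebra_simps)
qed

lemma solves_scale: "solves u k x b \<Longrightarrow> solves u k (\<lambda>n. c * x n) (\<lambda>n. c * b n)"
  by (simp add: solves_def hh_scale conv_scale_right algebra_simps) (metis mult.left_commute right_diff_distrib' distrib_left)

lemma solves_add:
  assumes "0 \<le> s" "s < 1/2" "hs (- s) u" "solves u k x b" "solves u k y c"
  shows "solves u k (\<lambda>n. x n + y n) (\<lambda>n. b n + c n)"
  using solves_diff[OF assms(1-4) solves_scale[OF assms(5), of "-1"]] by simp

lemma solves_unique:
  assumes "k \<ge> 1" "0 \<le> s" "s < 1/2" "hs (- s) u" "solves u k x b" "solves u k y b"
    "eps s k * neg_norm s k u < 1"
  shows "x = y"
proof -
  have "solves u k (\<lambda>n. x n - y n) (\<lambda>n. 0)"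
    using solves_diff[OF assms(2-6)] by simp
  from solves_coercive[OF assms(1-4) this order_refl]
  have "nk k (\<lambda>n. x n - y n) = 0"
    using assms(7) by (simp add: mult_le_0_iff)
  then have "(\<lambda>n. x n - y n) = (\<lambda>n. 0)"
    using nk_eq_0[OF assms(1)] assms(5,6) by (auto simp: solves_def intro: hh_diff)
  then show ?thesis
    by (metis eq_iff_diff_eq_0 ext)
qed

text \<open>The map from \<open>x\<close> to \<open>z\<close> is (D + k)^(-1) times the projected
  multiplication by u. By duality it suffices to pair the half-weighted \<open>z\<close> with a
  finitely supported \<open>y\<close>; one half weight then passes to \<open>y'\<close>, whose form
  norm is at most \<open>nrm y\<close>, and the form bound applies.\<close>

lemma neumann_step:
  assumes "k \<ge> 1" "0 \<le> s" "s < 1/2" "hs (- s) u" "hh x"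
  defines "z \<equiv> (\<lambda>n. if n \<ge> 0 then conv u x n / (of_int n + of_real k) else 0)"
  shows "hh z" "nk k z \<le> eps s k * neg_norm s k u * nk k x"
proof -
  have "norm (ip (wgt (1/2) k z) y) \<le> (eps s k * neg_norm s k u * nk k x) * nrm y"
    if fin: "finite {n. y n \<noteq> 0}" for y
  proof -
    define y' where "y' n = (if n \<ge> 0 then of_real ((real_of_int \<bar>n\<bar> + k) powr (-1/2)) * y n else 0)" for n
    have "hh y'"
      unfolding hh_def hardy_def
      by (auto simp: y'_def wgt_def intro!: l2_finite_support[OF fin] split: if_splits)
    have "nk k y' \<le> nrm y"
      unfolding nk_def
    proof (rule l2_mono(2))
      show "l2 y"
        by (rule l2_finite_support[OF fin]) auto
      show "norm (wgt (1/2) k y' n) \<le> norm (y n)" for n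
        using assms(1) by (auto simp: norm_wgt y'_def norm_mult mult.assoc[symmetric] powr_add[symmetric])
    qed
    have "wgt (1/2) k z n * cnj (y n) = conv u x n * cnj (y' n)" for n
    proof (cases "n \<ge> 0")
      case True
      define a where "a = real_of_int n + k"
      have a: "a > 0" using True assms(1) by (simp add: a_def)
      have aa: "of_int n + of_real k = complex_of_real a"
        by (simp add: a_def)
      have "a powr (1/2) / a = a powr (-1/2)"
        using powr_diff[of a "1/2" 1] a by simp
      then have e: "complex_of_real (a powr (1/2)) / of_real a = of_real (a powr (-1/2))"
        by (metis of_real_divide)
      have "wgt (1/2) k z n * cnj (y n) = complex_of_real (a powr (1/2)) / of_real a * (conv u x n * cnj (y n))"
        using True by (simp add: wgt_def z_def aa a_def[symmetric])
      also have "\<dots> = conv u x n * cnj (y' n)"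
        using True unfolding e y'_def by (simp add: a_def)
      finally show ?thesis .
    qed (simp add: wgt_def z_def y'_def)
    then have "ip (wgt (1/2) k z) y = ip (conv u x) y'"
      by (simp add: ip_def)
    also have "\<dots> = tf u x y'"
      using pairable_ip form_bound(1)[OF assms(1-5) \<open>hh y'\<close>] by blast
    finally have "norm (ip (wgt (1/2) k z) y) \<le> eps s k * neg_norm s k u * nk k x * nk k y'"
      using norm_tf_le[OF assms(1-5) \<open>hh y'\<close>] by simp
    also have "\<dots> \<le> eps s k * neg_norm s k u * nk k x * nrm y"
      using \<open>nk k y' \<le> nrm y\<close> by (intro mult_left_mono) (auto simp: eps_nonneg)
    finally show ?thesis .
  qed
  then have *: "l2 (wgt (1/2) k z)" "nrm (wgt (1/2) k z) \<le> eps s k * neg_norm s k u * nk k x"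
    using l2_dualityI[of "eps s k * neg_norm s k u * nk k x" "wgt (1/2) k z"] by (auto simp: eps_nonneg)
  then show "hh z" "nk k z \<le> eps s k * neg_norm s k u * nk k x"
    using l2_wgt_change(1)[OF assms(1)] by (auto simp: hh_def hardy_def z_def nk_def)
qed

lemma hh_series:
  fixes x :: "nat \<Rightarrow> int \<Rightarrow> complex"
  assumes k: "k \<ge> 1" and x: "\<And>j. hh (x j)" "\<And>j. nk k (x j) \<le> A * q ^ j" and q: "0 \<le> q" "q < 1"
  defines "X \<equiv> (\<lambda>n. \<Sum>\<^sub>\<infinity>j. x j n)"
  shows "hh X" "(\<lambda>j. x j n) summable_on UNIV"
proof -
  have A: "A \<ge> 0"
    using x(2)[of 0] order_trans[OF nk_nonneg[of k "x 0"]] by simp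
  have geo: "(\<lambda>j. A * q ^ j) summable_on UNIV"
    using q A by (intro summable_on_cmult_right summable_nonneg_imp_summable_on summable_geometric) auto
  have "(\<lambda>j. norm (x j n)) summable_on UNIV" for n
    by (rule summable_on_comparison_test[OF geo]) (use order_trans[OF norm_le_nk[OF k x(1)] x(2)] in auto)
  then show s: "(\<lambda>j. x j n) summable_on UNIV" for n
    by (rule abs_summable_summable)
  have "L2_set (\<lambda>n. norm (wgt (1/2) k X n)) F \<le> (\<Sum>\<^sub>\<infinity>j. A * q ^ j)" if "finite F" for F
  proof (rule LIMSEQ_le_const2)
    have "(\<lambda>J. \<Sum>j<J. x j n) \<longlonglongrightarrow> X n" for n
      using has_sum_imp_sums[OF has_sum_infsum[OF s[of n]]] by (simp add: sums_def X_def)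
    then show "(\<lambda>J. L2_set (\<lambda>n. norm (wgt (1/2) k (\<lambda>n. \<Sum>j<J. x j n) n)) F)
        \<longlonglongrightarrow> L2_set (\<lambda>n. norm (wgt (1/2) k X n)) F"
      unfolding L2_set_def wgt_def by (intro tendsto_intros)
    have "L2_set (\<lambda>n. norm (wgt (1/2) k (\<lambda>n. \<Sum>j<J. x j n) n)) F \<le> (\<Sum>\<^sub>\<infinity>j. A * q ^ j)" for J
    proof -
      have "hh (\<lambda>n. \<Sum>j<J. x j n) \<and> nk k (\<lambda>n. \<Sum>j<J. x j n) \<le> (\<Sum>j<J. A * q ^ j)"
      proof (induction J)
        case 0
        then show ?case
          using nk_scale[of k 0 "\<lambda>n. 0"] by (simp add: hh_0)
      next
        case (Suc J)
        then show ?case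
          using nk_triangle[OF k, of "\<lambda>n. \<Sum>j<J. x j n" "x J"] x(1)[of J] x(2)[of J]
          by (auto intro: hh_add)
      qed
      moreover have "(\<Sum>j<J. A * q ^ j) \<le> (\<Sum>\<^sub>\<infinity>j. A * q ^ j)"
        using geo q A by (intro finite_sum_le_infsum) auto
      ultimately show ?thesis
        using L2_set_le_nrm[OF hh_l2_wgt[OF _ k] that] by (fastforce simp: nk_def)
    qed
    then show "\<exists>N. \<forall>J\<ge>N. L2_set (\<lambda>n. norm (wgt (1/2) k (\<lambda>n. \<Sum>j<J. x j n) n)) F \<le> (\<Sum>\<^sub>\<infinity>j. A * q ^ j)"
      by blast
  qed
  from l2_bddI(1)[OF this] show "hh X"
    using x(1) l2_wgt_change(1)[OF k] by (auto simp: hh_def hardy_def X_def)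
qed

text \<open>The Neumann series for (D + k - Pi u)^(-1) 1. Its terms decay geometrically in
  \<open>nk k\<close>; the remaining work is to exchange the series with the infinite convolution
  sum at each index.\<close>

lemma resolvent_exists:
  assumes k: "k \<ge> 1" and s: "0 \<le> s" "s < 1/2" and u: "hs (- s) u" and e: "eps s k * neg_norm s k u < 1"
  obtains x where "solves u k x (unit_vec 0)"
proof -
  define step where "step x n = (if n \<ge> 0 then conv u x n / (of_int n + of_real k) else 0)"
    for x :: "int \<Rightarrow> complex" and n :: int
  \<comment> \<open>The zeroth term is (D + k)^(-1) 1, the constant 1 / k.\<close>
  define x where "x = rec_nat (\<lambda>n. (1 / of_real k) * unit_vec 0 n) (\<lambda>_. step)"
  define q where "q = eps s k * neg_norm s k u"
  have q: "0 \<le> q" "q < 1"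
    using e by (auto simp: q_def eps_nonneg)
  have x0: "x 0 = (\<lambda>n. (1 / of_real k) * unit_vec 0 n)" and xS: "x (Suc j) = step (x j)" for j
    by (simp_all add: x_def)
  have "hh (x j) \<and> nk k (x j) \<le> nk k (x 0) * q ^ j" for j
  proof (induction j)
    case 0
    show ?case
      unfolding x0 using hh_scale[OF hh_unit_vec[of 0], of "1 / of_real k"] by simp
  next
    case (Suc j)
    then have h: "hh (x j)" and "q * nk k (x j) \<le> nk k (x 0) * q ^ Suc j"
      using mult_left_mono[of "nk k (x j)" "nk k (x 0) * q ^ j" q] q by (auto simp: mult_ac)
    then show ?case
      using neumann_step[OF k s u h] unfolding xS step_def q_def by auto
  qed
  then have xj: "\<And>j. hh (x j)" "\<And>j. nk k (x j) \<le> nk k (x 0) * q ^ j"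
    by auto
  define X where "X = (\<lambda>n. \<Sum>\<^sub>\<infinity>j. x j n)"
  have X: "hh X" and xsum: "\<And>n. (\<lambda>j. x j n) summable_on UNIV"
    unfolding X_def using hh_series[OF k xj q] by auto
  have "(of_int n + of_real k) * X n - conv u X n = unit_vec 0 n" if n: "n \<ge> 0" for n
  proof -
    \<comment> \<open>The row at index \<open>n\<close> is part of the pairing with
      \<open>unit_vec n\<close>, so the form bound controls its absolute sum with this
      factor.\<close>
    define C where "C = eps s k * neg_norm s k u * nk k (unit_vec n)"
    have row: "(\<lambda>m. norm (u (n - m) * x j m)) summable_on UNIV"
      and le: "(\<Sum>\<^sub>\<infinity>m. norm (u (n - m) * x j m)) \<le> C * (nk k (x 0) * q ^ j)" for j
    proof -
      let ?f = "\<lambda>(n', m). norm (u (n' - m)) * norm (x j m) * norm (unit_vec n n')"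
      have s1: "?f summable_on UNIV"
        using form_bound(1)[OF k s u xj(1) hh_unit_vec[OF n], of j] by (simp add: pairable_def)
      have s2: "?f summable_on {n} \<times> UNIV"
        by (rule summable_on_subset_banach[OF s1]) auto
      have b: "bij_betw (\<lambda>m. (n, m)) UNIV ({n} \<times> UNIV)"
        by (auto simp: bij_betw_def inj_on_def)
      show "(\<lambda>m. norm (u (n - m) * x j m)) summable_on UNIV"
        using s2 summable_on_reindex_bij_betw[OF b, of ?f] by (simp add: norm_mult unit_vec_def)
      have "(\<Sum>\<^sub>\<infinity>m. norm (u (n - m) * x j m)) = infsum ?f ({n} \<times> UNIV)"
        using infsum_reindex_bij_betw[OF b, of ?f] by (simp add: norm_mult unit_vec_def)
      also have "\<dots> \<le> infsum ?f UNIV"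
        by (rule infsum_mono2[OF s2 s1]) auto
      also have "\<dots> \<le> eps s k * neg_norm s k u * nk k (x j) * nk k (unit_vec n)"
        by (rule form_bound_infsum[OF k s u xj(1) hh_unit_vec[OF n]])
      also have "\<dots> = C * nk k (x j)"
        by (simp add: C_def)
      also have "\<dots> \<le> C * (nk k (x 0) * q ^ j)"
        using xj(2)[of j] by (intro mult_left_mono) (auto simp: C_def eps_nonneg)
      finally show "(\<Sum>\<^sub>\<infinity>m. norm (u (n - m) * x j m)) \<le> C * (nk k (x 0) * q ^ j)" .
    qed
    define f where "f = (\<lambda>(j, m). u (n - m) * x j m)"
    have geo: "(\<lambda>j. C * (nk k (x 0) * q ^ j)) summable_on UNIV"
      using q by (intro summable_on_cmult_right summable_nonneg_imp_summable_on summable_geometric) auto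
    have "(\<lambda>p. norm (f p)) summable_on UNIV"
      by (rule summable_on_Sigma_nonneg(1), simp, use row in \<open>simp add: f_def\<close>)
        (rule summable_on_comparison_test[OF geo], use le in \<open>auto simp: f_def infsum_nonneg\<close>)
    note F = Fubini_swap[OF this] Fubini_UNIV_summable[OF this]
    have "conv u X n = (\<Sum>\<^sub>\<infinity>m. \<Sum>\<^sub>\<infinity>j. f (j, m))"
      by (simp add: conv_def X_def f_def infsum_cmult_right')
    also have "\<dots> = (\<Sum>\<^sub>\<infinity>j. conv u (x j) n)"
      unfolding F(1)[symmetric] by (simp add: f_def conv_def)
    also have "\<dots> = (\<Sum>\<^sub>\<infinity>j. (of_int n + of_real k) * x (Suc j) n)"
    proof (rule infsum_cong)
      have "real_of_int n + k \<noteq> 0"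
        using n k by simp
      then have nz: "of_int n + complex_of_real k \<noteq> 0"
        by (metis of_real_add of_real_eq_0_iff of_real_of_int_eq)
      show "conv u (x j) n = (of_int n + of_real k) * x (Suc j) n" for j
        using n nz by (simp add: xS step_def)
    qed
    also have "\<dots> = (of_int n + of_real k) * (\<Sum>\<^sub>\<infinity>j. x (Suc j) n)"
      by (simp add: infsum_cmult_right')
    also have "(\<Sum>\<^sub>\<infinity>j. x (Suc j) n) = X n - x 0 n"
    proof -
      have "(\<lambda>j. x j n) sums X n"
        unfolding X_def by (intro has_sum_imp_sums has_sum_infsum xsum)
      then have 1: "(\<lambda>j. x (Suc j) n) sums (X n - x 0 n)"
        using sums_Suc_iff[of "\<lambda>j. x j n" "X n - x 0 n"] by simp
      have "(\<lambda>j. x (Suc j) n) summable_on UNIV"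
        using summable_on_reindex[of Suc UNIV "\<lambda>j. x j n"] summable_on_subset_banach[OF xsum[of n], of "range Suc"]
        by (simp add: o_def)
      from has_sum_imp_sums[OF has_sum_infsum[OF this]] show ?thesis
        using 1 sums_unique2 by blast
    qed
    finally have "(of_int n + of_real k) * X n - conv u X n = (of_int n + of_real k) * x 0 n"
      by (simp add: algebra_simps)
    also have "\<dots> = unit_vec 0 n"
      using k by (simp add: x0 unit_vec_def)
    finally show ?thesis .
  qed
  with X have "solves u k X (unit_vec 0)"
    by (simp add: solves_def)
  then show ?thesis
    by (rule that)
qed

text \<open>With relative bound 1/2, coercivity gives half of \<open>(nk k x)\<^sup>2\<close> at
  most the modulus of \<open>x 0\<close>, which is at most \<open>nk k x\<close>. Hence the
  2.\<close>

lemma resolvent_bound: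
  assumes "k \<ge> 1" "0 \<le> s" "s < 1/2" "hs (- s) u" "solves u k x (unit_vec 0)"
    "eps s k * neg_norm s k u \<le> 1/2"
  shows "nk k x \<le> 2"
proof -
  have x: "hh x"
    using assms by (auto simp: solves_def)
  have "1/2 * (nk k x)\<^sup>2 \<le> norm (x 0)"
    using solves_coercive[OF assms] by simp
  then have "nk k x * nk k x \<le> 2 * nk k x"
    using norm_le_nk[OF assms(1) x, of 0] by (simp add: power2_eq_square)
  then show ?thesis
    using nk_nonneg[of k x] by (cases "nk k x = 0") auto
qed

text \<open>The vector \<open>x\<close> also solves the equation of \<open>w\<close>, with the
  forcing changed by \<open>conv (u - w) x\<close>. Coercivity for \<open>w\<close> applied to the
  difference of the solutions gives the bound, the factor 2 being the inverse of 1 - 1/2.\<close>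

lemma resolvent_lipschitz:
  assumes "k \<ge> 1" "0 \<le> s" "s < 1/2" "hs (- s) u" "hs (- s) w"
    "solves u k x b" "solves w k y b" "eps s k * neg_norm s k w \<le> 1/2"
  shows "nk k (\<lambda>n. x n - y n) \<le> 2 * eps s k * neg_norm s k (\<lambda>n. u n - w n) * nk k x"
proof -
  have x: "hh x" and y: "hh y"
    using assms by (auto simp: solves_def)
  define d where "d = (\<lambda>n. x n - y n)"
  have d: "hh d"
    unfolding d_def using x y by (rule hh_diff)
  have uw: "hs (- s) (\<lambda>n. u n - w n)"
    using assms by (intro hs_diff)
  have "solves w k x (\<lambda>n. b n + conv (\<lambda>n. u n - w n) x n)"
    unfolding solves_def
  proof (intro conjI allI impI x)
    fix n :: int
    assume n: "n \<ge> 0"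
    have "conv (\<lambda>n. u n - w n) x n = conv u x n - conv w x n"
      using infsum_add[OF hh_convable[OF assms(2,3,4) x n] summable_on_uminus[THEN iffD2, OF hh_convable[OF assms(2,3,5) x n]]]
      by (simp add: conv_def ring_distribs infsum_uminus)
    moreover have "(of_int n + of_real k) * x n - conv u x n = b n"
      using assms(6) n by (simp add: solves_def)
    ultimately show "(of_int n + of_real k) * x n - conv w x n = b n + conv (\<lambda>n. u n - w n) x n"
      by (simp add: algebra_simps)
  qed
  from solves_diff[OF assms(2,3,5) this assms(7)]
  have "solves w k d (conv (\<lambda>n. u n - w n) x)"
    by (simp add: d_def)
  from solves_coercive[OF assms(1-3) assms(5) this assms(8)]
  have "1/2 * (nk k d)\<^sup>2 \<le> norm (tf (\<lambda>n. u n - w n) x d)"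
    using pairable_ip[OF form_bound(1)[OF assms(1-3) uw x d]] by simp
  also have "\<dots> \<le> eps s k * neg_norm s k (\<lambda>n. u n - w n) * nk k x * nk k d"
    by (rule norm_tf_le[OF assms(1-3) uw x d])
  finally have "nk k d * nk k d \<le> (2 * eps s k * neg_norm s k (\<lambda>n. u n - w n) * nk k x) * nk k d"
    by (simp add: power2_eq_square)
  then show ?thesis
    unfolding d_def[symmetric] using nk_nonneg[of k d]
    by (cases "nk k d = 0") (auto simp: eps_nonneg)
qed

section \<open>Conservation of the resolvent of the Lax operator\<close>

definition pos_part :: "(int \<Rightarrow> complex) \<Rightarrow> int \<Rightarrow> complex" where
  "pos_part z n = (if n \<ge> 0 then z n else 0)"

definition neg_part :: "(int \<Rightarrow> complex) \<Rightarrow> int \<Rightarrow> complex" where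
  "neg_part z n = (if n < 0 then z n else 0)"

definition smooth_potential :: "(int \<Rightarrow> complex) \<Rightarrow> bool" where
  "smooth_potential u \<longleftrightarrow> herm u \<and> l1 u \<and> l1 (dd u) \<and> l1 (dd (dd u))"

text \<open>The Fourier coefficients of H v_xx - (v^2)_x, written as d/dx applied to
  \<open>abs_dd u - conv u u\<close>.\<close>

definition bo_field :: "(int \<Rightarrow> complex) \<Rightarrow> int \<Rightarrow> complex" where
  "bo_field u n = \<i> * of_int n * (of_int \<bar>n\<bar> * u n - conv u u n)"

text \<open>What conservation uses of a classical H^3 solution: up to two derivatives of each time
  slice have absolutely summable coefficients, and the curve is differentiable in the l2
  norm.\<close>

definition bo_flow :: "(real \<Rightarrow> int \<Rightarrow> complex) \<Rightarrow> bool" where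
  "bo_flow u \<longleftrightarrow> (\<forall>t. smooth_potential (u t)) \<and>
    (\<forall>t. ((\<lambda>r. nrm (\<lambda>n. u r n - u t n)) \<longlongrightarrow> 0) (at t)) \<and>
    (\<forall>t. ((\<lambda>h. nrm (\<lambda>n. (u (t + h) n - u t n) / of_real h - bo_field (u t) n)) \<longlongrightarrow> 0) (at 0))"

section \<open>Smooth potentials and the derivative of the resolvent value\<close>

lemma l2_pos_part: "l2 z \<Longrightarrow> l2 (pos_part z)" and l2_neg_part: "l2 z \<Longrightarrow> l2 (neg_part z)"
  by (auto intro: l2_mono(1)[of z] simp: pos_part_def neg_part_def)

lemma pos_neg_part: "z = (\<lambda>n. pos_part z n + neg_part z n)"
  by (auto simp: pos_part_def neg_part_def)

lemma l1_mono_norm: "l1 w \<Longrightarrow> (\<And>n. norm (u n) = norm (w n)) \<Longrightarrow> l1 u"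
  by (simp add: l1_def)

lemma l1_add: "l1 u \<Longrightarrow> l1 w \<Longrightarrow> l1 (\<lambda>n. u n + w n)"
  unfolding l1_def
  by (rule summable_on_comparison_test[OF summable_on_add[of "\<lambda>n. norm (u n)" UNIV "\<lambda>n. norm (w n)"]])
    (auto intro: norm_triangle_ineq)

lemma l1_scale: "l1 u \<Longrightarrow> l1 (\<lambda>n. c * u n)"
  unfolding l1_def by (auto simp: norm_mult intro: summable_on_cmult_right)

lemma l1_diff: "l1 u \<Longrightarrow> l1 w \<Longrightarrow> l1 (\<lambda>n. u n - w n)"
  using l1_add[of u "\<lambda>n. -1 * w n"] l1_scale[of w "-1"] by simp

lemma ip_dd: "ip (dd x) y = ip x (dd y)"
  unfolding ip_def dd_def by (rule infsum_cong) simp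

lemma ip_conv_real: "l1 w \<Longrightarrow> herm w \<Longrightarrow> l2 x \<Longrightarrow> Im (ip (conv w x) x) = 0"
  using ip_conv_swap[of w x x] ip_cnj[of "conv w x" x] by (metis cnj.sel(2) equal_neg_zero)

lemma Im_ip_same:
  assumes "\<And>n. x n * cnj (y n) = y n * cnj (x n)"
  shows "Im (ip x y) = 0"
proof -
  have "ip x y = ip y x"
    unfolding ip_def using assms by simp
  then show ?thesis
    using ip_cnj[of x y] by (metis cnj.sel(2) equal_neg_zero)
qed

lemma smooth_potentialD:
  assumes "smooth_potential u"
  shows "herm u" "l1 u" "l1 (dd u)" "l1 (dd (dd u))" "l1 (abs_dd u)" "l1 (dd (abs_dd u))" "herm (abs_dd u)"
  using assms unfolding smooth_potential_def
  by (auto simp: dd_def abs_dd_def norm_mult herm_def intro: l1_mono_norm)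

lemma smooth_potential_nonlinearity:
  assumes "smooth_potential u"
  defines "f \<equiv> (\<lambda>n. abs_dd u n - conv u u n)"
  shows "herm f" "l1 f" "l1 (dd f)"
proof -
  note D = smooth_potentialD[OF assms(1)]
  show "l1 f"
    unfolding f_def by (intro l1_diff l1_conv D)
  show "herm f"
    using herm_conv[OF D(1) D(1)] D(7) by (auto simp: herm_def f_def)
  have "dd f = (\<lambda>n. dd (abs_dd u) n - (conv (dd u) u n + conv u (dd u) n))"
    using dd_conv[of u u] l1_convable D l1_imp_l2 by (auto simp: f_def dd_def algebra_simps fun_eq_iff)
  then show "l1 (dd f)"
    by (simp add: l1_diff l1_add l1_conv D)
qed

text \<open>The gradient of \<open>\<phi> 0 = \<langle>(L\<^sub>u + k)\<^sup>-\<^sup>1 1, 1\<rangle>\<close> with respect to \<open>u\<close> is \<open>\<bar>\<phi>\<bar>\<^sup>2\<close>, which is orthogonal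
  to the Benjamin-Ono vector field. This replaces the Lax pair.\<close>

lemma tf_bo_field_eq_0:
  assumes u: "smooth_potential u" and hsu: "0 \<le> s" "s < 1/2" "hs (- s) u"
    and sol: "solves u k \<phi> (unit_vec 0)"
  shows "tf (bo_field u) \<phi> \<phi> = 0"
proof -
  note D = smooth_potentialD[OF u]
  \<comment> \<open>Since \<open>bo_field u\<close> is i times \<open>dd f\<close>, the claim
    concerns the pairing of (D f) \<phi> with \<phi>. By Leibniz and because \<open>f\<close> is
    hermitian, this pairing is w minus its conjugate for w the pairing of f \<phi> with D \<phi>. So
    it suffices that w is real.\<close>
  define f where "f = (\<lambda>n. abs_dd u n - conv u u n)"
  note f = smooth_potential_nonlinearity[OF u, folded f_def]
  have hh: "hh \<phi>" and eq: "\<And>n. n \<ge> 0 \<Longrightarrow> (of_int n + of_real k) * \<phi> n - conv u \<phi> n = unit_vec 0 n"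
    using sol by (auto simp: solves_def)
  have \<phi>: "l2 \<phi>" and neg: "\<And>n. n < 0 \<Longrightarrow> \<phi> n = 0"
    using hh_l2[OF hh] hardy_hh[OF hh] by (auto simp: hardy_def)
  define z where "z = conv u \<phi>"
  have z: "l2 z"
    unfolding z_def by (rule l2_conv(1)[OF D(2) \<phi>])
  note Pz = l2_pos_part[OF z] and Mz = l2_neg_part[OF z]
  \<comment> \<open>The resolvent equation replaces the derivative of \<phi> by terms without
    derivative: 1, \<phi> and the projection of u \<phi>.\<close>
  have dphi: "dd \<phi> = (\<lambda>n. unit_vec 0 n - of_real k * \<phi> n + pos_part z n)"
    using eq by (auto simp: fun_eq_iff dd_def pos_part_def z_def neg unit_vec_def not_le algebra_simps)
  have ddphi: "l2 (dd \<phi>)"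
    unfolding dphi by (intro l2_add(1) l2_diff(1) l2_unit_vec l2_scale \<phi> Pz)
  define g where "g = abs_dd u"
  have g: "l1 g" "herm g"
    using D by (auto simp: g_def)
  define G where "G = conv g \<phi>"
  have G: "l2 G"
    unfolding G_def by (rule l2_conv(1)[OF g(1) \<phi>])
  define F where "F = conv f \<phi>"
  have F: "l2 F"
    unfolding F_def by (rule l2_conv(1)[OF f(2) \<phi>])
  have F_eq: "F = (\<lambda>n. G n - conv u z n)"
    unfolding F_def f_def G_def z_def g_def
    by (subst conv_diff_left) (auto intro!: l1_convable l1_conv D \<phi> simp: conv_assoc[OF D(2) D(2) \<phi>])
  have phi0: "Im (\<phi> 0) = 0"
    using solves_sym[OF hsu D(1) sol sol] by (simp add: complex_eq_iff)
  have z0: "Im (z 0) = 0"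
    using eq[of 0] phi0 by (simp add: unit_vec_def z_def algebra_simps complex_eq_iff)
  have u0: "Im (u 0) = 0"
    using D(1) unfolding herm_def by (metis cnj.sel(2) equal_neg_zero minus_zero)
  have conv_dphi: "conv u (dd \<phi>) = (\<lambda>n. u n - of_real k * z n + conv u (pos_part z) n)"
    unfolding dphi
    by (subst conv_add_right, (intro l1_convable D l2_diff(1) l2_unit_vec l2_scale \<phi> Pz)+,
        subst conv_diff_right, (intro l1_convable D l2_diff(1) l2_unit_vec l2_scale \<phi> Pz)+)
      (simp add: conv_scale_right conv_unit_vec z_def)
  have conv_z: "conv u z = (\<lambda>n. conv u (pos_part z) n + conv u (neg_part z) n)"
    using conv_add_right[OF l1_convable[OF D(2) Pz] l1_convable[OF D(2) Mz]] pos_neg_part[of z] by simp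
  \<comment> \<open>\<phi> has only nonnegative frequencies m, and u is met at -m, where its |D|
    weight is m; the same factor arises when D falls on \<phi>.\<close>
  have G0: "G 0 = conv u (dd \<phi>) 0"
    unfolding G_def conv_def g_def
    by (rule infsum_cong) (auto simp: abs_dd_def dd_def neg abs_if)
  have Muneg: "conv u (neg_part z) 0 = ip (neg_part z) u"
    using ip_conv_swap[OF D(2,1) Mz l2_unit_vec, of 0] by (simp add: conv_unit_vec)
  have F0: "Im (F 0) = - Im (ip (neg_part z) u)"
    using u0 z0 by (simp add: F_eq G0 conv_dphi conv_z Muneg)
  have "Im (ip F (pos_part z)) = Im (ip G (pos_part z)) - Im (ip (neg_part z) (conv u (pos_part z)))"
  proof -
    have "ip F (pos_part z) = ip G (pos_part z) - (ip (conv u (pos_part z)) (pos_part z)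
        + ip (conv u (neg_part z)) (pos_part z))"
      unfolding F_eq conv_z
      by (simp add: ip_linear l2_add l2_conv(1)[OF D(2)] Pz Mz G)
    then show ?thesis
      using ip_conv_real[OF D(2,1) Pz] ip_conv_swap[OF D(2,1) Mz Pz] by simp
  qed
  \<comment> \<open>The terms with negative frequencies left over from \<open>F 0\<close> and from
    the pairing with \<open>pos_part z\<close> combine here; the derivative of z contributes a real
    number.\<close>
  moreover have "Im (ip (neg_part z) u) + Im (ip (neg_part z) (conv u (pos_part z)))
      = - Im (ip G (neg_part z))"
  proof -
    have dz: "dd z = (\<lambda>n. conv (dd u) \<phi> n + conv u (dd \<phi>) n)"
      unfolding z_def by (intro dd_conv l1_convable D \<phi> ddphi)
    have e: "conv u (pos_part z) = (\<lambda>n. dd z n - conv (dd u) \<phi> n - u n + of_real k * z n)"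
      unfolding dz conv_dphi by auto
    have l: "l2 (conv (dd u) \<phi>)" "l2 (dd z)"
      unfolding dz by (intro l2_add(1) l2_conv(1) D \<phi> ddphi)+
    have "ip (neg_part z) (conv u (pos_part z)) = ip (neg_part z) (dd z) - ip (neg_part z) (conv (dd u) \<phi>)
        - ip (neg_part z) u + of_real k * ip (neg_part z) z"
      unfolding e by (simp add: ip_linear l2_diff l2_scale l l1_imp_l2 D z Mz)
    moreover have "Im (ip (neg_part z) (dd z)) = 0" "Im (ip (neg_part z) z) = 0"
      by (rule Im_ip_same, simp add: neg_part_def dd_def)+
    moreover have "ip (neg_part z) (conv (dd u) \<phi>) = - ip (neg_part z) G"
    proof -
      \<comment> \<open>For n < 0 and m nonnegative the frequency n - m is negative, where |D| acts
        as -D.\<close>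
      have "conv (dd u) \<phi> n = - G n" if "n < 0" for n
        unfolding G_def conv_def g_def infsum_uminus[symmetric]
        using that by (intro infsum_cong) (auto simp: dd_def abs_dd_def neg abs_if not_le algebra_simps)
      then have "ip (neg_part z) (conv (dd u) \<phi>) = ip (neg_part z) (\<lambda>n. - G n)"
        unfolding ip_def by (intro infsum_cong) (auto simp: neg_part_def)
      then show ?thesis
        by (simp add: ip_uminus_right)
    qed
    ultimately show ?thesis
      using ip_cnj[of G "neg_part z", symmetric] by simp
  qed
  \<comment> \<open>The two halves recombine to the pairing of g \<phi> with u \<phi>, which is the
    quadratic form of the hermitian sequence \<open>conv u g\<close> and hence real.\<close>
  moreover have "Im (ip G (pos_part z)) + Im (ip G (neg_part z)) = 0"
  proof -
    have "ip G (pos_part z) + ip G (neg_part z) = ip G z"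
      by (subst (3) pos_neg_part[of z]) (simp add: ip_add_right Pz Mz G)
    also have "\<dots> = ip (conv (conv u g) \<phi>) \<phi>"
      using ip_conv_swap[OF D(2,1) G \<phi>] conv_assoc[OF D(2) g(1) \<phi>] by (simp add: G_def z_def)
    finally show ?thesis
      using ip_conv_real[OF l1_conv[OF D(2) g(1)] herm_conv[OF D(1) g(2)] \<phi>]
      by (metis plus_complex.sel(2))
  qed
  ultimately have FP: "Im (F 0) + Im (ip F (pos_part z)) = 0"
    using F0 by linarith
  have "ip F (dd \<phi>) = F 0 - of_real k * ip F \<phi> + ip F (pos_part z)"
    unfolding dphi by (simp add: ip_linear l2_diff l2_scale \<phi> Pz F)
  then have X: "Im (ip F (dd \<phi>)) = 0"
    using FP ip_conv_real[OF f(2,1) \<phi>] by (simp add: F_def)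
  have dF: "dd F = (\<lambda>n. conv (dd f) \<phi> n + conv f (dd \<phi>) n)"
    unfolding F_def by (intro dd_conv l1_convable f \<phi> ddphi)
  have "ip F (dd \<phi>) = ip (conv (dd f) \<phi>) \<phi> + ip (conv f (dd \<phi>)) \<phi>"
    unfolding ip_dd[symmetric] dF by (intro ip_add_left l2_conv(1) f \<phi> ddphi)
  moreover have "ip (conv f (dd \<phi>)) \<phi> = cnj (ip F (dd \<phi>))"
    using ip_conv_swap[OF f(2,1) ddphi \<phi>] by (simp add: F_def ip_cnj)
  ultimately have "ip (conv (dd f) \<phi>) \<phi> = 0"
    using X by (simp add: complex_eq_iff)
  then have "tf (dd f) \<phi> \<phi> = 0"
    using pairable_ip[OF l1_pairable(1)[OF f(3) \<phi> \<phi>]] by simp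
  moreover have "bo_field u = (\<lambda>n. \<i> * dd f n)"
    by (auto simp: bo_field_def dd_def f_def abs_dd_def fun_eq_iff)
  ultimately show ?thesis
    by (simp add: tf_scale_left)
qed

section \<open>Conservation along smooth flows\<close>

lemma l2_imp_hs:
  assumes "l2 x" "s \<ge> 0"
  shows "hs (- s) x" and neg_norm_le_nrm: "k \<ge> 1 \<Longrightarrow> neg_norm s k x \<le> nrm x"
proof -
  have le: "norm (wgt (- s) k x n) \<le> norm (x n)" if "k \<ge> 1" for k n
    using that assms(2) powr_mono2'[of "- s" 1 "real_of_int \<bar>n\<bar> + k"]
    by (auto simp: norm_wgt intro!: mult_left_le_one_le)
  show "hs (- s) x"
    unfolding hs_def using l2_mono(1)[OF assms(1) le[OF order_refl]] .
  show "k \<ge> 1 \<Longrightarrow> neg_norm s k x \<le> nrm x"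
    unfolding neg_norm_def using l2_mono(2)[OF assms(1) le] .
qed

lemma bo_field_l2:
  assumes "smooth_potential u" shows "l2 (bo_field u)"
proof -
  have "bo_field u = (\<lambda>n. \<i> * dd (\<lambda>n. abs_dd u n - conv u u n) n)"
    by (auto simp: bo_field_def dd_def abs_dd_def fun_eq_iff)
  then show ?thesis
    using smooth_potential_nonlinearity(3)[OF assms] l1_imp_l2 by (simp add: l2_scale)
qed

lemma bo_flow_l2: "bo_flow u \<Longrightarrow> l2 (u t)"
  by (auto simp: bo_flow_def smooth_potential_def intro: l1_imp_l2)

lemma bo_flow_difference_quotient:
  assumes "bo_flow u"
  shows "((\<lambda>r. nrm (\<lambda>n. (1 / of_real (r - t)) * (u r n - u t n) - bo_field (u t) n)) \<longlongrightarrow> 0) (at t)"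
proof -
  have "((\<lambda>h. nrm (\<lambda>n. (u (t + h) n - u t n) / of_real h - bo_field (u t) n)) \<longlongrightarrow> 0) (at 0)"
    using assms by (auto simp: bo_flow_def)
  then show ?thesis
    by (intro LIM_offset_zero_cancel[of _ t]) simp
qed

lemma norm_of_real_diff: "norm (complex_of_real r - of_real t) = \<bar>r - t\<bar>"
  by (metis norm_of_real of_real_diff)

text \<open>The vector field carries the factor n and vanishes at index 0. Conservation of the mean
  is what lets the term u 0 / k^2 of the resolvent expansion be subtracted at two different
  times.\<close>

lemma mean_conserved:
  assumes "bo_flow u" shows "u t 0 = u r 0"
proof -
  have "((\<lambda>t. u t 0) has_vector_derivative 0) (at t)" for t
    unfolding has_vector_derivative_def has_derivative_iff_norm
  proof (intro conjI)
    have "norm (norm (u r 0 - u t 0 - (r - t) *\<^sub>R 0) / norm (r - t))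
        \<le> nrm (\<lambda>n. (1 / of_real (r - t)) * (u r n - u t n) - bo_field (u t) n)" for r
    proof -
      have "l2 (\<lambda>n. (1 / of_real (r - t)) * (u r n - u t n) - bo_field (u t) n)"
        using assms by (intro l2_diff(1) l2_scale bo_flow_l2[OF assms] bo_field_l2) (simp add: bo_flow_def)
      from norm_le_nrm[OF this, of 0] show ?thesis
        by (simp add: bo_field_def norm_divide norm_of_real_diff)
    qed
    then show "((\<lambda>r. norm (u r 0 - u t 0 - (r - t) *\<^sub>R 0) / norm (r - t)) \<longlongrightarrow> 0) (at t)"
      by (intro Lim_null_comparison[OF _ bo_flow_difference_quotient[OF assms, of t]]) simp
  qed (simp add: bounded_linear_zero)
  from has_vector_derivative_zero_constant[OF convex_UNIV this]
  show ?thesis by (metis UNIV_I)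
qed

text \<open>By \<open>solves_pair\<close> the increment of the resolvent value is the form of the
  increment of u between the resolvent vectors at the two times. Its difference quotient tends to
  the form of \<open>bo_field\<close> at \<phi>, which is 0. Only a convex set \<open>S\<close> of
  times is considered, because in the continuity argument smallness is known on a segment of times
  first.\<close>

lemma resolvent_conserved:
  assumes flow: "bo_flow u" and k: "k \<ge> 1" and s: "0 \<le> s" "s < 1/2" and S: "convex S"
    and e: "\<And>t. t \<in> S \<Longrightarrow> eps s k * neg_norm s k (u t) \<le> 1/2"
    and ab: "a \<in> S" "b \<in> S"
    and sol: "solves (u a) k x (unit_vec 0)" "solves (u b) k y (unit_vec 0)"
  shows "x 0 = y 0"
proof -
  have sm: "smooth_potential (u t)" for t
    using flow by (auto simp: bo_flow_def)
  note lu = bo_flow_l2[OF flow]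
  note hsu = l2_imp_hs(1)[OF lu s(1)]
  note herm = smooth_potentialD(1)[OF sm]
  have "\<exists>x. solves (u t) k x (unit_vec 0)" if "t \<in> S" for t
  proof -
    have "eps s k * neg_norm s k (u t) < 1"
      using e[OF that] by simp
    from resolvent_exists[OF k s hsu this] show ?thesis
      by blast
  qed
  then obtain \<phi> where \<phi>: "\<And>t. t \<in> S \<Longrightarrow> solves (u t) k (\<phi> t) (unit_vec 0)"
    by metis
  have hh: "hh (\<phi> t)" if "t \<in> S" for t
    using \<phi>[OF that] by (simp add: solves_def)
  have bd: "nk k (\<phi> t) \<le> 2" if "t \<in> S" for t
    by (rule resolvent_bound[OF k s hsu \<phi>[OF that] e[OF that]])
  have real: "cnj (\<phi> t 0) = \<phi> t 0" if "t \<in> S" for t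
    using solves_sym[OF s hsu herm \<phi>[OF that] \<phi>[OF that]] by simp
  define E where "E = eps s k"
  have E: "E \<ge> 0" by (simp add: E_def eps_nonneg)
  have "((\<lambda>t. \<phi> t 0) has_vector_derivative 0) (at t within S)" if t: "t \<in> S" for t
    unfolding has_vector_derivative_def has_derivative_iff_norm
  proof (intro conjI)
    define v where "v = bo_field (u t)"
    have v: "l2 v"
      unfolding v_def by (rule bo_field_l2[OF sm])
    \<comment> \<open>The first summand is the error of the difference quotient of u, the second the
      Lipschitz variation of the resolvent vector; each bare factor 2 is a
      \<open>resolvent_bound\<close> or the Lipschitz constant.\<close>
    define B where "B r = E * nrm (\<lambda>n. (1 / of_real (r - t)) * (u r n - u t n) - v n) * 2 * 2
        + E * nrm v * (2 * E * nrm (\<lambda>n. u r n - u t n) * 2) * 2" for r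
    have "norm (norm (\<phi> r 0 - \<phi> t 0 - (r - t) *\<^sub>R 0) / norm (r - t)) \<le> B r"
      if r: "r \<in> S" "r \<noteq> t" for r
    proof -
      define w where "w = (\<lambda>n. u r n - u t n)"
      define q where "q = (\<lambda>n. (1 / of_real (r - t)) * w n)"
      define d where "d = (\<lambda>n. \<phi> r n - \<phi> t n)"
      have lw: "l2 w" and lq: "l2 q" and lqv: "l2 (\<lambda>n. q n - v n)"
        unfolding w_def q_def by (intro l2_scale l2_diff(1) lu v)+
      note pr = form_bound(1)[OF k s l2_imp_hs(1)[OF _ s(1)]]
      have hd: "hh d"
        unfolding d_def by (intro hh_diff hh r t)
      have nn: "\<And>x. l2 x \<Longrightarrow> neg_norm s k x \<le> nrm x"
        by (rule neg_norm_le_nrm[OF _ s(1) k])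
      have "cnj (\<phi> t 0) - \<phi> r 0 = tf (\<lambda>n. u t n - u r n) (\<phi> r) (\<phi> t)"
        using solves_pair[OF k s hsu hsu herm \<phi>[OF r(1)] \<phi>[OF t]] by simp
      then have "\<phi> r 0 - \<phi> t 0 = - tf (\<lambda>n. u t n - u r n) (\<phi> r) (\<phi> t)"
        unfolding real[OF t] by (metis minus_diff_eq)
      also have "\<dots> = tf w (\<phi> r) (\<phi> t)"
        using tf_scale_left[of "-1" w] by (simp add: w_def)
      finally have "(\<phi> r 0 - \<phi> t 0) / of_real (r - t) = tf q (\<phi> r) (\<phi> t)"
        unfolding q_def tf_scale_left by simp
      also have "\<dots> = tf (\<lambda>n. q n - v n) (\<phi> r) (\<phi> t) + tf v (\<phi> r) (\<phi> t)"
        using tf_diff_left[OF pr[OF lq hh[OF r(1)] hh[OF t]] pr[OF v hh[OF r(1)] hh[OF t]]] by simp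
      \<comment> \<open>This subtracts \<open>tf v (\<phi> t) (\<phi> t)\<close>, which vanishes by
        \<open>tf_bo_field_eq_0\<close>, so that only the increment of the resolvent vector
        remains.\<close>
      also have "tf v (\<phi> r) (\<phi> t) = tf v d (\<phi> t)"
        using tf_diff_mid[OF pr[OF v hh[OF r(1)] hh[OF t]] pr[OF v hh[OF t] hh[OF t]]]
          tf_bo_field_eq_0[OF sm s hsu \<phi>[OF t]]
        by (simp add: d_def v_def)
      finally have "norm ((\<phi> r 0 - \<phi> t 0) / of_real (r - t))
          \<le> norm (tf (\<lambda>n. q n - v n) (\<phi> r) (\<phi> t)) + norm (tf v d (\<phi> t))"
        by (simp add: norm_triangle_ineq)
      also have "norm (tf (\<lambda>n. q n - v n) (\<phi> r) (\<phi> t))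
          \<le> E * neg_norm s k (\<lambda>n. q n - v n) * nk k (\<phi> r) * nk k (\<phi> t)"
        unfolding E_def by (intro norm_tf_le k s l2_imp_hs(1) lqv hh r t)
      also have "\<dots> \<le> E * nrm (\<lambda>n. q n - v n) * 2 * 2"
        using nn[OF lqv] bd r t E by (intro mult_mono mult_nonneg_nonneg) auto
      also have "norm (tf v d (\<phi> t)) \<le> E * neg_norm s k v * nk k d * nk k (\<phi> t)"
        unfolding E_def by (intro norm_tf_le k s l2_imp_hs(1) v hd hh t)
      also have "\<dots> \<le> E * nrm v * (2 * E * nrm w * 2) * 2"
      proof -
        have "nk k d \<le> 2 * E * neg_norm s k w * nk k (\<phi> r)"
          unfolding d_def w_def E_def
          by (rule resolvent_lipschitz[OF k s hsu hsu \<phi>[OF r(1)] \<phi>[OF t] e[OF t]])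
        also have "\<dots> \<le> 2 * E * nrm w * 2"
          using nn[OF lw] bd[OF r(1)] E by (intro mult_mono) auto
        finally show ?thesis
          using nn[OF v] bd[OF t] E by (intro mult_mono mult_nonneg_nonneg) auto
      qed
      finally show ?thesis
        by (simp add: B_def q_def w_def norm_divide norm_of_real_diff)
    qed
    then have ev: "\<forall>\<^sub>F r in at t within S. norm (norm (\<phi> r 0 - \<phi> t 0 - (r - t) *\<^sub>R 0) / norm (r - t)) \<le> B r"
      by (auto simp: eventually_at_filter)
    have "(B \<longlongrightarrow> E * 0 * 2 * 2 + E * nrm v * (2 * E * 0 * 2) * 2) (at t)"
      unfolding B_def v_def using flow
      by (intro tendsto_intros bo_flow_difference_quotient[OF flow]) (auto simp: bo_flow_def)
    then have "(B \<longlongrightarrow> 0) (at t within S)"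
      by (auto intro: tendsto_within_subset)
    then show "((\<lambda>r. norm (\<phi> r 0 - \<phi> t 0 - (r - t) *\<^sub>R 0) / norm (r - t)) \<longlongrightarrow> 0) (at t within S)"
      by (rule Lim_null_comparison[OF ev])
  qed (simp add: bounded_linear_zero)
  from has_vector_derivative_zero_constant[OF S this]
  have "\<phi> a 0 = \<phi> b 0"
    using ab by metis
  moreover have "x = \<phi> a" "y = \<phi> b"
    using solves_unique[OF k s hsu sol(1) \<phi>[OF ab(1)]] solves_unique[OF k s hsu sol(2) \<phi>[OF ab(2)]]
      e[OF ab(1)] e[OF ab(2)] by auto
  ultimately show ?thesis by simp
qed

text \<open>Its square is the pairing of (D + k)^(-1) Pi u with Pi u; divided by k^2 it is the
  quadratic term in the expansion of the resolvent value.\<close>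

definition pos_energy :: "real \<Rightarrow> (int \<Rightarrow> complex) \<Rightarrow> real" where
  "pos_energy k u = nrm (wgt (-1/2) k (pos_part u))"

text \<open>Subtracting (D + k)^(-1) 1 = 1 / k leaves \<open>\<psi>\<close>, which solves the
  equation with right-hand side u / k, and the pairing of u / k with \<open>\<psi>\<close> is the
  resolvent value minus its first two terms. The form bound places this pairing between (1 - e) X^2
  and (1 + e) X^2 in modulus, X being the form norm of \<open>\<psi>\<close>. One Neumann step
  \<open>z\<close> compares X with the energy: \<open>\<psi> - z\<close> is exactly (D + k)^(-1) Pi
  u / k, and \<open>z\<close> has norm at most e X.\<close>

lemma resolvent_energy:
  assumes k: "k \<ge> 1" and s: "0 \<le> s" "s < 1/2" and u: "l2 u" "herm u"
    and sol: "solves u k \<phi> (unit_vec 0)"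
    and e: "eps s k * neg_norm s k u \<le> e" "e \<le> 1/2"
  obtains X where "X \<ge> 0"
    "(1 - e) * X\<^sup>2 \<le> norm (\<phi> 0 - 1 / of_real k - u 0 / of_real (k\<^sup>2))"
    "norm (\<phi> 0 - 1 / of_real k - u 0 / of_real (k\<^sup>2)) \<le> (1 + e) * X\<^sup>2"
    "pos_energy k u / k \<le> (1 + e) * X" "(1 - e) * X \<le> pos_energy k u / k"
proof -
  note hsu = l2_imp_hs(1)[OF u(1) s(1)]
  define c where "c = complex_of_real (1 / k)"
  define b where "b = (\<lambda>n. c * u n)"
  define \<psi> where "\<psi> = (\<lambda>n. \<phi> n - c * unit_vec 0 n)"
  have k0: "k \<noteq> 0" "complex_of_real k \<noteq> 0" using k by auto
  have e0: "solves u k (\<lambda>n. c * unit_vec 0 n) (\<lambda>n. unit_vec 0 n - b n)"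
    unfolding solves_def
  proof (intro conjI allI impI)
    show "hh (\<lambda>n. c * unit_vec 0 n)"
      by (intro hh_scale hh_unit_vec) simp
    show "(of_int n + of_real k) * (c * unit_vec 0 n) - conv u (\<lambda>n. c * unit_vec 0 n) n = unit_vec 0 n - b n" for n
      unfolding conv_scale_right conv_unit_vec using k0 by (simp add: b_def c_def unit_vec_def)
  qed
  have \<psi>sol: "solves u k \<psi> b"
    using solves_diff[OF s hsu sol e0] by (simp add: \<psi>_def)
  have \<phi>: "hh \<phi>" and \<psi>: "hh \<psi>"
    using sol \<psi>sol by (auto simp: solves_def)
  have lb: "l2 b" unfolding b_def by (rule l2_scale[OF u(1)])
  have "ip b \<phi> = ip \<psi> (unit_vec 0)"
    by (rule solves_sym[OF s hsu u(2) \<psi>sol sol])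
  moreover have "ip b \<psi> = ip b \<phi> - ip b (\<lambda>n. c * unit_vec 0 n)"
    unfolding \<psi>_def by (intro ip_diff_right lb hh_l2 \<phi> l2_scale l2_unit_vec)
  moreover have "ip b (\<lambda>n. c * unit_vec 0 n) = u 0 / of_real (k\<^sup>2)"
    unfolding ip_scale_right by (simp add: b_def c_def power2_eq_square)
  ultimately have \<beta>: "ip b \<psi> = \<phi> 0 - 1 / of_real k - u 0 / of_real (k\<^sup>2)"
    by (simp add: \<psi>_def c_def unit_vec_def)
  define X where "X = nk k \<psi>"
  have "norm (tf u \<psi> \<psi>) \<le> e * X\<^sup>2"
    using norm_tf_le[OF k s hsu \<psi> \<psi>] mult_right_mono[OF e(1), of "X\<^sup>2"]
    by (simp add: power2_eq_square X_def mult.assoc)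
  moreover have "norm (qf k \<psi> \<psi>) = X\<^sup>2"
    by (simp add: qf_self[OF k \<psi>] norm_power X_def)
  moreover have "norm (qf k \<psi> \<psi>) - norm (tf u \<psi> \<psi>) \<le> norm (ip b \<psi>)"
    "norm (ip b \<psi>) \<le> norm (qf k \<psi> \<psi>) + norm (tf u \<psi> \<psi>)"
    unfolding solves_ip[OF k s hsu \<psi>sol \<psi>]
    by (rule norm_triangle_ineq2 norm_triangle_ineq4)+
  ultimately have 1: "(1 - e) * X\<^sup>2 \<le> norm (ip b \<psi>)" "norm (ip b \<psi>) \<le> (1 + e) * X\<^sup>2"
    by (simp_all add: left_diff_distrib distrib_right)
  define z where "z = (\<lambda>n. if n \<ge> 0 then conv u \<psi> n / (of_int n + of_real k) else 0)"
  have z: "hh z" "nk k z \<le> e * X"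
    using neumann_step[OF k s hsu \<psi>] mult_right_mono[OF e(1), of X] unfolding z_def X_def by auto
  have "wgt (1/2) k (\<lambda>n. \<psi> n - z n) = (\<lambda>n. c * wgt (-1/2) k (pos_part u) n)"
  proof
    fix n :: int
    show "wgt (1/2) k (\<lambda>n. \<psi> n - z n) n = c * wgt (-1/2) k (pos_part u) n"
    proof (cases "n \<ge> 0")
      case True
      define a where "a = real_of_int n + k"
      have a: "a > 0" using True k by (simp add: a_def)
      have aa: "of_int n + of_real k = complex_of_real a" by (simp add: a_def)
      have "\<psi> n - z n = b n / of_real a"
      proof -
        have "of_real a * \<psi> n - conv u \<psi> n = b n"
          using \<psi>sol True unfolding solves_def aa[symmetric] by simp
        then have "of_real a * (\<psi> n - z n) = b n"
          using True a by (simp add: z_def aa right_diff_distrib)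
        then show ?thesis
          using a by (simp add: eq_divide_eq mult.commute)
      qed
      moreover have "complex_of_real (a powr (1/2)) / of_real a = of_real (a powr (-1/2))"
        using powr_diff[of a "1/2" 1] a by (simp flip: of_real_divide)
      moreover have "wgt (1/2) k (\<lambda>n. \<psi> n - z n) n = of_real (a powr (1/2)) * (\<psi> n - z n)"
        "wgt (-1/2) k (pos_part u) n = of_real (a powr (-1/2)) * u n"
        using True by (simp_all add: wgt_def pos_part_def a_def)
      ultimately show ?thesis
        unfolding b_def by (metis (no_types, lifting) mult.left_commute times_divide_eq_left times_divide_eq_right)
    next
      case False
      then show ?thesis
        using hardy_hh[OF \<psi>] by (simp add: wgt_def pos_part_def z_def hardy_def)
    qed
  qed
  then have Q: "nk k (\<lambda>n. \<psi> n - z n) = pos_energy k u / k"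
    using k nrm_scale[of c "wgt (-1/2) k (pos_part u)"]
    unfolding nk_def pos_energy_def by (simp add: c_def norm_divide)
  have 2: "pos_energy k u / k \<le> (1 + e) * X"
    using nk_diff_le[OF k \<psi> z(1)] z(2) unfolding Q X_def by (simp add: algebra_simps)
  have 3: "(1 - e) * X \<le> pos_energy k u / k"
    using nk_triangle[OF k hh_diff[OF \<psi> z(1)] z(1)] z(2) unfolding Q by (simp add: X_def algebra_simps)
  show thesis
    by (rule that[of X]) (use 1 2 3 in \<open>auto simp: \<beta> X_def\<close>)
qed

text \<open>One factor (1 + e) / (1 - e) comes from comparing X at the two times through the
  conserved value, two more from replacing X^2 by the squared energy at each end. For e = 1/2 the
  product is 27; as e tends to 0 it tends to 1, which is what the case s = 0 requires.\<close>

lemma pos_energy_bound: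
  assumes flow: "bo_flow u" and k: "k \<ge> 1" and s: "0 \<le> s" "s < 1/2" and S: "convex S"
    and e: "\<And>t. t \<in> S \<Longrightarrow> eps s k * neg_norm s k (u t) \<le> e" "e \<le> 1/2"
    and ab: "a \<in> S" "b \<in> S"
  shows "(pos_energy k (u b))\<^sup>2 \<le> ((1 + e) / (1 - e)) ^ 3 * (pos_energy k (u a))\<^sup>2"
proof -
  have sm: "smooth_potential (u t)" for t
    using flow by (auto simp: bo_flow_def)
  note lu = bo_flow_l2[OF flow]
  note hsu = l2_imp_hs(1)[OF lu s(1)]
  note herm = smooth_potentialD(1)[OF sm]
  have e12: "eps s k * neg_norm s k (u t) \<le> 1/2" if "t \<in> S" for t
    using e(1)[OF that] e(2) by simp
  have e0: "e \<ge> 0"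
    using e(1)[OF ab(1)] by (meson eps_nonneg neg_norm_nonneg mult_nonneg_nonneg order_trans)
  obtain x where x: "solves (u a) k x (unit_vec 0)"
    using resolvent_exists[OF k s hsu, of a] e12[OF ab(1)] by auto
  obtain y where y: "solves (u b) k y (unit_vec 0)"
    using resolvent_exists[OF k s hsu, of b] e12[OF ab(2)] by auto
  have same: "x 0 = y 0"
    by (rule resolvent_conserved[OF flow k s S e12 ab x y])
  obtain X where X: "X \<ge> 0"
    "(1 - e) * X\<^sup>2 \<le> norm (x 0 - 1 / of_real k - u a 0 / of_real (k\<^sup>2))"
    "norm (x 0 - 1 / of_real k - u a 0 / of_real (k\<^sup>2)) \<le> (1 + e) * X\<^sup>2"
    "pos_energy k (u a) / k \<le> (1 + e) * X" "(1 - e) * X \<le> pos_energy k (u a) / k"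
    by (rule resolvent_energy[OF k s lu herm x e(1)[OF ab(1)] e(2)])
  obtain Y where Y: "Y \<ge> 0"
    "(1 - e) * Y\<^sup>2 \<le> norm (y 0 - 1 / of_real k - u b 0 / of_real (k\<^sup>2))"
    "norm (y 0 - 1 / of_real k - u b 0 / of_real (k\<^sup>2)) \<le> (1 + e) * Y\<^sup>2"
    "pos_energy k (u b) / k \<le> (1 + e) * Y" "(1 - e) * Y \<le> pos_energy k (u b) / k"
    by (rule resolvent_energy[OF k s lu herm y e(1)[OF ab(2)] e(2)])
  define A B where "A = pos_energy k (u a) / k" and "B = pos_energy k (u b) / k"
  have AB: "A \<ge> 0" "B \<ge> 0"
    using k by (auto simp: A_def B_def pos_energy_def)
  have d: "1 - e > 0" using e(2) by simp
  have YX: "(1 - e) * Y\<^sup>2 \<le> (1 + e) * X\<^sup>2"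
    using X(3) Y(2) mean_conserved[OF flow, of a b] same by simp
  have XA: "(1 - e)\<^sup>2 * X\<^sup>2 \<le> A\<^sup>2"
    using power_mono[OF X(5), of 2] X(1) d by (simp add: A_def power_mult_distrib)
  have BY: "B\<^sup>2 \<le> (1 + e)\<^sup>2 * Y\<^sup>2"
    using power_mono[OF Y(4), of 2] AB(2) by (simp add: B_def power_mult_distrib)
  have "(1 - e) ^ 3 * B\<^sup>2 \<le> (1 - e) ^ 3 * ((1 + e)\<^sup>2 * Y\<^sup>2)"
    using BY d by (intro mult_left_mono) auto
  also have "\<dots> = (1 - e)\<^sup>2 * (1 + e)\<^sup>2 * ((1 - e) * Y\<^sup>2)"
    by (simp add: power2_eq_square power3_eq_cube)
  also have "\<dots> \<le> (1 - e)\<^sup>2 * (1 + e)\<^sup>2 * ((1 + e) * X\<^sup>2)"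
    using YX by (intro mult_left_mono) auto
  also have "\<dots> = (1 + e) ^ 3 * ((1 - e)\<^sup>2 * X\<^sup>2)"
    by (simp add: power2_eq_square power3_eq_cube)
  also have "\<dots> \<le> (1 + e) ^ 3 * A\<^sup>2"
    using XA e0 by (intro mult_left_mono) auto
  finally have "B\<^sup>2 \<le> ((1 + e) / (1 - e)) ^ 3 * A\<^sup>2"
    using d by (simp add: power_divide field_simps)
  then show ?thesis
    using k by (simp add: A_def B_def power_divide field_simps)
qed

section \<open>A priori bounds for the flow\<close>

lemma sum_power_dist_le:
  fixes a :: real
  assumes a: "0 \<le> a" "a < 1" and F: "finite F"
  shows "(\<Sum>j\<in>F. a ^ nat \<bar>int j - int i\<bar>) \<le> 2 / (1 - a)"
proof -
  have half: "(\<Sum>j\<in>G. a ^ h j) \<le> 1 / (1 - a)" if "finite G" "inj_on h G" for G and h :: "nat \<Rightarrow> nat"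
  proof -
    have "(\<Sum>j\<in>G. a ^ h j) = (\<Sum>m\<in>h ` G. a ^ m)"
      using that(2) by (simp add: sum.reindex)
    also have "\<dots> \<le> (\<Sum>m. a ^ m)"
      using a that(1) by (intro sum_le_suminf summable_geometric) auto
    finally show ?thesis
      using a by (simp add: suminf_geometric)
  qed
  have "(\<Sum>j\<in>F. a ^ nat \<bar>int j - int i\<bar>)
      = (\<Sum>j\<in>{j \<in> F. j < i}. a ^ (i - j)) + (\<Sum>j\<in>{j \<in> F. \<not> j < i}. a ^ (j - i))"
    by (subst sum.Int_Diff[OF F, of _ "{j. j < i}"])
      (auto intro!: arg_cong2[of _ _ _ _ "(+)"] sum.cong simp: nat_diff_distrib Int_def)
  also have "\<dots> \<le> 1 / (1 - a) + 1 / (1 - a)"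
    using F by (intro add_mono half) (auto simp: inj_on_def)
  finally show ?thesis by simp
qed

lemma dyadic_index:
  assumes "k \<ge> 1" "X \<ge> (k :: real)"
  obtains i where "k * 2 ^ i \<le> X" "X < 2 * (k * 2 ^ i)"
proof -
  have X: "X > 0" using assms by simp
  define i where "i = nat \<lfloor>log 2 (X / k)\<rfloor>"
  have "log 2 (X / k) \<ge> 0"
    using assms by (simp add: zero_le_log_cancel_iff)
  then have "real i \<le> log 2 (X / k)" "log 2 (X / k) < real i + 1"
    unfolding i_def by linarith+
  moreover have "2 powr (log 2 (X / k)) = X / k"
    using X assms by simp
  ultimately have "2 powr real i \<le> X / k" "X / k < 2 powr (real i + 1)"
    by (metis powr_le_cancel_iff one_less_numeral_iff semiring_norm(76))
      (metis \<open>log 2 (X / k) < real i + 1\<close> \<open>2 powr log 2 (X / k) = X / k\<close> powr_less_cancel_iff one_less_numeral_iff semiring_norm(76))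
  then have "k * 2 ^ i \<le> X" "X < 2 * (k * 2 ^ i)"
    using assms(1) by (auto simp: powr_add powr_realpow field_simps)
  then show thesis by (rule that)
qed

text \<open>Let X = n + k and x = k 2^j. The summand is of size x^(1 - 2 s) / X while x is below X
  and x^(-2 s) above it, so it decays geometrically on both sides of the index i with k 2^i
  comparable to X. The ratio \<open>a\<close> is the worse of the two rates, and a < 1 requires both
  0 < s and s < 1/2. In \<open>C\<close> one factor 2 bounds 2^(2 s) and 2 / (1 - a) is the two
  geometric series; the 4 bounds 2^(1 - 2 s) times the loss in the denominator. The constants do not
  depend on k.\<close>

lemma dyadic_weight:
  assumes s: "0 < s" "s < 1/2"
  obtains C :: real where "C \<ge> 1" and
    "\<And>k n. k \<ge> 1 \<Longrightarrow> n \<ge> 0 \<Longrightarrow> (\<lambda>j. (k * 2 ^ j) powr (1 - 2 * s) / (n + k * 2 ^ j)) summable_on UNIV" and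
    "\<And>k n. k \<ge> 1 \<Longrightarrow> n \<ge> 0 \<Longrightarrow>
      (\<Sum>\<^sub>\<infinity>j. (k * 2 ^ j) powr (1 - 2 * s) / (n + k * 2 ^ j)) \<le> C * (n + k) powr (- 2 * s)" and
    "\<And>k n. k \<ge> 1 \<Longrightarrow> n \<ge> 0 \<Longrightarrow>
      (n + k) powr (- 2 * s) \<le> 4 * (\<Sum>\<^sub>\<infinity>j. (k * 2 ^ j) powr (1 - 2 * s) / (n + k * 2 ^ j))"
proof -
  define a :: real where "a = max (2 powr (2 * s - 1)) (2 powr (- 2 * s))"
  have a: "0 < a" "a < 1"
    using s powr_less_mono[of "2 * s - 1" 0 "2 :: real"] powr_less_mono[of "- 2 * s" 0 "2 :: real"]
    by (simp_all add: a_def less_max_iff_disj)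
  define C where "C = 2 * (2 / (1 - a))"
  have C: "C \<ge> 1"
    using a by (simp add: C_def field_simps)
  have main: "(\<forall>F. finite F \<longrightarrow> (\<Sum>j\<in>F. (k * 2 ^ j) powr (1 - 2 * s) / (n + k * 2 ^ j)) \<le> C * (n + k) powr (- 2 * s))
      \<and> (\<exists>i. (n + k) powr (- 2 * s) \<le> 4 * ((k * 2 ^ i) powr (1 - 2 * s) / (n + k * 2 ^ i)))"
    if k: "k \<ge> 1" and n: "n \<ge> 0" for k n :: real
  proof -
    define X where "X = n + k"
    have X: "X \<ge> k" "X > 0" using k n by (auto simp: X_def)
    obtain i where i: "k * 2 ^ i \<le> X" "X < 2 * (k * 2 ^ i)"
      using dyadic_index[OF k X(1)] by blast
    have k2: "k * 2 ^ j > 0" "k * 2 ^ j \<ge> k" for j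
      using k by auto
    have trm: "(k * 2 ^ j) powr (1 - 2 * s) / (n + k * 2 ^ j) \<le> 2 * X powr (- 2 * s) * a ^ nat \<bar>int j - int i\<bar>" for j
    proof (cases "j \<le> i")
      case True
      define d where "d = i - j"
      have d: "nat \<bar>int j - int i\<bar> = d" and ij: "i = j + d"
        using True by (auto simp: d_def)
      have "k * 2 ^ j \<le> X * 2 powr (- real d)"
        using i(1) by (simp add: ij power_add powr_minus powr_realpow field_simps)
      then have "(k * 2 ^ j) powr (1 - 2 * s) \<le> (X * 2 powr (- real d)) powr (1 - 2 * s)"
        using s k2(1)[of j] by (intro powr_mono2) auto
      also have "\<dots> = X powr (1 - 2 * s) * (2 powr (2 * s - 1)) powr (real d)"
        using X by (simp add: powr_mult powr_powr algebra_simps)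
      also have "\<dots> \<le> X powr (1 - 2 * s) * a powr (real d)"
        by (intro mult_left_mono powr_mono2) (auto simp: a_def)
      finally have "(k * 2 ^ j) powr (1 - 2 * s) \<le> X powr (1 - 2 * s) * a ^ d"
        using a by (simp add: powr_realpow)
      then have "(k * 2 ^ j) powr (1 - 2 * s) / (n + k * 2 ^ j) \<le> X powr (1 - 2 * s) * a ^ d / X"
        using X k2(2)[of j] a by (intro frac_le) (auto simp: X_def)
      also have "\<dots> = X powr (- 2 * s) * a ^ d"
        using X by (simp add: powr_diff powr_minus field_simps)
      also have "\<dots> \<le> 2 * X powr (- 2 * s) * a ^ d"
        using a by simp
      finally show ?thesis
        by (simp add: d)
    next
      case False
      define d where "d = j - i"
      have d: "nat \<bar>int j - int i\<bar> = d" and ij: "j = i + d"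
        using False by (auto simp: d_def)
      have "(k * 2 ^ j) powr (1 - 2 * s) / (n + k * 2 ^ j) \<le> (k * 2 ^ j) powr (1 - 2 * s) / (k * 2 ^ j)"
        using k2(1)[of j] n by (intro divide_left_mono) auto
      also have "\<dots> = (k * 2 ^ j) powr (- 2 * s)"
        using k2(1)[of j] by (simp add: powr_diff powr_minus field_simps)
      also have "\<dots> \<le> (X / 2 * 2 powr (real d)) powr (- 2 * s)"
        using s X i(2) by (intro powr_mono2') (auto simp: ij power_add powr_realpow field_simps)
      also have "\<dots> = X powr (- 2 * s) * (2 powr (2 * s)) * (2 powr (- 2 * s)) powr (real d)"
        using X by (simp add: powr_mult powr_divide powr_powr powr_minus field_simps)
      also have "\<dots> \<le> X powr (- 2 * s) * 2 * a powr (real d)"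
        using s powr_mono[of "2 * s" 1 2] by (intro mult_mono mult_left_mono powr_mono2) (auto simp: a_def)
      finally show ?thesis
        using a by (simp add: d powr_realpow mult_ac)
    qed
    have "(\<Sum>j\<in>F. (k * 2 ^ j) powr (1 - 2 * s) / (n + k * 2 ^ j)) \<le> C * (n + k) powr (- 2 * s)"
      if F: "finite F" for F
    proof -
      have "(\<Sum>j\<in>F. (k * 2 ^ j) powr (1 - 2 * s) / (n + k * 2 ^ j))
          \<le> (\<Sum>j\<in>F. 2 * X powr (- 2 * s) * a ^ nat \<bar>int j - int i\<bar>)"
        by (intro sum_mono trm)
      also have "\<dots> = 2 * X powr (- 2 * s) * (\<Sum>j\<in>F. a ^ nat \<bar>int j - int i\<bar>)"
        by (simp add: sum_distrib_left)
      also have "\<dots> \<le> 2 * X powr (- 2 * s) * (2 / (1 - a))"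
        using a by (intro mult_left_mono sum_power_dist_le F) auto
      finally show ?thesis
        by (simp add: C_def X_def mult_ac)
    qed
    moreover have "X powr (- 2 * s) \<le> 4 * ((k * 2 ^ i) powr (1 - 2 * s) / (n + k * 2 ^ i))"
    proof -
      have "X powr (1 - 2 * s) \<le> (2 * (k * 2 ^ i)) powr (1 - 2 * s)"
        using i X s by (intro powr_mono2) auto
      also have "\<dots> = 2 powr (1 - 2 * s) * (k * 2 ^ i) powr (1 - 2 * s)"
        using k2(1)[of i] by (subst powr_mult) auto
      also have "\<dots> \<le> 2 * (k * 2 ^ i) powr (1 - 2 * s)"
        using s powr_mono[of "1 - 2 * s" 1 "2 :: real"] by (intro mult_right_mono) auto
      finally have le: "X powr (1 - 2 * s) \<le> 2 * (k * 2 ^ i) powr (1 - 2 * s)" .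
      have "X powr (- 2 * s) = X powr (1 - 2 * s) / X"
        using X by (simp add: powr_diff powr_minus field_simps)
      also have "\<dots> \<le> 2 * (k * 2 ^ i) powr (1 - 2 * s) / X"
        using le X by (intro divide_right_mono) auto
      also have "\<dots> \<le> 2 * (k * 2 ^ i) powr (1 - 2 * s) / ((n + k * 2 ^ i) / 2)"
      proof (intro divide_left_mono)
        show "(n + k * 2 ^ i) / 2 \<le> X"
        proof -
          have "(n + y) / 2 \<le> X" if "y \<le> X" for y
            using that k unfolding X_def by (simp add: field_simps)
          then show ?thesis
            using i(1) by blast
        qed
      qed (use X k2(1)[of i] n in auto)
      finally show ?thesis by simp
    qed
    ultimately show ?thesis
      by (auto simp: X_def)
  qed
  have nonneg: "0 \<le> (k * 2 ^ j) powr (1 - 2 * s) / (n + k * 2 ^ j)" if "k \<ge> 1" "n \<ge> 0" for k n :: real and j :: nat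
    using that by (intro divide_nonneg_nonneg) auto
  have sumb: "(\<lambda>j. (k * 2 ^ j) powr (1 - 2 * s) / (n + k * 2 ^ j)) summable_on UNIV"
    if "k \<ge> 1" "n \<ge> 0" for k n :: real
    by (intro nonneg_bdd_above_summable_on nonneg that bdd_aboveI2) (use main[OF that] in auto)
  show thesis
  proof (rule that[OF C])
    fix k n :: real
    assume kn: "k \<ge> 1" "n \<ge> 0"
    show "(\<lambda>j. (k * 2 ^ j) powr (1 - 2 * s) / (n + k * 2 ^ j)) summable_on UNIV"
      by (rule sumb[OF kn])
    show "(\<Sum>\<^sub>\<infinity>j. (k * 2 ^ j) powr (1 - 2 * s) / (n + k * 2 ^ j)) \<le> C * (n + k) powr (- 2 * s)"
      by (rule infsum_le_finite_sums[OF sumb[OF kn]]) (use main[OF kn] in auto)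
    obtain i where i: "(n + k) powr (- 2 * s) \<le> 4 * ((k * 2 ^ i) powr (1 - 2 * s) / (n + k * 2 ^ i))"
      using main[OF kn] by blast
    also have "(k * 2 ^ i) powr (1 - 2 * s) / (n + k * 2 ^ i)
        \<le> (\<Sum>\<^sub>\<infinity>j. (k * 2 ^ j) powr (1 - 2 * s) / (n + k * 2 ^ j))"
      using finite_sum_le_infsum[OF sumb[OF kn], of "{i}"] nonneg[OF kn] by simp
    finally show "(n + k) powr (- 2 * s) \<le> 4 * (\<Sum>\<^sub>\<infinity>j. (k * 2 ^ j) powr (1 - 2 * s) / (n + k * 2 ^ j))"
      by simp
  qed
qed

text \<open>A hermitian sequence has the same modulus at n and -n, so its nonnegative half controls
  it; index 0 is counted twice, hence an inequality.\<close>

lemma neg_norm_pos_part: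
  assumes "hs (- s) u" "herm u" "k \<ge> 1"
  shows "(neg_norm s k u)\<^sup>2 \<le> 2 * (neg_norm s k (pos_part u))\<^sup>2"
    and neg_norm_pos_part_le: "neg_norm s k (pos_part u) \<le> neg_norm s k u"
    and hs_pos_part: "hs (- s) (pos_part u)"
proof -
  let ?w = "wgt (- s) k u" and ?p = "wgt (- s) k (pos_part u)"
  have lw: "l2 ?w"
    by (rule hs_l2_wgt[OF assms(1,3)])
  have le: "norm (wgt (- s) k (pos_part u) n) \<le> norm (wgt (- s) k u n)" for k n
    by (auto simp: wgt_def pos_part_def)
  have lp: "l2 ?p"
    using l2_mono(1)[OF lw le] .
  show "neg_norm s k (pos_part u) \<le> neg_norm s k u"
    unfolding neg_norm_def using l2_mono(2)[OF lw le] .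
  show "hs (- s) (pos_part u)"
    unfolding hs_def by (rule l2_mono(1)[OF _ le]) (use assms(1) in \<open>simp add: hs_def\<close>)
  have b: "bij (\<lambda>n :: int. - n)"
    using bij_reflect[of 0] by simp
  have sp: "(\<lambda>n. (norm (?p n))\<^sup>2) summable_on UNIV"
    using lp by (simp add: l2_def)
  have sm: "(\<lambda>n. (norm (?p (- n)))\<^sup>2) summable_on UNIV"
    using summable_on_reindex_bij_betw[OF b, of "\<lambda>n. (norm (?p n))\<^sup>2"] sp by simp
  have "(neg_norm s k u)\<^sup>2 \<le> (\<Sum>\<^sub>\<infinity>n. (norm (?p n))\<^sup>2 + (norm (?p (- n)))\<^sup>2)"
    unfolding neg_norm_def nrm_power2
  proof (rule infsum_mono)
    show "(\<lambda>n. (norm (?w n))\<^sup>2) summable_on UNIV"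
      using lw by (simp add: l2_def)
    show "(\<lambda>n. (norm (?p n))\<^sup>2 + (norm (?p (- n)))\<^sup>2) summable_on UNIV"
      by (rule summable_on_add[OF sp sm])
    fix n :: int
    have "norm (u (- n)) = norm (u n)"
      using assms(2) by (simp add: herm_def)
    then show "(norm (?w n))\<^sup>2 \<le> (norm (?p n))\<^sup>2 + (norm (?p (- n)))\<^sup>2"
      by (cases "n \<ge> 0") (auto simp: norm_wgt pos_part_def)
  qed
  also have "\<dots> = 2 * (neg_norm s k (pos_part u))\<^sup>2"
    unfolding infsum_add[OF sp sm] neg_norm_def nrm_power2
    using infsum_reindex_bij[OF b, of "\<lambda>n. (norm (?p n))\<^sup>2"] by simp
  finally show "(neg_norm s k u)\<^sup>2 \<le> 2 * (neg_norm s k (pos_part u))\<^sup>2" .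
qed

lemma neg_norm_antimono:
  assumes "hs (- s) u" "s \<ge> 0" "1 \<le> k" "k \<le> k'"
  shows "neg_norm s k' u \<le> neg_norm s k u"
  unfolding neg_norm_def
  by (rule l2_mono(2)[OF hs_l2_wgt[OF assms(1,3)]])
    (use assms in \<open>auto simp: norm_wgt intro!: mult_right_mono powr_mono2'\<close>)

lemma eps_antimono:
  assumes "s < 1/2" "1 \<le> k" "k \<le> k'"
  shows "eps s k' \<le> eps s k"
  unfolding eps_def
  by (intro real_sqrt_le_mono infsum_mono eps_summable assms powr_mono2') (use assms in auto)

lemma pos_energy_power2:
  assumes "k \<ge> 1" 
  shows "(pos_energy k u)\<^sup>2 = (\<Sum>\<^sub>\<infinity>n. (norm (pos_part u n))\<^sup>2 / (real_of_int \<bar>n\<bar> + k))"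
proof -
  have "(norm (wgt (-1/2) k (pos_part u) n))\<^sup>2 = (norm (pos_part u n))\<^sup>2 / (real_of_int \<bar>n\<bar> + k)" for n
  proof -
    have "((real_of_int \<bar>n\<bar> + k) powr (-1/2))\<^sup>2 = 1 / (real_of_int \<bar>n\<bar> + k)"
      using assms by (simp add: power2_eq_square powr_add[symmetric] powr_minus_divide)
    then show ?thesis
      by (simp add: norm_wgt power_mult_distrib)
  qed
  then show ?thesis
    by (simp add: pos_energy_def nrm_power2)
qed

lemma neg_norm_power2:
  assumes "k \<ge> 1" 
  shows "(neg_norm s k u)\<^sup>2 = (\<Sum>\<^sub>\<infinity>n. (real_of_int \<bar>n\<bar> + k) powr (- 2 * s) * (norm (u n))\<^sup>2)"
  using assms
  by (simp add: neg_norm_def nrm_power2 norm_wgt power_mult_distrib power2_eq_square[of "_ powr _"] powr_add[symmetric])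

text \<open>Summing \<open>\<langle>(D + k\<^sub>j)\<^sup>-\<^sup>1 \<Pi>u, \<Pi>u\<rangle>\<close> over \<open>k\<^sub>j = 2\<^sup>j k\<close> with weights \<open>k\<^sub>j\<^sup>1\<^sup>-\<^sup>2\<^sup>s\<close> recovers the \<open>H\<^sup>-\<^sup>s\<close> norm.\<close>

lemma neg_norm_dyadic:
  assumes s: "0 < s" "s < 1/2"
  obtains C :: real where "C \<ge> 1" and
    "\<And>k u. k \<ge> 1 \<Longrightarrow> hs (- s) u \<Longrightarrow>
      (\<lambda>j. (k * 2 ^ j) powr (1 - 2 * s) * (pos_energy (k * 2 ^ j) u)\<^sup>2) summable_on UNIV" and
    "\<And>k u. k \<ge> 1 \<Longrightarrow> hs (- s) u \<Longrightarrow>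
      (\<Sum>\<^sub>\<infinity>j. (k * 2 ^ j) powr (1 - 2 * s) * (pos_energy (k * 2 ^ j) u)\<^sup>2) \<le> C * (neg_norm s k (pos_part u))\<^sup>2" and
    "\<And>k u. k \<ge> 1 \<Longrightarrow> hs (- s) u \<Longrightarrow>
      (neg_norm s k (pos_part u))\<^sup>2 \<le> 4 * (\<Sum>\<^sub>\<infinity>j. (k * 2 ^ j) powr (1 - 2 * s) * (pos_energy (k * 2 ^ j) u)\<^sup>2)"
proof -
  obtain C :: real where C: "C \<ge> 1" and
    Cs: "\<And>k n. k \<ge> 1 \<Longrightarrow> n \<ge> 0 \<Longrightarrow> (\<lambda>j. (k * 2 ^ j) powr (1 - 2 * s) / (n + k * 2 ^ j)) summable_on UNIV" and
    Cu: "\<And>k n. k \<ge> 1 \<Longrightarrow> n \<ge> 0 \<Longrightarrow>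
      (\<Sum>\<^sub>\<infinity>j. (k * 2 ^ j) powr (1 - 2 * s) / (n + k * 2 ^ j)) \<le> C * (n + k) powr (- 2 * s)" and
    Cl: "\<And>k n. k \<ge> 1 \<Longrightarrow> n \<ge> 0 \<Longrightarrow>
      (n + k) powr (- 2 * s) \<le> 4 * (\<Sum>\<^sub>\<infinity>j. (k * 2 ^ j) powr (1 - 2 * s) / (n + k * 2 ^ j))"
    by (rule dyadic_weight[OF s]) blast
  have main: "(\<lambda>j. (k * 2 ^ j) powr (1 - 2 * s) * (pos_energy (k * 2 ^ j) u)\<^sup>2) summable_on UNIV
     \<and> (\<Sum>\<^sub>\<infinity>j. (k * 2 ^ j) powr (1 - 2 * s) * (pos_energy (k * 2 ^ j) u)\<^sup>2) \<le> C * (neg_norm s k (pos_part u))\<^sup>2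
     \<and> (neg_norm s k (pos_part u))\<^sup>2 \<le> 4 * (\<Sum>\<^sub>\<infinity>j. (k * 2 ^ j) powr (1 - 2 * s) * (pos_energy (k * 2 ^ j) u)\<^sup>2)"
    if k: "k \<ge> 1" and u: "hs (- s) u" for k u
  proof -
    define p where "p n = (norm (pos_part u n))\<^sup>2" for n
    define om where "om n j = (k * 2 ^ j) powr (1 - 2 * s) / (real_of_int \<bar>n\<bar> + k * 2 ^ j)" for n :: int and j :: nat
    define W where "W n = (real_of_int \<bar>n\<bar> + k) powr (- 2 * s)" for n :: int
    have k2: "k * 2 ^ j \<ge> 1" for j
    proof -
      have "k \<le> k * 2 ^ j" using k by simp
      then show ?thesis using k by linarith
    qed
    have p0: "p n \<ge> 0" for n by (simp add: p_def)
    have om0: "om n j \<ge> 0" for n j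
      using k2[of j] by (simp add: om_def)
    have oms: "om n summable_on UNIV" "infsum (om n) UNIV \<le> C * W n" "W n \<le> 4 * infsum (om n) UNIV" for n
      using Cs[OF k, of "real_of_int \<bar>n\<bar>"] Cu[OF k, of "real_of_int \<bar>n\<bar>"] Cl[OF k, of "real_of_int \<bar>n\<bar>"]
      by (simp_all add: om_def[abs_def] W_def)
    have Wp: "(\<lambda>n. W n * p n) summable_on UNIV"
    proof -
      have "l2 (wgt (- s) k (pos_part u))"
        by (rule l2_mono(1)[OF hs_l2_wgt[OF u k]]) (auto simp: wgt_def pos_part_def)
      then show ?thesis
        using k by (simp add: l2_def norm_wgt power_mult_distrib power2_eq_square[of "_ powr _"]
            powr_add[symmetric] W_def p_def)
    qed
    define f where "f = (\<lambda>(n, j). om n j * p n)"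
    have f0: "f q \<ge> 0" for q
      using om0 p0 by (auto simp: f_def split: prod.split)
    have row: "(\<lambda>j. f (n, j)) summable_on UNIV" for n
      unfolding f_def using oms(1)[of n] by (simp add: summable_on_cmult_left)
    have rowsum: "(\<Sum>\<^sub>\<infinity>j. f (n, j)) = infsum (om n) UNIV * p n" for n
      unfolding f_def by (simp add: infsum_cmult_left')
    have CWp: "(\<lambda>n. C * W n * p n) summable_on UNIV"
      using summable_on_cmult_right[OF Wp, of C] by (simp add: mult.assoc)
    have tot: "(\<lambda>n. \<Sum>\<^sub>\<infinity>j. f (n, j)) summable_on UNIV"
      by (rule summable_on_comparison_test[OF CWp])
        (use oms(2) p0 om0 in \<open>auto simp: rowsum intro!: mult_right_mono mult_nonneg_nonneg infsum_nonneg\<close>)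
    have fs: "f summable_on UNIV"
      by (rule summable_on_Sigma_nonneg(1)[OF f0 row tot])
    have fs': "(\<lambda>(j, n). f (n, j)) summable_on UNIV \<times> UNIV"
      using fs summable_on_swap[of f UNIV UNIV] by simp
    have col: "(\<Sum>\<^sub>\<infinity>n. f (n, j)) = (k * 2 ^ j) powr (1 - 2 * s) * (pos_energy (k * 2 ^ j) u)\<^sup>2" for j
      unfolding pos_energy_power2[OF k2] infsum_cmult_right'[symmetric]
      by (rule infsum_cong) (simp add: f_def om_def p_def)
    have 1: "(\<lambda>j. (k * 2 ^ j) powr (1 - 2 * s) * (pos_energy (k * 2 ^ j) u)\<^sup>2) summable_on UNIV"
      using summable_on_Sigma_banach[of "\<lambda>j n. f (n, j)" UNIV "\<lambda>_. UNIV"] fs' unfolding col by simp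
    have 2: "(\<Sum>\<^sub>\<infinity>j. (k * 2 ^ j) powr (1 - 2 * s) * (pos_energy (k * 2 ^ j) u)\<^sup>2) = (\<Sum>\<^sub>\<infinity>n. infsum (om n) UNIV * p n)"
      unfolding col[symmetric] rowsum[symmetric]
      using infsum_swap_banach[of "\<lambda>n j. f (n, j)" UNIV UNIV] fs by simp
    have N: "(neg_norm s k (pos_part u))\<^sup>2 = (\<Sum>\<^sub>\<infinity>n. W n * p n)"
      by (simp add: neg_norm_power2[OF k] W_def p_def)
    have tot': "(\<lambda>n. infsum (om n) UNIV * p n) summable_on UNIV"
      using tot unfolding rowsum .
    have 3: "(\<Sum>\<^sub>\<infinity>n. infsum (om n) UNIV * p n) \<le> (\<Sum>\<^sub>\<infinity>n. C * W n * p n)"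
      by (intro infsum_mono tot' CWp mult_right_mono oms p0)
    have 4: "(\<Sum>\<^sub>\<infinity>n. W n * p n) \<le> (\<Sum>\<^sub>\<infinity>n. 4 * (infsum (om n) UNIV * p n))"
      by (rule infsum_mono[OF Wp summable_on_cmult_right[OF tot']])
        (use mult_right_mono[OF oms(3) p0] in \<open>simp add: mult.assoc\<close>)
    show ?thesis
      using 1 3 4 unfolding 2 N by (simp add: mult.assoc infsum_cmult_right')
  qed
  show thesis
    by (rule that[OF C]) (use main in blast)+
qed

text \<open>The smallness condition at k is inherited by every k 2^j, as \<open>eps\<close> and
  \<open>neg_norm\<close> decrease in k; so \<open>pos_energy_bound\<close> holds for all terms of
  the dyadic sum with the same factor 27. With 4 from the lower dyadic bound and 2 from
  \<open>neg_norm_pos_part\<close> this makes 216. The constant does not depend on k.\<close>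

lemma neg_norm_flow_local:
  assumes s: "0 < s" "s < 1/2"
  obtains K :: real where "K \<ge> 1" and
    "\<And>u k S a b. bo_flow u \<Longrightarrow> k \<ge> 1 \<Longrightarrow> convex S \<Longrightarrow> a \<in> S \<Longrightarrow> b \<in> S \<Longrightarrow>
      (\<And>t. t \<in> S \<Longrightarrow> eps s k * neg_norm s k (u t) \<le> 1/2) \<Longrightarrow>
      (neg_norm s k (u b))\<^sup>2 \<le> K * (neg_norm s k (u a))\<^sup>2"
proof -
  obtain C :: real where C: "C \<ge> 1" and
    Cs: "\<And>k u. k \<ge> 1 \<Longrightarrow> hs (- s) u \<Longrightarrow>
      (\<lambda>j. (k * 2 ^ j) powr (1 - 2 * s) * (pos_energy (k * 2 ^ j) u)\<^sup>2) summable_on UNIV" and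
    Cu: "\<And>k u. k \<ge> 1 \<Longrightarrow> hs (- s) u \<Longrightarrow>
      (\<Sum>\<^sub>\<infinity>j. (k * 2 ^ j) powr (1 - 2 * s) * (pos_energy (k * 2 ^ j) u)\<^sup>2) \<le> C * (neg_norm s k (pos_part u))\<^sup>2" and
    Cl: "\<And>k u. k \<ge> 1 \<Longrightarrow> hs (- s) u \<Longrightarrow>
      (neg_norm s k (pos_part u))\<^sup>2 \<le> 4 * (\<Sum>\<^sub>\<infinity>j. (k * 2 ^ j) powr (1 - 2 * s) * (pos_energy (k * 2 ^ j) u)\<^sup>2)"
    by (rule neg_norm_dyadic[OF s]) blast
  show thesis
  proof (rule that[of "216 * C"])
    show "216 * C \<ge> 1" using C by simp
    fix u k S and a b :: real
    assume flow: "bo_flow u" and k: "k \<ge> 1" and S: "convex S" and ab: "a \<in> S" "b \<in> S"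
      and e: "\<And>t. t \<in> S \<Longrightarrow> eps s k * neg_norm s k (u t) \<le> 1/2"
    have s0: "s \<ge> 0" using s by simp
    note hsu = l2_imp_hs(1)[OF bo_flow_l2[OF flow] s0]
    have herm: "herm (u t)" for t
      using flow by (auto simp: bo_flow_def smooth_potential_def)
    have k2: "k * 2 ^ j \<ge> k" "k * 2 ^ j \<ge> 1" for j
    proof -
      show "k * 2 ^ j \<ge> k" using k by simp
      then show "k * 2 ^ j \<ge> 1" using k by linarith
    qed
    have "(pos_energy (k * 2 ^ j) (u b))\<^sup>2 \<le> 27 * (pos_energy (k * 2 ^ j) (u a))\<^sup>2" for j
    proof -
      have "eps s (k * 2 ^ j) * neg_norm s (k * 2 ^ j) (u t) \<le> 1/2" if "t \<in> S" for t
      proof -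
        have "eps s (k * 2 ^ j) * neg_norm s (k * 2 ^ j) (u t) \<le> eps s k * neg_norm s k (u t)"
          using s k k2(1)[of j] hsu
          by (intro mult_mono eps_antimono neg_norm_antimono) (auto simp: eps_nonneg)
        then show ?thesis
          using e[OF that] by linarith
      qed
      from pos_energy_bound[OF flow k2(2) s0 s(2) S this order_refl ab] show ?thesis
        by simp
    qed
    then have le: "(k * 2 ^ j) powr (1 - 2 * s) * (pos_energy (k * 2 ^ j) (u b))\<^sup>2
        \<le> 27 * ((k * 2 ^ j) powr (1 - 2 * s) * (pos_energy (k * 2 ^ j) (u a))\<^sup>2)" for j
      by (metis mult.left_commute mult_left_mono powr_ge_zero)
    have "(neg_norm s k (u b))\<^sup>2 \<le> 2 * (neg_norm s k (pos_part (u b)))\<^sup>2"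
      by (rule neg_norm_pos_part(1)[OF hsu herm k])
    also have "\<dots> \<le> 2 * (4 * (\<Sum>\<^sub>\<infinity>j. (k * 2 ^ j) powr (1 - 2 * s) * (pos_energy (k * 2 ^ j) (u b))\<^sup>2))"
      using Cl[OF k hsu] by (intro mult_left_mono) auto
    also have "(\<Sum>\<^sub>\<infinity>j. (k * 2 ^ j) powr (1 - 2 * s) * (pos_energy (k * 2 ^ j) (u b))\<^sup>2)
        \<le> (\<Sum>\<^sub>\<infinity>j. 27 * ((k * 2 ^ j) powr (1 - 2 * s) * (pos_energy (k * 2 ^ j) (u a))\<^sup>2))"
      by (intro infsum_mono le summable_on_cmult_right Cs k hsu)
    also have "\<dots> = 27 * (\<Sum>\<^sub>\<infinity>j. (k * 2 ^ j) powr (1 - 2 * s) * (pos_energy (k * 2 ^ j) (u a))\<^sup>2)"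
      by (rule infsum_cmult_right')
    also have "(\<Sum>\<^sub>\<infinity>j. (k * 2 ^ j) powr (1 - 2 * s) * (pos_energy (k * 2 ^ j) (u a))\<^sup>2)
        \<le> C * (neg_norm s k (pos_part (u a)))\<^sup>2"
      by (rule Cu[OF k hsu])
    also have "\<dots> \<le> C * (neg_norm s k (u a))\<^sup>2"
      using C neg_norm_pos_part_le[OF hsu herm k] by (intro mult_left_mono power_mono) auto
    finally show "(neg_norm s k (u b))\<^sup>2 \<le> 216 * C * (neg_norm s k (u a))\<^sup>2"
      by simp
  qed
qed

section \<open>The bootstrap in time\<close>

lemma neg_norm_diff_le:
  assumes "hs (- s) u" "hs (- s) w" "k \<ge> 1"
  shows "\<bar>neg_norm s k u - neg_norm s k w\<bar> \<le> neg_norm s k (\<lambda>n. u n - w n)"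
proof -
  have *: "neg_norm s k u \<le> neg_norm s k (\<lambda>n. u n - w n) + neg_norm s k w"
    if "hs (- s) u" "hs (- s) w" for u w
    using nrm_triangle[OF hs_l2_wgt[OF hs_diff[OF that] assms(3)] hs_l2_wgt[OF that(2) assms(3)]]
    by (simp add: neg_norm_def wgt_linear)
  have "neg_norm s k (\<lambda>n. w n - u n) = neg_norm s k (\<lambda>n. u n - w n)"
    unfolding neg_norm_def by (rule l2_cong_norm(2)) (simp add: norm_wgt norm_minus_commute)
  then show ?thesis
    using *[OF assms(1,2)] *[OF assms(2,1)] by linarith
qed

lemma neg_norm_flow_continuous:
  assumes "bo_flow u" "s \<ge> 0" "k \<ge> 1"
  shows "continuous_on UNIV (\<lambda>t. neg_norm s k (u t))"
  unfolding continuous_on_def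
proof
  fix t
  note lu = bo_flow_l2[OF assms(1)]
  have "norm (neg_norm s k (u r) - neg_norm s k (u t)) \<le> nrm (\<lambda>n. u r n - u t n)" for r
    using neg_norm_diff_le[OF l2_imp_hs(1)[OF lu[of r] assms(2)] l2_imp_hs(1)[OF lu[of t] assms(2)] assms(3)]
      neg_norm_le_nrm[OF l2_diff(1)[OF lu[of r] lu[of t]] assms(2,3)] unfolding real_norm_def by linarith
  note le = this
  have lim: "((\<lambda>r. nrm (\<lambda>n. u r n - u t n)) \<longlongrightarrow> 0) (at t)"
    using assms(1) by (simp add: bo_flow_def)
  have "((\<lambda>r. neg_norm s k (u r) - neg_norm s k (u t)) \<longlongrightarrow> 0) (at t)"
    by (rule Lim_null_comparison[OF always_eventually lim]) (intro allI le)
  then show "((\<lambda>t. neg_norm s k (u t)) \<longlongrightarrow> neg_norm s k (u t)) (at t within UNIV)"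
    by (rule LIM_zero_cancel)
qed

text \<open>While the norm stays at most \<open>M\<close> the local estimate holds and even gives a
  bound by \<open>K * neg_norm s k (u 0)\<close>, which is strictly below \<open>M\<close>. By
  continuity the value \<open>M\<close> is never reached.\<close>

lemma neg_norm_flow_bound:
  assumes s: "0 < s" "s < 1/2"
  obtains K :: real where "K \<ge> 1" and
    "\<And>u k M t. bo_flow u \<Longrightarrow> k \<ge> 1 \<Longrightarrow> K * neg_norm s k (u 0) < M \<Longrightarrow> eps s k * M \<le> 1/2 \<Longrightarrow>
      neg_norm s k (u t) \<le> K * neg_norm s k (u 0) \<and> eps s k * neg_norm s k (u t) \<le> 1/2"
proof -
  obtain K :: real where K: "K \<ge> 1" and
    loc: "\<And>u k S a b. bo_flow u \<Longrightarrow> k \<ge> 1 \<Longrightarrow> convex S \<Longrightarrow> a \<in> S \<Longrightarrow> b \<in> S \<Longrightarrow>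
      (\<And>t. t \<in> S \<Longrightarrow> eps s k * neg_norm s k (u t) \<le> 1/2) \<Longrightarrow>
      (neg_norm s k (u b))\<^sup>2 \<le> K * (neg_norm s k (u a))\<^sup>2"
    by (rule neg_norm_flow_local[OF s]) blast
  show thesis
  proof (rule that[OF K])
    fix u k M t
    assume flow: "bo_flow u" and k: "k \<ge> 1" and M: "K * neg_norm s k (u 0) < M" "eps s k * M \<le> 1/2"
    define E where "E t = neg_norm s k (u t)" for t
    have E0: "E t \<ge> 0" for t by (simp add: E_def)
    have loc': "E b \<le> K * E 0"
      if "convex S" "0 \<in> S" "b \<in> S" "\<And>t. t \<in> S \<Longrightarrow> E t \<le> M" for S b
    proof -
      have "eps s k * neg_norm s k (u t) \<le> 1/2" if "t \<in> S" for t
        using mult_left_mono[OF \<open>\<And>t. t \<in> S \<Longrightarrow> E t \<le> M\<close>[OF that], of "eps s k"] M(2)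
        by (simp add: E_def eps_nonneg)
      from loc[OF flow k that(1-3) this] have "(E b)\<^sup>2 \<le> K * (E 0)\<^sup>2"
        by (simp add: E_def)
      also have "\<dots> \<le> (K * E 0)\<^sup>2"
      proof -
        have "K \<le> K\<^sup>2"
          using K by (simp add: power2_eq_square)
        then show ?thesis
          unfolding power_mult_distrib by (intro mult_right_mono) auto
      qed
      finally show ?thesis
        using K E0[of 0] by (intro power2_le_imp_le[of "E b"]) auto
    qed
    have cont: "continuous_on UNIV E"
      unfolding E_def by (rule neg_norm_flow_continuous[OF flow _ k]) (use s in simp)
    have "E b < M" for b
    proof (rule ccontr)
      assume neg: "\<not> E b < M"
      \<comment> \<open>Scaling the segment from 0 to \<open>b\<close> to the unit interval treats
        both directions of time at once.\<close>
      define g where "g r = E (r * b)" for r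
      have g: "continuous_on A g" for A
        unfolding g_def by (rule continuous_on_compose2[OF cont]) (auto intro!: continuous_intros)
      have "1 * E 0 \<le> K * E 0"
        using K E0 by (intro mult_right_mono) auto
      then have g0: "g 0 < M"
        using M(1) by (simp add: g_def E_def)
      define Z where "Z = {r \<in> {0..1}. g r = M}"
      have ivt: "\<exists>r\<in>{0..r1}. g r = M" if "0 \<le> r1" "M \<le> g r1" for r1
        using IVT'[of g 0 M r1] g0 that g by auto
      have "Z \<noteq> {}"
        using ivt[of 1] neg by (auto simp: Z_def g_def)
      have "closed Z"
        unfolding Z_def by (rule continuous_closed_preimage_constant[OF g]) simp
      have bdd: "bdd_below Z"
        by (rule bdd_belowI[of _ 0]) (auto simp: Z_def)
      \<comment> \<open>\<open>Inf Z\<close> is the first parameter at which the value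
        \<open>M\<close> is attained; up to it the local estimate is available.\<close>
      have r0: "Inf Z \<in> Z"
        by (rule closed_contains_Inf[OF \<open>Z \<noteq> {}\<close> bdd \<open>closed Z\<close>])
      define S where "S = (\<lambda>r. r * b) ` {0..Inf Z}"
      have "g r \<le> M" if r: "r \<in> {0..Inf Z}" for r
      proof (rule ccontr)
        assume "\<not> g r \<le> M"
        then obtain r' where r': "r' \<in> {0..r}" "g r' = M"
          using ivt[of r] r by auto
        then have "r' \<in> Z"
          using r r0 by (auto simp: Z_def)
        then have "Inf Z \<le> r'"
          by (rule cInf_lower[OF _ bdd])
        then have "r = Inf Z"
          using r' r by auto
        then show False
          using \<open>\<not> g r \<le> M\<close> r0 by (simp add: Z_def)
      qed
      then have SM: "E t \<le> M" if "t \<in> S" for t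
        using that by (auto simp: S_def g_def)
      have "convex S"
        unfolding S_def
        by (intro convex_linear_image convex_real_interval) (auto intro!: linearI simp: algebra_simps)
      moreover have "0 \<in> S" "Inf Z * b \<in> S"
        using r0 imageI[of 0 "{0..Inf Z}" "\<lambda>r. r * b"] by (auto simp: S_def Z_def)
      ultimately have "E (Inf Z * b) \<le> K * E 0"
        using loc'[of S "Inf Z * b"] SM by blast
      then show False
        using r0 M(1) by (simp add: Z_def g_def E_def)
    qed
    then have lt: "E t < M" for t .
    have "E t \<le> K * E 0"
      using loc'[of UNIV t] lt by (simp add: less_imp_le)
    moreover have "eps s k * E t \<le> 1/2"
      using mult_left_mono[OF less_imp_le[OF lt], of "eps s k" t] M(2) by (simp add: eps_nonneg)
    ultimately show "neg_norm s k (u t) \<le> K * neg_norm s k (u 0) \<and> eps s k * neg_norm s k (u t) \<le> 1/2"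
      by (simp add: E_def)
  qed
qed

section \<open>The L^2 norm in the case s = 0\<close>

lemma wgt_0: "k \<ge> 1 \<Longrightarrow> wgt 0 k u = u"
proof
  fix n :: int
  assume "k \<ge> 1"
  then have "real_of_int \<bar>n\<bar> + k \<noteq> 0" by linarith
  then show "wgt 0 k u n = u n"
    by (simp add: wgt_def)
qed

text \<open>k times the squared energy tends to the squared L^2 norm of Pi u as k tends to infinity,
  since k / (n + k) tends to 1 at each index, while the factor in \<open>pos_energy_bound\<close>
  tends to 1. The dyadic summation, which requires s > 0, is bypassed; smallness holds for large k
  because the L^2 norm is bounded on the compact segment between the two times.\<close>

lemma pos_part_nrm_flow:
  assumes flow: "bo_flow u"
  shows "nrm (pos_part (u b)) \<le> nrm (pos_part (u a))"
proof -
  note lu = bo_flow_l2[OF flow]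
  define S where "S = closed_segment a b"
  have S: "convex S" "compact S" "a \<in> S" "b \<in> S"
    by (auto simp: S_def)
  have N: "neg_norm 0 k w = nrm w" if "k \<ge> 1" for k w
    using wgt_0[OF that] by (simp add: neg_norm_def)
  have "compact ((\<lambda>t. nrm (u t)) ` S)"
    using neg_norm_flow_continuous[OF flow order_refl order_refl] S(2) N[OF order_refl]
    by (intro compact_continuous_image) (auto intro: continuous_on_subset)
  then have "bounded ((\<lambda>t. nrm (u t)) ` S)"
    by (rule compact_imp_bounded)
  then obtain R where "R > 0" "\<forall>x\<in>S. nrm (u x) \<le> R"
    by (auto simp: bounded_pos)
  then have R: "\<And>t. t \<in> S \<Longrightarrow> nrm (u t) \<le> R" "R > 0"
    by auto
  define e where "e k = eps 0 k * R" for k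
  have e0: "(e \<longlongrightarrow> 0) at_top"
    unfolding e_def using tendsto_mult_left_zero[OF eps_tendsto_0[of 0]] by simp
  have ev: "\<forall>\<^sub>F k in at_top. e k \<le> 1/2 \<and> k \<ge> 1"
    using eventually_conj[OF order_tendstoD(2)[OF e0, of "1/2"] eventually_ge_at_top[of 1]]
    by (auto elim: eventually_mono)
  have main: "k * (pos_energy k (u b))\<^sup>2 \<le> ((1 + e k) / (1 - e k)) ^ 3 * (nrm (pos_part (u a)))\<^sup>2"
    if "e k \<le> 1/2 \<and> k \<ge> 1" for k
  proof -
    have k: "k \<ge> 1" and ek: "e k \<le> 1/2" using that by auto
    have e0: "e k \<ge> 0" using R(2) by (simp add: e_def eps_nonneg)
    have "eps 0 k * neg_norm 0 k (u t) \<le> e k" if "t \<in> S" for t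
      using R(1)[OF that] by (simp add: N[OF k] e_def eps_nonneg mult_left_mono)
    from pos_energy_bound[OF flow k _ _ S(1) this ek S(3,4)]
    have 1: "(pos_energy k (u b))\<^sup>2 \<le> ((1 + e k) / (1 - e k)) ^ 3 * (pos_energy k (u a))\<^sup>2"
      by simp
    have "k * (pos_energy k (u a))\<^sup>2 \<le> (nrm (pos_part (u a)))\<^sup>2"
      unfolding pos_energy_power2[OF k] nrm_power2 infsum_cmult_right'[symmetric]
    proof (rule infsum_mono)
      show s2: "(\<lambda>n. (norm (pos_part (u a) n))\<^sup>2) summable_on UNIV"
        using l2_pos_part[OF lu] by (simp add: l2_def)
      have le: "k * ((norm (pos_part (u a) n))\<^sup>2 / (real_of_int \<bar>n\<bar> + k)) \<le> (norm (pos_part (u a) n))\<^sup>2" for n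
        using k by (simp add: field_simps)
      show "(\<lambda>n. k * ((norm (pos_part (u a) n))\<^sup>2 / (real_of_int \<bar>n\<bar> + k))) summable_on UNIV"
        by (rule summable_on_comparison_test[OF s2]) (use le k in auto)
      show "k * ((norm (pos_part (u a) n))\<^sup>2 / (real_of_int \<bar>n\<bar> + k)) \<le> (norm (pos_part (u a) n))\<^sup>2" for n
        by (rule le)
    qed
    then have "((1 + e k) / (1 - e k)) ^ 3 * (k * (pos_energy k (u a))\<^sup>2)
        \<le> ((1 + e k) / (1 - e k)) ^ 3 * (nrm (pos_part (u a)))\<^sup>2"
      using e0 ek by (intro mult_left_mono) auto
    moreover have "k * (pos_energy k (u b))\<^sup>2 \<le> k * (((1 + e k) / (1 - e k)) ^ 3 * (pos_energy k (u a))\<^sup>2)"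
      using 1 k by (intro mult_left_mono) auto
    ultimately show ?thesis
      by (simp add: mult_ac)
  qed
  have "L2_set (\<lambda>n. norm (pos_part (u b) n)) F \<le> nrm (pos_part (u a))" if F: "finite F" for F
  proof -
    have "(\<Sum>n\<in>F. (norm (pos_part (u b) n))\<^sup>2) \<le> (nrm (pos_part (u a)))\<^sup>2"
    proof (rule tendsto_le[of at_top])
      have "((\<lambda>k. \<Sum>n\<in>F. (norm (pos_part (u b) n))\<^sup>2 * (1 - real_of_int \<bar>n\<bar> / (real_of_int \<bar>n\<bar> + k)))
          \<longlongrightarrow> (\<Sum>n\<in>F. (norm (pos_part (u b) n))\<^sup>2 * (1 - 0))) at_top"
        by (intro tendsto_intros tendsto_divide_0[OF tendsto_const]
            filterlim_at_top_imp_at_infinity filterlim_tendsto_add_at_top[OF tendsto_const] filterlim_ident)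
      then show "((\<lambda>k. \<Sum>n\<in>F. (norm (pos_part (u b) n))\<^sup>2 * (1 - real_of_int \<bar>n\<bar> / (real_of_int \<bar>n\<bar> + k)))
          \<longlongrightarrow> (\<Sum>n\<in>F. (norm (pos_part (u b) n))\<^sup>2)) at_top"
        by simp
      have "((\<lambda>k. ((1 + e k) / (1 - e k)) ^ 3 * (nrm (pos_part (u a)))\<^sup>2)
          \<longlongrightarrow> ((1 + 0) / (1 - 0)) ^ 3 * (nrm (pos_part (u a)))\<^sup>2) at_top"
        by (intro tendsto_intros e0) simp
      then show "((\<lambda>k. ((1 + e k) / (1 - e k)) ^ 3 * (nrm (pos_part (u a)))\<^sup>2)
          \<longlongrightarrow> (nrm (pos_part (u a)))\<^sup>2) at_top"
        by simp
      show "\<forall>\<^sub>F k in at_top. (\<Sum>n\<in>F. (norm (pos_part (u b) n))\<^sup>2 * (1 - real_of_int \<bar>n\<bar> / (real_of_int \<bar>n\<bar> + k)))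
          \<le> ((1 + e k) / (1 - e k)) ^ 3 * (nrm (pos_part (u a)))\<^sup>2"
        using ev
      proof eventually_elim
        case (elim k)
        have k: "k \<ge> 1" using elim by simp
        have "(\<Sum>n\<in>F. (norm (pos_part (u b) n))\<^sup>2 * (1 - real_of_int \<bar>n\<bar> / (real_of_int \<bar>n\<bar> + k)))
            = (\<Sum>n\<in>F. k * ((norm (pos_part (u b) n))\<^sup>2 / (real_of_int \<bar>n\<bar> + k)))"
          using k by (intro sum.cong) (auto simp: field_simps add_nonneg_eq_0_iff)
        also have "\<dots> \<le> (\<Sum>\<^sub>\<infinity>n. k * ((norm (pos_part (u b) n))\<^sup>2 / (real_of_int \<bar>n\<bar> + k)))"
        proof (rule finite_sum_le_infsum[OF _ F])
          have s2: "(\<lambda>n. (norm (pos_part (u b) n))\<^sup>2) summable_on UNIV"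
            using l2_pos_part[OF lu] by (simp add: l2_def)
          show "(\<lambda>n. k * ((norm (pos_part (u b) n))\<^sup>2 / (real_of_int \<bar>n\<bar> + k))) summable_on UNIV"
            by (rule summable_on_comparison_test[OF s2]) (use k in \<open>auto simp: field_simps\<close>)
        qed (use k in auto)
        also have "\<dots> = k * (pos_energy k (u b))\<^sup>2"
          unfolding pos_energy_power2[OF k] by (rule infsum_cmult_right')
        finally show ?case
          using main[OF elim] by linarith
      qed
    qed simp
    then show ?thesis
      unfolding L2_set_def by (intro real_le_lsqrt) (auto intro: sum_nonneg)
  qed
  then show ?thesis
    by (rule l2_bddI(2))
qed

section \<open>Rigidity of two-eigenvalue potentials\<close>

definition eigen :: "(int \<Rightarrow> complex) \<Rightarrow> real \<Rightarrow> (int \<Rightarrow> complex) \<Rightarrow> bool" where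
  "eigen u lam f \<longleftrightarrow> solves u (- lam) f (\<lambda>n. 0)"

definition admissible :: "real \<Rightarrow> (int \<Rightarrow> complex) \<Rightarrow> bool" where
  "admissible s u \<longleftrightarrow> 0 \<le> s \<and> s < 1/2 \<and> hs (- s) u \<and> herm u"

text \<open>\<open>unit_vec 0\<close> is the constant function 1, split into eigenvectors for
  \<open>la\<close> and \<open>lb\<close>; the last two conditions make both parts nonzero.\<close>

definition two_gap :: "(int \<Rightarrow> complex) \<Rightarrow> real \<Rightarrow> real \<Rightarrow> (int \<Rightarrow> complex) \<Rightarrow> bool" where
  "two_gap u la lb f \<longleftrightarrow> la < lb \<and> eigen u la f \<and> eigen u lb (\<lambda>n. unit_vec 0 n - f n)
    \<and> f \<noteq> (\<lambda>n. 0) \<and> f \<noteq> unit_vec 0"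

section \<open>Eigenvectors, the backward shift and the recursion for two eigenvalues\<close>

lemma admissibleD:
  assumes "admissible s u"
  shows "0 \<le> s" "s < 1/2" "hs (- s) u" "herm u"
  using assms by (auto simp: admissible_def)

lemma eigen_iff: "eigen u lam f \<longleftrightarrow> hh f \<and> (\<forall>n\<ge>0. of_int n * f n - conv u f n = of_real lam * f n)"
  by (auto simp: eigen_def solves_def algebra_simps)

lemma eigen_solves: "eigen u lam f \<longleftrightarrow> solves u k f (\<lambda>n. of_real (lam + k) * f n)"
  by (auto simp: eigen_def solves_def algebra_simps)

lemma eigen_hh: "eigen u lam f \<Longrightarrow> hh f"
  by (simp add: eigen_iff)

lemma eigen_orthogonal:
  assumes "admissible s u" "eigen u lam f" "eigen u mu g" "lam \<noteq> mu"
  shows "ip f g = 0"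
proof -
  note A = admissibleD[OF assms(1)]
  have "ip (\<lambda>n. of_real (lam + 0) * f n) g = ip f (\<lambda>n. of_real (mu + 0) * g n)"
    using assms(2,3) by (intro solves_sym[OF A]) (simp_all add: eigen_solves[of _ _ _ 0])
  then show ?thesis
    using assms(4) unfolding ip_scale_left ip_scale_right by simp
qed

lemma eigen_diff:
  assumes "admissible s u" "eigen u lam f" "eigen u lam g"
  shows "eigen u lam (\<lambda>n. f n - c * g n)"
proof -
  note A = admissibleD[OF assms(1)]
  show ?thesis
    using solves_diff[OF A(1-3) _ solves_scale, of "- lam" f "\<lambda>n. 0" g "\<lambda>n. 0" c] assms(2,3)
    by (simp add: eigen_def)
qed

lemma hh_shift:
  assumes "hh h" "d \<ge> 0" "\<And>n. n < d \<Longrightarrow> h n = 0"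
  shows "hh (\<lambda>n. h (n + d))"
proof -
  have "l2 (\<lambda>n. wgt (1/2) 1 h (n + d))"
    using assms(1) l2_reindex(1)[of "\<lambda>n. n + d" "wgt (1/2) 1 h"] by (simp add: hh_def bij_plus_right)
  then have "l2 (wgt (1/2) 1 (\<lambda>n. h (n + d)))"
  proof (rule l2_mono(1))
    fix n :: int
    show "norm (wgt (1/2) 1 (\<lambda>n. h (n + d)) n) \<le> norm (wgt (1/2) 1 h (n + d))"
    proof (cases "n \<ge> 0")
      case True
      then show ?thesis
        using assms(2) by (auto simp: norm_wgt intro!: mult_right_mono powr_mono2)
    qed (simp add: wgt_def assms(3))
  qed
  then show ?thesis
    by (auto simp: hh_def hardy_def assms(3))
qed

lemma conv_shift: "conv u (\<lambda>n. h (n + d)) n = conv u h (n + d)"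
proof -
  have "conv u h (n + d) = (\<Sum>\<^sub>\<infinity>m. u (n + d - (m + d)) * h (m + d))"
    unfolding conv_def
    by (rule infsum_reindex_bij[of "\<lambda>m. m + d", symmetric]) (simp add: bij_plus_right)
  then show ?thesis
    by (simp add: conv_def)
qed

text \<open>If \<open>L h - \<mu> h\<close> is constant and \<open>h\<close> vanishes to order \<open>d \<ge> 1\<close>, then \<open>S\<^sup>*\<^sup>d h\<close> is an eigenvector
  for \<open>\<mu> - d\<close>, because \<open>S\<^sup>* L S = L + 1\<close>.\<close>

lemma eigen_descend:
  assumes "hh h" "d \<ge> 1" "\<And>n. n < d \<Longrightarrow> h n = 0"
    "\<And>n. n \<ge> 1 \<Longrightarrow> of_int n * h n - conv u h n = of_real mu * h n"
  shows "eigen u (mu - of_int d) (\<lambda>n. h (n + d))"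
  unfolding eigen_iff
proof (intro conjI allI impI)
  show "hh (\<lambda>n. h (n + d))"
    using assms by (intro hh_shift) auto
  fix n :: int
  assume "n \<ge> 0"
  then have "of_int (n + d) * h (n + d) - conv u h (n + d) = of_real mu * h (n + d)"
    using assms(2) by (intro assms(4)) simp
  then show "of_int n * h (n + d) - conv u (\<lambda>n. h (n + d)) n = of_real (mu - of_int d) * h (n + d)"
    unfolding conv_shift by (simp add: algebra_simps)
qed

lemma hardy_least:
  assumes "hardy h" "h \<noteq> (\<lambda>n. 0)"
  obtains d where "d \<ge> 0" "h d \<noteq> 0" "\<And>n. n < d \<Longrightarrow> h n = 0"
proof -
  obtain m where m: "h m \<noteq> 0" using assms(2) by auto
  then have "m \<ge> 0" using assms(1) by (auto simp: hardy_def not_le[symmetric])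
  define k where "k = (LEAST k. h (int k) \<noteq> 0)"
  have "h (int (nat m)) \<noteq> 0" using m \<open>m \<ge> 0\<close> by simp
  then have k: "h (int k) \<noteq> 0"
    unfolding k_def by (rule LeastI)
  have "h n = 0" if "n < int k" for n
  proof (cases "n < 0")
    case False
    then have "nat n < k" using that by linarith
    then show ?thesis
      using not_less_Least[of "nat n" "\<lambda>k. h (int k) \<noteq> 0"] False by (simp add: k_def)
  qed (use assms(1) in \<open>simp add: hardy_def\<close>)
  then show thesis
    using that[of "int k"] k by auto
qed

lemma l2_nonzero_nrm: "l2 x \<Longrightarrow> x \<noteq> (\<lambda>n. 0) \<Longrightarrow> nrm x > 0"
  using nrm_eq_0[of x] nrm_nonneg[of x] by (metis less_eq_real_def ext)

text \<open>The two parts of 1 are orthogonal, so pairing \<open>f\<close> with 1 gives the squared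
  norm of \<open>f\<close>: the mean of \<open>f\<close> is the spectral weight of
  \<open>la\<close>.\<close>

lemma two_gap_weights:
  assumes A: "admissible s u" and tg: "two_gap u la lb f"
  defines "w \<equiv> Re (f 0)"
  shows "f 0 = of_real w" "0 < w" "w < 1" "(nrm f)\<^sup>2 = w"
    "ip f (\<lambda>n. unit_vec 0 n - f n) = 0" "(nrm (\<lambda>n. unit_vec 0 n - f n))\<^sup>2 = 1 - w"
proof -
  let ?g = "\<lambda>n. unit_vec 0 n - f n"
  have f: "hh f" and g: "hh ?g" and nz: "f \<noteq> (\<lambda>n. 0)" "f \<noteq> unit_vec 0"
    using tg eigen_hh by (auto simp: two_gap_def)
  note lf = hh_l2[OF f] and lg = hh_l2[OF g]
  show o: "ip f ?g = 0"
    using tg by (intro eigen_orthogonal[OF A]) (auto simp: two_gap_def)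
  then have "ip f (unit_vec 0) = ip f f"
    using ip_diff_right[OF l2_unit_vec lf lf] by simp
  then have f0: "f 0 = of_real ((nrm f)\<^sup>2)"
    by (simp add: ip_self[OF lf])
  then show nf: "(nrm f)\<^sup>2 = w" and "f 0 = of_real w"
    by (simp_all add: w_def)
  have "ip ?g ?g = ip (unit_vec 0) ?g - ip f ?g"
    by (rule ip_diff_left) (auto intro: lf lg)
  then have "of_real ((nrm ?g)\<^sup>2) = 1 - complex_of_real w"
    unfolding o ip_self[OF lg] using \<open>f 0 = of_real w\<close> by (simp add: unit_vec_def)
  then show ng: "(nrm ?g)\<^sup>2 = 1 - w"
    by (metis of_real_1 of_real_diff of_real_eq_iff)
  show "0 < w"
    using l2_nonzero_nrm[OF lf nz(1)] nf by (metis zero_less_power)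
  have "?g \<noteq> (\<lambda>n. 0)"
    using nz(2) by (metis eq_iff_diff_eq_0 ext)
  then show "w < 1"
    using l2_nonzero_nrm[OF lg] ng zero_less_power[of "nrm ?g" 2] by auto
qed

text \<open>An eigenvector for any other eigenvalue is orthogonal to both parts of 1, hence has mean
  0.\<close>

lemma two_gap_spectrum:
  assumes A: "admissible s u" and tg: "two_gap u la lb f" and F: "eigen u mu F" "F 0 \<noteq> 0"
  shows "mu = la \<or> mu = lb"
proof (rule ccontr)
  assume neg: "\<not> (mu = la \<or> mu = lb)"
  let ?g = "\<lambda>n. unit_vec 0 n - f n"
  have e: "eigen u la f" "eigen u lb ?g"
    using tg by (auto simp: two_gap_def)
  have l: "l2 F" "l2 f" "l2 ?g"
    using F e by (auto intro: hh_l2 eigen_hh)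
  have "F 0 = ip F (\<lambda>n. f n + ?g n)"
    by simp
  also have "\<dots> = ip F f + ip F ?g"
    by (rule ip_add_right[OF l(2,3,1)])
  also have "\<dots> = 0"
    using eigen_orthogonal[OF A F(1) e(1)] eigen_orthogonal[OF A F(1) e(2)] neg by simp
  finally show False
    using F(2) by simp
qed

text \<open>If \<open>e\<close> vanishes to order d at least 1, shifting it down by d gives an
  eigenvector with nonzero mean and eigenvalue la - d, which lies below both \<open>la\<close> and
  \<open>lb\<close>.\<close>

lemma two_gap_simple:
  assumes A: "admissible s u" and tg: "two_gap u la lb f" and e: "eigen u la e" "e 0 = 0"
  shows "e = (\<lambda>n. 0)"
proof (rule ccontr)
  assume "e \<noteq> (\<lambda>n. 0)"
  then obtain d where d: "d \<ge> 0" "e d \<noteq> 0" "\<And>n. n < d \<Longrightarrow> e n = 0"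
    using hardy_least[OF hardy_hh[OF eigen_hh[OF e(1)]]] by blast
  have "d \<ge> 1"
    using d e(2) by (cases "d = 0") auto
  have "eigen u (la - of_int d) (\<lambda>n. e (n + d))"
    using e(1) \<open>d \<ge> 1\<close> d(3) by (intro eigen_descend) (auto simp: eigen_iff)
  from two_gap_spectrum[OF A tg this]
  show False
    using d(2) \<open>d \<ge> 1\<close> tg by (auto simp: two_gap_def)
qed

text \<open>\<open>mu\<close> is the zero of w / (la - mu) + (1 - w) / (lb - mu), so that h = (L -
  mu)^(-1) 1 has mean 0. Shifting \<open>h\<close> down by its order of vanishing d gives an
  eigenvector with nonzero mean, which must belong to \<open>la\<close> and is by simplicity a
  multiple \<theta> of \<open>f\<close>. The resulting relation determines \<open>f\<close>
  recursively up to the phase of \<theta>; its modulus follows from the norms.\<close>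

lemma two_gap_recursion:
  assumes A: "admissible s u" and tg: "two_gap u la lb f"
  defines "w \<equiv> Re (f 0)"
  defines "mu \<equiv> w * lb + (1 - w) * la"
  obtains d \<theta> where "d \<ge> 1" "of_int d = mu - la"
    "(norm \<theta>)\<^sup>2 = (w / (la - mu)\<^sup>2 + (1 - w) / (lb - mu)\<^sup>2) / w"
    "\<And>n. of_real (1 / (la - mu)) * f n + of_real (1 / (lb - mu)) * (unit_vec 0 n - f n) = \<theta> * f (n - d)"
proof -
  note W = two_gap_weights[OF A tg, folded w_def]
  let ?g = "\<lambda>n. unit_vec 0 n - f n"
  have lab: "la < lb" and e: "eigen u la f" "eigen u lb ?g"
    using tg by (auto simp: two_gap_def)
  note AA = admissibleD[OF A]
  have "mu - la = w * (lb - la)" "lb - mu = (1 - w) * (lb - la)"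
    by (auto simp: mu_def algebra_simps)
  then have mu: "la < mu" "mu < lb"
    using W(2,3) lab by (metis diff_gt_0_iff_gt mult_pos_pos)+
  define a b where "a = 1 / (la - mu)" and "b = 1 / (lb - mu)"
  have ab: "a * (la - mu) = 1" "b * (lb - mu) = 1"
    using mu by (auto simp: a_def b_def)
  define h where "h = (\<lambda>n. of_real a * f n + of_real b * ?g n)"
  have lf: "l2 f" "l2 ?g"
    using e by (auto intro: hh_l2 eigen_hh)
  have hh: "hh h"
    unfolding h_def using e by (intro hh_add hh_scale eigen_hh)
  have "solves u 0 h (\<lambda>n. of_real a * (of_real (la + 0) * f n) + of_real b * (of_real (lb + 0) * ?g n))"
    unfolding h_def using e unfolding eigen_solves[of _ _ _ 0]
    by (intro solves_add[OF AA(1-3)] solves_scale)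
  then have Lh: "of_int n * h n - conv u h n = of_real (a * la) * f n + of_real (b * lb) * ?g n" if "n \<ge> 0" for n
    using that by (simp add: solves_def)
  have "a * la = 1 + mu * a" "b * lb = 1 + mu * b"
    using ab by (auto simp: algebra_simps)
  then have Lh1: "of_int n * h n - conv u h n = of_real mu * h n" if "n \<ge> 1" for n
    using Lh[of n] that by (simp add: h_def unit_vec_def algebra_simps)
  have mu_w: "w * (lb - mu) + (1 - w) * (la - mu) = 0"
    by (simp add: mu_def algebra_simps)
  have "a * w + b * (1 - w) = 0"
  proof -
    have "a * w + b * (1 - w) = a * b * (w * (lb - mu) + (1 - w) * (la - mu))"
      using ab by algebra
    then show ?thesis using mu_w by simp
  qed
  moreover have "h 0 = of_real (a * w + b * (1 - w))"
    using W(1) by (simp add: h_def unit_vec_def)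
  ultimately have h0: "h 0 = 0"
    by simp
  have "ip h h = ip h (\<lambda>n. of_real a * f n) + ip h (\<lambda>n. of_real b * ?g n)"
    unfolding h_def by (rule ip_add_right) (intro l2_scale l2_add(1) lf)+
  also have "\<dots> = of_real a * ip h f + of_real b * ip h ?g"
    unfolding ip_scale_right by simp
  also have "ip h f = of_real a * of_real w"
    unfolding h_def using W(4,5) lf ip_cnj[of f ?g]
    by (subst ip_add_left) (auto simp: ip_scale_left ip_self[OF lf(1)])
  also have "ip h ?g = of_real b * of_real (1 - w)"
    unfolding h_def using W(5,6) lf
    by (subst ip_add_left) (auto simp: ip_scale_left ip_self[OF lf(2)])
  finally have nh: "(nrm h)\<^sup>2 = a\<^sup>2 * w + b\<^sup>2 * (1 - w)"
    unfolding ip_self[OF hh_l2[OF hh]]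
    by (simp add: power2_eq_square mult.assoc flip: of_real_mult of_real_add of_real_diff of_real_power)
  have "a \<noteq> 0" "b \<noteq> 0"
    using ab by auto
  then have "a\<^sup>2 * w + b\<^sup>2 * (1 - w) > 0"
    using W(2,3) by (intro add_pos_pos mult_pos_pos) auto
  then have "h \<noteq> (\<lambda>n. 0)"
    using nh by auto
  then obtain d where d: "d \<ge> 0" "h d \<noteq> 0" "\<And>n. n < d \<Longrightarrow> h n = 0"
    using hardy_least[OF hardy_hh[OF hh]] by blast
  have d1: "d \<ge> 1"
    using d h0 by (cases "d = 0") auto
  define F where "F = (\<lambda>n. h (n + d))"
  have F: "eigen u (mu - of_int d) F"
    unfolding F_def by (rule eigen_descend[OF hh d1 d(3) Lh1])
  \<comment> \<open>\<open>mu\<close> lies below \<open>lb\<close>, so \<open>mu - d\<close> can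
    only be the lower eigenvalue.\<close>
  have "mu - of_int d = la"
    using two_gap_spectrum[OF A tg F] d(2) d1 mu by (auto simp: F_def)
  then have F0: "eigen u la F" and dmu: "of_int d = mu - la"
    using F by auto
  define \<theta> where "\<theta> = F 0 / of_real w"
  have "(\<lambda>n. F n - \<theta> * f n) = (\<lambda>n. 0)"
    using W(1,2) by (intro two_gap_simple[OF A tg] eigen_diff[OF A F0 e(1)]) (simp add: \<theta>_def)
  then have Ff: "F n = \<theta> * f n" for n
    by (metis eq_iff_diff_eq_0)
  have hf: "h n = \<theta> * f (n - d)" for n
    using Ff[of "n - d"] by (simp add: F_def)
  have "nrm h = nrm F"
    unfolding F_def using l2_reindex(2)[of "\<lambda>n. n + d" h] by (simp add: bij_plus_right)
  also have "\<dots> = norm \<theta> * nrm f"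
    using Ff nrm_scale[of \<theta> f] by (metis ext)
  finally have "(norm \<theta>)\<^sup>2 * w = (nrm h)\<^sup>2"
    using W(4) by (simp add: power_mult_distrib)
  then have "(norm \<theta>)\<^sup>2 = (w / (la - mu)\<^sup>2 + (1 - w) / (lb - mu)\<^sup>2) / w"
    using W(2) unfolding nh a_def b_def by (simp add: power_divide field_simps)
  then show thesis
    using that[OF d1 dmu] hf unfolding h_def a_def b_def by blast
qed

text \<open>L applied to 1 is - Pi u, so applying L to 1 = f + (1 - f) recovers the
  potential.\<close>

lemma two_gap_coefficients:
  assumes A: "admissible s u" and tg: "two_gap u la lb f" and n: "n \<ge> 0"
  shows "u n = - of_real la * f n - of_real lb * (unit_vec 0 n - f n)"
proof -
  note AA = admissibleD[OF A]
  let ?g = "\<lambda>n. unit_vec 0 n - f n"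
  have e: "eigen u la f" "eigen u lb ?g"
    using tg by (auto simp: two_gap_def)
  have "solves u 0 (\<lambda>n. f n + ?g n) (\<lambda>n. of_real (la + 0) * f n + of_real (lb + 0) * ?g n)"
    using e unfolding eigen_solves[of _ _ _ 0] by (intro solves_add[OF AA(1-3)])
  then have "of_int n * unit_vec 0 n - conv u (unit_vec 0) n = of_real la * f n + of_real lb * ?g n"
    using n by (simp add: solves_def)
  moreover have "of_int n * unit_vec 0 n = (0 :: complex)"
    by (simp add: unit_vec_def)
  ultimately show ?thesis
    unfolding conv_unit_vec by (simp add: algebra_simps)
qed

text \<open>Both potentials have the same \<open>mu\<close>, hence the same step d and the same
  modulus of the multiplier in their recursions. The two multipliers differ by a phase, which a
  translation absorbs, and the common mean starts the induction.\<close>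

lemma two_gap_rigid:
  assumes Au: "admissible s u" and Av: "admissible s v"
    and u: "two_gap u la lb f" and v: "two_gap v la lb g" and fg: "f 0 = g 0"
  obtains \<tau> where "\<And>n. u n = exp (\<i> * of_int n * of_real \<tau>) * v n"
proof -
  define w where "w = Re (f 0)"
  define mu where "mu = w * lb + (1 - w) * la"
  have wg: "w = Re (g 0)" by (simp add: w_def fg)
  note W = two_gap_weights[OF Au u, folded w_def]
  have lab: "la < lb" using u by (simp add: two_gap_def)
  obtain d \<theta> where d: "d \<ge> 1" "of_int d = mu - la"
    and \<theta>: "(norm \<theta>)\<^sup>2 = (w / (la - mu)\<^sup>2 + (1 - w) / (lb - mu)\<^sup>2) / w"
    and rf: "\<And>n. of_real (1 / (la - mu)) * f n + of_real (1 / (lb - mu)) * (unit_vec 0 n - f n) = \<theta> * f (n - d)"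
    by (rule two_gap_recursion[OF Au u, folded w_def, folded mu_def]) blast
  obtain d' \<theta>' where d': "d' \<ge> 1" "of_int d' = mu - la"
    and \<theta>': "(norm \<theta>')\<^sup>2 = (w / (la - mu)\<^sup>2 + (1 - w) / (lb - mu)\<^sup>2) / w"
    and rg: "\<And>n. of_real (1 / (la - mu)) * g n + of_real (1 / (lb - mu)) * (unit_vec 0 n - g n) = \<theta>' * g (n - d')"
    by (rule two_gap_recursion[OF Av v, folded wg, folded mu_def]) blast
  have dd: "d' = d"
    using d(2) d'(2) by (metis of_int_eq_iff)
  have "norm \<theta> = norm \<theta>'"
    using \<theta> \<theta>' by (metis norm_ge_zero power2_eq_imp_eq)
  then obtain \<psi> where psi: "\<theta> = \<theta>' * exp (\<i> * of_real \<psi>)"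
  proof (cases "\<theta>' = 0")
    case False
    then have "norm (\<theta> / \<theta>') = 1"
      using \<open>norm \<theta> = norm \<theta>'\<close> by (simp add: norm_divide)
    then obtain \<psi> where "\<theta> / \<theta>' = exp (\<i> * of_real \<psi>)"
      by (metis complex_norm_eq_1_exp)
    then show ?thesis
      using that[of \<psi>] False by (simp add: field_simps)
  qed (use that[of 0] in simp)
  \<comment> \<open>A translation by \<open>\<tau>\<close> multiplies index n by exp(i n \<tau>); at
    n = d this has to be the phase \<open>\<theta> / \<theta>'\<close>.\<close>
  define \<tau> where "\<tau> = \<psi> / of_int d"
  define E where "E n = exp (\<i> * of_int n * of_real \<tau>)" for n :: int
  have Eadd: "E (m + n) = E m * E n" for m n
    by (simp add: E_def exp_add[symmetric] algebra_simps)
  have Ed: "E d = exp (\<i> * of_real \<psi>)"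
    using d(1) by (simp add: E_def \<tau>_def)
  define c where "c = complex_of_real (1 / (la - mu) - 1 / (lb - mu))"
  have "mu - la = w * (lb - la)" "lb - mu = (1 - w) * (lb - la)"
    by (auto simp: mu_def algebra_simps)
  then have mu: "la < mu" "mu < lb"
    using W(2,3) lab by (metis diff_gt_0_iff_gt mult_pos_pos)+
  then have "1 / (la - mu) < 0" "1 / (lb - mu) > 0"
    by auto
  then have c: "c \<noteq> 0"
    unfolding c_def of_real_eq_0_iff by linarith
  have hf: "hardy f" "hardy g"
    using u v by (auto simp: two_gap_def dest: eigen_hh hardy_hh)
  have f_eq: "f n = E n * g n" for n
  proof (cases "n < 0")
    case False
    then have "n \<ge> 0" by simp
    then show ?thesis
    proof (induction "nat n" arbitrary: n rule: less_induct)
      case less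
      show ?case
      proof (cases "n = 0")
        case True
        then show ?thesis by (simp add: fg E_def)
      next
        case False
        have "f (n - d) = E (n - d) * g (n - d)"
        proof (cases "n - d < 0")
          case True
          then show ?thesis using hf by (simp add: hardy_def)
        next
          case nd: False
          then show ?thesis
            using less d(1) by (intro less.hyps) auto
        qed
        moreover have "c * f n = \<theta> * f (n - d)" "c * g n = \<theta>' * g (n - d)"
          using rf[of n] rg[of n] False by (auto simp: c_def unit_vec_def dd algebra_simps)
        ultimately have "c * f n = E n * (c * g n)"
          using Eadd[of d "n - d"] by (simp add: psi Ed)
        then show ?thesis
          using c by simp
      qed
    qed
  qed (use hf in \<open>simp add: hardy_def\<close>)
  have pos: "u n = E n * v n" if "n \<ge> 0" for n
  proof -
    have "unit_vec 0 n = E n * unit_vec 0 n"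
      by (simp add: unit_vec_def E_def)
    then show ?thesis
      unfolding two_gap_coefficients[OF Au u that] two_gap_coefficients[OF Av v that] f_eq[of n]
      by (simp add: algebra_simps)
  qed
  have "u n = E n * v n" for n
  proof (cases "n \<ge> 0")
    case False
    then have "u (- n) = E (- n) * v (- n)"
      by (intro pos) simp
    moreover have "u (- n) = cnj (u n)" "v (- n) = cnj (v n)"
      using Au Av by (auto simp: admissible_def herm_def)
    moreover have "E (- n) = cnj (E n)"
      by (simp add: E_def exp_cnj)
    ultimately show ?thesis
      by (metis complex_cnj_cnj complex_cnj_mult)
  qed (rule pos)
  then show thesis
    using that unfolding E_def by blast
qed

text \<open>The first resolvent identity: for distinct parameters the inner product of two resolvent
  vectors is a difference quotient of resolvent values.\<close>

lemma resolvent_pair_product: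
  assumes A: "admissible s u" and x: "solves u k x (unit_vec 0)" and y: "solves u k' y (unit_vec 0)"
  shows "of_real (k - k') * ip x y = y 0 - x 0"
proof -
  note AA = admissibleD[OF A]
  have real: "cnj (y 0) = y 0"
    using solves_sym[OF AA y y] by simp
  have "solves u k y (\<lambda>n. unit_vec 0 n + of_real (k - k') * y n)"
    using y solves_shift[of u k' y _ k] by simp
  from solves_sym[OF AA x this] have "cnj (y 0) = ip x (\<lambda>n. unit_vec 0 n + of_real (k - k') * y n)"
    by simp
  also have "\<dots> = x 0 + of_real (k - k') * ip x y"
    using x y by (subst ip_add_right) (auto simp: solves_def hh_l2 l2_scale ip_scale_right simp flip: of_real_diff)
  finally show ?thesis
    using real by (simp add: algebra_simps)
qed

lemma nrm_le_nk:
  assumes "1 \<le> k" "hh x" shows "nrm x \<le> nk k x"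
  unfolding nk_def
proof (rule l2_mono(2)[OF hh_l2_wgt[OF assms(2,1)]])
  show "norm (x n) \<le> norm (wgt (1/2) k x n)" for n
    using ge_one_powr_ge_zero[of "real_of_int \<bar>n\<bar> + k" "1/2"] assms(1)
    by (simp add: norm_wgt mult_le_cancel_right1)
qed

text \<open>Supplies the case of equal parameters, which the difference quotient does not cover, by
  a limit. The 4 is 2 from coercivity times 2 from \<open>resolvent_bound\<close>.\<close>

lemma resolvent_continuous:
  assumes A: "admissible s u" and k: "1 \<le> k" "k \<le> k'"
    and e: "eps s k * neg_norm s k u \<le> 1/2" "eps s k' * neg_norm s k' u \<le> 1/2"
    and x: "solves u k x (unit_vec 0)" and y: "solves u k' y (unit_vec 0)"
  shows "nrm (\<lambda>n. x n - y n) \<le> 4 * (k' - k)"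
proof -
  note AA = admissibleD[OF A]
  have hx: "hh x" and hy: "hh y"
    using x y by (auto simp: solves_def)
  define d where "d = (\<lambda>n. x n - y n)"
  have d: "hh d" unfolding d_def by (rule hh_diff[OF hx hy])
  have "solves u k y (\<lambda>n. unit_vec 0 n + of_real (k - k') * y n)"
    using y solves_shift[of u k' y _ k] by simp
  from solves_diff[OF AA(1-3) x this]
  have "solves u k d (\<lambda>n. of_real (k' - k) * y n)"
    by (simp add: d_def algebra_simps)
  from solves_coercive[OF k(1) AA(1-3) this e(1)]
  have "1/2 * (nk k d)\<^sup>2 \<le> (k' - k) * norm (ip y d)"
    using k by (simp add: ip_scale_left norm_mult flip: of_real_diff)
  also have "\<dots> \<le> (k' - k) * (2 * nk k d)"
  proof (intro mult_left_mono)
    have "norm (ip y d) \<le> nrm y * nrm d"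
      by (intro norm_ip_le hh_l2 hy d)
    also have "\<dots> \<le> 2 * nk k d"
      using nrm_le_nk[OF k(1) d] nrm_le_nk[of k' y] k hy
        resolvent_bound[of k' s u y] AA y e(2)
      by (intro mult_mono) auto
    finally show "norm (ip y d) \<le> 2 * nk k d" .
  qed (use k in simp)
  finally have "nk k d * nk k d \<le> (4 * (k' - k)) * nk k d"
    by (simp add: power2_eq_square algebra_simps)
  then have "nk k d \<le> 4 * (k' - k)"
    using k nk_nonneg[of k d] by (cases "nk k d = 0") auto
  then show ?thesis
    using nrm_le_nk[OF k(1) d] by (simp add: d_def)
qed

text \<open>The Gram matrix of \<open>1\<close> and the resolvent vectors is determined by the function
  \<open>k \<mapsto> \<langle>(L\<^sub>u + k)\<^sup>-\<^sup>1 1, 1\<rangle>\<close>, hence so are their linear relations.\<close>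

lemma resolvent_relation_transfer:
  assumes Au: "admissible s u" and Av: "admissible s v" and k0: "k0 \<ge> 1"
    and eu: "\<And>k. k \<ge> k0 \<Longrightarrow> eps s k * neg_norm s k u \<le> 1/2"
    and ev: "\<And>k. k \<ge> k0 \<Longrightarrow> eps s k * neg_norm s k v \<le> 1/2"
    and H: "\<And>k x y. k \<ge> k0 \<Longrightarrow> solves u k x (unit_vec 0) \<Longrightarrow> solves v k y (unit_vec 0) \<Longrightarrow> x 0 = y 0"
    and k12: "k1 \<ge> k0" "k2 \<ge> k0"
    and x: "solves u k1 x1 (unit_vec 0)" "solves u k2 x2 (unit_vec 0)"
    and y: "solves v k1 y1 (unit_vec 0)" "solves v k2 y2 (unit_vec 0)"
    and rel: "\<And>n. of_real c1 * y1 n + of_real c2 * y2 n + of_real c0 * unit_vec 0 n = 0"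
  shows "of_real c1 * x1 n + of_real c2 * x2 n + of_real c0 * unit_vec 0 n = 0"
proof -
  note Du = admissibleD[OF Au] and Dv = admissibleD[OF Av]
  define z where "z = (\<lambda>n. of_real c1 * x1 n + of_real c2 * x2 n + of_real c0 * unit_vec 0 n)"
  have l: "l2 x1" "l2 x2" "l2 y1" "l2 y2"
    using x y by (auto simp: solves_def intro: hh_l2)
  have lz: "l2 z"
    unfolding z_def by (intro l2_add(1) l2_scale l l2_unit_vec)
  have zip: "ip z a = of_real c1 * ip x1 a + of_real c2 * ip x2 a + of_real c0 * cnj (a 0)" if "l2 a" for a
    unfolding z_def
    by (subst ip_add_left, (intro l2_add(1) l2_scale l l2_unit_vec that)+,
        subst ip_add_left, (intro l2_add(1) l2_scale l l2_unit_vec that)+)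
      (simp add: ip_scale_left)
  have yip: "of_real c1 * ip y1 a + of_real c2 * ip y2 a + of_real c0 * cnj (a 0) = 0" if "l2 a" for a
  proof -
    have "ip (\<lambda>n. of_real c1 * y1 n + of_real c2 * y2 n + of_real c0 * unit_vec 0 n) a = 0"
      unfolding rel by simp
    then show ?thesis
      by (subst (asm) ip_add_left, (intro l2_add(1) l2_scale l l2_unit_vec that)+,
          subst (asm) ip_add_left, (intro l2_add(1) l2_scale l l2_unit_vec that)+)
        (simp add: ip_scale_left)
  qed
  have orth: "ip z a = 0" if k: "k \<ge> k0" "k \<noteq> k1" "k \<noteq> k2" and a: "solves u k a (unit_vec 0)" for k a
  proof -
    have "eps s k * neg_norm s k v < 1" using ev[OF k(1)] by simp
    then obtain b where b: "solves v k b (unit_vec 0)"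
      using resolvent_exists[OF _ Dv(1-3), of k] k(1) k0 by (metis order_trans)
    have la: "l2 a" "l2 b"
      using a b by (auto simp: solves_def intro: hh_l2)
    have ab: "a 0 = b 0" by (rule H[OF k(1) a b])
    have "ip x1 a = ip y1 b"
      using resolvent_pair_product[OF Au x(1) a] resolvent_pair_product[OF Av y(1) b] k(2) ab
        H[OF k12(1) x(1) y(1)] by (metis mult_cancel_left of_real_eq_0_iff right_minus_eq)
    moreover have "ip x2 a = ip y2 b"
      using resolvent_pair_product[OF Au x(2) a] resolvent_pair_product[OF Av y(2) b] k(3) ab
        H[OF k12(2) x(2) y(2)] by (metis mult_cancel_left of_real_eq_0_iff right_minus_eq)
    ultimately show ?thesis
      using zip[OF la(1)] yip[OF la(2)] ab by simp
  qed
  \<comment> \<open>The formula for inner products excludes the parameters \<open>k1\<close> and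
    \<open>k2\<close>; they are approached from the right through parameters k' + h.\<close>
  have orth': "ip z x' = 0" if k': "k' \<ge> k0" and x': "solves u k' x' (unit_vec 0)" for k' x'
  proof -
    have lx': "l2 x'" using x' by (auto simp: solves_def intro: hh_l2)
    have "norm (ip z x') \<le> nrm z * (4 * h)" if h: "h > 0" "k' + h \<noteq> k1" "k' + h \<noteq> k2" for h
    proof -
      have k: "k' + h \<ge> k0" using k' h by simp
      have "eps s (k' + h) * neg_norm s (k' + h) u < 1" using eu[OF k] by simp
      then obtain a where a: "solves u (k' + h) a (unit_vec 0)"
        using resolvent_exists[OF _ Du(1-3), of "k' + h"] k k0 by (metis order_trans)
      have la: "l2 a" using a by (auto simp: solves_def intro: hh_l2)
      have "ip z x' = ip z (\<lambda>n. x' n - a n)"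
        using orth[OF k h(2,3) a] by (simp add: ip_diff_right lx' la lz)
      then have "norm (ip z x') \<le> nrm z * nrm (\<lambda>n. x' n - a n)"
        using norm_ip_le[OF lz l2_diff(1)[OF lx' la]] by simp
      also have "\<dots> \<le> nrm z * (4 * h)"
        using resolvent_continuous[OF Au _ _ eu[OF k'] eu[OF k] x' a] k' k0 h
        by (intro mult_left_mono) auto
      finally show ?thesis .
    qed
    note bd = this
    have "\<forall>\<^sub>F h in at_right 0. norm (ip z x') \<le> nrm z * (4 * h)"
    proof -
      have "\<forall>\<^sub>F h in at_right (0::real). k' + h \<noteq> k1 \<and> k' + h \<noteq> k2"
      proof -
        have ev: "\<forall>\<^sub>F h in at_right (0::real). h \<noteq> c" for c :: real
        proof (cases "c > 0")
          case True
          then show ?thesis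
            using eventually_at_right_less[of 0] eventually_at_right[of 0 1]
            by (auto simp: eventually_at_right[OF zero_less_one] intro!: exI[of _ c])
        next
          case False
          then show ?thesis
            by (auto simp: eventually_at_right[OF zero_less_one] intro!: exI[of _ 1])
        qed
        show ?thesis
          using eventually_conj[OF ev[of "k1 - k'"] ev[of "k2 - k'"]]
          by (rule eventually_mono) auto
      qed
      then show ?thesis
        using eventually_at_right_less[of 0] by eventually_elim (use bd in auto)
    qed
    moreover have "((\<lambda>h. nrm z * (4 * h)) \<longlongrightarrow> nrm z * (4 * 0)) (at_right 0)"
      by (intro tendsto_intros)
    ultimately have "norm (ip z x') \<le> nrm z * (4 * 0)"
      by (intro tendsto_lowerbound[of _ _ "at_right 0"]) auto
    then show ?thesis by simp
  qed
  have "ip z (unit_vec 0) = 0"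
  proof -
    have "x1 0 = y1 0" "x2 0 = y2 0"
      using H k12 x y by blast+
    then show ?thesis
      using rel[of 0] by (simp add: z_def)
  qed
  then have "z 0 = 0"
    by simp
  moreover have "ip x1 z = 0" "ip x2 z = 0"
    using orth'[OF k12(1) x(1)] orth'[OF k12(2) x(2)] ip_cnj[of z] by (metis complex_cnj_zero)+
  \<comment> \<open>\<open>z\<close> is orthogonal to the three vectors of which it is a
    combination.\<close>
  ultimately have "ip z z = 0"
    unfolding zip[OF lz] by simp
  then have "nrm z = 0"
    by (simp add: ip_self[OF lz])
  from nrm_eq_0[OF lz this] show ?thesis
    by (simp add: z_def)
qed

text \<open>For v the resolvent vectors at two parameters are combinations of \<open>g\<close> and
  \<open>1 - g\<close> with an invertible coefficient matrix, so 1 is a combination of them. The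
  transferred relation says the same for u; inverting the matrix there produces \<open>f\<close> and
  \<open>f1\<close>, and the two resolvent equations become the two eigenvalue equations.\<close>

lemma two_gap_transfer:
  assumes Au: "admissible s u" and Av: "admissible s v" and k0: "k0 \<ge> 1"
    and eu: "\<And>k. k \<ge> k0 \<Longrightarrow> eps s k * neg_norm s k u \<le> 1/2"
    and ev: "\<And>k. k \<ge> k0 \<Longrightarrow> eps s k * neg_norm s k v \<le> 1/2"
    and H: "\<And>k x y. k \<ge> k0 \<Longrightarrow> solves u k x (unit_vec 0) \<Longrightarrow> solves v k y (unit_vec 0) \<Longrightarrow> x 0 = y 0"
    and tg: "two_gap v la lb g"
  obtains f where "two_gap u la lb f" "f 0 = g 0"
proof -
  note Du = admissibleD[OF Au] and Dv = admissibleD[OF Av]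
  have lab: "la < lb" and e: "eigen v la g" "eigen v lb (\<lambda>n. unit_vec 0 n - g n)"
    and gnz: "g \<noteq> (\<lambda>n. 0)" "g \<noteq> unit_vec 0"
    using tg by (auto simp: two_gap_def)
  \<comment> \<open>The maximum makes la + k1, and with it all four denominators, positive.\<close>
  define k1 where "k1 = max k0 (1 - la)"
  define k2 where "k2 = k1 + 1"
  have k12: "k1 \<ge> k0" "k2 \<ge> k0" "k1 \<ge> 1" "k2 \<ge> 1" and pos: "la + k1 > 0" "lb + k1 > 0" "la + k2 > 0" "lb + k2 > 0"
    using k0 lab by (auto simp: k1_def k2_def)
  define yy where "yy k n = of_real (1 / (la + k)) * g n + of_real (1 / (lb + k)) * (unit_vec 0 n - g n)" for k :: real and n
  have yy: "solves v k (yy k) (unit_vec 0)" if "la + k > 0" "lb + k > 0" for k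
  proof -
    have "solves v k (yy k) (\<lambda>n. of_real (1 / (la + k)) * (of_real (la + k) * g n)
        + of_real (1 / (lb + k)) * (of_real (lb + k) * (unit_vec 0 n - g n)))"
      unfolding yy_def using e unfolding eigen_solves[of _ _ _ k]
      by (intro solves_add[OF Dv(1-3)] solves_scale)
    moreover have "of_real (1 / c) * (of_real c * a) = (a :: complex)" if "c > 0" for c a
      using that by simp
    note this[OF that(1)] this[OF that(2)]
    ultimately show ?thesis
      by simp
  qed
  have "eps s k1 * neg_norm s k1 u < 1" "eps s k2 * neg_norm s k2 u < 1"
    using eu[OF k12(1)] eu[OF k12(2)] by auto
  then obtain x1 x2 where x: "solves u k1 x1 (unit_vec 0)" "solves u k2 x2 (unit_vec 0)"
    using resolvent_exists[OF k12(3) Du(1-3)] resolvent_exists[OF k12(4) Du(1-3)] by metis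
  define a1 a2 b1 b2 where "a1 = 1 / (la + k1)" and "a2 = 1 / (la + k2)" and "b1 = 1 / (lb + k1)" and "b2 = 1 / (lb + k2)"
  have inv: "a1 * (la + k1) = 1" "a2 * (la + k2) = 1" "b1 * (lb + k1) = 1" "b2 * (lb + k2) = 1"
    using pos by (auto simp: a1_def a2_def b1_def b2_def)
  define D where "D = a1 * b2 - a2 * b1"
  have "D * ((la + k1) * (lb + k2) * (la + k2) * (lb + k1))
      = (la + k2) * (lb + k1) * (a1 * (la + k1)) * (b2 * (lb + k2)) - (la + k1) * (lb + k2) * (a2 * (la + k2)) * (b1 * (lb + k1))"
    by (simp add: D_def algebra_simps)
  also have "\<dots> = lb - la"
    unfolding inv by (simp add: k2_def algebra_simps)
  finally have D: "D \<noteq> 0"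
    using lab by auto
  \<comment> \<open>Cramer's rule for c1 a1 + c2 a2 = 1 and c1 b1 + c2 b2 = 1, with determinant
    \<open>D\<close>.\<close>
  define c1 c2 where "c1 = (b2 - a2) / D" and "c2 = (a1 - b1) / D"
  have cD: "c1 * D = b2 - a2" "c2 * D = a1 - b1"
    using D by (auto simp: c1_def c2_def)
  have "D * (c1 * a1 + c2 * a2) = D * 1" "D * (c1 * b1 + c2 * b2) = D * 1"
    using cD unfolding D_def by algebra+
  then have cc: "c1 * a1 + c2 * a2 = 1" "c1 * b1 + c2 * b2 = 1"
    using D by (simp_all only: mult_cancel_left) auto
  have yrel: "of_real c1 * yy k1 n + of_real c2 * yy k2 n + of_real (-1) * unit_vec 0 n = 0" for n
  proof -
    have "of_real c1 * yy k1 n + of_real c2 * yy k2 n + of_real (-1) * unit_vec 0 n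
        = of_real (c1 * a1 + c2 * a2) * g n + of_real (c1 * b1 + c2 * b2) * (unit_vec 0 n - g n) - unit_vec 0 n"
      by (simp add: yy_def a1_def a2_def b1_def b2_def algebra_simps)
    then show ?thesis
      unfolding cc by simp
  qed
  have xrel: "of_real c1 * x1 n + of_real c2 * x2 n + of_real (-1) * unit_vec 0 n = 0" for n
    by (rule resolvent_relation_transfer[where s = s and u = u and v = v and ?k0.0 = k0 and ?k1.0 = k1
          and ?k2.0 = k2 and ?y1.0 = "yy k1" and ?y2.0 = "yy k2"])
      (fact Au Av k0 eu ev H k12 x yy[OF pos(1,2)] yy[OF pos(3,4)] yrel)+
  define f where "f = (\<lambda>n. of_real (b2 / D) * x1 n - of_real (b1 / D) * x2 n)"
  define f1 where "f1 = (\<lambda>n. of_real (a1 / D) * x2 n - of_real (a2 / D) * x1 n)"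
  have ff1: "f n + f1 n = unit_vec 0 n" for n
    using xrel[of n] by (simp add: f_def f1_def c1_def c2_def diff_divide_distrib algebra_simps)
  have hf: "hh f" "hh f1"
  proof -
    have "hh x1" "hh x2"
      using x by (simp_all add: solves_def)
    note hx = this
    show "hh f" "hh f1"
      unfolding f_def f1_def by (intro hh_diff hh_scale hx)+
  qed
  have Dab: "a1 * (b2 / D) - b1 * (a2 / D) = 1" "a2 * (b1 / D) - b2 * (a1 / D) = -1"
  proof -
    have "a1 * (b2 / D) - b1 * (a2 / D) = (a1 * b2 - a2 * b1) / D"
      "a2 * (b1 / D) - b2 * (a1 / D) = - ((a1 * b2 - a2 * b1) / D)"
      by (simp_all add: diff_divide_distrib mult.commute)
    then show "a1 * (b2 / D) - b1 * (a2 / D) = 1" "a2 * (b1 / D) - b2 * (a1 / D) = -1"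
      using D unfolding D_def[symmetric] by simp_all
  qed
  have x1: "x1 n = of_real a1 * f n + of_real b1 * f1 n" for n
  proof -
    have "of_real a1 * f n + of_real b1 * f1 n = of_real (a1 * (b2 / D) - b1 * (a2 / D)) * x1 n"
      by (simp add: f_def f1_def algebra_simps)
    then show ?thesis unfolding Dab by simp
  qed
  have x2: "x2 n = of_real a2 * f n + of_real b2 * f1 n" for n
  proof -
    have "of_real a2 * f n + of_real b2 * f1 n = - of_real (a2 * (b1 / D) - b2 * (a1 / D)) * x2 n"
      by (simp add: f_def f1_def algebra_simps)
    then show ?thesis unfolding Dab by simp
  qed
  have eig: "of_int n * f n - conv u f n = of_real la * f n \<and> of_int n * f1 n - conv u f1 n = of_real lb * f1 n"
    if n: "n \<ge> 0" for n
  proof -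
    define q q1 where "q m = of_int m * f m - conv u f m" and "q1 m = of_int m * f1 m - conv u f1 m" for m
    have sq: "solves u 0 f q" "solves u 0 f1 q1"
      using hf by (auto simp: solves_def q_def q1_def)
    have "of_real a1 * (q n - of_real la * f n) + of_real b1 * (q1 n - of_real lb * f1 n) = 0"
    proof -
      have "solves u 0 x1 (\<lambda>n. of_real a1 * q n + of_real b1 * q1 n)"
        unfolding x1[abs_def] by (intro solves_add[OF Du(1-3)] solves_scale sq)
      then have "of_real a1 * q n + of_real b1 * q1 n = of_int n * x1 n - conv u x1 n"
        using n by (simp add: solves_def)
      also have "\<dots> = f n + f1 n - of_real k1 * x1 n"
        using x(1) n unfolding ff1 by (simp add: solves_def algebra_simps)
      also have "\<dots> = of_real (1 - k1 * a1) * f n + of_real (1 - k1 * b1) * f1 n"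
        unfolding x1 by (simp add: algebra_simps)
      also have "1 - k1 * a1 = a1 * la"
        using inv by (auto simp: algebra_simps)
      also have "1 - k1 * b1 = b1 * lb"
        using inv by (auto simp: algebra_simps)
      finally show ?thesis
        by (simp add: algebra_simps)
    qed
    moreover have "of_real a2 * (q n - of_real la * f n) + of_real b2 * (q1 n - of_real lb * f1 n) = 0"
    proof -
      have "solves u 0 x2 (\<lambda>n. of_real a2 * q n + of_real b2 * q1 n)"
        unfolding x2[abs_def] by (intro solves_add[OF Du(1-3)] solves_scale sq)
      then have "of_real a2 * q n + of_real b2 * q1 n = of_int n * x2 n - conv u x2 n"
        using n by (simp add: solves_def)
      also have "\<dots> = f n + f1 n - of_real k2 * x2 n"
        using x(2) n unfolding ff1 by (simp add: solves_def algebra_simps)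
      also have "\<dots> = of_real (1 - k2 * a2) * f n + of_real (1 - k2 * b2) * f1 n"
        unfolding x2 by (simp add: algebra_simps)
      also have "1 - k2 * a2 = a2 * la"
        using inv by (auto simp: algebra_simps)
      also have "1 - k2 * b2 = b2 * lb"
        using inv by (auto simp: algebra_simps)
      finally show ?thesis
        by (simp add: algebra_simps)
    qed
    \<comment> \<open>The two resolvent equations are a homogeneous linear system with determinant
      \<open>D\<close> for the defects of \<open>f\<close> and \<open>f1\<close> in their eigenvalue
      equations.\<close>
    ultimately have "of_real D * (q n - of_real la * f n) = 0" "of_real D * (q1 n - of_real lb * f1 n) = 0"
      unfolding D_def of_real_diff of_real_mult by algebra+
    then show ?thesis
      using D by (simp add: q_def q1_def)
  qed
  have f1: "f1 = (\<lambda>n. unit_vec 0 n - f n)"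
    using ff1 by (simp add: fun_eq_iff algebra_simps)
  have yxeq: "x1 0 = yy k1 0" "x2 0 = yy k2 0"
    using H[OF k12(1) x(1) yy[OF pos(1,2)]] H[OF k12(2) x(2) yy[OF pos(3,4)]] by auto
  have "f 0 = of_real ((a1 * b2 - a2 * b1) / D) * g 0"
  proof -
    have "yy k1 0 = of_real a1 * g 0 + of_real b1 * (unit_vec (0 :: int) 0 - g 0)"
      "yy k2 0 = of_real a2 * g 0 + of_real b2 * (unit_vec (0 :: int) 0 - g 0)"
      unfolding yy_def a1_def a2_def b1_def b2_def by simp_all
    note yy0 = this
    show ?thesis
      unfolding f_def yxeq yy0 by (simp add: diff_divide_distrib algebra_simps)
  qed
  then have f0: "f 0 = g 0"
    using D by (simp add: D_def)
  have "0 < Re (g 0)" "Re (g 0) < 1"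
    using two_gap_weights[OF Av tg] by auto
  then have "f \<noteq> (\<lambda>n. 0)" "f \<noteq> unit_vec 0"
    using f0 by (auto simp: unit_vec_def)
  then have "two_gap u la lb f"
    using lab hf eig unfolding two_gap_def f1[symmetric] eigen_iff by blast
  then show thesis
    using that f0 by blast
qed

text \<open>If 1 is an eigenvector for v, its resolvent vector is a multiple of 1. This relation
  passes to u, and since L applied to 1 is - Pi u, the same multiple gives the same
  potential.\<close>

lemma constant_transfer:
  assumes Au: "admissible s u" and Av: "admissible s v" and k0: "k0 \<ge> 1"
    and eu: "\<And>k. k \<ge> k0 \<Longrightarrow> eps s k * neg_norm s k u \<le> 1/2"
    and ev: "\<And>k. k \<ge> k0 \<Longrightarrow> eps s k * neg_norm s k v \<le> 1/2"
    and H: "\<And>k x y. k \<ge> k0 \<Longrightarrow> solves u k x (unit_vec 0) \<Longrightarrow> solves v k y (unit_vec 0) \<Longrightarrow> x 0 = y 0"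
    and eig: "eigen v l (unit_vec 0)"
  shows "u = v"
proof -
  note Du = admissibleD[OF Au] and Dv = admissibleD[OF Av]
  define k1 where "k1 = max k0 (1 - l)"
  have k1: "k1 \<ge> k0" "k1 \<ge> 1" and pos: "l + k1 > 0"
    using k0 by (auto simp: k1_def)
  define a where "a = 1 / (l + k1)"
  have y: "solves v k1 (\<lambda>n. of_real a * unit_vec 0 n) (unit_vec 0)"
  proof -
    have e: "complex_of_real a * of_real (l + k1) = 1"
      using pos by (simp add: a_def flip: of_real_add of_real_mult)
    show ?thesis
      using solves_scale[OF eig[unfolded eigen_solves[of _ _ _ k1]], of "of_real a"]
      by (simp only: mult.assoc[symmetric] e mult_1)
  qed
  have "eps s k1 * neg_norm s k1 u < 1"
    using eu[OF k1(1)] by simp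
  then obtain x where x: "solves u k1 x (unit_vec 0)"
    using resolvent_exists[OF k1(2) Du(1-3)] by metis
  \<comment> \<open>A relation with one resolvent vector, obtained as the degenerate case of equal
    parameters and second coefficient 0.\<close>
  have "of_real 1 * x n + of_real 0 * x n + of_real (- a) * unit_vec 0 n = 0" for n
  proof (rule resolvent_relation_transfer[where s = s and u = u and v = v and ?k0.0 = k0 and ?k1.0 = k1
        and ?k2.0 = k1 and ?y1.0 = "\<lambda>n. of_real a * unit_vec 0 n" and ?y2.0 = "\<lambda>n. of_real a * unit_vec 0 n"])
  qed ((fact Au Av k0 eu ev H k1(1) x y)+, simp)
  then have "x n = of_real a * unit_vec 0 n" for n
    by (simp add: eq_neg_iff_add_eq_0[symmetric])
  then have xa: "solves u k1 (\<lambda>n. of_real a * unit_vec 0 n) (unit_vec 0)"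
    using x by (metis ext)
  have a: "complex_of_real a \<noteq> 0"
    using pos by (simp add: a_def flip: of_real_add)
  have "u n = v n" if "n \<ge> 0" for n
  proof -
    have "(of_int n + of_real k1) * (of_real a * unit_vec 0 n) - of_real a * u n = unit_vec 0 n"
      "(of_int n + of_real k1) * (of_real a * unit_vec 0 n) - of_real a * v n = unit_vec 0 n"
      using xa y that unfolding solves_def conv_scale_right conv_unit_vec by blast+
    then have "of_real a * u n = of_real a * v n"
      by (simp add: algebra_simps)
    then show ?thesis using a by simp
  qed
  note pos_eq = this
  have "u n = v n" for n
  proof (cases "n \<ge> 0")
    case False
    have "cnj (u n) = cnj (v n)"
      using pos_eq[of "- n"] False Du(4) Dv(4) by (simp add: herm_def)
    then show ?thesis by simp
  qed (rule pos_eq)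
  then show ?thesis by auto
qed

section \<open>Travelling waves have at most two eigenvalues\<close>

definition h1 :: "(int \<Rightarrow> complex) \<Rightarrow> bool" where
  "h1 x \<longleftrightarrow> hardy x \<and> l2 x \<and> l2 (dd x)"

text \<open>For hermitian v this is A* A with the Hankel operator A x = (1 - Pi)(v x); positivity is
  read off from \<open>ip_hank\<close>.\<close>

definition hank :: "(int \<Rightarrow> complex) \<Rightarrow> (int \<Rightarrow> complex) \<Rightarrow> int \<Rightarrow> complex" where
  "hank v x = pos_part (conv v (neg_part (conv v x)))"

text \<open>Gaussian elimination: an unknown with nonzero coefficient in the last equation is
  eliminated from the others.\<close>

lemma homogeneous_system_solvable:
  fixes a :: "nat \<Rightarrow> 'b \<Rightarrow> 'c::field"
  assumes "finite J" "card J > n"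
  shows "\<exists>c. (\<exists>j\<in>J. c j \<noteq> 0) \<and> (\<forall>i<n. (\<Sum>j\<in>J. c j * a i j) = 0)"
  using assms
proof (induction n arbitrary: J a)
  case 0
  then obtain j where "j \<in> J" by (metis card_gt_0_iff ex_in_conv)
  then show ?case by (intro exI[of _ "\<lambda>_. 1"]) auto
next
  case (Suc n)
  show ?case
  proof (cases "\<forall>j\<in>J. a n j = 0")
    case True
    obtain c where "\<exists>j\<in>J. c j \<noteq> 0" "\<forall>i<n. (\<Sum>j\<in>J. c j * a i j) = 0"
      using Suc.IH[of J a] Suc.prems by auto
    then show ?thesis
      using True by (intro exI[of _ c]) (auto simp: less_Suc_eq)
  next
    case False
    then obtain j0 where j0: "j0 \<in> J" "a n j0 \<noteq> 0" by auto
    define J' where "J' = J - {j0}"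
    have J': "finite J'" "card J' > n" "j0 \<notin> J'" "J = insert j0 J'"
      using Suc.prems j0 by (auto simp: J'_def)
    define a' where "a' i j = a i j - a n j / a n j0 * a i j0" for i j
    obtain c where c: "\<exists>j\<in>J'. c j \<noteq> 0" "\<And>i. i < n \<Longrightarrow> (\<Sum>j\<in>J'. c j * a' i j) = 0"
      using Suc.IH[of J' a'] J' by auto
    define t where "t = - (\<Sum>j\<in>J'. c j * (a n j / a n j0))"
    define c' where "c' = c(j0 := t)"
    have split: "(\<Sum>j\<in>J. c' j * a i j) = t * a i j0 + (\<Sum>j\<in>J'. c j * a i j)" for i
    proof -
      have "(\<Sum>j\<in>J'. c' j * a i j) = (\<Sum>j\<in>J'. c j * a i j)"
        using J'(3) by (intro sum.cong) (auto simp: c'_def)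
      then show ?thesis
        using J' by (simp add: c'_def)
    qed
    have "(\<Sum>j\<in>J. c' j * a i j) = 0" if "i < Suc n" for i
    proof (cases "i = n")
      case True
      have "(\<Sum>j\<in>J'. c j * a n j) = (\<Sum>j\<in>J'. c j * (a n j / a n j0)) * a n j0"
        using j0(2) by (simp add: sum_distrib_right)
      then show ?thesis
        by (simp add: split True t_def)
    next
      case False
      then have "(\<Sum>j\<in>J'. c j * a' i j) = 0" using that by (intro c(2)) simp
      moreover have "(\<Sum>j\<in>J'. c j * a' i j) = (\<Sum>j\<in>J'. c j * a i j) + t * a i j0"
        by (simp add: a'_def right_diff_distrib sum_subtractf t_def sum_distrib_right mult.assoc)
      ultimately show ?thesis
        by (simp add: split add.commute)
    qed
    moreover have "\<exists>j\<in>J. c' j \<noteq> 0"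
      using c(1) J'(3,4) by (auto simp: c'_def)
    ultimately show ?thesis by blast
  qed
qed

lemma wgt_half_le: "norm (wgt (1/2) 1 x n) \<le> norm (x n) + norm (dd x n)"
proof -
  have "(real_of_int \<bar>n\<bar> + 1) powr (1/2) \<le> (real_of_int \<bar>n\<bar> + 1) powr 1"
    by (intro powr_mono) auto
  then have "(real_of_int \<bar>n\<bar> + 1) powr (1/2) * norm (x n) \<le> (real_of_int \<bar>n\<bar> + 1) * norm (x n)"
    by (intro mult_right_mono) auto
  then show ?thesis
    by (simp add: norm_wgt dd_def norm_mult algebra_simps)
qed

lemma h1_hh:
  assumes "h1 x" shows "hh x"
proof -
  have "l2 (\<lambda>n. norm (x n) + norm (dd x n))"
    using assms by (intro l2_add(1)) (auto simp: h1_def)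
  then have "l2 (wgt (1/2) 1 x)"
    by (rule l2_mono(1)) (use wgt_half_le in \<open>auto intro: order_trans\<close>)
  then show ?thesis
    using assms by (simp add: hh_def h1_def)
qed

lemma dd_linear:
  "dd (\<lambda>n. x n + y n) = (\<lambda>n. dd x n + dd y n)"
  "dd (\<lambda>n. c * x n) = (\<lambda>n. c * dd x n)"
  by (auto simp: dd_def algebra_simps)

lemma h1_add: "h1 x \<Longrightarrow> h1 y \<Longrightarrow> h1 (\<lambda>n. x n + y n)"
  unfolding h1_def hardy_def dd_linear by (auto intro!: l2_add(1))

lemma h1_scale: "h1 x \<Longrightarrow> h1 (\<lambda>n. c * x n)"
  unfolding h1_def hardy_def dd_linear by (auto intro!: l2_scale)

lemma h1_unit_vec: "h1 (unit_vec 0)"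
proof -
  have "dd (unit_vec 0) = (\<lambda>n. 0)"
    by (auto simp: dd_def unit_vec_def)
  then show ?thesis
    by (simp add: h1_def hardy_def unit_vec_def[abs_def] l2_unit_vec[unfolded unit_vec_def[abs_def]])
qed

section \<open>The travelling wave equation, integrated once with constant C, and its Hankel
  operator\<close>

context
  fixes v :: "int \<Rightarrow> complex" and c C :: real
  assumes v_herm: "herm v" and v_l1: "l1 v" and dv_l1: "l1 (dd v)"
    and tw: "\<And>n. abs_dd v n = conv v v n + of_real c * v n + of_real C * unit_vec 0 n"
begin

text \<open>The exponent 1/4 is just some number below 1/2; v is even absolutely summable.\<close>

private lemma adm: "admissible (1/4) v"
  unfolding admissible_def by (simp add: v_herm l2_imp_hs(1)[OF l1_imp_l2[OF v_l1]])

private definition "g = abs_dd v"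

private lemma g_l1: "l1 g"
  unfolding g_def by (rule l1_mono_norm[OF dv_l1]) (simp add: abs_dd_def dd_def norm_mult)

private lemma conv_l2: "l2 x \<Longrightarrow> l2 (conv v x)"
  by (rule l2_conv(1)[OF v_l1])

private lemma convb: "l2 x \<Longrightarrow> convable v x"
  by (rule l1_convable[OF v_l1])

private lemma conv_add: "l2 x \<Longrightarrow> l2 y \<Longrightarrow> conv v (\<lambda>n. x n + y n) = (\<lambda>n. conv v x n + conv v y n)"
  by (intro conv_add_right convb)

private lemma conv_diff: "l2 x \<Longrightarrow> l2 y \<Longrightarrow> conv v (\<lambda>n. x n - y n) = (\<lambda>n. conv v x n - conv v y n)"
  by (intro conv_diff_right convb)

private lemma conv_g: "l2 x \<Longrightarrow> conv g x = (\<lambda>n. conv v (conv v x) n + of_real c * conv v x n + of_real C * x n)"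
proof -
  assume x: "l2 x"
  have e: "g = (\<lambda>n. (conv v v n + of_real c * v n) + of_real C * unit_vec 0 n)"
    by (simp add: g_def tw fun_eq_iff)
  have l: "l1 (conv v v)" "l1 (\<lambda>n. of_real c * v n)" "l1 (\<lambda>n. of_real C * unit_vec 0 n)"
  proof -
    show "l1 (conv v v)" "l1 (\<lambda>n. of_real c * v n)"
      by (intro l1_conv l1_scale v_l1)+
    have "l1 (unit_vec 0)"
      unfolding l1_def
      by (rule summable_on_cong_neutral[THEN iffD1, of _ "{0}" _ "\<lambda>n. norm (unit_vec 0 n)"])
        (auto simp: unit_vec_def)
    then show "l1 (\<lambda>n. of_real C * unit_vec 0 n)"
      by (rule l1_scale)
  qed
  have cu: "conv (unit_vec 0) x = x"
    by (metis conv_commute conv_unit_vec)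
  show ?thesis
    unfolding e
    by (subst conv_add_left, (intro l1_convable l1_add l x)+, subst conv_add_left, (intro l1_convable l x)+)
      (simp add: cu conv_scale_left conv_assoc[OF v_l1 v_l1 x])
qed

private lemma hank_l2: "l2 x \<Longrightarrow> l2 (hank v x)"
  unfolding hank_def by (intro l2_pos_part conv_l2 l2_neg_part)

private lemma dd_conv_v: "l2 x \<Longrightarrow> l2 (dd x) \<Longrightarrow> dd (conv v x) = (\<lambda>n. conv (dd v) x n + conv v (dd x) n)"
  by (intro dd_conv l1_convable dv_l1 v_l1)

private lemma l2_dd_conv: "l2 x \<Longrightarrow> l2 (dd x) \<Longrightarrow> l2 (dd (conv v x))"
  using dd_conv_v by (auto intro!: l2_add(1) l2_conv(1) dv_l1 v_l1)

private lemma dd_parts: "dd (pos_part x) = pos_part (dd x)" "dd (neg_part x) = neg_part (dd x)"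
  by (auto simp: dd_def pos_part_def neg_part_def)

private lemma hank_h1: "h1 x \<Longrightarrow> h1 (hank v x)"
  unfolding h1_def
proof (elim conjE, intro conjI)
  assume x: "hardy x" "l2 x" "l2 (dd x)"
  show "hardy (hank v x)"
    by (simp add: hardy_def hank_def pos_part_def)
  show "l2 (hank v x)"
    by (rule hank_l2[OF x(2)])
  show "l2 (dd (hank v x))"
    unfolding hank_def dd_parts
    by (intro l2_pos_part l2_dd_conv l2_neg_part conv_l2 x) (simp add: dd_parts l2_neg_part l2_dd_conv x)
qed

private lemma hank_add: "l2 x \<Longrightarrow> l2 y \<Longrightarrow> hank v (\<lambda>n. x n + y n) = (\<lambda>n. hank v x n + hank v y n)"
proof -
  assume l: "l2 x" "l2 y"
  have "neg_part (\<lambda>n. conv v x n + conv v y n) = (\<lambda>n. neg_part (conv v x) n + neg_part (conv v y) n)"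
    by (auto simp: neg_part_def)
  then show ?thesis
    unfolding hank_def using l
    by (simp add: conv_add conv_l2 l2_neg_part) (auto simp: pos_part_def)
qed

private lemma hank_scale: "hank v (\<lambda>n. a * x n) = (\<lambda>n. a * hank v x n)"
proof -
  have "neg_part (\<lambda>n. a * z n) = (\<lambda>n. a * neg_part z n)" "pos_part (\<lambda>n. a * z n) = (\<lambda>n. a * pos_part z n)" for z
    by (auto simp: neg_part_def pos_part_def)
  then show ?thesis
    by (simp add: hank_def conv_scale_right)
qed

private lemma ip_pos_part: "hardy y \<Longrightarrow> ip (pos_part x) y = ip x y"
  unfolding ip_def by (rule infsum_cong) (auto simp: pos_part_def hardy_def)

private lemma ip_hank:
  assumes "hardy y" "l2 x" "l2 y"
  shows "ip (hank v x) y = ip (neg_part (conv v x)) (neg_part (conv v y))"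
proof -
  have "ip (hank v x) y = ip (neg_part (conv v x)) (conv v y)"
    unfolding hank_def ip_pos_part[OF assms(1)]
    by (intro ip_conv_swap v_l1 v_herm l2_neg_part conv_l2 assms)
  also have "\<dots> = ip (neg_part (conv v x)) (neg_part (conv v y))"
    unfolding ip_def by (rule infsum_cong) (auto simp: neg_part_def)
  finally show ?thesis .
qed

private lemma lax_eq: "hardy x \<Longrightarrow> lax v x = (\<lambda>n. dd x n - pos_part (conv v x) n)"
  by (auto simp: lax_def dd_def pos_part_def hardy_def)

private lemma lax_l2: "h1 x \<Longrightarrow> l2 (lax v x)"
  unfolding h1_def by (auto simp: lax_eq intro!: l2_diff(1) l2_pos_part conv_l2)

private lemma lax_add: "l2 x \<Longrightarrow> l2 y \<Longrightarrow> lax v (\<lambda>n. x n + y n) = (\<lambda>n. lax v x n + lax v y n)"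
  by (auto simp: lax_def conv_add algebra_simps)

private lemma lax_scale: "lax v (\<lambda>n. a * x n) = (\<lambda>n. a * lax v x n)"
  by (auto simp: lax_def conv_scale_right algebra_simps)

private lemma lax_sum: "(\<And>i. i \<in> I \<Longrightarrow> l2 (x i)) \<Longrightarrow> lax v (\<lambda>n. \<Sum>i\<in>I. x i n) = (\<lambda>n. \<Sum>i\<in>I. lax v (x i) n)"
proof (induction I rule: infinite_finite_induct)
  case (insert i I)
  then show ?case
    by (simp add: lax_add l2_sum)
qed (auto simp: lax_def conv_def)

private lemma hank_0: "hank v (\<lambda>n. 0) = (\<lambda>n. 0)"
  using hank_scale[of 0 "\<lambda>n. 0"] by simp

private lemma hank_sum: "(\<And>i. i \<in> I \<Longrightarrow> l2 (x i)) \<Longrightarrow> hank v (\<lambda>n. \<Sum>i\<in>I. x i n) = (\<lambda>n. \<Sum>i\<in>I. hank v (x i) n)"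
proof (induction I rule: infinite_finite_induct)
  case (insert i I)
  then show ?case
    by (simp add: hank_add l2_sum)
qed (simp_all add: hank_0)

private lemma lax_sym: "h1 x \<Longrightarrow> h1 y \<Longrightarrow> ip (lax v x) y = ip x (lax v y)"
  using solves_sym[OF admissibleD[OF adm], of 0 x "lax v x" y "lax v y"]
  by (simp add: solves_def lax_def h1_hh)

text \<open>The travelling wave equation makes the Hankel part of the Lax pair commute with the Lax
  operator.\<close>

private lemma hank_commute:
  assumes "h1 x"
  shows "lax v (hank v x) = hank v (lax v x)"
proof
  fix n :: int
  have x: "hardy x" "l2 x" "l2 (dd x)"
    using assms by (auto simp: h1_def)
  define z where "z = conv v x"
  define w where "w = neg_part z"
  have z: "l2 z" "l2 (dd z)"
    unfolding z_def by (intro conv_l2 l2_dd_conv x)+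
  have w: "l2 w" "l2 (dd w)"
    unfolding w_def dd_parts by (intro l2_neg_part z)+
  have Kx: "hank v x = pos_part (conv v w)"
    by (simp add: hank_def w_def z_def)
  show "lax v (hank v x) n = hank v (lax v x) n"
  proof (cases "n \<ge> 0")
    case False
    then show ?thesis by (simp add: lax_def hank_def pos_part_def)
  next
    case n: True
    have w0: "w n = 0" using n by (simp add: w_def neg_part_def)
    \<comment> \<open>Here n is nonnegative and \<open>w\<close> lives on negative frequencies, so
      only positive frequencies of v occur, where D = |D|. In the next step the signs are opposite,
      whence the minus.\<close>
    have 1: "conv (dd v) w n = conv g w n"
      unfolding conv_def using n
      by (intro infsum_cong) (auto simp: w_def neg_part_def g_def abs_dd_def dd_def)
    have "neg_part (conv (dd v) x) = (\<lambda>n. - neg_part (conv g x) n)"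
    proof
      fix n :: int
      show "neg_part (conv (dd v) x) n = - neg_part (conv g x) n"
      proof (cases "n < 0")
        case True
        have "conv (dd v) x n = - conv g x n"
          unfolding conv_def infsum_uminus[symmetric]
        proof (rule infsum_cong)
          fix m :: int
          show "dd v (n - m) * x m = - (g (n - m) * x m)"
          proof (cases "m < 0")
            case False
            then have "\<bar>n - m\<bar> = m - n" using True by simp
            then show ?thesis by (simp add: g_def abs_dd_def dd_def algebra_simps)
          qed (use x(1) in \<open>simp add: hardy_def\<close>)
        qed
        then show ?thesis using True by (simp add: neg_part_def)
      qed (simp add: neg_part_def)
    qed
    note 2 = this
    have Lx: "lax v x = (\<lambda>n. dd x n - pos_part z n)"
      unfolding z_def by (rule lax_eq[OF x(1)])
    have ddz: "dd z = (\<lambda>n. conv (dd v) x n + conv v (dd x) n)"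
      unfolding z_def by (rule dd_conv_v[OF x(2,3)])
    have "neg_part (conv v (lax v x)) = (\<lambda>n. dd w n + neg_part (conv g x) n - neg_part (conv v (pos_part z)) n)"
    proof
      fix m
      have "conv v (lax v x) m = dd z m - conv (dd v) x m - conv v (pos_part z) m"
        unfolding Lx conv_diff[OF x(3) l2_pos_part[OF z(1)]] ddz by simp
      moreover have "dd w m = neg_part (dd z) m"
        by (simp add: w_def dd_parts)
      moreover have "neg_part (conv (dd v) x) m = - neg_part (conv g x) m"
        using 2 by metis
      ultimately show "neg_part (conv v (lax v x)) m = dd w m + neg_part (conv g x) m - neg_part (conv v (pos_part z)) m"
        by (auto simp: neg_part_def)
    qed
    note 3 = this
    have gx: "l2 (conv g x)" by (rule l2_conv(1)[OF g_l1 x(2)])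
    have vp: "l2 (conv v (pos_part z))" by (intro conv_l2 l2_pos_part z)
    have KL: "hank v (lax v x) n = conv v (dd w) n + conv v (neg_part (conv g x)) n
        - conv v (neg_part (conv v (pos_part z))) n"
      using n unfolding hank_def 3
      by (simp add: conv_diff conv_add w l2_neg_part gx vp l2_add pos_part_def)
    have "pos_part (conv v w) = (\<lambda>m. conv v w m - neg_part (conv v w) m)"
      by (auto simp: pos_part_def neg_part_def)
    then have LK: "lax v (hank v x) n = conv g w n + conv v (dd w) n
        - conv v (conv v w) n + conv v (neg_part (conv v w)) n"
      using n dd_conv_v[OF w] 1 unfolding Kx
      by (simp add: lax_def conv_diff conv_l2 l2_neg_part w)
        (simp add: dd_def[abs_def] fun_eq_iff neg_part_def algebra_simps)
    \<comment> \<open>This is the operator form of the wave equation, g x = v (v x) + c v x + C x,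
      projected to negative frequencies; the last term vanishes there because \<open>x\<close> is in
      the Hardy space.\<close>
    have "neg_part (conv v w) = (\<lambda>m. neg_part (conv g x) m - of_real c * w m - neg_part (conv v (pos_part z)) m)"
    proof
      fix m
      have "conv v z m = conv v (pos_part z) m + conv v w m"
        unfolding w_def using conv_add[OF l2_pos_part[OF z(1)] l2_neg_part[OF z(1)]] pos_neg_part[of z]
        by metis
      moreover have "conv g x m = conv v z m + of_real c * z m + of_real C * x m"
        unfolding conv_g[OF x(2)] z_def ..
      ultimately show "neg_part (conv v w) m = neg_part (conv g x) m - of_real c * w m - neg_part (conv v (pos_part z)) m"
        using x(1) by (auto simp: neg_part_def w_def hardy_def)
    qed
    then have "conv v (neg_part (conv v w)) n = conv v (neg_part (conv g x)) n - of_real c * conv v w n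
        - conv v (neg_part (conv v (pos_part z))) n"
      by (simp add: conv_diff l2_neg_part gx vp w l2_scale l2_diff conv_scale_right)
    \<comment> \<open>The same identity applied to \<open>w\<close>; the constant term vanishes as
      \<open>w\<close> has no nonnegative frequencies.\<close>
    moreover have "conv g w n = conv v (conv v w) n + of_real c * conv v w n"
      using conv_g[OF w(1)] w0 by simp
    ultimately show ?thesis
      unfolding LK KL by simp
  qed
qed

section \<open>The cyclic space of 1 under the Lax operator\<close>

private definition xs :: "nat \<Rightarrow> int \<Rightarrow> complex" where
  "xs j = (lax v ^^ j) (unit_vec 0)"

private lemma xs_Suc: "lax v (xs j) = xs (Suc j)"
  by (simp add: xs_def)

private lemma lax_1: "lax v (unit_vec 0) = (\<lambda>n. - pos_part v n)"
  by (auto simp: lax_def conv_unit_vec pos_part_def unit_vec_def)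

text \<open>For j = 0 the identity is the wave equation projected to the Hardy space.
  \<open>hank_commute\<close> carries it to all powers, so that on the cyclic space the Hankel part
  is the polynomial - L^2 + c L - C.\<close>

private lemma xs_facts:
  "h1 (xs j) \<and> h1 (xs (Suc j)) \<and>
    xs (Suc (Suc j)) = (\<lambda>n. - hank v (xs j) n + of_real c * xs (Suc j) n - of_real C * xs j n)"
proof (induction j)
  case 0
  have x0: "xs 0 = unit_vec 0" and x1: "xs (Suc 0) = (\<lambda>n. - pos_part v n)"
    by (simp_all add: xs_def lax_1)
  have lv: "l2 v" "l2 (dd v)"
    by (intro l1_imp_l2 v_l1 dv_l1)+
  have h: "h1 (\<lambda>n. - pos_part v n)"
  proof -
    have "dd (\<lambda>n. - pos_part v n) = (\<lambda>n. - pos_part (dd v) n)"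
      by (auto simp: dd_def pos_part_def)
    moreover have "hardy (\<lambda>n. - pos_part v n)"
      by (simp add: hardy_def pos_part_def)
    ultimately show ?thesis
      using l2_uminus[OF l2_pos_part[OF lv(1)]] l2_uminus[OF l2_pos_part[OF lv(2)]] by (simp add: h1_def)
  qed
  have "xs (Suc (Suc 0)) = (\<lambda>n. - hank v (xs 0) n + of_real c * xs (Suc 0) n - of_real C * xs 0 n)"
  proof
    fix n :: int
    have e: "xs (Suc (Suc 0)) n = lax v (\<lambda>n. - pos_part v n) n"
      using xs_Suc[of "Suc 0"] x1 by simp
    show "xs (Suc (Suc 0)) n = - hank v (xs 0) n + of_real c * xs (Suc 0) n - of_real C * xs 0 n"
    proof (cases "n \<ge> 0")
      case True
      have "lax v (\<lambda>n. - pos_part v n) n = - of_int n * v n + conv v (pos_part v) n"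
        using True conv_scale_right[of v "-1" "pos_part v"] by (simp add: lax_def pos_part_def[of v])
      moreover have "hank v (unit_vec 0) n = conv v (neg_part v) n"
        using True by (simp add: hank_def conv_unit_vec pos_part_def)
      moreover have "conv v v n = conv v (pos_part v) n + conv v (neg_part v) n"
        using conv_add[OF l2_pos_part[OF lv(1)] l2_neg_part[OF lv(1)]] pos_neg_part[of v] by metis
      moreover have "of_int n * v n = conv v v n + of_real c * v n + of_real C * unit_vec 0 n"
        using tw[of n] True by (simp add: abs_dd_def)
      ultimately show ?thesis
        unfolding e x0 x1 using True by (simp add: pos_part_def[of v])
    next
      case False
      then show ?thesis
        unfolding e x0 x1 by (simp add: lax_def hank_def pos_part_def unit_vec_def)
    qed
  qed
  then show ?case
    using h h1_unit_vec by (simp add: x0 x1)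
next
  case (Suc j)
  then have hj: "h1 (xs j)" "h1 (xs (Suc j))"
    and eq: "xs (Suc (Suc j)) = (\<lambda>n. - hank v (xs j) n + of_real c * xs (Suc j) n - of_real C * xs j n)"
    by auto
  have eq': "xs (Suc (Suc j)) = (\<lambda>n. (-1) * hank v (xs j) n + of_real c * xs (Suc j) n + (- of_real C) * xs j n)"
    unfolding eq by simp
  have hS: "h1 (xs (Suc (Suc j)))"
    unfolding eq' by (intro h1_add h1_scale hank_h1 hj)
  have l: "l2 (hank v (xs j))" "l2 (xs (Suc j))" "l2 (xs j)"
    using hj hank_h1[OF hj(1)] by (auto simp: h1_def)
  have "xs (Suc (Suc (Suc j))) = lax v (xs (Suc (Suc j)))"
    by (simp add: xs_Suc)
  also have "\<dots> = (\<lambda>n. (-1) * lax v (hank v (xs j)) n + of_real c * lax v (xs (Suc j)) n + (- of_real C) * lax v (xs j) n)"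
    unfolding eq'
    by (subst lax_add, (intro l2_add(1) l2_scale l)+, subst lax_add, (intro l2_scale l)+)
      (simp only: lax_scale)
  also have "\<dots> = (\<lambda>n. - hank v (xs (Suc j)) n + of_real c * xs (Suc (Suc j)) n - of_real C * xs (Suc j) n)"
    unfolding hank_commute[OF hj(1)] xs_Suc by simp
  finally show ?case
    using hj hS by simp
qed

text \<open>The vector p(L) 1; polynomials parametrise the cyclic space.\<close>

private definition ev :: "complex poly \<Rightarrow> int \<Rightarrow> complex" where
  "ev p n = (\<Sum>i\<le>degree p. coeff p i * xs i n)"

private lemma ev_bound: "degree p \<le> N \<Longrightarrow> ev p n = (\<Sum>i\<le>N. coeff p i * xs i n)"
  unfolding ev_def by (rule sum.mono_neutral_left) (auto simp: coeff_eq_0)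

private lemma ev_add: "ev (p + q) n = ev p n + ev q n"
proof -
  define N where "N = max (degree p) (degree q)"
  have "degree (p + q) \<le> N" "degree p \<le> N" "degree q \<le> N"
    by (auto simp: N_def degree_add_le)
  then show ?thesis
    by (simp add: ev_bound ring_distribs sum.distrib)
qed

private lemma ev_smult: "ev (smult a p) n = a * ev p n"
  using ev_bound[OF degree_smult_le[of a p], of n] by (simp add: ev_def sum_distrib_left mult.assoc)

private lemma ev_0: "ev 0 n = 0"
  by (simp add: ev_def)

private lemma ev_1: "ev 1 = unit_vec 0"
  by (simp add: ev_def xs_def fun_eq_iff)

private lemma xs_l2: "l2 (xs i)"
  using xs_facts[of i] by (simp add: h1_def)

private lemma ev_h1: "h1 (ev p)"
proof -
  have "h1 (\<lambda>n. \<Sum>i\<in>I. coeff p i * xs i n)" for I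
  proof (induction I rule: infinite_finite_induct)
    case (insert i I)
    then show ?case using xs_facts[of i] by (auto intro!: h1_add h1_scale)
  qed (use h1_scale[OF h1_unit_vec, of 0] in auto)
  then show ?thesis by (simp add: ev_def[abs_def])
qed

private lemma ev_l2: "l2 (ev p)"
  using ev_h1[of p] by (simp add: h1_def)

private lemma ev_lax: "lax v (ev p) = ev (pCons 0 p)"
proof -
  have "lax v (ev p) = (\<lambda>n. \<Sum>i\<le>degree p. coeff p i * xs (Suc i) n)"
    unfolding ev_def[abs_def] using lax_sum[of "{..degree p}" "\<lambda>i n. coeff p i * xs i n"]
    by (simp add: l2_scale xs_l2 lax_scale xs_Suc)
  also have "\<dots> = ev (pCons 0 p)"
  proof
    fix n
    have "ev (pCons 0 p) n = (\<Sum>i\<le>Suc (degree p). coeff (pCons 0 p) i * xs i n)"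
      by (rule ev_bound) (simp add: degree_pCons_le)
    then show "(\<Sum>i\<le>degree p. coeff p i * xs (Suc i) n) = ev (pCons 0 p) n"
      by (simp only: sum.atMost_Suc_shift coeff_pCons_Suc coeff_pCons_0) simp
  qed
  finally show ?thesis .
qed

private lemma ev_linear_factor: "ev ([:- z, 1:] * p) n = lax v (ev p) n - z * ev p n"
proof -
  have e: "[:- z, 1:] * p = pCons 0 p + smult (- z) p"
    by simp
  show ?thesis
    unfolding e ev_lax ev_add ev_smult by simp
qed

private lemma ev_hank:
  "hank v (ev p) n = - lax v (lax v (ev p)) n + of_real c * lax v (ev p) n - of_real C * ev p n"
proof -
  have xh: "hank v (xs i) n = - xs (Suc (Suc i)) n + of_real c * xs (Suc i) n - of_real C * xs i n" for i
    using xs_facts[of i] by (simp add: fun_eq_iff)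
  have L: "lax v (\<lambda>n. \<Sum>i\<in>I. coeff p i * xs (f i) n) = (\<lambda>n. \<Sum>i\<in>I. coeff p i * xs (Suc (f i)) n)" for I and f :: "nat \<Rightarrow> nat"
    by (subst lax_sum) (auto simp: lax_scale xs_Suc intro!: l2_scale xs_l2)
  have "hank v (ev p) n = (\<Sum>i\<le>degree p. coeff p i * hank v (xs i) n)"
    unfolding ev_def[abs_def] by (subst hank_sum) (auto simp: hank_scale intro!: l2_scale xs_l2)
  also have "\<dots> = - (\<Sum>i\<le>degree p. coeff p i * xs (Suc (Suc i)) n)
      + of_real c * (\<Sum>i\<le>degree p. coeff p i * xs (Suc i) n) - of_real C * (\<Sum>i\<le>degree p. coeff p i * xs i n)"
    unfolding xh by (simp add: sum_distrib_left sum.distrib sum_subtractf sum_negf algebra_simps)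
  finally show ?thesis
    unfolding ev_def[abs_def] L[of "\<lambda>i. i"] L .
qed

text \<open>Positivity of the Hankel part bounds \<open>L\<^sup>2 \<le> c L - C\<close> on the cyclic space of \<open>1\<close>, so \<open>D\<close> is bounded
  there and the space is finite-dimensional.\<close>

private lemma cyclic_bound:
  obtains B where "\<And>p. nrm (dd (ev p)) \<le> B * nrm (ev p)"
proof (rule that)
  fix p
  define y where "y = ev p"
  have y: "h1 y" "l2 y" "hardy y" and ly: "l2 (lax v y)" and hl: "h1 (lax v y)"
    using ev_h1[of p] ev_h1[of "pCons 0 p"] by (auto simp: y_def h1_def ev_lax)
  define a b where "a = nrm (lax v y)" and "b = nrm y"
  have ab: "a \<ge> 0" "b \<ge> 0" by (auto simp: a_def b_def)
  have ll: "l2 (lax v (lax v y))" by (rule lax_l2[OF hl])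
  have "lax v (lax v y) = (\<lambda>n. - hank v y n + of_real c * lax v y n - of_real C * y n)"
    unfolding y_def using ev_hank[of p] by (auto simp: fun_eq_iff algebra_simps)
  then have "ip (lax v (lax v y)) y = - ip (hank v y) y + of_real c * ip (lax v y) y - of_real C * ip y y"
    by (simp add: ip_linear l2_uminus l2_scale l2_add l2_diff hank_l2 y ly)
  moreover have "ip (lax v (lax v y)) y = of_real (a\<^sup>2)"
    using lax_sym[OF hl y(1)] ip_self[OF ly] by (simp add: a_def)
  moreover have "ip (hank v y) y = of_real ((nrm (neg_part (conv v y)))\<^sup>2)"
    using ip_hank[OF y(3,2,2)] ip_self[OF l2_neg_part[OF conv_l2[OF y(2)]]] by simp
  moreover have "ip y y = of_real (b\<^sup>2)"
    by (simp add: ip_self[OF y(2)] b_def)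
  \<comment> \<open>The wave identity paired with \<open>y\<close>: the Hankel term is a nonnegative
    number and may be dropped from the estimate of \<open>a\<close>.\<close>
  ultimately have "of_real (a\<^sup>2 + (nrm (neg_part (conv v y)))\<^sup>2 + C * b\<^sup>2) = of_real c * ip (lax v y) y"
    by simp
  then have "\<bar>a\<^sup>2 + (nrm (neg_part (conv v y)))\<^sup>2 + C * b\<^sup>2\<bar> = \<bar>c\<bar> * norm (ip (lax v y) y)"
    by (metis norm_mult norm_of_real)
  also have "\<dots> \<le> \<bar>c\<bar> * (a * b)"
    using norm_ip_le[OF ly y(2)] by (intro mult_left_mono) (auto simp: a_def b_def)
  finally have *: "a\<^sup>2 \<le> \<bar>c\<bar> * (a * b) + \<bar>C\<bar> * b\<^sup>2"
    using abs_le_iff[of "C * b\<^sup>2" "\<bar>C\<bar> * b\<^sup>2"] by (auto simp: abs_mult)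
      (smt (verit) zero_le_power2 abs_ge_self abs_ge_minus_self mult_right_mono minus_mult_left)
  \<comment> \<open>A quadratic inequality for a in terms of b. If the claim failed, then b < a, and
    dividing by a gives the contradiction.\<close>
  have "a \<le> (\<bar>c\<bar> + \<bar>C\<bar> + 1) * b"
  proof (rule ccontr)
    assume neg: "\<not> a \<le> (\<bar>c\<bar> + \<bar>C\<bar> + 1) * b"
    have "b \<le> (\<bar>c\<bar> + \<bar>C\<bar> + 1) * b"
      using ab by (simp add: mult_le_cancel_right1)
    then have ba: "b < a" using neg by simp
    have "b * b \<le> a * b"
      using ba ab by (intro mult_right_mono) auto
    then have "\<bar>C\<bar> * b\<^sup>2 \<le> \<bar>C\<bar> * (a * b)"
      by (intro mult_left_mono) (auto simp: power2_eq_square)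
    then have "a * a \<le> (\<bar>c\<bar> + \<bar>C\<bar>) * b * a"
      using * by (simp add: power2_eq_square algebra_simps)
    then have "a \<le> (\<bar>c\<bar> + \<bar>C\<bar>) * b"
      using ba ab by simp
    then show False
      using neg ab by (simp add: algebra_simps)
  qed
  moreover have "nrm (dd y) \<le> a + (\<Sum>\<^sub>\<infinity>n. norm (v n)) * b"
  proof -
    have "dd y = (\<lambda>n. lax v y n + pos_part (conv v y) n)"
      using lax_eq[OF y(3)] by (auto simp: fun_eq_iff)
    then have "nrm (dd y) \<le> a + nrm (pos_part (conv v y))"
      using nrm_triangle[OF ly l2_pos_part[OF conv_l2[OF y(2)]]] by (simp add: a_def)
    moreover have "nrm (pos_part (conv v y)) \<le> nrm (conv v y)"
      by (rule l2_mono(2)[OF conv_l2[OF y(2)]]) (simp add: pos_part_def)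
    ultimately show ?thesis
      using nrm_conv_le[OF v_l1 y(2)] by (simp add: b_def)
  qed
  ultimately show "nrm (dd (ev p)) \<le> (\<bar>c\<bar> + \<bar>C\<bar> + 1 + (\<Sum>\<^sub>\<infinity>n. norm (v n))) * nrm (ev p)"
    unfolding y_def[symmetric] b_def[symmetric] by (simp add: algebra_simps)
qed

text \<open>For N above the bound B of D on the cyclic space, the N + 1 vectors L^j 1 have a
  nontrivial combination that vanishes at the indices below N. There D is at least N in norm, so the
  combination is 0.\<close>

private lemma annihilating_polynomial:
  obtains Q where "Q \<noteq> 0" "ev Q = (\<lambda>n. 0)"
proof -
  obtain B where B: "\<And>p. nrm (dd (ev p)) \<le> B * nrm (ev p)"
    by (rule cyclic_bound) blast
  obtain N :: nat where N: "B < real N"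
    using reals_Archimedean2 by blast
  obtain a where a: "\<exists>j\<in>{..N}. a j \<noteq> 0" "\<forall>i<N. (\<Sum>j\<in>{..N}. a j * xs j (int i)) = 0"
    using homogeneous_system_solvable[of "{..N}" N "\<lambda>i j. xs j (int i)"] by auto
  define Q where "Q = (\<Sum>j\<le>N. monom (a j) j)"
  have co: "coeff Q j = (if j \<le> N then a j else 0)" for j
    by (simp add: Q_def coeff_sum)
  have "Q \<noteq> 0"
    using a(1) co by (metis atMost_iff coeff_0)
  moreover have "ev Q = (\<lambda>n. 0)"
  proof -
    have deg: "degree Q \<le> N"
      by (rule degree_le) (simp add: co)
    have z: "ev Q n = 0" if "n < int N" for n
    proof (cases "n < 0")
      case True
      then show ?thesis using ev_h1[of Q] by (simp add: h1_def hardy_def)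
    next
      case False
      then show ?thesis
        using a(2) that unfolding ev_bound[OF deg] by (auto simp: co dest: spec[of _ "nat n"])
    qed
    have "real N * nrm (ev Q) = nrm (\<lambda>n. complex_of_real (real N) * ev Q n)"
      by (simp add: nrm_scale)
    also have "\<dots> \<le> nrm (dd (ev Q))"
    proof (rule l2_mono(2))
      show "l2 (dd (ev Q))" using ev_h1[of Q] by (simp add: h1_def)
      show "norm (complex_of_real (real N) * ev Q n) \<le> norm (dd (ev Q) n)" for n
        using z[of n] by (cases "n < int N") (auto simp: dd_def norm_mult intro!: mult_right_mono)
    qed
    also have "\<dots> \<le> B * nrm (ev Q)" by (rule B)
    finally have "nrm (ev Q) = 0"
      using N nrm_nonneg[of "ev Q"] by (metis less_eq_real_def mult_less_cancel_right_disj not_le)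
    then show ?thesis
      using nrm_eq_0[OF ev_l2] by auto
  qed
  ultimately show thesis by (rule that)
qed

text \<open>Eigenvalues are complex at this stage because they arise as roots of a complex
  polynomial; \<open>eig_real\<close> makes them real when the vector is nonzero.\<close>

private definition eig :: "complex \<Rightarrow> (int \<Rightarrow> complex) \<Rightarrow> bool" where
  "eig l y \<longleftrightarrow> (\<exists>p. y = ev p) \<and> lax v y = (\<lambda>n. l * y n)"

private lemma ev_sum: "\<exists>q. (\<lambda>n. \<Sum>i\<in>I. a i * ev (p i) n) = ev q"
proof (induction I rule: infinite_finite_induct)
  case (insert i I)
  then obtain q where "(\<lambda>n. \<Sum>i\<in>I. a i * ev (p i) n) = ev q" by blast
  then have "(\<lambda>n. \<Sum>i\<in>insert i I. a i * ev (p i) n) = ev (smult (a i) (p i) + q)"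
    using insert by (auto simp: ev_add ev_smult fun_eq_iff)
  then show ?case by blast
qed (use ev_0 in \<open>auto simp: fun_eq_iff intro!: exI[of _ 0]\<close>)

private lemma eig_real: "eig z y \<Longrightarrow> y \<noteq> (\<lambda>n. 0) \<Longrightarrow> z = of_real (Re z)"
proof -
  assume y: "eig z y" "y \<noteq> (\<lambda>n. 0)"
  have h: "h1 y" and l: "l2 y" using y ev_h1 ev_l2 by (auto simp: eig_def)
  have "z * ip y y = cnj z * ip y y"
    using lax_sym[OF h h] y by (simp add: eig_def ip_scale_left ip_scale_right)
  moreover have "ip y y \<noteq> 0"
    using l2_nonzero_nrm[OF l y(2)] by (simp add: ip_self[OF l])
  ultimately have "z = cnj z"
    by simp
  then show ?thesis
    by (simp add: complex_eq_iff)
qed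

text \<open>Induction on the degree of the annihilator: for a root z, the vector (L - z) p(L) 1 is
  decomposed by the induction hypothesis, and its components for eigenvalues other than z are
  divided by l - z and removed. Symmetry of L excludes a Jordan block, so the rest is an eigenvector
  for z.\<close>

private lemma eigen_decomposition:
  assumes "Q \<noteq> 0" "ev (Q * p) = (\<lambda>n. 0)"
  shows "\<exists>\<Lambda> f. finite \<Lambda> \<and> (\<forall>l\<in>\<Lambda>. eig (of_real l) (f l)) \<and> ev p = (\<lambda>n. \<Sum>l\<in>\<Lambda>. f l n)"
  using assms
proof (induction "degree Q" arbitrary: Q p)
  case 0
  then obtain a where a: "Q = [:a:]" "a \<noteq> 0"
    by (metis degree_eq_zeroE pCons_0_0)
  have "a * ev p n = 0" for n
    using 0(3) by (simp add: a ev_smult fun_eq_iff)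
  then have "ev p = (\<lambda>n. 0)"
    using a(2) by auto
  then show ?case
    by (intro exI[of _ "{}"]) auto
next
  case (Suc d)
  have "\<not> constant (poly Q)"
    using Suc(2) constant_degree[of Q] by simp
  then obtain z where "poly Q z = 0"
    using fundamental_theorem_of_algebra by blast
  then obtain Q1 where Q1: "Q = [:- z, 1:] * Q1"
    by (metis poly_eq_0_iff_dvd dvdE)
  have nz: "Q1 \<noteq> 0" using Suc(3) Q1 by auto
  have "degree Q = Suc (degree Q1)"
    unfolding Q1 using nz by (subst degree_mult_eq) auto
  then have "d = degree Q1" using Suc(2) by simp
  moreover have "ev (Q1 * ([:- z, 1:] * p)) = (\<lambda>n. 0)"
    using Suc(4) unfolding Q1 by (metis mult.assoc mult.commute)
  ultimately obtain \<Lambda> f where \<Lambda>: "finite \<Lambda>" "\<And>l. l \<in> \<Lambda> \<Longrightarrow> eig (of_real l) (f l)"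
    and sum: "ev ([:- z, 1:] * p) = (\<lambda>n. \<Sum>l\<in>\<Lambda>. f l n)"
    using Suc(1)[of Q1] nz by blast
  define \<Lambda>' where "\<Lambda>' = {l \<in> \<Lambda>. of_real l \<noteq> z}"
  have fin: "finite \<Lambda>'" using \<Lambda>(1) by (simp add: \<Lambda>'_def)
  define a where "a l = 1 / (of_real l - z)" for l :: real
  define F where "F = (\<lambda>n. \<Sum>l\<in>\<Lambda>'. a l * f l n)"
  define x' where "x' = (\<lambda>n. ev p n - F n)"
  have fl: "l2 (f l)" "h1 (f l)" "lax v (f l) = (\<lambda>n. of_real l * f l n)" if "l \<in> \<Lambda>" for l
    using \<Lambda>(2)[OF that] ev_h1 ev_l2 by (auto simp: eig_def)
  obtain pp where pp: "\<And>l. l \<in> \<Lambda> \<Longrightarrow> f l = ev (pp l)"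
    using \<Lambda>(2) unfolding eig_def by metis
  have "F = (\<lambda>n. \<Sum>l\<in>\<Lambda>'. a l * ev (pp l) n)"
    unfolding F_def using pp by (auto simp: \<Lambda>'_def)
  then obtain q where q: "F = ev q"
    using ev_sum[where I = \<Lambda>' and a = a and p = pp] by auto
  have x'_ev: "x' = ev (p + smult (-1) q)"
    by (simp add: x'_def q ev_add ev_smult fun_eq_iff del: smult_minus_left)
  have x': "h1 x'" "l2 x'"
    using ev_h1 ev_l2 by (simp_all add: x'_ev)
  have lF: "lax v F = (\<lambda>n. \<Sum>l\<in>\<Lambda>'. a l * (of_real l * f l n))"
    unfolding F_def by (subst lax_sum) (auto simp: \<Lambda>'_def lax_scale fl intro!: l2_scale)
  have FF: "lax v F n - z * F n = (\<Sum>l\<in>\<Lambda>'. f l n)" for n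
  proof -
    have "lax v F n - z * F n = (\<Sum>l\<in>\<Lambda>'. a l * (of_real l * f l n) - z * (a l * f l n))"
      unfolding lF by (simp add: F_def sum_subtractf sum_distrib_left)
    also have "\<dots> = (\<Sum>l\<in>\<Lambda>'. f l n)"
    proof (rule sum.cong)
      fix l assume "l \<in> \<Lambda>'"
      then have "a l * (of_real l - z) = 1"
        by (simp add: a_def \<Lambda>'_def)
      then have "a l * (of_real l - z) * f l n = f l n" by simp
      then show "a l * (of_real l * f l n) - z * (a l * f l n) = f l n"
        by (simp add: algebra_simps)
    qed simp
    finally show ?thesis .
  qed
  define r where "r = (\<lambda>n. \<Sum>l\<in>\<Lambda> - \<Lambda>'. f l n)"
  have lx': "lax v x' n - z * x' n = r n" for n
  proof -
    have "x' = (\<lambda>n. ev p n + (-1) * F n)" by (simp add: x'_def)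
    then have "lax v x' = (\<lambda>n. lax v (ev p) n + (-1) * lax v F n)"
      using lax_add[OF ev_l2, of "\<lambda>n. -1 * F n" p] l2_scale[OF ev_l2, of "-1" q] lax_scale[of "-1" F]
      by (simp add: q)
    then have "lax v x' n - z * x' n = (lax v (ev p) n - z * ev p n) - (lax v F n - z * F n)"
      by (simp add: x'_def algebra_simps)
    also have "\<dots> = (\<Sum>l\<in>\<Lambda>. f l n) - (\<Sum>l\<in>\<Lambda>'. f l n)"
      using sum ev_linear_factor[of z p n] FF[of n] by simp
    also have "\<dots> = r n"
      unfolding r_def using \<Lambda>(1) by (subst sum_diff) (auto simp: \<Lambda>'_def)
    finally show ?thesis .
  qed
  \<comment> \<open>A nonzero \<open>r\<close> would lie both in the kernel and in the range of L -
    z with z real, hence be orthogonal to itself.\<close>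
  have "r = (\<lambda>n. 0)"
  proof (cases "\<exists>l\<in>\<Lambda>. of_real l = z")
    case True
    then obtain l where l: "l \<in> \<Lambda>" "of_real l = z" by blast
    then have "\<Lambda> - \<Lambda>' = {l}"
      by (auto simp: \<Lambda>'_def)
    then have r: "r = f l" by (simp add: r_def)
    have "ip r r = ip (\<lambda>n. lax v x' n - z * x' n) r"
      using lx' by (simp add: fun_eq_iff)
    also have "\<dots> = ip x' (lax v r) - z * ip x' r"
      using lax_sym[OF x'(1) fl(2)[OF l(1)]]
      by (simp add: ip_diff_left ip_scale_left l2_scale lax_l2 x' r fl l)
    also have "\<dots> = 0"
      unfolding r fl(3)[OF l(1)] ip_scale_right using l(2) by auto
    finally show ?thesis
      using nrm_eq_0[of r] fl(1)[OF l(1)] by (auto simp: ip_self r)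
  next
    case False
    then have e: "\<Lambda> - \<Lambda>' = {}" by (auto simp: \<Lambda>'_def)
    show ?thesis unfolding r_def e by simp
  qed
  then have "lax v x' = (\<lambda>n. z * x' n)"
    using lx' by (auto simp: fun_eq_iff)
  then have ex': "eig z x'"
    unfolding eig_def using x'_ev by blast
  have pF: "ev p = (\<lambda>n. x' n + F n)"
    by (simp add: x'_def)
  have ef: "eig (of_real l) (\<lambda>n. a l * f l n)" if "l \<in> \<Lambda>'" for l
  proof -
    have "l \<in> \<Lambda>" using that by (simp add: \<Lambda>'_def)
    then have "(\<lambda>n. a l * f l n) = ev (smult (a l) (pp l))"
      using pp by (auto simp: ev_smult)
    moreover have "lax v (\<lambda>n. a l * f l n) = (\<lambda>n. of_real l * (a l * f l n))"
      using fl(3)[OF \<open>l \<in> \<Lambda>\<close>] by (simp add: lax_scale mult.left_commute)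
    ultimately show ?thesis
      unfolding eig_def by blast
  qed
  show ?case
  proof (cases "x' = (\<lambda>n. 0)")
    case True
    then show ?thesis
      using fin ef pF by (intro exI[of _ \<Lambda>'] exI[of _ "\<lambda>l n. a l * f l n"]) (auto simp: F_def)
  next
    case False
    then have z: "z = of_real (Re z)"
      using eig_real[OF ex'] by simp
    then have nin: "Re z \<notin> \<Lambda>'"
      by (auto simp: \<Lambda>'_def)
    define f' where "f' l = (if l = Re z then x' else (\<lambda>n. a l * f l n))" for l
    have "(\<Sum>l\<in>\<Lambda>'. f' l n) = F n" for n
      unfolding F_def using nin by (intro sum.cong) (auto simp: f'_def)
    then have "ev p = (\<lambda>n. \<Sum>l\<in>insert (Re z) \<Lambda>'. f' l n)"
      using fin nin pF by (simp add: f'_def)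
    moreover have "eig (of_real l) (f' l)" if "l \<in> insert (Re z) \<Lambda>'" for l
      using that ex' ef z by (auto simp: f'_def)
    ultimately show ?thesis
      using fin by (intro exI[of _ "insert (Re z) \<Lambda>'"] exI[of _ f']) auto
  qed
qed

text \<open>The backward shift moves the entry of v x at index 0 to index -1, into the negative
  part. The Hankel part therefore commutes with the shift up to this one entry times a shifted
  v.\<close>

private lemma hank_shift:
  assumes "l2 x" "n \<ge> 0"
  shows "hank v (\<lambda>n. x (n + 1)) n = hank v x (n + 1) + conv v x 0 * v (n + 1)"
proof -
  define z where "z = conv v x"
  have z: "l2 z" unfolding z_def by (rule conv_l2[OF assms(1)])
  have "neg_part (conv v (\<lambda>n. x (n + 1))) = (\<lambda>m. neg_part z (m + 1) + z 0 * unit_vec (-1) m)"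
  proof
    fix m :: int
    consider "m < -1" | "m = -1" | "m \<ge> 0" by linarith
    then show "neg_part (conv v (\<lambda>n. x (n + 1))) m = neg_part z (m + 1) + z 0 * unit_vec (-1) m"
      by cases (auto simp: neg_part_def conv_shift z_def unit_vec_def)
  qed
  moreover have "l2 (\<lambda>m. neg_part z (m + 1))"
    using l2_reindex(1)[of "\<lambda>m. m + 1" "neg_part z"] l2_neg_part[OF z] by (simp add: bij_plus_right)
  ultimately have "conv v (neg_part (conv v (\<lambda>n. x (n + 1)))) n
      = conv v (\<lambda>m. neg_part z (m + 1)) n + z 0 * conv v (unit_vec (-1)) n"
    by (simp add: conv_add l2_scale conv_scale_right)
  also have "conv v (\<lambda>m. neg_part z (m + 1)) n = conv v (neg_part z) (n + 1)"
    by (rule conv_shift)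
  also have "conv v (unit_vec (-1)) n = v (n + 1)"
  proof -
    have "conv v (unit_vec (-1)) n = (\<Sum>\<^sub>\<infinity>m\<in>{-1}. v (n - m))"
      unfolding conv_def by (rule infsum_cong_neutral) (auto simp: unit_vec_def)
    then show ?thesis by simp
  qed
  finally show ?thesis
    using assms(2) by (simp add: hank_def pos_part_def z_def)
qed

private lemma eig_eigen: "eig (of_real l) y \<Longrightarrow> eigen v l y"
  unfolding eigen_iff
proof (intro conjI allI impI)
  assume y: "eig (of_real l) y"
  show "hh y" using y ev_h1 h1_hh by (auto simp: eig_def)
  fix n :: int
  assume "n \<ge> 0"
  then show "of_int n * y n - conv v y n = of_real l * y n"
    using y by (auto simp: eig_def lax_def fun_eq_iff dest: spec[of _ n])
qed

text \<open>A zero \<open>\<mu>\<close> of \<open>\<langle>(L - \<mu>)\<^sup>-\<^sup>1 1, 1\<rangle>\<close> gives \<open>h = (L - \<mu>)\<^sup>-\<^sup>1 1\<close> with \<open>h 0 = 0\<close>. Descending from \<open>h\<close> by the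
  backward shift ends at an eigenvector with eigenvalue \<open>\<mu> - d \<in> \<Lambda>\<close>, and the Hankel part acts by the same
  scalar all along, so \<open>- \<mu>\<^sup>2 + c \<mu>\<close> takes equal values at \<open>\<mu>\<close> and \<open>\<mu> - d\<close>.\<close>

private lemma resolvent_zero:
  assumes fin: "finite \<Lambda>" and f: "\<And>l. l \<in> \<Lambda> \<Longrightarrow> eig (of_real l) (f l)" "\<And>l. l \<in> \<Lambda> \<Longrightarrow> f l \<noteq> (\<lambda>n. 0)"
    and sum: "unit_vec 0 = (\<lambda>n. \<Sum>l\<in>\<Lambda>. f l n)" and mu: "mu \<notin> \<Lambda>" "(\<Sum>l\<in>\<Lambda>. f l 0 / of_real (l - mu)) = 0"
    and ne: "\<Lambda> \<noteq> {}"
  shows "\<exists>l\<in>\<Lambda>. l < mu \<and> l + mu = c"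
proof -
  \<comment> \<open>The scalar by which the Hankel part acts on an eigenvector with eigenvalue t in
    the cyclic space.\<close>
  define P where "P t = - t\<^sup>2 + c * t - C" for t :: real
  define a where "a l = complex_of_real (1 / (l - mu))" for l
  define h where "h = (\<lambda>n. \<Sum>l\<in>\<Lambda>. a l * f l n)"
  have fl: "l2 (f l)" "h1 (f l)" "lax v (f l) = (\<lambda>n. of_real l * f l n)" "eigen v l (f l)" if "l \<in> \<Lambda>" for l
    using f(1)[OF that] ev_h1 ev_l2 eig_eigen by (auto simp: eig_def)
  have Kf: "hank v (f l) = (\<lambda>n. of_real (P l) * f l n)" if lL: "l \<in> \<Lambda>" for l
  proof -
    obtain p where p: "f l = ev p" using f(1)[OF lL] by (auto simp: eig_def)
    show ?thesis
      using ev_hank[of p] fl(3)[OF lL] unfolding p[symmetric]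
      by (auto simp: lax_scale P_def power2_eq_square algebra_simps fun_eq_iff)
  qed
  have orth: "ip (f l) (f l') = 0" if "l \<in> \<Lambda>" "l' \<in> \<Lambda>" "l \<noteq> l'" for l l'
    by (rule eigen_orthogonal[OF adm fl(4)[OF that(1)] fl(4)[OF that(2)] that(3)])
  have al: "a l * (of_real l - of_real mu) = 1" if "l \<in> \<Lambda>" for l
    using that mu(1) by (auto simp: a_def simp flip: of_real_diff of_real_mult)
  have hh: "hh h"
    unfolding h_def by (intro hh_sum hh_scale h1_hh fl)
  have lh: "l2 h" by (rule hh_l2[OF hh])
  have h0: "h 0 = 0"
    using mu(2) by (simp add: h_def a_def field_simps)
  have hnz: "h \<noteq> (\<lambda>n. 0)"
  proof
    assume "h = (\<lambda>n. 0)"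
    obtain l where l: "l \<in> \<Lambda>" using ne by auto
    have "0 = ip h (f l)" by (simp add: \<open>h = (\<lambda>n. 0)\<close>)
    also have "\<dots> = (\<Sum>l'\<in>\<Lambda>. a l' * ip (f l') (f l))"
      unfolding h_def by (subst ip_sum_left) (auto intro!: l2_scale fl l simp: ip_scale_left)
    also have "\<dots> = (\<Sum>l'\<in>{l}. a l' * ip (f l') (f l))"
      using fin l orth by (intro sum.mono_neutral_right) auto
    also have "\<dots> = a l * ip (f l) (f l)"
      by simp
    finally show False
      using al[OF l] l2_nonzero_nrm[OF fl(1)[OF l] f(2)[OF l]] by (auto simp: ip_self[OF fl(1)[OF l]])
  qed
  have Lh: "of_int n * h n - conv v h n = of_real mu * h n + unit_vec 0 n" if "n \<ge> 0" for n
  proof -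
    have "lax v h n = (\<Sum>l\<in>\<Lambda>. a l * (of_real l * f l n))"
      unfolding h_def by (subst lax_sum) (auto simp: lax_scale fl intro!: l2_scale)
    also have "\<dots> = (\<Sum>l\<in>\<Lambda>. of_real mu * (a l * f l n) + f l n)"
    proof (rule sum.cong)
      fix l assume "l \<in> \<Lambda>"
      then have "a l * (of_real l - of_real mu) * f l n = f l n" using al by simp
      then show "a l * (of_real l * f l n) = of_real mu * (a l * f l n) + f l n"
        by (simp add: algebra_simps)
    qed simp
    also have "\<dots> = of_real mu * h n + unit_vec 0 n"
      by (subst sum) (simp add: sum.distrib h_def sum_distrib_left)
    finally show ?thesis
      using that by (simp add: lax_def)
  qed
  obtain d where d: "d \<ge> 0" "h d \<noteq> 0" "\<And>n. n < d \<Longrightarrow> h n = 0"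
    using hardy_least[OF hardy_hh[OF hh] hnz] by blast
  have d1: "d \<ge> 1" using d h0 by (cases "d = 0") auto
  have L1: "of_int n * h n - conv v h n = of_real mu * h n" if "n \<ge> 1" for n
    using Lh[of n] that by (simp add: unit_vec_def)
  define F where "F j = (\<lambda>n. h (n + j))" for j :: int
  have Fe: "eigen v (mu - of_int j) (F j)" if "1 \<le> j" "j \<le> d" for j
    unfolding F_def using that by (intro eigen_descend hh L1 d) auto
  have lF: "l2 (F j)" for j
    unfolding F_def using l2_reindex(1)[of "\<lambda>n. n + j" h] lh by (simp add: bij_plus_right)
  \<comment> \<open>The divided difference of \<open>P\<close> at l and \<open>mu\<close> is c - mu
    - l, so (P(L) - P(mu)) (L - mu)^(-1) 1 is (c - mu) 1 - L 1, and - L 1 = Pi v.\<close>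
  have Kh: "hank v h n = of_real (P mu) * h n + pos_part v n + of_real (c - mu) * unit_vec 0 n" for n
  proof -
    have "hank v h n = (\<Sum>l\<in>\<Lambda>. a l * (of_real (P l) * f l n))"
      unfolding h_def by (subst hank_sum) (auto simp: hank_scale Kf fl intro!: l2_scale)
    also have "\<dots> = (\<Sum>l\<in>\<Lambda>. of_real (P mu) * (a l * f l n) + (of_real (c - mu) * f l n - of_real l * f l n))"
    proof (rule sum.cong)
      fix l assume "l \<in> \<Lambda>"
      have Pl: "P l = P mu + (c - mu - l) * (l - mu)"
        by (simp add: P_def power2_eq_square algebra_simps)
      have "a l * of_real (P l) = of_real (P mu) * a l + of_real (c - mu - l) * (a l * (of_real l - of_real mu))"
        unfolding Pl by (simp add: algebra_simps)
      then have "a l * of_real (P l) = of_real (P mu) * a l + of_real (c - mu - l)"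
        using al[OF \<open>l \<in> \<Lambda>\<close>] by simp
      then show "a l * (of_real (P l) * f l n) = of_real (P mu) * (a l * f l n) + (of_real (c - mu) * f l n - of_real l * f l n)"
        by (simp add: mult.assoc[symmetric]) (simp add: algebra_simps)
    qed simp
    also have "\<dots> = of_real (P mu) * h n + (of_real (c - mu) * unit_vec 0 n - lax v (unit_vec 0) n)"
    proof -
      have "lax v (unit_vec 0) n = (\<Sum>l\<in>\<Lambda>. of_real l * f l n)"
        by (subst sum, subst lax_sum) (auto simp: fl)
      moreover have "unit_vec 0 n = (\<Sum>l\<in>\<Lambda>. f l n)"
        by (subst sum) (rule refl)
      ultimately show ?thesis
        by (simp add: sum.distrib sum_subtractf sum_distrib_left h_def)
    qed
    finally show ?thesis
      by (simp add: lax_1)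
  qed
  \<comment> \<open>For j = 1 the product v h has the value -1 at index 0, because \<open>h\<close>
    has mean 0; the rank one term of \<open>hank_shift\<close> then cancels the v in
    \<open>Kh\<close>. For larger j up to d the previous vector has mean 0 and is an eigenvector, so
    the rank one term vanishes.\<close>
  have KF: "hank v (F j) n = of_real (P mu) * F j n" if "1 \<le> j" "j \<le> d" "n \<ge> 0" for j n
    using that
  proof (induction j arbitrary: n rule: int_ge_induct)
    case base
    have "conv v h 0 = - 1"
      using Lh[of 0] h0 by (simp add: unit_vec_def) (metis minus_minus)
    then show ?case
      using hank_shift[OF lh base(2)] Kh[of "n + 1"] base(2)
      by (simp add: F_def pos_part_def unit_vec_def)
  next
    case (step j)
    have FS: "F (j + 1) = (\<lambda>n. F j (n + 1))"
      by (simp add: F_def add.assoc add.commute[of j 1])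
    have "F j 0 = 0"
      using step d(3) by (simp add: F_def)
    then have "conv v (F j) 0 = 0"
      using Fe[of j] step by (auto simp: eigen_iff dest: spec[of _ 0])
    then show ?case
      using hank_shift[OF lF step(4), of j] step by (simp add: FS)
  qed
  define G where "G = F d"
  have G: "eigen v (mu - of_int d) G" and G0: "G 0 \<noteq> 0"
    using Fe[of d] d1 d(2) by (auto simp: G_def F_def)
  have lG: "l2 G" and hG: "hardy G"
    using G by (auto simp: eigen_iff intro: hh_l2 hardy_hh)
  have ipz: "ip G (f l) = 0" if "l \<in> \<Lambda>" "l \<noteq> mu - of_int d" for l
    using eigen_orthogonal[OF adm G fl(4)[OF that(1)]] that(2) by auto
  have G0s: "G 0 = (\<Sum>l\<in>\<Lambda>. ip G (f l))"
  proof -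
    have "ip G (unit_vec 0) = (\<Sum>l\<in>\<Lambda>. ip G (f l))"
      by (subst sum, rule ip_sum_right) (auto intro: fl lG)
    then show ?thesis by simp
  qed
  then obtain l where l: "l \<in> \<Lambda>" "l = mu - of_int d"
    using G0 ipz by (metis sum.neutral)
  \<comment> \<open>Pairing with 1 evaluates the Hankel part on \<open>G\<close> in two ways: as
    \<open>P mu\<close>, and through the decomposition of 1, of which only the component with
    eigenvalue mu - d meets \<open>G\<close>.\<close>
  have "of_real (P mu) * G 0 = ip (hank v G) (unit_vec 0)"
    using KF[of d 0] d1 by (simp add: G_def)
  also have "\<dots> = ip G (hank v (unit_vec 0))"
  proof -
    have hu: "hardy (unit_vec 0)" by (simp add: hardy_def unit_vec_def)
    have "ip (hank v (unit_vec 0)) G = ip (neg_part (conv v (unit_vec 0))) (neg_part (conv v G))"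
      by (rule ip_hank[OF hG l2_unit_vec lG])
    then show ?thesis
      using ip_hank[OF hu lG l2_unit_vec] by (metis ip_cnj)
  qed
  also have "hank v (unit_vec 0) = (\<lambda>n. \<Sum>l\<in>\<Lambda>. of_real (P l) * f l n)"
    by (subst sum, subst hank_sum) (auto simp: Kf fl)
  also have "ip G (\<lambda>n. \<Sum>l\<in>\<Lambda>. of_real (P l) * f l n) = (\<Sum>l\<in>\<Lambda>. of_real (P l) * ip G (f l))"
    by (subst ip_sum_right) (auto intro!: l2_scale fl lG simp: ip_scale_right)
  also have "\<dots> = (\<Sum>l'\<in>\<Lambda>. of_real (P l) * ip G (f l'))"
    using ipz l(2) by (intro sum.cong) auto
  also have "\<dots> = of_real (P l) * G 0"
    by (simp add: G0s sum_distrib_left)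
  finally have "P mu = P l"
    using G0 by simp
  then have "(mu - l) * (c - mu - l) = 0"
    by (simp add: P_def power2_eq_square algebra_simps)
  then have "l + mu = c" "l < mu"
    using l(2) d1 by auto
  then show ?thesis
    using l(1) by blast
qed

text \<open>After clearing denominators the numerator \<open>N\<close> has opposite signs at a and
  b: only the factors b - a and a - b differ in sign, since every other point lies on the same side
  of both.\<close>

private lemma herglotz_zero:
  fixes w :: "real \<Rightarrow> real"
  assumes fin: "finite \<Lambda>" and w: "\<And>l. l \<in> \<Lambda> \<Longrightarrow> w l > 0" and ab: "a \<in> \<Lambda>" "b \<in> \<Lambda>" "a < b"
    and gap: "\<And>l. l \<in> \<Lambda> \<Longrightarrow> l \<le> a \<or> l \<ge> b"
  shows "\<exists>mu. a < mu \<and> mu < b \<and> (\<Sum>l\<in>\<Lambda>. w l / (l - mu)) = 0"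
proof -
  define N where "N t = (\<Sum>l\<in>\<Lambda>. w l * (\<Prod>l'\<in>\<Lambda> - {l}. (l' - t)))" for t
  have cont: "continuous_on A N" for A
    unfolding N_def by (intro continuous_intros)
  have Nl: "N l = w l * (\<Prod>l'\<in>\<Lambda> - {l}. (l' - l))" if "l \<in> \<Lambda>" for l
  proof -
    have "(\<Prod>l'\<in>\<Lambda> - {m}. (l' - l)) = 0" if "m \<in> \<Lambda>" "m \<noteq> l" for m
      using fin that \<open>l \<in> \<Lambda>\<close> by (intro prod_zero) auto
    then have "N l = (\<Sum>m\<in>{l}. w m * (\<Prod>l'\<in>\<Lambda> - {m}. (l' - l)))"
      unfolding N_def using fin that by (intro sum.mono_neutral_right) auto
    then show ?thesis by simp
  qed
  let ?R = "\<Lambda> - {a, b}"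
  have "(\<Prod>l'\<in>\<Lambda> - {a}. (l' - a)) = (b - a) * (\<Prod>l'\<in>?R. (l' - a))"
    using fin ab by (subst prod.remove[of _ b]) (auto intro!: arg_cong2[of _ _ _ _ "(*)"] prod.cong)
  moreover have "(\<Prod>l'\<in>\<Lambda> - {b}. (l' - b)) = (a - b) * (\<Prod>l'\<in>?R. (l' - b))"
    using fin ab by (subst prod.remove[of _ a]) (auto intro!: arg_cong2[of _ _ _ _ "(*)"] prod.cong)
  moreover have "(\<Prod>l'\<in>?R. (l' - a)) * (\<Prod>l'\<in>?R. (l' - b)) > 0"
    unfolding prod.distrib[symmetric]
  proof (rule prod_pos)
    fix l assume "l \<in> ?R"
    then have "l < a \<or> l > b" using gap[of l] by auto
    then show "(l - a) * (l - b) > 0"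
      using ab(3) by (auto intro: mult_pos_pos mult_neg_neg)
  qed
  ultimately have "N a * N b < 0"
  proof -
    assume 1: "(\<Prod>l'\<in>\<Lambda> - {a}. (l' - a)) = (b - a) * (\<Prod>l'\<in>?R. (l' - a))"
      and 2: "(\<Prod>l'\<in>\<Lambda> - {b}. (l' - b)) = (a - b) * (\<Prod>l'\<in>?R. (l' - b))"
      and 3: "(\<Prod>l'\<in>?R. (l' - a)) * (\<Prod>l'\<in>?R. (l' - b)) > 0"
    have "N a * N b = - (w a * w b * ((b - a) * (b - a)) * ((\<Prod>l'\<in>?R. (l' - a)) * (\<Prod>l'\<in>?R. (l' - b))))"
      unfolding Nl[OF ab(1)] Nl[OF ab(2)] 1 2 by (simp add: algebra_simps)
    moreover have "w a * w b * ((b - a) * (b - a)) > 0"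
      using w ab by (intro mult_pos_pos) auto
    ultimately show ?thesis
      using 3 by (simp add: mult_pos_pos)
  qed
  then have "\<exists>mu. a \<le> mu \<and> mu \<le> b \<and> N mu = 0"
  proof (cases "N a < 0")
    case True
    then show ?thesis
      using \<open>N a * N b < 0\<close> IVT'[of N a 0 b, OF _ _ _ cont] ab(3) by (auto simp: mult_less_0_iff)
  next
    case False
    then show ?thesis
      using \<open>N a * N b < 0\<close> IVT2'[of N b 0 a, OF _ _ _ cont] ab(3) by (auto simp: mult_less_0_iff)
  qed
  then obtain mu where mu: "a \<le> mu" "mu \<le> b" "N mu = 0" by blast
  have "mu \<noteq> a" "mu \<noteq> b"
    using mu(3) \<open>N a * N b < 0\<close> by auto
  then have mu': "a < mu" "mu < b" using mu by auto
  then have nin: "mu \<notin> \<Lambda>" using gap by force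
  have "(\<Prod>l\<in>\<Lambda>. (l - mu)) * (\<Sum>l\<in>\<Lambda>. w l / (l - mu)) = N mu"
    unfolding N_def sum_distrib_left
  proof (rule sum.cong)
    fix l assume l: "l \<in> \<Lambda>"
    then have "l - mu \<noteq> 0" using nin by auto
    then show "(\<Prod>l\<in>\<Lambda>. (l - mu)) * (w l / (l - mu)) = w l * (\<Prod>l'\<in>\<Lambda> - {l}. (l' - mu))"
      by (subst prod.remove[OF fin l]) simp
  qed simp
  moreover have "(\<Prod>l\<in>\<Lambda>. (l - mu)) \<noteq> 0"
    using fin nin by auto
  ultimately have "(\<Sum>l\<in>\<Lambda>. w l / (l - mu)) = 0"
    using mu(3) by simp
  then show ?thesis
    using mu' by blast
qed

text \<open>Three eigenvalues a < b < e give zeros m1 in (a, b) and m2 in (b, e) of the resolvent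
  function. Each needs an eigenvalue below it that completes it to the sum c. Below m1 there is only
  a, so c = a + m1, and the partner c - m2 of m2 would be less than a.\<close>

lemma travelling_wave_two_gap: "(\<exists>l. eigen v l (unit_vec 0)) \<or> (\<exists>la lb f. two_gap v la lb f)"
proof -
  obtain Q where "Q \<noteq> 0" "ev Q = (\<lambda>n. 0)"
    by (rule annihilating_polynomial)
  then obtain \<Lambda>0 f where \<Lambda>0: "finite \<Lambda>0" "\<And>l. l \<in> \<Lambda>0 \<Longrightarrow> eig (of_real l) (f l)" "unit_vec 0 = (\<lambda>n. \<Sum>l\<in>\<Lambda>0. f l n)"
    using eigen_decomposition[of Q 1] by (auto simp: ev_1)
  define \<Lambda> where "\<Lambda> = {l \<in> \<Lambda>0. f l \<noteq> (\<lambda>n. 0)}"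
  have fin: "finite \<Lambda>" and f: "\<And>l. l \<in> \<Lambda> \<Longrightarrow> eig (of_real l) (f l)" "\<And>l. l \<in> \<Lambda> \<Longrightarrow> f l \<noteq> (\<lambda>n. 0)"
    using \<Lambda>0 by (auto simp: \<Lambda>_def)
  have sum: "unit_vec 0 = (\<lambda>n. \<Sum>l\<in>\<Lambda>. f l n)"
  proof -
    have "(\<Sum>l\<in>\<Lambda>0. f l n) = (\<Sum>l\<in>\<Lambda>. f l n)" for n
      using \<Lambda>0(1) by (intro sum.mono_neutral_right) (auto simp: \<Lambda>_def)
    then show ?thesis using \<Lambda>0(3) by simp
  qed
  have ne: "\<Lambda> \<noteq> {}"
  proof
    assume "\<Lambda> = {}"
    then have "unit_vec (0 :: int) 0 = (0 :: complex)"
      by (subst sum) simp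
    then show False by (simp add: unit_vec_def)
  qed
  have el: "eigen v l (f l)" "l2 (f l)" if "l \<in> \<Lambda>" for l
    using eig_eigen[OF f(1)[OF that]] by (auto simp: eigen_iff intro: hh_l2)
  define w where "w l = (nrm (f l))\<^sup>2" for l
  have w: "w l > 0" if "l \<in> \<Lambda>" for l
    using l2_nonzero_nrm[OF el(2)[OF that] f(2)[OF that]] by (simp add: w_def)
  have f0: "f l 0 = of_real (w l)" if l: "l \<in> \<Lambda>" for l
  proof -
    have "ip (f l) (unit_vec 0) = (\<Sum>l'\<in>\<Lambda>. ip (f l) (f l'))"
      by (subst sum, rule ip_sum_right) (auto intro: el l)
    then have "f l 0 = (\<Sum>l'\<in>\<Lambda>. ip (f l) (f l'))"
      by simp
    also have "\<dots> = (\<Sum>l'\<in>{l}. ip (f l) (f l'))"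
      using fin l eigen_orthogonal[OF adm el(1)[OF l] el(1)] by (intro sum.mono_neutral_right) auto
    also have "\<dots> = of_real (w l)"
      by (simp add: ip_self[OF el(2)[OF l]] w_def)
    finally show ?thesis .
  qed
  have zero: "\<exists>l\<in>\<Lambda>. l < mu \<and> l + mu = c" if "mu \<notin> \<Lambda>" "(\<Sum>l\<in>\<Lambda>. w l / (l - mu)) = 0" for mu
  proof (rule resolvent_zero[OF fin f sum that(1) _ ne])
    have "(\<Sum>l\<in>\<Lambda>. f l 0 / of_real (l - mu)) = of_real (\<Sum>l\<in>\<Lambda>. w l / (l - mu))"
      using f0 by (simp flip: of_real_diff)
    then show "(\<Sum>l\<in>\<Lambda>. f l 0 / of_real (l - mu)) = 0"
      using that(2) by simp
  qed
  have "card \<Lambda> \<le> 2"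
  proof (rule ccontr)
    assume c3: "\<not> card \<Lambda> \<le> 2"
    define a where "a = Min \<Lambda>"
    have a: "a \<in> \<Lambda>" "\<And>l. l \<in> \<Lambda> \<Longrightarrow> a \<le> l"
      using fin ne by (auto simp: a_def)
    have "card (\<Lambda> - {a}) > 1" using c3 fin a by simp
    then have ne1: "\<Lambda> - {a} \<noteq> {}" by (metis card.empty not_one_less_zero)
    define b where "b = Min (\<Lambda> - {a})"
    have b: "b \<in> \<Lambda>" "b \<noteq> a" "\<And>l. l \<in> \<Lambda> \<Longrightarrow> l \<noteq> a \<Longrightarrow> b \<le> l"
      using Min_in[of "\<Lambda> - {a}"] fin ne1 by (auto simp: b_def)
    have "card (\<Lambda> - {a} - {b}) > 0" using c3 fin a b by simp
    then have ne2: "\<Lambda> - {a} - {b} \<noteq> {}" by (metis card.empty less_irrefl)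
    define e where "e = Min (\<Lambda> - {a} - {b})"
    have e: "e \<in> \<Lambda>" "e \<noteq> a" "e \<noteq> b" "\<And>l. l \<in> \<Lambda> \<Longrightarrow> l \<noteq> a \<Longrightarrow> l \<noteq> b \<Longrightarrow> e \<le> l"
      using Min_in[of "\<Lambda> - {a} - {b}"] fin ne2 by (auto simp: e_def)
    have ab: "a < b" using a(2)[OF b(1)] b(2) by simp
    have be: "b < e" using b(3)[OF e(1,2)] e(3) by simp
    have "\<exists>mu. a < mu \<and> mu < b \<and> (\<Sum>l\<in>\<Lambda>. w l / (l - mu)) = 0"
    proof (rule herglotz_zero[OF fin _ a(1) b(1) ab])
      show "l \<le> a \<or> l \<ge> b" if "l \<in> \<Lambda>" for l
        using b(3)[OF that] by auto
    qed (rule w)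
    then obtain m1 where m1: "a < m1" "m1 < b" "(\<Sum>l\<in>\<Lambda>. w l / (l - m1)) = 0"
      by blast
    have "\<exists>mu. b < mu \<and> mu < e \<and> (\<Sum>l\<in>\<Lambda>. w l / (l - mu)) = 0"
    proof (rule herglotz_zero[OF fin _ b(1) e(1) be])
      show "l \<le> b \<or> l \<ge> e" if "l \<in> \<Lambda>" for l
        using e(4)[OF that] ab by (cases "l = a"; cases "l = b") auto
    qed (rule w)
    then obtain m2 where m2: "b < m2" "m2 < e" "(\<Sum>l\<in>\<Lambda>. w l / (l - m2)) = 0"
      by blast
    have "m1 \<notin> \<Lambda>" "m2 \<notin> \<Lambda>"
      using m1 m2 b(3)[of m1] e(4)[of m2] ab by auto
    then obtain p q where p: "p \<in> \<Lambda>" "p < m1" "p + m1 = c" and q: "q \<in> \<Lambda>" "q < m2" "q + m2 = c"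
      using zero[OF _ m1(3)] zero[OF _ m2(3)] by blast
    have "p = a" using p(2) m1(2) b(3)[OF p(1)] by linarith
    then show False
      using q p m1 m2 a(2)[OF q(1)] by linarith
  qed
  moreover have "card \<Lambda> \<noteq> 0" using fin ne by simp
  ultimately consider "card \<Lambda> = 1" | "card \<Lambda> = 2" by linarith
  then show ?thesis
  proof cases
    case 1
    then obtain l where l: "\<Lambda> = {l}" by (auto simp: card_1_singleton_iff)
    then have "unit_vec 0 = f l" using sum by simp
    then show ?thesis using el[of l] l by auto
  next
    case 2
    then obtain la lb where L: "\<Lambda> = {la, lb}" "la < lb"
      by (auto simp: card_2_iff) (metis insert_commute linorder_neqE_linordered_idom)
    have fb: "f lb = (\<lambda>n. unit_vec 0 n - f la n)"
    proof
      fix n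
      have "unit_vec 0 n = f la n + f lb n"
        using L by (subst sum) simp
      then show "f lb n = unit_vec 0 n - f la n" by simp
    qed
    have "f la \<noteq> unit_vec 0"
      using f(2)[of lb] L(1) fb by auto
    then have "two_gap v la lb (f la)"
      unfolding two_gap_def fb[symmetric] using L el(1)[of la] el(1)[of lb] f(2)[of la] by auto
    then show ?thesis by blast
  qed
qed

end

section \<open>Compactness of orbits and stability of Fourier coefficients\<close>

text \<open>Compactness of a product of closed discs takes the place of a diagonal argument.\<close>

lemma pointwise_convergent_subsequence:
  fixes x :: "nat \<Rightarrow> int \<Rightarrow> complex"
  assumes "\<And>k n. norm (x k n) \<le> B n"
  obtains r a where "strict_mono (r :: nat \<Rightarrow> nat)" "\<And>n. (\<lambda>k. x (r k) n) \<longlonglongrightarrow> a n"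
proof -
  have "compactin (product_topology (\<lambda>_. euclidean) UNIV) (PiE UNIV (\<lambda>n. cball (0 :: complex) (B n)))"
    by (subst compactin_PiE) simp
  then have "compact (PiE UNIV (\<lambda>n. cball (0 :: complex) (B n)))"
    by (simp add: euclidean_product_topology)
  then have "seq_compact (PiE UNIV (\<lambda>n. cball (0 :: complex) (B n)))"
    by (rule compact_imp_seq_compact)
  moreover have "x k \<in> PiE UNIV (\<lambda>n. cball 0 (B n))" for k
    using assms by auto
  ultimately obtain a r where r: "strict_mono (r :: nat \<Rightarrow> nat)" "(x \<circ> r) \<longlonglongrightarrow> a"
    unfolding seq_compact_def by metis
  have "(\<lambda>k. x (r k) n) \<longlonglongrightarrow> a n" for n
  proof -
    have "isCont (\<lambda>f :: int \<Rightarrow> complex. f n) a"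
      using continuous_on_product_coordinates[of n] continuous_on_eq_continuous_at[OF open_UNIV] by blast
    from isCont_tendsto_compose[OF this r(2)] show ?thesis
      by (simp add: o_def)
  qed
  with r(1) show thesis by (rule that)
qed

lemma neg_norm_le_powr:
  assumes "l2 v" "s \<ge> 0" "k \<ge> 1"
  shows "neg_norm s k v \<le> k powr (- s) * nrm v"
proof -
  have "neg_norm s k v \<le> nrm (\<lambda>n. complex_of_real (k powr (- s)) * v n)"
    unfolding neg_norm_def
    by (rule l2_mono(2)[OF l2_scale[OF assms(1)]])
      (use assms in \<open>auto simp: norm_wgt norm_mult intro!: mult_right_mono powr_mono2'\<close>)
  then show ?thesis
    unfolding nrm_scale by simp
qed

lemma neg_norm_pointwise_limit:
  assumes k: "k \<ge> 1" and x: "\<And>j. hs (- s) (x j)" and lim: "\<And>n. (\<lambda>j. x j n) \<longlonglongrightarrow> a n"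
    and bd: "\<forall>\<^sub>F j in sequentially. neg_norm s k (x j) \<le> M"
  shows "hs (- s) a" "neg_norm s k a \<le> M"
proof -
  have "L2_set (\<lambda>n. norm (wgt (- s) k a n)) F \<le> M" if F: "finite F" for F
  proof (rule tendsto_upperbound)
    show "(\<lambda>j. L2_set (\<lambda>n. norm (wgt (- s) k (x j) n)) F) \<longlonglongrightarrow> L2_set (\<lambda>n. norm (wgt (- s) k a n)) F"
      unfolding L2_set_def wgt_def by (intro tendsto_intros lim)
    show "\<forall>\<^sub>F j in sequentially. L2_set (\<lambda>n. norm (wgt (- s) k (x j) n)) F \<le> M"
      using bd
    proof eventually_elim
      case (elim j)
      then show ?case
        using L2_set_le_nrm[OF hs_l2_wgt[OF x k] F, of j] by (simp add: neg_norm_def)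
    qed
  qed simp
  note b = l2_bddI[of "wgt (- s) k a", OF this]
  show "hs (- s) a"
    using b(1) l2_wgt_change(1)[OF k] by (simp add: hs_def)
  show "neg_norm s k a \<le> M"
    using b(2) by (simp add: neg_norm_def)
qed

text \<open>Raising k damps frequencies below k but changes the weight above k by at most 2^s.
  Smallness of \<open>neg_norm s k\<close> is therefore control of the high-frequency tail, and
  finitely many coefficients remain.\<close>

lemma neg_norm_tight_convergence:
  assumes s: "s \<ge> 0" and x: "\<And>j. hs (- s) (x j)" and a: "hs (- s) a"
    and lim: "\<And>n. (\<lambda>j. x j n) \<longlonglongrightarrow> a n"
    and tight: "\<And>\<epsilon>. \<epsilon> > 0 \<Longrightarrow> \<exists>k\<ge>1. \<forall>\<^sub>F j in sequentially. neg_norm s k (x j) \<le> \<epsilon>"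
  shows "(\<lambda>j. neg_norm s 1 (\<lambda>n. x j n - a n)) \<longlonglongrightarrow> 0"
proof (rule LIMSEQ_I)
  fix \<epsilon> :: real
  assume "\<epsilon> > 0"
  \<comment> \<open>The final estimate is \<delta> + 2^s (\<delta> + \<delta>); the denominator has
    2 in place of 1 for a strict inequality.\<close>
  define \<delta> where "\<delta> = \<epsilon> / (2 powr s * 2 + 2)"
  have den: "2 powr s * 2 + 2 > 0" by (simp add: add_pos_pos)
  have "\<delta> > 0" using \<open>\<epsilon> > 0\<close> den by (simp add: \<delta>_def)
  then obtain k where k: "k \<ge> 1" and ev: "\<forall>\<^sub>F j in sequentially. neg_norm s k (x j) \<le> \<delta>"
    using tight by blast
  have ak: "neg_norm s k a \<le> \<delta>"
    by (rule neg_norm_pointwise_limit(2)[OF k x lim ev])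
  define F where "F = {n :: int. \<bar>n\<bar> \<le> \<lceil>k\<rceil>}"
  have finF: "finite F"
    by (rule finite_subset[of _ "{-\<lceil>k\<rceil>..\<lceil>k\<rceil>}"]) (auto simp: F_def)
  have "(\<lambda>j. L2_set (\<lambda>n. norm (x j n - a n)) F) \<longlonglongrightarrow> L2_set (\<lambda>n. norm (a n - a n)) F"
    unfolding L2_set_def by (intro tendsto_intros lim)
  then have "(\<lambda>j. L2_set (\<lambda>n. norm (x j n - a n)) F) \<longlonglongrightarrow> 0"
    by (simp add: L2_set_def)
  then have ev2: "\<forall>\<^sub>F j in sequentially. L2_set (\<lambda>n. norm (x j n - a n)) F < \<delta>"
    using \<open>\<delta> > 0\<close> by (rule order_tendstoD(2))
  have "\<forall>\<^sub>F j in sequentially. norm (neg_norm s 1 (\<lambda>n. x j n - a n) - 0) < \<epsilon>"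
    using ev ev2
  proof eventually_elim
    case (elim j)
    define d where "d = (\<lambda>n. x j n - a n)"
    have d: "hs (- s) d" unfolding d_def by (intro hs_diff x a)
    define d1 d2 where "d1 = (\<lambda>n. if n \<in> F then wgt (- s) 1 d n else 0)"
      and "d2 = (\<lambda>n. if n \<in> F then 0 else wgt (- s) 1 d n)"
    have ld: "l2 (wgt (- s) 1 d)" using d by (simp add: hs_def)
    have l12: "l2 d1" "l2 d2"
      by (auto intro: l2_mono(1)[OF ld] simp: d1_def d2_def)
    have "neg_norm s 1 d = nrm (\<lambda>n. d1 n + d2 n)"
      unfolding neg_norm_def by (rule arg_cong[of _ _ nrm]) (auto simp: d1_def d2_def)
    also have "\<dots> \<le> nrm d1 + nrm d2"
      by (rule nrm_triangle[OF l12])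
    also have "nrm d1 \<le> L2_set (\<lambda>n. norm (d n)) F"
    proof (rule l2_bddI(2))
      fix G :: "int set"
      assume G: "finite G"
      have "(\<Sum>n\<in>G. (norm (d1 n))\<^sup>2) = (\<Sum>n\<in>G \<inter> F. (norm (d1 n))\<^sup>2)"
        using G by (intro sum.mono_neutral_right) (auto simp: d1_def)
      also have "\<dots> \<le> (\<Sum>n\<in>G \<inter> F. (norm (d n))\<^sup>2)"
      proof (intro sum_mono power_mono)
        show "norm (d1 n) \<le> norm (d n)" for n
          using powr_mono2'[of "- s" 1 "real_of_int \<bar>n\<bar> + 1"] s
          by (auto simp: d1_def norm_wgt intro!: mult_left_le_one_le)
      qed auto
      also have "\<dots> \<le> (\<Sum>n\<in>F. (norm (d n))\<^sup>2)"
        using finF by (intro sum_mono2) auto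
      finally show "L2_set (\<lambda>n. norm (d1 n)) G \<le> L2_set (\<lambda>n. norm (d n)) F"
        unfolding L2_set_def by (rule real_sqrt_le_mono)
    qed
    also have "nrm d2 \<le> 2 powr s * neg_norm s k d"
    proof -
      have "nrm d2 \<le> nrm (\<lambda>n. complex_of_real (2 powr s) * wgt (- s) k d n)"
      proof (rule l2_mono(2)[OF l2_scale[OF hs_l2_wgt[OF d k]]])
        fix n :: int
        show "norm (d2 n) \<le> norm (complex_of_real (2 powr s) * wgt (- s) k d n)"
        proof (cases "n \<in> F")
          case False
          then have "real_of_int \<bar>n\<bar> \<ge> k" unfolding F_def by simp linarith
          then have "(real_of_int \<bar>n\<bar> + 1) powr (- s) \<le> ((real_of_int \<bar>n\<bar> + k) / 2) powr (- s)"
            using s k by (intro powr_mono2') auto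
          also have "\<dots> = 2 powr s * (real_of_int \<bar>n\<bar> + k) powr (- s)"
            using k by (simp add: powr_divide powr_minus field_simps)
          finally have "(real_of_int \<bar>n\<bar> + 1) powr (- s) * norm (d n)
              \<le> 2 powr s * (real_of_int \<bar>n\<bar> + k) powr (- s) * norm (d n)"
            by (rule mult_right_mono) simp
          then show ?thesis
            using False by (simp add: d2_def norm_wgt norm_mult mult.assoc)
        qed (simp add: d2_def)
      qed
      then show ?thesis
        unfolding nrm_scale neg_norm_def by simp
    qed
    also have "neg_norm s k d \<le> \<delta> + \<delta>"
    proof -
      have "neg_norm s k d \<le> neg_norm s k (x j) + neg_norm s k a"
        unfolding neg_norm_def d_def wgt_linear by (intro nrm_triangle_diff hs_l2_wgt x a k)
      then show ?thesis using elim(1) ak by linarith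
    qed
    finally have "neg_norm s 1 d \<le> L2_set (\<lambda>n. norm (d n)) F + 2 powr s * (\<delta> + \<delta>)"
      by simp
    also have "\<dots> < \<delta> + 2 powr s * (\<delta> + \<delta>)"
      using elim(2) by (simp add: d_def)
    also have "\<dots> < (2 powr s * 2 + 2) * \<delta>"
      using \<open>\<delta> > 0\<close> by (simp add: algebra_simps)
    also have "\<dots> = \<epsilon>"
      using den by (simp add: \<delta>_def)
    finally show ?case
      by (simp add: d_def)
  qed
  then show "\<exists>N. \<forall>j\<ge>N. norm (neg_norm s 1 (\<lambda>n. x j n - a n) - 0) < \<epsilon>"
    by (simp add: eventually_sequentially)
qed

lemma resolvent_value_limit:
  assumes A: "\<And>j. admissible s (x j)" "admissible s a" and k: "k \<ge> 1"
    and e: "\<And>j. eps s k * neg_norm s k (x j) \<le> 1/2" "eps s k * neg_norm s k a \<le> 1/2"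
    and lim: "(\<lambda>j. neg_norm s 1 (\<lambda>n. x j n - a n)) \<longlonglongrightarrow> 0"
    and \<phi>: "\<And>j. solves (x j) k (\<phi> j) (unit_vec 0)" and y: "solves a k y (unit_vec 0)"
  shows "(\<lambda>j. \<phi> j 0) \<longlonglongrightarrow> y 0"
proof -
  note Dx = admissibleD[OF A(1)] and Da = admissibleD[OF A(2)]
  have "norm (\<phi> j 0 - y 0) \<le> 4 * eps s k * neg_norm s 1 (\<lambda>n. x j n - a n)" for j
  proof -
    have h: "hh (\<phi> j)" "hh y"
      using \<phi>[of j] y by (auto simp: solves_def)
    have "norm (\<phi> j 0 - y 0) \<le> nk k (\<lambda>n. \<phi> j n - y n)"
      using norm_le_nk[OF k hh_diff[OF h], of 0] by simp
    also have "\<dots> \<le> 2 * eps s k * neg_norm s k (\<lambda>n. x j n - a n) * nk k (\<phi> j)"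
      by (rule resolvent_lipschitz[OF k Da(1,2) Dx(3) Da(3) \<phi> y e(2)])
    also have "\<dots> \<le> 2 * eps s k * neg_norm s 1 (\<lambda>n. x j n - a n) * 2"
      using resolvent_bound[OF k Da(1,2) Dx(3) \<phi> e(1), of j]
        neg_norm_antimono[OF hs_diff[OF Dx(3) Da(3)] Da(1) order_refl k, of j]
      by (intro mult_mono mult_nonneg_nonneg) (auto simp: eps_nonneg)
    finally show ?thesis by simp
  qed
  note le = this
  have "(\<lambda>j. 4 * eps s k * neg_norm s 1 (\<lambda>n. x j n - a n)) \<longlonglongrightarrow> 4 * eps s k * 0"
    by (intro tendsto_mult_left lim)
  then have z: "(\<lambda>j. 4 * eps s k * neg_norm s 1 (\<lambda>n. x j n - a n)) \<longlonglongrightarrow> 0"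
    by simp
  show ?thesis
    by (rule LIM_zero_cancel, rule Lim_null_comparison[OF always_eventually[OF allI[OF le]] z])
qed

text \<open>The constant K of the a priori bound does not depend on k. This turns boundedness into
  tightness: at time 0 the norm at parameter k is at most k^(-s) times the L^2 norm of v plus the
  distance to v, and both become small. The same k0 serves all orbits and both potentials in the
  comparison of resolvent values.\<close>

lemma orbit_compact_pos:
  assumes v: "herm v" "l1 v" "l1 (dd v)"
    and tw: "\<And>n. abs_dd v n = conv v v n + of_real c * v n + of_real C * unit_vec 0 n"
    and s: "0 < s" "s < 1/2" and flow: "\<And>k. bo_flow (u k)"
    and conv0: "(\<lambda>k. neg_norm s 1 (\<lambda>n. u k 0 n - v n)) \<longlonglongrightarrow> 0"
  obtains r \<tau> where "strict_mono (r :: nat \<Rightarrow> nat)"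
    "(\<lambda>k. neg_norm s 1 (\<lambda>n. u (r k) (t (r k)) n - exp (\<i> * of_int n * of_real \<tau>) * v n)) \<longlonglongrightarrow> 0"
proof -
  have s0: "s \<ge> 0" using s by simp
  have lv: "l2 v" by (rule l1_imp_l2[OF v(2)])
  have Av: "admissible s v"
    using s v l2_imp_hs(1)[OF lv s0] by (simp add: admissible_def)
  have Au: "admissible s (u k t)" for k t
    using s flow[of k] l2_imp_hs(1)[OF bo_flow_l2[OF flow] s0]
    by (simp add: admissible_def bo_flow_def smooth_potential_def)
  note Dv = admissibleD[OF Av] and Du = admissibleD[OF Au]
  obtain K :: real where K: "K \<ge> 1" and
    KB: "\<And>u k M t. bo_flow u \<Longrightarrow> k \<ge> 1 \<Longrightarrow> K * neg_norm s k (u 0) < M \<Longrightarrow> eps s k * M \<le> 1/2 \<Longrightarrow>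
      neg_norm s k (u t) \<le> K * neg_norm s k (u 0) \<and> eps s k * neg_norm s k (u t) \<le> 1/2"
    by (rule neg_norm_flow_bound[OF s]) blast
  have d0: "neg_norm s k (u j 0) \<le> neg_norm s k v + neg_norm s 1 (\<lambda>n. u j 0 n - v n)" if "k \<ge> 1" for k j
    using neg_norm_diff_le[OF Du(3) Dv(3) that, of j 0]
      neg_norm_antimono[OF hs_diff[OF Du(3) Dv(3)] s0 order_refl that, of j 0] by linarith
  have "Bseq (\<lambda>k. neg_norm s 1 (\<lambda>n. u k 0 n - v n))"
    using conv0 by (intro convergent_imp_Bseq) (auto simp: convergent_def)
  then obtain R0 where R0: "\<And>k. neg_norm s 1 (\<lambda>n. u k 0 n - v n) \<le> R0"
    by (auto simp: Bseq_def)
  define R where "R = neg_norm s 1 v + R0"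
  have R: "neg_norm s k (u j 0) \<le> R" if "k \<ge> 1" for k j
    using d0[OF order_refl, of j] R0[of j] neg_norm_antimono[OF Du(3) s0 order_refl that, of j 0]
    by (simp add: R_def)
  have KR: "K * neg_norm s k (u j 0) \<le> K * R" if "k \<ge> 1" for k j
    using R[OF that] K by (intro mult_left_mono) auto
  \<comment> \<open>The bootstrap requires a threshold strictly above K times the initial norm; K R
    + 1 is one for all orbits and all k.\<close>
  have "((\<lambda>k. eps s k * (K * R + 1)) \<longlongrightarrow> 0 * (K * R + 1)) at_top"
    by (intro tendsto_mult_right eps_tendsto_0 s)
  then have "((\<lambda>k. eps s k * (K * R + 1)) \<longlongrightarrow> 0) at_top"
    by simp
  then have "\<forall>\<^sub>F k in at_top. eps s k * (K * R + 1) < 1/2"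
    by (rule order_tendstoD(2)) simp
  then obtain k0' where k0': "\<And>k. k \<ge> k0' \<Longrightarrow> eps s k * (K * R + 1) < 1/2"
    by (auto simp: eventually_at_top_linorder)
  define k0 where "k0 = max 1 k0'"
  have k0: "k0 \<ge> 1" by (simp add: k0_def)
  have main: "neg_norm s k (u j t) \<le> K * neg_norm s k (u j 0)" "eps s k * neg_norm s k (u j t) \<le> 1/2"
    if "k \<ge> k0" for k j t
  proof -
    have k: "k \<ge> 1" "k \<ge> k0'" using that by (auto simp: k0_def)
    have "K * neg_norm s k (u j 0) < K * R + 1"
      using KR[OF k(1), of j] by linarith
    moreover have "eps s k * (K * R + 1) \<le> 1/2"
      using k0'[OF k(2)] by simp
    ultimately show "neg_norm s k (u j t) \<le> K * neg_norm s k (u j 0)" "eps s k * neg_norm s k (u j t) \<le> 1/2"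
      using KB[OF flow k(1), of j] by blast+
  qed
  define x where "x j = u j (t j)" for j
  have "norm (x j n) \<le> (real_of_int \<bar>n\<bar> + k0) powr s * (K * R)" for j n
  proof -
    have "norm (wgt (- s) k0 (x j) n) \<le> neg_norm s k0 (x j)"
      unfolding neg_norm_def x_def by (rule norm_le_nrm[OF hs_l2_wgt[OF Du(3) k0]])
    also have "\<dots> \<le> K * R"
      unfolding x_def by (rule order_trans[OF main(1)[OF order_refl] KR[OF k0]])
    finally have "(real_of_int \<bar>n\<bar> + k0) powr s * norm (wgt (- s) k0 (x j) n)
        \<le> (real_of_int \<bar>n\<bar> + k0) powr s * (K * R)"
      by (intro mult_left_mono) auto
    moreover have "(real_of_int \<bar>n\<bar> + k0) powr s * norm (wgt (- s) k0 (x j) n) = norm (x j n)"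
      using k0 by (simp add: norm_wgt mult.assoc[symmetric] powr_add[symmetric])
    ultimately show ?thesis by simp
  qed
  note x_le = this
  obtain r a where r: "strict_mono (r :: nat \<Rightarrow> nat)" and lim: "\<And>n. (\<lambda>j. x (r j) n) \<longlonglongrightarrow> a n"
    by (rule pointwise_convergent_subsequence[of x "\<lambda>n. (real_of_int \<bar>n\<bar> + k0) powr s * (K * R)"])
      (use x_le in auto)
  have conv0r: "(\<lambda>j. neg_norm s 1 (\<lambda>n. u (r j) 0 n - v n)) \<longlonglongrightarrow> 0"
    using LIMSEQ_subseq_LIMSEQ[OF conv0 r] by (simp add: o_def)
  have hsx: "hs (- s) (x (r j))" for j
    unfolding x_def by (rule Du(3))
  have tight: "\<exists>k\<ge>1. \<forall>\<^sub>F j in sequentially. neg_norm s k (x (r j)) \<le> \<epsilon>" if "\<epsilon> > 0" for \<epsilon>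
  proof -
    have "((\<lambda>k. K * (k powr (- s) * nrm v)) \<longlongrightarrow> K * (0 * nrm v)) at_top"
      using s by (intro tendsto_intros tendsto_neg_powr filterlim_ident) auto
    then have "((\<lambda>k. K * (k powr (- s) * nrm v)) \<longlongrightarrow> 0) at_top"
      by simp
    then have "\<forall>\<^sub>F k in at_top. K * (k powr (- s) * nrm v) < \<epsilon> / 2"
      by (rule order_tendstoD(2)) (use that in simp)
    then obtain k1 where k1: "\<And>k. k \<ge> k1 \<Longrightarrow> K * (k powr (- s) * nrm v) < \<epsilon> / 2"
      by (auto simp: eventually_at_top_linorder)
    define k where "k = max k0 k1"
    have k: "k \<ge> k0" "k \<ge> 1" "k \<ge> k1" using k0 by (auto simp: k_def)
    have "(\<lambda>j. K * neg_norm s 1 (\<lambda>n. u (r j) 0 n - v n)) \<longlonglongrightarrow> K * 0"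
      by (intro tendsto_intros conv0r)
    then have "(\<lambda>j. K * neg_norm s 1 (\<lambda>n. u (r j) 0 n - v n)) \<longlonglongrightarrow> 0"
      by simp
    then have "\<forall>\<^sub>F j in sequentially. K * neg_norm s 1 (\<lambda>n. u (r j) 0 n - v n) < \<epsilon> / 2"
      by (rule order_tendstoD(2)) (use that in simp)
    then have "\<forall>\<^sub>F j in sequentially. neg_norm s k (x (r j)) \<le> \<epsilon>"
    proof eventually_elim
      case (elim j)
      have "neg_norm s k (x (r j)) \<le> K * neg_norm s k (u (r j) 0)"
        unfolding x_def by (rule main(1)[OF k(1)])
      also have "\<dots> \<le> K * (neg_norm s k v + neg_norm s 1 (\<lambda>n. u (r j) 0 n - v n))"
        using K d0[OF k(2)] by (intro mult_left_mono) auto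
      also have "\<dots> \<le> K * (k powr (- s) * nrm v) + K * neg_norm s 1 (\<lambda>n. u (r j) 0 n - v n)"
        using K mult_left_mono[OF neg_norm_le_powr[OF lv s0 k(2)], of K] by (simp add: distrib_left)
      also have "\<dots> \<le> \<epsilon>"
        using k1[OF k(3)] elim by simp
      finally show ?case .
    qed
    then show ?thesis using k(2) by blast
  qed
  have bd: "\<forall>\<^sub>F j in sequentially. neg_norm s k0 (x (r j)) \<le> K * R"
    unfolding x_def by (intro always_eventually allI order_trans[OF main(1)[OF order_refl] KR[OF k0]])
  have hsa: "hs (- s) a"
    by (rule neg_norm_pointwise_limit(1)[OF k0 hsx lim bd])
  have "herm a"
    unfolding herm_def
  proof
    fix n
    have "(\<lambda>j. cnj (x (r j) n)) \<longlonglongrightarrow> cnj (a n)"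
      by (intro tendsto_intros lim)
    moreover have "cnj (x (r j) n) = x (r j) (- n)" for j
      using Du(4) by (simp add: x_def herm_def)
    ultimately show "a (- n) = cnj (a n)"
      using LIMSEQ_unique[OF lim[of "- n"]] by simp
  qed
  with hsa s have Aa: "admissible s a"
    by (simp add: admissible_def)
  have strong: "(\<lambda>j. neg_norm s 1 (\<lambda>n. x (r j) n - a n)) \<longlonglongrightarrow> 0"
    by (rule neg_norm_tight_convergence[OF s0 hsx hsa lim tight])
  have ea: "eps s k * neg_norm s k a \<le> 1/2" if "k \<ge> k0" for k
  proof (cases "eps s k = 0")
    case False
    then have ep: "eps s k > 0" using eps_nonneg[of s k] by simp
    have k: "k \<ge> 1" using that k0 by simp
    have "neg_norm s k (x (r j)) \<le> 1 / 2 / eps s k" for j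
      using main(2)[OF that, of "r j" "t (r j)"] ep by (simp add: x_def field_simps)
    then have "neg_norm s k a \<le> 1 / 2 / eps s k"
      by (intro neg_norm_pointwise_limit(2)[OF k hsx lim] always_eventually) auto
    then show ?thesis using ep by (simp add: field_simps)
  qed simp
  have "(\<lambda>j. u (r j) 0 n) \<longlonglongrightarrow> v n" for n
  proof -
    have "norm (u (r j) 0 n - v n) \<le> (real_of_int \<bar>n\<bar> + 1) powr s * neg_norm s 1 (\<lambda>n. u (r j) 0 n - v n)" for j
    proof -
      have "norm (wgt (- s) 1 (\<lambda>n. u (r j) 0 n - v n) n) \<le> neg_norm s 1 (\<lambda>n. u (r j) 0 n - v n)"
        unfolding neg_norm_def using hs_diff[OF Du(3) Dv(3)] by (intro norm_le_nrm) (simp add: hs_def)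
      then have "(real_of_int \<bar>n\<bar> + 1) powr s * norm (wgt (- s) 1 (\<lambda>n. u (r j) 0 n - v n) n)
          \<le> (real_of_int \<bar>n\<bar> + 1) powr s * neg_norm s 1 (\<lambda>n. u (r j) 0 n - v n)"
        by (intro mult_left_mono) auto
      moreover have "\<bar>real_of_int n\<bar> + 1 \<noteq> 0"
        by linarith
      ultimately show ?thesis
        by (simp add: norm_wgt mult.assoc[symmetric] powr_add[symmetric])
    qed
    note le = this
    have "(\<lambda>j. (real_of_int \<bar>n\<bar> + 1) powr s * neg_norm s 1 (\<lambda>n. u (r j) 0 n - v n)) \<longlonglongrightarrow> (real_of_int \<bar>n\<bar> + 1) powr s * 0"
      by (intro tendsto_mult_left conv0r)
    then have z: "(\<lambda>j. (real_of_int \<bar>n\<bar> + 1) powr s * neg_norm s 1 (\<lambda>n. u (r j) 0 n - v n)) \<longlonglongrightarrow> 0"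
      by simp
    show ?thesis
      by (rule LIM_zero_cancel, rule Lim_null_comparison[OF always_eventually[OF allI[OF le]] z])
  qed
  note lim0 = this
  have ev: "eps s k * neg_norm s k v \<le> 1/2" if "k \<ge> k0" for k
  proof (cases "eps s k = 0")
    case False
    then have ep: "eps s k > 0" using eps_nonneg[of s k] by simp
    have k: "k \<ge> 1" using that k0 by simp
    have "neg_norm s k (u (r j) 0) \<le> 1 / 2 / eps s k" for j
      using main(2)[OF that, of "r j" 0] ep by (simp add: field_simps)
    then have "neg_norm s k v \<le> 1 / 2 / eps s k"
      by (intro neg_norm_pointwise_limit(2)[OF k Du(3) lim0] always_eventually) auto
    then show ?thesis using ep by (simp add: field_simps)
  qed simp
  \<comment> \<open>Conservation equates the resolvent values of each orbit at time 0 and at the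
    chosen time; both sides converge along the subsequence.\<close>
  have H: "y 0 = z 0" if k: "k \<ge> k0" and y: "solves a k y (unit_vec 0)" and z: "solves v k z (unit_vec 0)" for k y z
  proof -
    have k1: "k \<ge> 1" using k k0 by simp
    have "\<exists>p. solves (u j t) k p (unit_vec 0)" for j t
    proof -
      have "eps s k * neg_norm s k (u j t) < 1"
        using main(2)[OF k, of j t] by simp
      from resolvent_exists[OF k1 Du(1,2,3) this] show ?thesis by blast
    qed
    then obtain p where p: "\<And>j t. solves (u j t) k (p j t) (unit_vec 0)"
      by metis
    define \<phi> \<psi> where "\<phi> j = p (r j) (t (r j))" and "\<psi> j = p (r j) 0" for j
    have \<phi>: "solves (x (r j)) k (\<phi> j) (unit_vec 0)" and psi: "solves (u (r j) 0) k (\<psi> j) (unit_vec 0)" for j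
      unfolding x_def \<phi>_def \<psi>_def by (rule p)+
    have "\<psi> j 0 = \<phi> j 0" for j
      by (rule resolvent_conserved[OF flow k1 s0 s(2) convex_UNIV main(2)[OF k] UNIV_I UNIV_I psi \<phi>[unfolded x_def]])
    moreover have "(\<lambda>j. \<phi> j 0) \<longlonglongrightarrow> y 0"
      by (rule resolvent_value_limit[OF _ Aa k1 _ ea[OF k] strong \<phi> y])
        (use Au main(2)[OF k] in \<open>auto simp: x_def\<close>)
    moreover have "(\<lambda>j. \<psi> j 0) \<longlonglongrightarrow> z 0"
      by (rule resolvent_value_limit[OF Au Av k1 main(2)[OF k] ev[OF k] conv0r psi z])
    ultimately show ?thesis
      using LIMSEQ_unique by simp
  qed
  have "\<exists>\<tau>. \<forall>n. a n = exp (\<i> * of_int n * of_real \<tau>) * v n"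
    using travelling_wave_two_gap[OF v tw]
  proof (elim disjE exE)
    fix l assume l: "eigen v l (unit_vec 0)"
    have "a = v"
      by (rule constant_transfer[where s = s and v = v and l = l and ?k0.0 = k0]) (fact Aa Av k0 ea ev H l)+
    then show ?thesis by (intro exI[of _ 0]) simp
  next
    fix la lb g assume g: "two_gap v la lb g"
    have "\<exists>f. two_gap a la lb f \<and> f 0 = g 0"
    proof (rule two_gap_transfer[where s = s and u = a and v = v and g = g and la = la and lb = lb and ?k0.0 = k0])
    qed ((fact Aa Av k0 ea ev H g)+, blast)
    then obtain f where f: "two_gap a la lb f" "f 0 = g 0"
      by blast
    show ?thesis
    proof (rule two_gap_rigid[OF Aa Av f(1) g f(2)])
      fix \<tau>
      assume "\<And>n. a n = exp (\<i> * of_int n * of_real \<tau>) * v n"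
      then show ?thesis by (intro exI[of _ \<tau>] allI)
    qed
  qed
  then obtain \<tau> where \<tau>: "\<forall>n. a n = exp (\<i> * of_int n * of_real \<tau>) * v n" by (rule exE)
  show thesis
    by (rule that[OF r, of \<tau>]) (rule strong[unfolded x_def \<tau>[rule_format]])
qed

section \<open>Strong convergence in the case s = 0\<close>

lemma dd_cis_l2:
  assumes "l2 v" "l2 (dd v)"
  shows "l2 (wgt (1/4) 1 v)"
proof -
  have "l2 (\<lambda>n. norm (v n) + norm (dd v n))"
    using assms by (intro l2_add(1)) auto
  then show ?thesis
  proof (rule l2_mono(1))
    fix n :: int
    have "(real_of_int \<bar>n\<bar> + 1) powr (1/4) \<le> (real_of_int \<bar>n\<bar> + 1) powr 1"
      by (intro powr_mono) auto
    then have "(real_of_int \<bar>n\<bar> + 1) powr (1/4) * norm (v n) \<le> (real_of_int \<bar>n\<bar> + 1) * norm (v n)"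
      by (intro mult_right_mono) auto
    then show "norm (wgt (1/4) 1 v n) \<le> norm (norm (v n) + norm (dd v n))"
      by (simp add: norm_wgt dd_def norm_mult algebra_simps)
  qed
qed

lemma nrm_diff_power2:
  assumes "l2 y" "l2 b"
  shows "(nrm (\<lambda>n. y n - b n))\<^sup>2 = (nrm y)\<^sup>2 - (nrm b)\<^sup>2 - 2 * Re (ip (\<lambda>n. y n - b n) b)"
proof -
  define d where "d = (\<lambda>n. y n - b n)"
  have d: "l2 d" unfolding d_def by (rule l2_diff(1)[OF assms])
  have "ip y y = ip (\<lambda>n. d n + b n) (\<lambda>n. d n + b n)"
    by (simp add: d_def)
  also have "\<dots> = ip d d + ip d b + (ip b d + ip b b)"
    using d assms by (simp add: ip_add_left ip_add_right l2_add)
  finally have "Re (ip y y) = Re (ip d d) + Re (ip b b) + 2 * Re (ip d b)"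
    using ip_cnj[of d b, symmetric] by simp
  then show ?thesis
    using d assms by (simp add: ip_self d_def flip: of_real_power)
qed

text \<open>The squared distance to the limit is a difference of squared norms minus twice the real
  part of \<open>ip (y - b) b\<close>. The norms do not exceed the limit norm asymptotically, and
  the inner product tends to 0 because \<open>b\<close> belongs to H^(1/4) while convergence is
  known in H^(-1/4).\<close>

lemma orbit_compact_0:
  assumes v: "herm v" "l1 v" "l1 (dd v)"
    and tw: "\<And>n. abs_dd v n = conv v v n + of_real c * v n + of_real C * unit_vec 0 n"
    and flow: "\<And>k. bo_flow (u k)"
    and conv0: "(\<lambda>k. nrm (\<lambda>n. u k 0 n - v n)) \<longlonglongrightarrow> 0"
  obtains r \<tau> where "strict_mono (r :: nat \<Rightarrow> nat)"
    "(\<lambda>k. nrm (\<lambda>n. u (r k) (t (r k)) n - exp (\<i> * of_int n * of_real \<tau>) * v n)) \<longlonglongrightarrow> 0"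
proof -
  have lv: "l2 v" "l2 (dd v)" by (intro l1_imp_l2 v)+
  have lu: "l2 (u k t)" for k t by (rule bo_flow_l2[OF flow])
  have "(\<lambda>k. neg_norm (1/4) 1 (\<lambda>n. u k 0 n - v n)) \<longlonglongrightarrow> 0"
    by (rule Lim_null_comparison[OF always_eventually conv0])
      (use neg_norm_le_nrm[OF l2_diff(1)[OF lu lv(1)], of "1/4" 1] in auto)
  note conv14 = this
  obtain r \<tau> where r: "strict_mono (r :: nat \<Rightarrow> nat)" and
    weak: "(\<lambda>k. neg_norm (1/4) 1 (\<lambda>n. u (r k) (t (r k)) n - exp (\<i> * of_int n * of_real \<tau>) * v n)) \<longlonglongrightarrow> 0"
    by (rule orbit_compact_pos[OF v tw _ _ flow conv14, where t = t]) auto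
  define a where "a = (\<lambda>n. exp (\<i> * of_int n * of_real \<tau>) * v n)"
  have na: "norm (a n) = norm (v n)" for n
    by (simp add: a_def norm_mult)
  have la: "l2 a" "l2 (dd a)"
    using lv l2_cong_norm(1)[of a v] l2_cong_norm(1)[of "dd a" "dd v"] na by (simp_all add: dd_def norm_mult)
  have "herm a"
    using v(1) by (simp add: herm_def a_def exp_cnj)
  define x where "x k = u (r k) (t (r k))" for k
  have lx: "l2 (x k)" for k unfolding x_def by (rule lu)
  have hermx: "herm (x k)" for k
    using flow by (simp add: x_def bo_flow_def smooth_potential_def)
  define b y where "b = pos_part a" and "y k = pos_part (x k)" for k
  have lb: "l2 b" and ly: "l2 (y k)" for k
    unfolding b_def y_def by (intro l2_pos_part la lx)+
  have lby: "l2 (\<lambda>n. y k n - b n)" for k by (rule l2_diff(1)[OF ly lb])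
  define W where "W = nrm (wgt (1/4) 1 a)"
  have lw: "l2 (wgt (1/4) 1 a)" by (rule dd_cis_l2[OF la])
  have ipb: "norm (ip (\<lambda>n. y k n - b n) b) \<le> neg_norm (1/4) 1 (\<lambda>n. x k n - a n) * W" for k
  proof -
    let ?d = "\<lambda>n. x k n - a n"
    have lwd: "l2 (wgt (-(1/4)) 1 ?d)"
      using l2_imp_hs(1)[OF l2_diff(1)[OF lx la(1)], of "1/4"] by (simp add: hs_def)
    have "ip (\<lambda>n. y k n - b n) b = ip (wgt (-(1/4)) 1 ?d) (pos_part (wgt (1/4) 1 a))"
      unfolding ip_def
    proof (rule infsum_cong)
      fix n :: int
      define w1 w2 where "w1 = complex_of_real ((real_of_int \<bar>n\<bar> + 1) powr (-(1/4)))"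
        and "w2 = complex_of_real ((real_of_int \<bar>n\<bar> + 1) powr (1/4))"
      have "w1 * w2 = 1"
        by (simp add: w1_def w2_def powr_add[symmetric] flip: of_real_mult)
      then have "w1 * ?d n * cnj (w2 * a n) = ?d n * cnj (a n)"
        by (simp add: w2_def mult.left_commute mult.assoc)
      moreover have "wgt (-(1/4)) 1 ?d n = w1 * ?d n" "wgt (1/4) 1 a n = w2 * a n"
        by (simp_all add: wgt_def w1_def w2_def)
      ultimately have "wgt (-(1/4)) 1 ?d n * cnj (wgt (1/4) 1 a n) = ?d n * cnj (a n)"
        by (simp only:)
      then show "(y k n - b n) * cnj (b n) = wgt (-(1/4)) 1 ?d n * cnj (pos_part (wgt (1/4) 1 a) n)"
        by (auto simp: y_def b_def pos_part_def)
    qed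
    also have "norm \<dots> \<le> nrm (wgt (-(1/4)) 1 ?d) * nrm (pos_part (wgt (1/4) 1 a))"
      by (intro norm_ip_le lwd l2_pos_part lw)
    also have "\<dots> \<le> neg_norm (1/4) 1 ?d * W"
      unfolding neg_norm_def W_def
      by (intro mult_left_mono l2_mono(2)[OF lw]) (auto simp: pos_part_def)
    finally show ?thesis .
  qed
  have nb: "nrm b = nrm (pos_part v)"
    by (rule l2_cong_norm(2)) (simp add: b_def pos_part_def na)
  have yk: "nrm (y k) \<le> nrm b + nrm (\<lambda>n. u (r k) 0 n - v n)" for k
  proof -
    have "nrm (y k) \<le> nrm (pos_part (u (r k) 0))"
      unfolding y_def x_def by (rule pos_part_nrm_flow[OF flow])
    also have "pos_part (u (r k) 0) = (\<lambda>n. pos_part v n + pos_part (\<lambda>n. u (r k) 0 n - v n) n)"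
      by (auto simp: pos_part_def)
    also have "nrm \<dots> \<le> nrm (pos_part v) + nrm (pos_part (\<lambda>n. u (r k) 0 n - v n))"
      by (intro nrm_triangle l2_pos_part lv l2_diff(1) lu)
    also have "nrm (pos_part (\<lambda>n. u (r k) 0 n - v n)) \<le> nrm (\<lambda>n. u (r k) 0 n - v n)"
      by (rule l2_mono(2)[OF l2_diff(1)[OF lu lv(1)]]) (simp add: pos_part_def)
    finally show ?thesis by (simp add: nb)
  qed
  define g where "g k = (nrm b + nrm (\<lambda>n. u (r k) 0 n - v n))\<^sup>2 - (nrm b)\<^sup>2
      + 2 * (neg_norm (1/4) 1 (\<lambda>n. x k n - a n) * W)" for k
  have bound: "nrm (\<lambda>n. x k n - a n) \<le> sqrt (2 * g k)" for k
  proof -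
    have N0: "neg_norm 0 1 w = nrm w" for w
      using wgt_0[of 1 w] by (simp add: neg_norm_def)
    have hd: "herm (\<lambda>n. x k n - a n)"
      using hermx \<open>herm a\<close> by (simp add: herm_def)
    have "(nrm (\<lambda>n. x k n - a n))\<^sup>2 \<le> 2 * (nrm (pos_part (\<lambda>n. x k n - a n)))\<^sup>2"
      using neg_norm_pos_part(1)[OF l2_imp_hs(1)[OF l2_diff(1)[OF lx la(1)] order_refl] hd order_refl]
      by (simp add: N0)
    also have "pos_part (\<lambda>n. x k n - a n) = (\<lambda>n. y k n - b n)"
      by (auto simp: pos_part_def y_def b_def)
    also have "(nrm (\<lambda>n. y k n - b n))\<^sup>2 \<le> g k"
    proof -
      have "(nrm (y k))\<^sup>2 \<le> (nrm b + nrm (\<lambda>n. u (r k) 0 n - v n))\<^sup>2"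
        using yk by (intro power_mono) auto
      moreover have "- Re (ip (\<lambda>n. y k n - b n) b) \<le> neg_norm (1/4) 1 (\<lambda>n. x k n - a n) * W"
        using ipb[of k] abs_Re_le_cmod[of "ip (\<lambda>n. y k n - b n) b"] by linarith
      ultimately show ?thesis
        unfolding nrm_diff_power2[OF ly lb] g_def by linarith
    qed
    finally show ?thesis
      by (intro real_le_rsqrt) simp
  qed
  have "(\<lambda>k. nrm (\<lambda>n. u (r k) 0 n - v n)) \<longlonglongrightarrow> 0"
    using LIMSEQ_subseq_LIMSEQ[OF conv0 r] by (simp add: o_def)
  then have "(\<lambda>k. sqrt (2 * g k)) \<longlonglongrightarrow> sqrt (2 * ((nrm b + 0)\<^sup>2 - (nrm b)\<^sup>2 + 2 * (0 * W)))"
    unfolding g_def using weak by (intro tendsto_intros) (simp_all add: x_def a_def)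
  then have lim0: "(\<lambda>k. sqrt (2 * g k)) \<longlonglongrightarrow> 0" by simp
  have "(\<lambda>k. nrm (\<lambda>n. x k n - a n)) \<longlonglongrightarrow> 0"
    by (rule Lim_null_comparison[OF always_eventually lim0]) (use bound in auto)
  then show thesis
    using that[OF r, of \<tau>] by (simp add: x_def a_def)
qed

lemma orbit_compact:
  assumes "herm v" "l1 v" "l1 (dd v)"
    and "\<And>n. abs_dd v n = conv v v n + of_real c * v n + of_real C * unit_vec 0 n"
    and s: "0 \<le> s" "s < 1/2" and "\<And>k. bo_flow (u k)"
    and conv0: "(\<lambda>k. neg_norm s 1 (\<lambda>n. u k 0 n - v n)) \<longlonglongrightarrow> 0"
  obtains r \<tau> where "strict_mono (r :: nat \<Rightarrow> nat)"
    "(\<lambda>k. neg_norm s 1 (\<lambda>n. u (r k) (t (r k)) n - exp (\<i> * of_int n * of_real \<tau>) * v n)) \<longlonglongrightarrow> 0"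
proof (cases "s = 0")
  case True
  have N0: "neg_norm 0 1 w = nrm w" for w
    using wgt_0[of 1 w] by (simp add: neg_norm_def)
  show ?thesis
    by (rule orbit_compact_0[OF assms(1-4,7) conv0[unfolded True N0], where t = t])
      (rule that[unfolded True N0])
next
  case False
  then have "0 < s" using s by simp
  then show ?thesis
    by (rule orbit_compact_pos[OF assms(1-4) _ s(2) assms(7) conv0, where t = t]) (rule that)
qed

section \<open>Fourier series of periodic functions\<close>

definition chr :: "int \<Rightarrow> real \<Rightarrow> complex" where
  "chr n x = exp (\<i> * of_int n * of_real x)"

lemma tfun_test_exp: "tfun (test_exp n) = chr n"
  by (simp add: test_exp.rep_eq chr_def fun_eq_iff)

lemma chr_add: "chr n x * chr m x = chr (n + m) x"
  by (simp add: chr_def exp_add[symmetric] algebra_simps)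

lemma chr_0 [simp]: "chr 0 = (\<lambda>_. 1)"
  by (simp add: chr_def fun_eq_iff)

lemma norm_chr [simp]: "norm (chr n x) = 1"
proof -
  have "chr n x = exp (\<i> * of_real (of_int n * x))" by (simp add: chr_def mult.assoc)
  then show ?thesis by (simp only: norm_exp_i_times)
qed

lemma cnj_chr: "cnj (chr n x) = chr (- n) x"
  by (simp add: chr_def exp_cnj)

lemma chr_cis: "chr n x = cis (of_int n * x)"
  by (simp add: chr_def cis_conv_exp mult.assoc)

lemma continuous_chr [continuous_intros]: "continuous_on A (chr n)"
  unfolding chr_def by (intro continuous_intros)

lemma periodic_chr: "periodic (chr n)"
  using test_exp.rep_eq tfun[of "test_exp n"] by (simp add: tfun_test_exp)

lemma integral_chr: "integral {0..2 * pi} (chr n) = (if n = 0 then 2 * pi else 0)"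
proof (cases "n = 0")
  case False
  have "((\<lambda>x. chr n x / (\<i> * of_int n)) has_vector_derivative chr n x) (at x within {0..2 * pi})" for x
    unfolding chr_def
    by (rule has_vector_derivative_real_field) (use False in \<open>auto intro!: derivative_eq_intros\<close>)
  then have "(chr n has_integral (chr n (2 * pi) / (\<i> * of_int n) - chr n 0 / (\<i> * of_int n))) {0..2 * pi}"
    by (intro fundamental_theorem_of_calculus) auto
  moreover have "chr n (2 * pi) = chr n 0"
    using periodic_chr[of n] by (metis add_0 periodic_def)
  ultimately show ?thesis
    using False by (simp add: integral_unique)
qed (simp add: scaleR_conv_of_real)

definition trig_null :: "(real \<Rightarrow> complex) \<Rightarrow> bool" where
  "trig_null f \<longleftrightarrow> continuous_on UNIV f \<and> (\<forall>n. integral {0..2 * pi} (\<lambda>x. f x * chr n x) = 0)"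

lemma integrable_cont: "continuous_on UNIV f \<Longrightarrow> (f :: real \<Rightarrow> complex) integrable_on {a..b}"
  by (intro integrable_continuous_interval) (auto intro: continuous_on_subset)

lemma trig_null_linear:
  assumes "trig_null f" "trig_null g"
  shows "trig_null (\<lambda>x. a * f x + b * g x)"
proof -
  have c: "continuous_on UNIV f" "continuous_on UNIV g" using assms by (auto simp: trig_null_def)
  have "integral {0..2 * pi} (\<lambda>x. (a * f x + b * g x) * chr n x) = 0" for n
  proof -
    have "integral {0..2 * pi} (\<lambda>x. (a * f x + b * g x) * chr n x)
      = integral {0..2 * pi} (\<lambda>x. a * (f x * chr n x) + b * (g x * chr n x))"
      by (simp add: algebra_simps)
    also have "\<dots> = a * integral {0..2 * pi} (\<lambda>x. f x * chr n x) + b * integral {0..2 * pi} (\<lambda>x. g x * chr n x)"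
      by (subst integral_add) (auto intro!: integrable_cont continuous_intros c)
    finally show ?thesis using assms by (simp add: trig_null_def)
  qed
  then show ?thesis
    using c by (auto simp: trig_null_def intro!: continuous_intros)
qed

lemma trig_null_chr:
  assumes "trig_null f"
  shows "trig_null (\<lambda>x. f x * chr n x)"
  using assms by (auto simp: trig_null_def mult.assoc chr_add intro!: continuous_intros)

lemma trig_null_polynomial:
  assumes "real_polynomial_function p" "trig_null f"
  shows "trig_null (\<lambda>x. f x * of_real (p (cis x)))"
  using assms
proof (induction p arbitrary: f rule: real_polynomial_function.induct)
  case (linear h)
  interpret bounded_linear h by fact
  have "h (cis x) = cos x * h 1 + sin x * h \<i>" for x
  proof -
    have "cis x = cos x *\<^sub>R 1 + sin x *\<^sub>R \<i>" by (simp add: complex_eq_iff)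
    then show ?thesis by (simp only: add scaleR real_scaleR_def)
  qed
  note h = this
  have cs: "of_real (cos x) = (chr 1 x + chr (-1) x) / 2" "of_real (sin x) = (chr 1 x - chr (-1) x) / (2 * \<i>)" for x
    by (auto simp: chr_cis complex_eq_iff)
  have "f x * of_real (h (cis x)) = (h 1 / 2 + h \<i> / (2 * \<i>)) * (f x * chr 1 x)
      + (h 1 / 2 - h \<i> / (2 * \<i>)) * (f x * chr (-1) x)" for x
    unfolding h of_real_add of_real_mult cs by (simp add: field_simps)
  then show ?case
    by (simp only:) (intro trig_null_linear trig_null_chr linear.prems)
next
  case (const c)
  then show ?case
    using trig_null_linear[OF const const, of "of_real c" 0] by (simp add: mult.commute)
next
  case (add p q)
  then show ?case
    using trig_null_linear[OF add.IH[OF add.prems], where a = 1 and b = 1] by (simp add: algebra_simps)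
next
  case (mult p q)
  have "trig_null (\<lambda>x. f x * of_real (p (cis x)) * of_real (q (cis x)))"
    by (intro mult)
  then show ?case by (simp add: mult.assoc)
qed

text \<open>Transports a periodic function to the compact circle, where Stone-Weierstrass applies.
  Continuity holds because \<open>cis\<close> on the closed interval is a quotient map onto the
  circle.\<close>

lemma circle_lift:
  assumes f: "continuous_on UNIV f" "periodic (f :: real \<Rightarrow> complex)"
  obtains F where "continuous_on (sphere 0 1) F" "\<forall>x\<in>{0..2 * pi}. F (cis x) = f x"
proof -
  define F where "F z = f (Arg2pi z)" for z
  have F: "F (cis x) = f x" if "x \<in> {0..2 * pi}" for x
  proof (cases "x = 2 * pi")
    case True
    have "cis x = 1" by (simp add: True complex_eq_iff)
    then show ?thesis
      using f(2)[unfolded periodic_def, rule_format, of 0] True Arg2pi_of_real[of 1] by (simp add: F_def)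
  next
    case False
    then have "Arg2pi (cis x) = x"
      using that Arg2pi_unique[of 1 x "cis x"] by (simp add: cis_conv_exp)
    then show ?thesis by (simp add: F_def)
  qed
  have img: "cis ` {0..2 * pi} = sphere 0 1"
  proof (intro equalityI subsetI)
    fix z :: complex assume "z \<in> sphere 0 1"
    then have "z = cis (Arg2pi z)"
      using Arg2pi_eq[of z] by (simp add: cis_conv_exp)
    then show "z \<in> cis ` {0..2 * pi}"
      using Arg2pi_ge_0[of z] Arg2pi_lt_2pi[of z] by (intro image_eqI[of _ _ "Arg2pi z"]) auto
  qed auto
  have "openin (top_of_set (sphere 0 1)) (sphere 0 1 \<inter> F -` U)" if "open U" for U
  proof -
    have "{0..2 * pi} \<inter> cis -` (sphere 0 1 \<inter> F -` U) = {0..2 * pi} \<inter> f -` U"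
      using F by auto
    moreover have "openin (top_of_set {0..2 * pi}) ({0..2 * pi} \<inter> f -` U)"
      using f(1) that by (intro continuous_openin_preimage_gen) (auto intro: continuous_on_subset)
    ultimately have "openin (top_of_set {0..2 * pi}) ({0..2 * pi} \<inter> cis -` (sphere 0 1 \<inter> F -` U))"
      by simp
    moreover have "continuous_on {0..2 * pi} cis"
      unfolding cis_conv_exp by (intro continuous_intros)
    ultimately show ?thesis
      by (subst Abstract_Topology_2.continuous_imp_quotient_map[OF _ img compact_Icc, symmetric]) auto
  qed
  then have "continuous_on (sphere 0 1) F"
    unfolding continuous_openin_preimage_eq by (intro allI impI)
  then show thesis
    by (rule that) (rule ballI, rule F)
qed

lemma periodic_reduce:
  assumes f: "periodic f"
  obtains y where "y \<in> {0..2 * pi}" "f x = f y"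
proof -
  have per: "f (y + 2 * pi * of_int m) = f y" for y m
  proof (induction m rule: int_induct[where k = 0])
    case (step1 i)
    have "y + 2 * pi * of_int (i + 1) = y + 2 * pi * of_int i + 2 * pi" by (simp add: algebra_simps)
    then show ?case using f step1 unfolding periodic_def by metis
  next
    case (step2 i)
    have "y + 2 * pi * of_int i = y + 2 * pi * of_int (i - 1) + 2 * pi" by (simp add: algebra_simps)
    then show ?case using f step2 unfolding periodic_def by metis
  qed simp
  define m where "m = \<lfloor>x / (2 * pi)\<rfloor>"
  have "of_int m \<le> x / (2 * pi)" "x / (2 * pi) < of_int m + 1"
    by (simp_all add: m_def)
  then have "x + 2 * pi * of_int (- m) \<in> {0..2 * pi}"
    by (simp add: field_simps)
  then show thesis by (rule that) (rule per[symmetric])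
qed

text \<open>A polynomial on the circle that is uniformly close to the conjugate of f integrates to 0
  against f, so the integral of |f|^2 is arbitrarily small.\<close>

lemma trig_null_imp_0:
  assumes f: "trig_null f" "periodic f"
  shows "f x = 0"
proof -
  have c: "continuous_on UNIV f" using f by (simp add: trig_null_def)
  obtain F where F: "continuous_on (sphere 0 1) F" "\<forall>x\<in>{0..2 * pi}. F (cis x) = f x"
    by (rule circle_lift[OF c f(2)])
  have "bounded (f ` {0..2 * pi})"
    by (intro compact_imp_bounded compact_continuous_image continuous_on_subset[OF c]) auto
  then obtain B where B: "B > 0" "\<And>x. x \<in> {0..2 * pi} \<Longrightarrow> norm (f x) \<le> B"
    unfolding bounded_pos by auto
  have ci: "continuous_on {0..2 * pi} (\<lambda>x. (norm (f x))\<^sup>2)"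
    by (intro continuous_intros continuous_on_subset[OF c]) auto
  have "norm (integral {0..2 * pi} (\<lambda>x. f x * cnj (f x))) \<le> 0 + e" if "e > 0" for e
  proof -
    define d where "d = e / (B * (2 * pi))"
    have d: "d > 0" using that B by (simp add: d_def)
    obtain g where g: "polynomial_function g" "\<And>z. z \<in> sphere 0 1 \<Longrightarrow> norm (cnj (F z) - g z) < d"
      using Stone_Weierstrass_polynomial_function[of "sphere 0 1" "\<lambda>z. cnj (F z)" d] d F(1)
      by (auto intro!: continuous_intros)
    have gp: "real_polynomial_function (\<lambda>z. Re (g z))" "real_polynomial_function (\<lambda>z. Im (g z))"
      using g(1) bounded_linear_Re bounded_linear_Im by (auto simp: polynomial_function_def o_def)
    have "trig_null (\<lambda>x. 1 * (f x * of_real (Re (g (cis x)))) + \<i> * (f x * of_real (Im (g (cis x)))))"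
      by (intro trig_null_linear trig_null_polynomial gp f)
    also have "(\<lambda>x. 1 * (f x * of_real (Re (g (cis x)))) + \<i> * (f x * of_real (Im (g (cis x))))) = (\<lambda>x. f x * g (cis x))"
      by (auto simp: complex_eq_iff algebra_simps)
    finally have o: "trig_null (\<lambda>x. f x * g (cis x))" .
    then have i0: "integral {0..2 * pi} (\<lambda>x. f x * g (cis x)) = 0" and cg: "continuous_on UNIV (\<lambda>x. f x * g (cis x))"
      by (auto simp: trig_null_def dest: spec[of _ 0])
    have "integral {0..2 * pi} (\<lambda>x. f x * cnj (f x)) = integral {0..2 * pi} (\<lambda>x. f x * cnj (f x) - f x * g (cis x))"
      by (subst integral_diff) (use i0 in \<open>auto intro!: integrable_cont continuous_intros c cg\<close>)
    also have "norm \<dots> \<le> (B * d) * (2 * pi - 0)"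
    proof (rule integral_bound)
      show "continuous_on {0..2 * pi} (\<lambda>x. f x * cnj (f x) - f x * g (cis x))"
        by (rule continuous_on_subset[of UNIV]) (auto intro!: continuous_intros c cg)
      fix x assume x: "x \<in> {0..2 * pi}"
      have "norm (f x * cnj (f x) - f x * g (cis x)) = norm (f x) * norm (cnj (F (cis x)) - g (cis x))"
        using bspec[OF F(2) x] by (simp add: norm_mult[symmetric] algebra_simps)
      also have "\<dots> \<le> B * d"
        using B(2)[OF x] g(2)[of "cis x"] B(1) by (intro mult_mono) auto
      finally show "norm (f x * cnj (f x) - f x * g (cis x)) \<le> B * d" .
    qed simp
    also have "\<dots> = e" using B by (simp add: d_def)
    finally show ?thesis by simp
  qed
  then have "norm (integral {0..2 * pi} (\<lambda>x. f x * cnj (f x))) \<le> 0"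
    by (rule field_le_epsilon)
  then have "integral {0..2 * pi} (\<lambda>x. of_real ((norm (f x))\<^sup>2) :: complex) = 0"
    by (simp add: complex_norm_square del: of_real_power)
  note i0 = this
  have "((\<lambda>x. of_real ((norm (f x))\<^sup>2) :: complex) has_integral of_real (integral {0..2 * pi} (\<lambda>x. (norm (f x))\<^sup>2))) {0..2 * pi}"
    by (intro has_integral_of_real integrable_integral integrable_continuous_interval ci)
  from trans[OF integral_unique[OF this, symmetric] i0]
  have "integral {0..2 * pi} (\<lambda>x. (norm (f x))\<^sup>2) = 0"
    by (simp only: of_real_eq_0_iff)
  then have z: "f y = 0" if "y \<in> {0..2 * pi}" for y
    using integral_eq_0_iff[OF ci] that by simp
  obtain y where "y \<in> {0..2 * pi}" "f x = f y"
    by (rule periodic_reduce[OF f(2)])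
  then show ?thesis using z by simp
qed

section \<open>Absolutely convergent Fourier series and distributions\<close>

definition fser :: "(int \<Rightarrow> complex) \<Rightarrow> real \<Rightarrow> complex" where
  "fser a x = (\<Sum>\<^sub>\<infinity>n. a n * chr n x)"

lemma norm_fser_le:
  assumes "l1 a" shows "norm (fser a x) \<le> (\<Sum>\<^sub>\<infinity>n. norm (a n))"
  using norm_infsum_bound[of "\<lambda>n. a n * chr n x" UNIV] assms by (simp add: fser_def norm_mult l1_def)

lemma fser_uniform_limit:
  assumes "l1 a"
  shows "uniform_limit A (\<lambda>F x. \<Sum>n\<in>F. a n * chr n x) (fser a) (finite_subsets_at_top UNIV)"
  unfolding fser_def
  by (rule Weierstrass_m_test_general[where M = "\<lambda>n. norm (a n)"])
    (use assms in \<open>simp_all add: norm_mult l1_def\<close>)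

lemma continuous_fser:
  assumes "l1 a" shows "continuous_on A (fser a)"
  by (rule uniform_limit_theorem[OF _ fser_uniform_limit[OF assms]])
    (auto intro!: always_eventually continuous_intros)

lemma periodic_fser: "periodic (fser a)"
  using periodic_chr by (simp add: fser_def periodic_def)

lemma integral_fser:
  assumes "l1 a" "continuous_on UNIV g"
  shows "((\<lambda>n. a n * integral {0..2 * pi} (\<lambda>x. g x * chr n x)) has_sum
    integral {0..2 * pi} (\<lambda>x. g x * fser a x)) UNIV"
proof -
  have cg: "continuous_on {0..2 * pi} g" using assms(2) by (rule continuous_on_subset) simp
  have "bounded (g ` {0..2 * pi})"
    by (intro compact_imp_bounded compact_continuous_image cg) auto
  moreover have "bounded (fser a ` {0..2 * pi})"
    by (intro compact_imp_bounded compact_continuous_image continuous_fser assms) auto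
  ultimately have u: "uniform_limit {0..2 * pi} (\<lambda>F x. g x * (\<Sum>n\<in>F. a n * chr n x)) (\<lambda>x. g x * fser a x)
      (finite_subsets_at_top UNIV)"
    by (intro uniform_lim_mult uniform_limit_const fser_uniform_limit assms)
  obtain I J where I: "\<And>F. ((\<lambda>x. g x * (\<Sum>n\<in>F. a n * chr n x)) has_integral I F) {0..2 * pi}"
    "((\<lambda>x. g x * fser a x) has_integral J) {0..2 * pi}" "(I \<longlongrightarrow> J) (finite_subsets_at_top UNIV)"
    by (rule uniform_limit_integral[OF u]) (auto intro!: continuous_intros cg)
  have "I F = (\<Sum>n\<in>F. a n * integral {0..2 * pi} (\<lambda>x. g x * chr n x))" if "finite F" for F
  proof -
    have "I F = integral {0..2 * pi} (\<lambda>x. \<Sum>n\<in>F. a n * (g x * chr n x))"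
      using integral_unique[OF I(1)[of F]] by (simp add: sum_distrib_left mult_ac)
    also have "\<dots> = (\<Sum>n\<in>F. integral {0..2 * pi} (\<lambda>x. a n * (g x * chr n x)))"
      by (rule integral_sum[OF that]) (auto intro!: integrable_continuous_interval continuous_intros cg)
    finally show ?thesis by simp
  qed
  then have "\<forall>\<^sub>F F in finite_subsets_at_top UNIV. I F = (\<Sum>n\<in>F. a n * integral {0..2 * pi} (\<lambda>x. g x * chr n x))"
    by (intro eventually_finite_subsets_at_top_weakI)
  then show ?thesis
    using I(3) integral_unique[OF I(2)] unfolding has_sum_def by (simp add: tendsto_cong)
qed

lemma fourier_dist_of: "fourier (dist_of f) n = integral {0..2 * pi} (\<lambda>x. f x * chr (- n) x) / (2 * pi)"
  by (simp add: fourier_def dist_of_def tfun_test_exp)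

lemma fourier_fser:
  assumes "l1 a" shows "fourier (dist_of (fser a)) n = a n"
proof -
  have "((\<lambda>m. a m * integral {0..2 * pi} (\<lambda>x. chr (- n) x * chr m x)) has_sum
      integral {0..2 * pi} (\<lambda>x. chr (- n) x * fser a x)) UNIV"
    by (intro integral_fser assms continuous_intros)
  moreover have "a m * integral {0..2 * pi} (\<lambda>x. chr (- n) x * chr m x) = 2 * pi * a n * unit_vec n m" for m
    unfolding chr_add integral_chr by (simp add: unit_vec_def)
  moreover have "((\<lambda>m. 2 * pi * a n * unit_vec n m) has_sum 2 * pi * a n) UNIV"
    by (rule has_sum_finite_neutralI[of "{n}"]) (auto simp: unit_vec_def)
  ultimately have "integral {0..2 * pi} (\<lambda>x. chr (- n) x * fser a x) = 2 * pi * a n"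
    by (simp only: has_sum_unique)
  then show ?thesis
    by (simp add: fourier_dist_of mult.commute)
qed

lemma fourier_fser_square:
  assumes "l1 a" shows "fourier (dist_of (\<lambda>x. (fser a x)\<^sup>2)) n = conv a a n"
proof -
  have "((\<lambda>m. a m * integral {0..2 * pi} (\<lambda>x. (fser a x * chr (- n) x) * chr m x)) has_sum
      integral {0..2 * pi} (\<lambda>x. (fser a x * chr (- n) x) * fser a x)) UNIV"
    by (intro integral_fser assms continuous_intros continuous_fser)
  also have "(\<lambda>m. a m * integral {0..2 * pi} (\<lambda>x. (fser a x * chr (- n) x) * chr m x))
      = (\<lambda>m. (2 * pi) * (a (n - m) * a m))"
  proof
    fix m
    have "(\<lambda>x. (fser a x * chr (- n) x) * chr m x) = (\<lambda>x. fser a x * chr (- (n - m)) x)"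
      by (simp add: mult.assoc chr_add)
    then show "a m * integral {0..2 * pi} (\<lambda>x. (fser a x * chr (- n) x) * chr m x) = (2 * pi) * (a (n - m) * a m)"
      using fourier_fser[OF assms, of "n - m"] by (simp add: fourier_dist_of divide_eq_eq mult_ac)
  qed
  finally have "((\<lambda>m. (2 * pi) * (a (n - m) * a m)) has_sum
      integral {0..2 * pi} (\<lambda>x. (fser a x * chr (- n) x) * fser a x)) UNIV" .
  from infsumI[OF this] have "integral {0..2 * pi} (\<lambda>x. (fser a x * chr (- n) x) * fser a x) = 2 * pi * conv a a n"
    unfolding infsum_cmult_right' conv_def by simp
  moreover have "(\<lambda>x. (fser a x)\<^sup>2 * chr (- n) x) = (\<lambda>x. (fser a x * chr (- n) x) * fser a x)"
    by (simp add: power2_eq_square mult_ac)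
  ultimately show ?thesis
    by (simp add: fourier_dist_of)
qed

lemma fser_fourier:
  assumes "continuous_on UNIV f" "periodic f" "l1 (fourier (dist_of f))"
  shows "fser (fourier (dist_of f)) = f"
proof
  fix x
  let ?g = "\<lambda>x. fser (fourier (dist_of f)) x - f x"
  have cg: "continuous_on UNIV ?g"
    by (intro continuous_intros continuous_fser assms)
  have "integral {0..2 * pi} (\<lambda>x. ?g x * chr n x) = 0" for n
  proof -
    have "integral {0..2 * pi} (\<lambda>x. ?g x * chr n x)
        = integral {0..2 * pi} (\<lambda>x. fser (fourier (dist_of f)) x * chr n x) - integral {0..2 * pi} (\<lambda>x. f x * chr n x)"
      unfolding left_diff_distrib
      by (intro integral_diff integrable_cont continuous_intros continuous_fser assms)
    also have "\<dots> = 0"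
      using fourier_fser[OF assms(3), of "- n"] by (simp add: fourier_dist_of)
    finally show ?thesis .
  qed
  then have "trig_null ?g" using cg by (simp add: trig_null_def)
  moreover have "periodic ?g"
    using assms(2) periodic_fser by (simp add: periodic_def)
  ultimately show "fser (fourier (dist_of f)) x = f x"
    using trig_null_imp_0[of ?g x] by simp
qed

lemma dist_of_inject:
  assumes "continuous_on UNIV f" "periodic f" "continuous_on UNIV g" "periodic g"
    and "\<And>n. fourier (dist_of f) n = fourier (dist_of g) n"
  shows "f = g"
proof
  fix x
  have "trig_null (\<lambda>x. f x - g x)"
    unfolding trig_null_def
  proof (intro conjI allI)
    fix n
    have "integral {0..2 * pi} (\<lambda>x. (f x - g x) * chr n x)
        = integral {0..2 * pi} (\<lambda>x. f x * chr n x) - integral {0..2 * pi} (\<lambda>x. g x * chr n x)"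
      unfolding left_diff_distrib
      by (intro integral_diff integrable_cont continuous_intros assms)
    then show "integral {0..2 * pi} (\<lambda>x. (f x - g x) * chr n x) = 0"
      using assms(5)[of "- n"] by (simp add: fourier_dist_of)
  qed (intro continuous_intros assms)
  then show "f x = g x"
    using trig_null_imp_0[of "\<lambda>x. f x - g x" x] assms by (simp add: periodic_def)
qed

lemma norm_fourier_le:
  assumes "continuous_on UNIV f" "\<And>x. norm (f x) \<le> B"
  shows "norm (fourier (dist_of f) n) \<le> B"
proof -
  have "norm (integral {0..2 * pi} (\<lambda>x. f x * chr (- n) x)) \<le> B * (2 * pi - 0)"
    by (rule integral_bound)
      (auto simp: norm_mult intro!: assms continuous_intros continuous_on_subset[OF assms(1)])
  then show ?thesis by (simp add: fourier_dist_of norm_divide field_simps)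
qed

section \<open>Fourier coefficients determine distributions\<close>

lemma tfun_deriv: "(tfun \<phi> has_vector_derivative tfun (test_deriv \<phi>) x) (at x)"
proof -
  obtain D where "D 0 = tfun \<phi>" "\<And>j x. (D j has_vector_derivative D (Suc j) x) (at x)"
    using tfun[of \<phi>] unfolding smooth_def by auto
  then have D: "(tfun \<phi> has_vector_derivative D 1 x) (at x)" for x
    by (metis One_nat_def)
  then show ?thesis
    by (simp add: test_deriv.rep_eq vector_derivative_at[OF D])
qed

lemma continuous_tfun [continuous_intros]: "continuous_on A (tfun \<phi>)"
  by (intro continuous_at_imp_continuous_on ballI has_vector_derivative_continuous[OF tfun_deriv])

lemma periodic_tfun: "periodic (tfun \<phi>)"
  using tfun[of \<phi>] by simp

lemma periodic_bounded:
  assumes "continuous_on UNIV f" "periodic f"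
  obtains B where "\<forall>x. norm (f x) \<le> B"
proof -
  have "bounded (f ` {0..2 * pi})"
    by (intro compact_imp_bounded compact_continuous_image continuous_on_subset[OF assms(1)]) auto
  then obtain B where B: "\<forall>x\<in>{0..2 * pi}. norm (f x) \<le> B"
    unfolding bounded_iff by auto
  show thesis
  proof (rule that, rule allI)
    fix x
    show "norm (f x) \<le> B"
      by (rule periodic_reduce[OF assms(2), of x]) (use B in simp)
  qed
qed

lemma tfun_bdd_above: "bdd_above (range (\<lambda>x. norm (tfun \<phi> x)))"
  by (rule periodic_bounded[OF continuous_tfun[of UNIV \<phi>] periodic_tfun]) (auto intro!: bdd_aboveI2)

abbreviation tcoef :: "test_fun \<Rightarrow> int \<Rightarrow> complex" where
  "tcoef \<phi> \<equiv> fourier (dist_of (tfun \<phi>))"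

lemma tcoef_linear:
  "tcoef (test_add \<phi> \<psi>) n = tcoef \<phi> n + tcoef \<psi> n"
  "tcoef (test_scale c \<phi>) n = c * tcoef \<phi> n"
proof -
  have "integral {0..2 * pi} (\<lambda>x. tfun (test_add \<phi> \<psi>) x * chr (- n) x)
      = integral {0..2 * pi} (\<lambda>x. tfun \<phi> x * chr (- n) x) + integral {0..2 * pi} (\<lambda>x. tfun \<psi> x * chr (- n) x)"
    unfolding test_add.rep_eq distrib_right
    by (intro integral_add integrable_cont continuous_intros)
  then show "tcoef (test_add \<phi> \<psi>) n = tcoef \<phi> n + tcoef \<psi> n"
    by (simp add: fourier_dist_of add_divide_distrib)
  show "tcoef (test_scale c \<phi>) n = c * tcoef \<phi> n"
    by (simp add: fourier_dist_of test_scale.rep_eq mult.assoc)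
qed

lemma tcoef_test_exp: "tcoef (test_exp m) n = unit_vec m n"
  by (simp add: fourier_dist_of tfun_test_exp chr_add integral_chr unit_vec_def)

lemma tcoef_test_deriv: "tcoef (test_deriv \<phi>) n = \<i> * of_int n * tcoef \<phi> n"
proof -
  have "((\<lambda>x. tfun \<phi> x * chr (- n) x) has_vector_derivative
      tfun \<phi> x * (- \<i> * of_int n * chr (- n) x) + tfun (test_deriv \<phi>) x * chr (- n) x) (at x within {0..2 * pi})" for x
  proof (rule has_vector_derivative_mult[OF has_vector_derivative_at_within[OF tfun_deriv]])
    show "(chr (- n) has_vector_derivative - \<i> * of_int n * chr (- n) x) (at x within {0..2 * pi})"
      unfolding chr_def
      by (rule has_vector_derivative_real_field) (auto intro!: derivative_eq_intros)
  qed
  then have "((\<lambda>x. tfun \<phi> x * (- \<i> * of_int n * chr (- n) x) + tfun (test_deriv \<phi>) x * chr (- n) x) has_integral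
      (tfun \<phi> (2 * pi) * chr (- n) (2 * pi) - tfun \<phi> 0 * chr (- n) 0)) {0..2 * pi}"
    by (intro fundamental_theorem_of_calculus) auto
  moreover have "tfun \<phi> (2 * pi) = tfun \<phi> 0" "chr (- n) (2 * pi) = chr (- n) 0"
    using periodic_tfun[of \<phi>] periodic_chr[of "- n"] unfolding periodic_def by (metis add_0)+
  ultimately have "integral {0..2 * pi} (\<lambda>x. tfun \<phi> x * (- \<i> * of_int n * chr (- n) x) + tfun (test_deriv \<phi>) x * chr (- n) x) = 0"
    by (simp add: integral_unique)
  also have "(\<lambda>x. tfun \<phi> x * (- \<i> * of_int n * chr (- n) x) + tfun (test_deriv \<phi>) x * chr (- n) x)
      = (\<lambda>x. tfun (test_deriv \<phi>) x * chr (- n) x - \<i> * of_int n * (tfun \<phi> x * chr (- n) x))"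
    by (auto simp: algebra_simps)
  also have "integral {0..2 * pi} \<dots> = integral {0..2 * pi} (\<lambda>x. tfun (test_deriv \<phi>) x * chr (- n) x)
      - \<i> * of_int n * integral {0..2 * pi} (\<lambda>x. tfun \<phi> x * chr (- n) x)"
    unfolding integral_mult_right[symmetric]
    by (intro integral_diff integrable_cont continuous_intros)
  finally show ?thesis
    by (simp add: fourier_dist_of)
qed

lemma summable_on_int:
  fixes f :: "int \<Rightarrow> real"
  assumes "(\<lambda>n. f (int n)) summable_on UNIV" "(\<lambda>n. f (- int n)) summable_on UNIV"
  shows "f summable_on UNIV"
proof -
  have "f summable_on (range int)"
    by (subst summable_on_reindex) (use assms(1) in \<open>auto simp: o_def\<close>)
  moreover have "f summable_on (range (\<lambda>n. - int n))"
    by (subst summable_on_reindex) (use assms(2) in \<open>auto simp: o_def inj_on_def\<close>)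
  moreover have "(UNIV :: int set) = range int \<union> range (\<lambda>n. - int n)"
  proof -
    have "n \<in> range int \<union> range (\<lambda>n. - int n)" for n
      by (cases n rule: int_cases2) auto
    then show ?thesis by blast
  qed
  ultimately show ?thesis
    by (metis summable_on_union)
qed

lemma jbracket_ge_1: "jbracket n \<ge> 1"
  by (simp add: jbracket_def)

lemma jbracket_bounds: "jbracket n \<le> real_of_int \<bar>n\<bar> + 1" "real_of_int \<bar>n\<bar> + 1 \<le> 2 * jbracket n"
  by (auto simp: jbracket_def max_def)

lemma jbracket_summable:
  assumes "r > 1"
  shows "(\<lambda>n. jbracket n powr (- r)) summable_on UNIV"
proof -
  have 1: "(\<lambda>n. (real n + 1) powr (- r)) summable_on UNIV"
    by (intro summable_powr_shift) (use assms in auto)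
  have le: "jbracket n powr (- r) \<le> 2 powr r * (real_of_int \<bar>n\<bar> + 1) powr (- r)" for n
  proof -
    have "(2 * jbracket n) powr (- r) \<le> (real_of_int \<bar>n\<bar> + 1) powr (- r)"
      by (intro powr_mono2') (use assms jbracket_bounds in auto)
    then have "2 powr r * (2 * jbracket n) powr (- r) \<le> 2 powr r * (real_of_int \<bar>n\<bar> + 1) powr (- r)"
      by (intro mult_left_mono) auto
    then show ?thesis
      using jbracket_ge_1[of n] by (simp add: powr_mult powr_minus mult.assoc[symmetric])
  qed
  have "(\<lambda>n. (real_of_int \<bar>n\<bar> + 1) powr (- r)) summable_on UNIV"
    by (rule summable_on_int) (use 1 in auto)
  then have "(\<lambda>n. 2 powr r * (real_of_int \<bar>n\<bar> + 1) powr (- r)) summable_on UNIV"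
    by (rule summable_on_cmult_right)
  then show ?thesis
    by (rule summable_on_comparison_test) (use le in auto)
qed

text \<open>Bounds on the function and on its second derivative give coefficients of order
  n^(-2).\<close>

lemma l1_tcoef: "l1 (tcoef \<phi>)"
proof -
  obtain B0 where B0: "\<forall>x. norm (tfun \<phi> x) \<le> B0"
    by (rule periodic_bounded[OF continuous_tfun[of UNIV \<phi>] periodic_tfun])
  obtain B2 where B2: "\<forall>x. norm (tfun (test_deriv (test_deriv \<phi>)) x) \<le> B2"
    by (rule periodic_bounded[OF continuous_tfun[of UNIV "test_deriv (test_deriv \<phi>)"] periodic_tfun])
  have le: "norm (tcoef \<phi> n) \<le> (B0 + B2) * jbracket n powr (- 2)" for n
  proof -
    have 0: "norm (tcoef \<phi> n) \<le> B0"
      by (intro norm_fourier_le continuous_tfun B0[rule_format])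
    have "norm (tcoef (test_deriv (test_deriv \<phi>)) n) \<le> B2"
      by (intro norm_fourier_le continuous_tfun B2[rule_format])
    then have "(real_of_int n)\<^sup>2 * norm (tcoef \<phi> n) \<le> B2"
      by (simp add: tcoef_test_deriv norm_mult power2_eq_square mult.assoc[symmetric])
    moreover have "(jbracket n)\<^sup>2 \<le> 1 + (real_of_int n)\<^sup>2"
      by (simp add: jbracket_def max_def)
    then have "(jbracket n)\<^sup>2 * norm (tcoef \<phi> n) \<le> (1 + (real_of_int n)\<^sup>2) * norm (tcoef \<phi> n)"
      by (intro mult_right_mono) auto
    ultimately have "(jbracket n)\<^sup>2 * norm (tcoef \<phi> n) \<le> B0 + B2"
      using 0 by (simp add: algebra_simps)
    then show ?thesis
      using jbracket_ge_1[of n] by (simp add: powr_minus field_simps)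
  qed
  have "(\<lambda>n. (B0 + B2) * jbracket n powr (- 2)) summable_on UNIV"
    by (intro summable_on_cmult_right jbracket_summable) simp
  then show ?thesis
    unfolding l1_def by (rule summable_on_comparison_test) (use le in auto)
qed

lemma norm_tfun_le: "norm (tfun \<phi> x) \<le> (\<Sum>\<^sub>\<infinity>n. norm (tcoef \<phi> n))"
proof -
  have "tfun \<phi> = fser (tcoef \<phi>)"
    by (intro fser_fourier[symmetric] continuous_tfun periodic_tfun l1_tcoef)
  then show ?thesis
    using norm_fser_le[OF l1_tcoef, of \<phi> x] by simp
qed

lemma tail_tendsto_0:
  fixes f :: "int \<Rightarrow> real"
  assumes "f summable_on UNIV"
  shows "(\<lambda>M. \<Sum>\<^sub>\<infinity>n. if \<bar>n\<bar> \<le> int M then 0 else f n) \<longlonglongrightarrow> 0"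
proof -
  have "(\<Sum>\<^sub>\<infinity>n. if \<bar>n\<bar> \<le> int M then 0 else f n) = infsum f UNIV - sum f {- int M..int M}" for M
  proof -
    have "(\<Sum>\<^sub>\<infinity>n. if \<bar>n\<bar> \<le> int M then 0 else f n) = infsum f (UNIV - {- int M..int M})"
      by (rule infsum_cong_neutral) auto
    also have "\<dots> = infsum f UNIV - infsum f {- int M..int M}"
      by (intro infsum_Diff assms) auto
    finally show ?thesis by simp
  qed
  moreover have "filterlim (\<lambda>M. {- int M..int M}) (finite_subsets_at_top UNIV) sequentially"
    unfolding filterlim_def le_filter_def eventually_filtermap
  proof (intro allI impI)
    fix P :: "int set \<Rightarrow> bool"
    assume "\<forall>\<^sub>F A in finite_subsets_at_top UNIV. P A"
    then obtain X where X: "finite X" "\<And>Y. finite Y \<Longrightarrow> X \<subseteq> Y \<Longrightarrow> P Y"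
      unfolding eventually_finite_subsets_at_top by auto
    obtain m where m: "\<And>x. x \<in> X \<Longrightarrow> \<bar>x\<bar> \<le> m"
      using bdd_above_finite[of "abs ` X"] X(1) by (auto simp: bdd_above_def)
    have "P {- int M..int M}" if "M \<ge> nat m" for M
      using m that by (intro X) force+
    then show "\<forall>\<^sub>F M in sequentially. P {- int M..int M}"
      by (auto simp: eventually_sequentially)
  qed
  then have "(\<lambda>M. sum f {- int M..int M}) \<longlonglongrightarrow> infsum f UNIV"
    using has_sum_infsum[OF assms] unfolding has_sum_def by (rule filterlim_compose[rotated])
  then have "(\<lambda>M. infsum f UNIV - sum f {- int M..int M}) \<longlonglongrightarrow> infsum f UNIV - infsum f UNIV"
    by (intro tendsto_intros)
  ultimately show ?thesis by simp
qed

text \<open>\<phi> minus a symmetric Fourier partial sum, built from \<open>test_add\<close> and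
  \<open>test_scale\<close>: a distribution that kills all exponentials has the same value on \<phi>
  and on every tail.\<close>

primrec test_tail :: "test_fun \<Rightarrow> nat \<Rightarrow> test_fun" where
  "test_tail \<phi> 0 = test_add \<phi> (test_scale (- tcoef \<phi> 0) (test_exp 0))"
| "test_tail \<phi> (Suc M) = test_add (test_tail \<phi> M)
    (test_add (test_scale (- tcoef \<phi> (int (Suc M))) (test_exp (int (Suc M))))
      (test_scale (- tcoef \<phi> (- int (Suc M))) (test_exp (- int (Suc M)))))"

lemma tcoef_test_tail: "tcoef (test_tail \<phi> M) n = (if \<bar>n\<bar> \<le> int M then 0 else tcoef \<phi> n)"
  by (induction M) (auto simp: tcoef_linear tcoef_test_exp unit_vec_def)

lemma tcoef_test_deriv_pow: "tcoef ((test_deriv ^^ j) \<phi>) n = (\<i> * of_int n) ^ j * tcoef \<phi> n"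
  by (induction j) (simp_all add: tcoef_test_deriv mult.assoc)

text \<open>Every derivative of \<phi> has absolutely summable coefficients, so the seminorms of the
  tails tend to 0, while \<open>u\<close> takes the same value on all of them.\<close>

lemma distribution_eq_0:
  assumes u: "distribution u" and z: "\<And>n. fourier u n = 0"
  shows "u \<phi> = 0"
proof -
  have ue: "u (test_exp n) = 0" for n
    using z[of "- n"] by (simp add: fourier_def)
  have ut: "u (test_tail \<phi> M) = u \<phi>" for M
    using u by (induction M) (simp_all add: distribution_def ue)
  obtain C N where C: "\<And>\<phi>. norm (u \<phi>) \<le> C * (\<Sum>j\<le>(N::nat). SUP x. cmod (tfun ((test_deriv ^^ j) \<phi>) x))"
    using u unfolding distribution_def by metis
  let ?T = "\<lambda>j M. \<Sum>\<^sub>\<infinity>n. if \<bar>n\<bar> \<le> int M then 0 else norm (tcoef ((test_deriv ^^ j) \<phi>) n)"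
  have sup: "(SUP x. cmod (tfun ((test_deriv ^^ j) (test_tail \<phi> M)) x)) \<le> ?T j M" for j M
  proof (rule cSUP_least)
    fix x
    have "cmod (tfun ((test_deriv ^^ j) (test_tail \<phi> M)) x) \<le> (\<Sum>\<^sub>\<infinity>n. norm (tcoef ((test_deriv ^^ j) (test_tail \<phi> M)) n))"
      by (rule norm_tfun_le)
    also have "\<dots> = ?T j M"
      by (rule infsum_cong) (simp add: tcoef_test_deriv_pow tcoef_test_tail)
    finally show "cmod (tfun ((test_deriv ^^ j) (test_tail \<phi> M)) x) \<le> ?T j M" .
  qed simp
  have sup0: "0 \<le> (SUP x. cmod (tfun \<psi> x))" for \<psi>
    by (rule order_trans[OF norm_ge_zero cSUP_upper[OF UNIV_I tfun_bdd_above]])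
  have "norm (u \<phi>) \<le> \<bar>C\<bar> * (\<Sum>j\<le>N. ?T j M)" for M
  proof -
    have "norm (u \<phi>) \<le> C * (\<Sum>j\<le>N. SUP x. cmod (tfun ((test_deriv ^^ j) (test_tail \<phi> M)) x))"
      using C[of "test_tail \<phi> M"] ut[of M] by simp
    also have "\<dots> \<le> \<bar>C\<bar> * (\<Sum>j\<le>N. SUP x. cmod (tfun ((test_deriv ^^ j) (test_tail \<phi> M)) x))"
      by (intro mult_right_mono sum_nonneg sup0) simp
    also have "\<dots> \<le> \<bar>C\<bar> * (\<Sum>j\<le>N. ?T j M)"
      by (intro mult_left_mono sum_mono sup) simp
    finally show ?thesis .
  qed
  moreover have "(\<lambda>M. \<bar>C\<bar> * (\<Sum>j\<le>N. ?T j M)) \<longlonglongrightarrow> \<bar>C\<bar> * (\<Sum>j\<le>N. 0)"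
    by (intro tendsto_mult_left tendsto_sum tail_tendsto_0 l1_tcoef[unfolded l1_def])
  ultimately have "norm (u \<phi>) \<le> \<bar>C\<bar> * (\<Sum>j\<le>N. 0)"
    by (intro LIMSEQ_le_const) auto
  then show ?thesis by simp
qed

lemma distribution_dist_of:
  assumes "continuous_on UNIV f"
  shows "distribution (dist_of f)"
  unfolding distribution_def
proof (intro conjI allI)
  fix \<phi> \<psi> c
  show "dist_of f (test_add \<phi> \<psi>) = dist_of f \<phi> + dist_of f \<psi>"
    unfolding dist_of_def test_add.rep_eq distrib_left
    by (intro integral_add integrable_cont continuous_intros assms)
  show "dist_of f (test_scale c \<phi>) = c * dist_of f \<phi>"
    by (simp add: dist_of_def test_scale.rep_eq mult.left_commute)
next
  have "bounded (f ` {0..2 * pi})"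
    by (intro compact_imp_bounded compact_continuous_image continuous_on_subset[OF assms]) auto
  then obtain B where B: "B > 0" "\<And>x. x \<in> {0..2 * pi} \<Longrightarrow> norm (f x) \<le> B"
    unfolding bounded_pos by auto
  have "cmod (dist_of f \<phi>) \<le> (B * (2 * pi)) * (\<Sum>j\<le>0::nat. SUP x. cmod (tfun ((test_deriv ^^ j) \<phi>) x))" for \<phi>
  proof -
    have "cmod (dist_of f \<phi>) \<le> (B * (SUP x. cmod (tfun \<phi> x))) * (2 * pi - 0)"
      unfolding dist_of_def
    proof (rule integral_bound)
      show "continuous_on {0..2 * pi} (\<lambda>x. f x * tfun \<phi> x)"
        by (intro continuous_intros continuous_on_subset[OF assms]) auto
      fix x assume "x \<in> {0..2 * pi}"
      then show "norm (f x * tfun \<phi> x) \<le> B * (SUP x. cmod (tfun \<phi> x))"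
        unfolding norm_mult using B by (intro mult_mono cSUP_upper tfun_bdd_above) auto
    qed simp
    then show ?thesis by (simp add: mult_ac)
  qed
  then show "\<exists>C N. \<forall>\<phi>. cmod (dist_of f \<phi>) \<le> C * (\<Sum>j\<le>(N::nat). SUP x. cmod (tfun ((test_deriv ^^ j) \<phi>) x))"
    by blast
qed

lemma distribution_diff:
  assumes "distribution u" "distribution w"
  shows "distribution (\<lambda>\<phi>. u \<phi> - w \<phi>)"
proof -
  let ?S = "\<lambda>N \<phi>. \<Sum>j\<le>(N::nat). SUP x. cmod (tfun ((test_deriv ^^ j) \<phi>) x)"
  obtain C N where C: "\<And>\<phi>. norm (u \<phi>) \<le> C * ?S N \<phi>"
    using assms(1) unfolding distribution_def by metis
  obtain D M where D: "\<And>\<phi>. norm (w \<phi>) \<le> D * ?S M \<phi>"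
    using assms(2) unfolding distribution_def by metis
  have sup0: "0 \<le> (SUP x. cmod (tfun \<psi> x))" for \<psi>
    by (rule order_trans[OF norm_ge_zero cSUP_upper[OF UNIV_I tfun_bdd_above]])
  have "norm (u \<phi> - w \<phi>) \<le> (\<bar>C\<bar> + \<bar>D\<bar>) * ?S (max N M) \<phi>" for \<phi>
  proof -
    have mono: "?S N \<phi> \<le> ?S (max N M) \<phi>" "?S M \<phi> \<le> ?S (max N M) \<phi>" and S0: "0 \<le> ?S N \<phi>" "0 \<le> ?S M \<phi>"
      by (intro sum_mono2 sum_nonneg sup0; auto)+
    have "norm (u \<phi> - w \<phi>) \<le> C * ?S N \<phi> + D * ?S M \<phi>"
      using norm_triangle_ineq4[of "u \<phi>" "w \<phi>"] C[of \<phi>] D[of \<phi>] by linarith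
    also have "\<dots> \<le> \<bar>C\<bar> * ?S N \<phi> + \<bar>D\<bar> * ?S M \<phi>"
      using S0 by (intro add_mono mult_right_mono) auto
    also have "\<dots> \<le> \<bar>C\<bar> * ?S (max N M) \<phi> + \<bar>D\<bar> * ?S (max N M) \<phi>"
      using mono by (intro add_mono mult_left_mono) auto
    finally show ?thesis by (simp only: distrib_right)
  qed
  moreover have "u (test_add \<phi> \<psi>) - w (test_add \<phi> \<psi>) = u \<phi> - w \<phi> + (u \<psi> - w \<psi>)"
    "u (test_scale c \<phi>) - w (test_scale c \<phi>) = c * (u \<phi> - w \<phi>)" for \<phi> \<psi> c
    using assms by (simp_all add: distribution_def algebra_simps)
  ultimately show ?thesis
    unfolding distribution_def by blast
qed

lemma distribution_eqI:
  assumes "distribution u" "distribution w" "\<And>n. fourier u n = fourier w n"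
  shows "u = w"
proof
  fix \<phi>
  have "u \<phi> - w \<phi> = 0"
    by (rule distribution_eq_0[OF distribution_diff[OF assms(1,2)]])
      (use assms(3) in \<open>simp add: fourier_def\<close>)
  then show "u \<phi> = w \<phi>" by simp
qed

section \<open>Sobolev spaces and the Benjamin-Ono flow in Fourier coordinates\<close>

text \<open>The weight of the Sobolev norm itself; \<open>nrm_weight_compare\<close> relates it to
  the weight |n| + 1 of \<open>wgt\<close>.\<close>

definition jwt :: "real \<Rightarrow> (int \<Rightarrow> complex) \<Rightarrow> int \<Rightarrow> complex" where
  "jwt \<sigma> a n = of_real (jbracket n powr \<sigma>) * a n"

lemma jbracket_powr_power2: "(jbracket n powr r)\<^sup>2 = jbracket n powr (2 * r)"
  by (simp add: power2_eq_square powr_add[symmetric])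

lemma norm_jwt: "norm (jwt \<sigma> a n) = jbracket n powr \<sigma> * norm (a n)"
  by (simp add: jwt_def norm_mult)

lemma norm_jwt_power2: "(norm (jwt \<sigma> a n))\<^sup>2 = jbracket n powr (2 * \<sigma>) * (norm (a n))\<^sup>2"
  by (simp add: norm_jwt power_mult_distrib jbracket_powr_power2)

lemma sobolev_norm_nrm: "sobolev_norm \<sigma> u = nrm (jwt \<sigma> (fourier u))"
  by (simp add: sobolev_norm_def nrm_def norm_jwt_power2)

lemma sobolevD:
  assumes "u \<in> sobolev \<sigma>"
  shows "distribution u" "real_valued u" "l2 (jwt \<sigma> (fourier u))"
  using assms by (simp_all add: sobolev_def l2_def norm_jwt_power2)

lemma sobolevI: "distribution u \<Longrightarrow> real_valued u \<Longrightarrow> l2 (jwt \<sigma> (fourier u)) \<Longrightarrow> u \<in> sobolev \<sigma>"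
  by (simp add: sobolev_def l2_def norm_jwt_power2)

lemma jwt_linear:
  "jwt \<sigma> (\<lambda>n. a n - b n) = (\<lambda>n. jwt \<sigma> a n - jwt \<sigma> b n)"
  "jwt \<sigma> (\<lambda>n. a n / c) = (\<lambda>n. (1 / c) * jwt \<sigma> a n)"
  by (auto simp: jwt_def algebra_simps)

lemma jwt_mono:
  assumes "l2 (jwt \<sigma> a)" "\<rho> \<le> \<sigma>"
  shows "l2 (jwt \<rho> a)" "nrm (jwt \<rho> a) \<le> nrm (jwt \<sigma> a)"
proof -
  have "norm (jwt \<rho> a n) \<le> norm (jwt \<sigma> a n)" for n
    unfolding norm_jwt using jbracket_ge_1[of n] assms(2) by (intro mult_right_mono powr_mono) auto
  then show "l2 (jwt \<rho> a)" "nrm (jwt \<rho> a) \<le> nrm (jwt \<sigma> a)"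
    using l2_mono[OF assms(1)] by auto
qed

lemma sobolev_mono: "u \<in> sobolev \<sigma> \<Longrightarrow> \<rho> \<le> \<sigma> \<Longrightarrow> u \<in> sobolev \<rho>"
  by (rule sobolevI[OF sobolevD(1,2) jwt_mono(1)[OF sobolevD(3)]])

lemma jwt_0: "jwt 0 a = a"
proof
  fix n
  show "jwt 0 a n = a n"
    using jbracket_ge_1[of n] by (auto simp: jwt_def)
qed

lemma jwt_dd:
  assumes "l2 (jwt \<sigma> a)" shows "l2 (jwt (\<sigma> - 1) (dd a))"
proof (rule l2_mono(1)[OF assms])
  fix n
  have j: "jbracket n > 0" using jbracket_ge_1[of n] by simp
  have "jbracket n powr (\<sigma> - 1) * real_of_int \<bar>n\<bar> \<le> jbracket n powr (\<sigma> - 1) * jbracket n"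
    by (intro mult_left_mono) (auto simp: jbracket_def)
  also have "\<dots> = jbracket n powr \<sigma>"
    using j powr_add[of "jbracket n" "\<sigma> - 1" 1] by simp
  finally show "norm (jwt (\<sigma> - 1) (dd a) n) \<le> norm (jwt \<sigma> a n)"
    by (simp add: norm_jwt dd_def norm_mult mult.assoc[symmetric] mult_right_mono)
qed

lemma jwt_l1:
  assumes "l2 (jwt \<sigma> a)" "\<sigma> > 1/2"
  shows "l1 a"
proof -
  have "l2 (\<lambda>n. jbracket n powr (- \<sigma>))"
  proof -
    show ?thesis
      using jbracket_summable[of "2 * \<sigma>"] assms(2) by (simp add: l2_def jbracket_powr_power2)
  qed
  from Cauchy_Schwarz_summable[OF this assms(1)]
  have "(\<lambda>n. norm (jbracket n powr (- \<sigma>)) * norm (jwt \<sigma> a n)) summable_on UNIV"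
    by simp
  moreover have "norm (jbracket n powr (- \<sigma>)) * norm (jwt \<sigma> a n) = norm (a n)" for n
    using jbracket_ge_1[of n] by (simp add: norm_jwt mult.assoc[symmetric] powr_add[symmetric])
  ultimately show ?thesis by (simp add: l1_def)
qed

text \<open>Reality is stated for real test functions, so the exponentials enter through multiples
  of cosine and sine.\<close>

lemma herm_fourier:
  assumes "distribution u" "real_valued u"
  shows "herm (fourier u)"
  unfolding herm_def
proof
  fix n
  have add: "u (test_add \<phi> \<psi>) = u \<phi> + u \<psi>" and scale: "u (test_scale c \<phi>) = c * u \<phi>" for \<phi> \<psi> c
    using assms(1) by (auto simp: distribution_def)
  have "u (test_add (test_exp n) (test_exp (- n))) \<in> \<real>"
    using assms(2) unfolding real_valued_def
    by (auto simp: test_add.rep_eq tfun_test_exp chr_cis complex_is_Real_iff)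
  then have "Im (u (test_exp n)) + Im (u (test_exp (- n))) = 0"
    by (simp add: add complex_is_Real_iff)
  moreover have "u (test_add (test_scale \<i> (test_exp n)) (test_scale (- \<i>) (test_exp (- n)))) \<in> \<real>"
    using assms(2) unfolding real_valued_def
    by (auto simp: test_add.rep_eq test_scale.rep_eq tfun_test_exp chr_cis complex_is_Real_iff)
  then have "Re (u (test_exp n)) - Re (u (test_exp (- n))) = 0"
    by (simp add: add scale complex_is_Real_iff)
  ultimately have "u (test_exp n) = cnj (u (test_exp (- n)))"
    by (simp add: complex_eq_iff)
  then show "fourier u (- n) = cnj (fourier u n)"
    by (simp add: fourier_def)
qed

lemma cont_rep_fser:
  assumes "distribution u" "l1 (fourier u)"
  shows "cont_rep u = fser (fourier u)"
  unfolding cont_rep_def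
proof (rule the_equality)
  have "dist_of (fser (fourier u)) = u"
    by (intro distribution_eqI distribution_dist_of continuous_fser fourier_fser assms)
  then show "continuous_on UNIV (fser (fourier u)) \<and> periodic (fser (fourier u)) \<and> dist_of (fser (fourier u)) = u"
    by (simp add: continuous_fser periodic_fser assms)
next
  fix f assume f: "continuous_on UNIV f \<and> periodic f \<and> dist_of f = u"
  then show "f = fser (fourier u)"
    by (intro dist_of_inject continuous_fser periodic_fser assms) (auto simp: fourier_fser assms)
qed

lemma fourier_dsquare:
  assumes "distribution u" "l1 (fourier u)"
  shows "fourier (dsquare u) n = conv (fourier u) (fourier u) n"
  unfolding dsquare_def cont_rep_fser[OF assms] by (rule fourier_fser_square[OF assms(2)])

lemma test_deriv_test_scale: "test_deriv (test_scale c \<phi>) = test_scale c (test_deriv \<phi>)"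
proof -
  have "tfun (test_deriv (test_scale c \<phi>)) x = c * tfun (test_deriv \<phi>) x" for x
    using has_vector_derivative_mult_right[OF tfun_deriv, of c \<phi> x]
    unfolding test_deriv.rep_eq[of "test_scale c \<phi>"] test_scale.rep_eq by (rule vector_derivative_at)
  then show ?thesis
    by (simp add: tfun_inject[symmetric] test_scale.rep_eq fun_eq_iff)
qed

lemma test_deriv_test_exp: "test_deriv (test_exp n) = test_scale (\<i> * of_int n) (test_exp n)"
proof -
  have "(chr n has_vector_derivative \<i> * of_int n * chr n x) (at x)" for x
    unfolding chr_def
    by (rule has_vector_derivative_real_field) (auto intro!: derivative_eq_intros)
  then show ?thesis
    by (simp add: tfun_inject[symmetric] test_deriv.rep_eq test_scale.rep_eq tfun_test_exp fun_eq_iff vector_derivative_at)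
qed

lemma test_shift_test_exp: "test_shift \<tau> (test_exp n) = test_scale (chr n \<tau>) (test_exp n)"
proof -
  have "chr n (x + \<tau>) = chr n \<tau> * chr n x" for x
    by (simp add: chr_def exp_add[symmetric] algebra_simps)
  then show ?thesis
    by (simp add: tfun_inject[symmetric] test_shift.rep_eq test_scale.rep_eq tfun_test_exp fun_eq_iff)
qed

lemma fourier_dderiv:
  assumes "\<And>c \<phi>. u (test_scale c \<phi>) = c * u \<phi>"
  shows "fourier (dderiv u) n = \<i> * of_int n * fourier u n"
  by (simp add: fourier_def dderiv_def test_deriv_test_exp assms)

lemma fourier_dshift:
  assumes "distribution u"
  shows "fourier (dshift \<tau> u) n = exp (\<i> * of_int n * of_real \<tau>) * fourier u n"
proof -
  have "u (test_scale c \<phi>) = c * u \<phi>" for c \<phi>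
    using assms by (simp add: distribution_def)
  then show ?thesis
    by (simp add: fourier_def dshift_def test_shift_test_exp chr_def)
qed

lemma fourier_hilbert: "fourier (hilbert u) n = - \<i> * of_int (sgn n) * fourier u n"
proof -
  have "dist_of (tfun (test_exp m)) (test_exp (- n)) = 2 * pi * unit_vec m n" for m
    using tcoef_test_exp[of m n] by (simp add: fourier_def divide_eq_eq mult_ac)
  then have "hilbert u (test_exp (- n))
      = (\<Sum>\<^sub>\<infinity>m. - \<i> * of_int (sgn m) * fourier u m * (2 * pi * unit_vec m n))"
    by (simp add: hilbert_def)
  also have "\<dots> = (\<Sum>\<^sub>\<infinity>m\<in>{n}. - \<i> * of_int (sgn m) * fourier u m * (2 * pi * unit_vec m n))"
    by (rule infsum_cong_neutral) (auto simp: unit_vec_def)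
  also have "\<dots> = 2 * pi * (- \<i> * of_int (sgn n) * fourier u n)"
    by (simp add: unit_vec_def)
  finally show ?thesis
    by (simp add: fourier_def[of "hilbert u"])
qed

lemma fourier_bo_field:
  assumes "distribution v" "l1 (fourier v)"
  shows "fourier (hilbert (dderiv (dderiv v)) - dderiv (dsquare v)) n = bo_field (fourier v) n"
proof -
  have sc: "v (test_scale c \<phi>) = c * v \<phi>" "dderiv v (test_scale c \<phi>) = c * dderiv v \<phi>"
    "dsquare v (test_scale c \<phi>) = c * dsquare v \<phi>" for c \<phi>
    using assms(1) by (simp_all add: distribution_def dderiv_def test_deriv_test_scale dsquare_def
        dist_of_def test_scale.rep_eq mult.left_commute)
  have "fourier (hilbert (dderiv (dderiv v)) - dderiv (dsquare v)) n
      = fourier (hilbert (dderiv (dderiv v))) n - fourier (dderiv (dsquare v)) n"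
    by (simp add: fourier_def diff_divide_distrib)
  also have "\<dots> = - \<i> * of_int (sgn n) * (\<i> * of_int n * (\<i> * of_int n * fourier v n))
      - \<i> * of_int n * conv (fourier v) (fourier v) n"
    by (simp only: fourier_hilbert fourier_dderiv[OF sc(1)] fourier_dderiv[OF sc(2)]
        fourier_dderiv[OF sc(3)] fourier_dsquare[OF assms])
  also have "\<dots> = bo_field (fourier v) n"
    by (auto simp: bo_field_def sgn_if algebra_simps)
  finally show ?thesis .
qed

lemma classical_solution_derivative:
  assumes "bo_classical_solution \<sigma> v0 v" "\<sigma> > 1/2"
  shows "l2 (jwt (\<sigma> - 2) (\<lambda>n. (fourier (v (t + h)) n - fourier (v t) n) / of_real h - bo_field (fourier (v t)) n))"
    and "((\<lambda>h. nrm (jwt (\<sigma> - 2) (\<lambda>n. (fourier (v (t + h)) n - fourier (v t) n) / of_real h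
      - bo_field (fourier (v t)) n))) \<longlongrightarrow> 0) (at 0)"
proof -
  obtain v' where v: "\<And>t. v t \<in> sobolev \<sigma>" and v': "\<And>t. v' t \<in> sobolev (\<sigma> - 2)"
    and d: "\<And>t. has_sobolev_derivative (\<sigma> - 2) v (v' t) t"
    and eq: "\<And>t. v' t = hilbert (dderiv (dderiv (v t))) - dderiv (dsquare (v t))"
    using assms(1) unfolding bo_classical_solution_def sobolev_curve_def by blast
  have f': "fourier (v' t) = bo_field (fourier (v t))"
    unfolding eq by (intro ext fourier_bo_field sobolevD(1)[OF v] jwt_l1[OF sobolevD(3)[OF v] assms(2)])
  have F: "fourier (\<lambda>\<phi>. (v (t + h) \<phi> - v t \<phi>) / of_real h - v' t \<phi>)
      = (\<lambda>n. (fourier (v (t + h)) n - fourier (v t) n) / of_real h - bo_field (fourier (v t)) n)" for h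
    unfolding f'[symmetric] by (simp add: fun_eq_iff fourier_def divide_simps)
  show "((\<lambda>h. nrm (jwt (\<sigma> - 2) (\<lambda>n. (fourier (v (t + h)) n - fourier (v t) n) / of_real h
      - bo_field (fourier (v t)) n))) \<longlongrightarrow> 0) (at 0)"
    using d[of t] by (simp only: has_sobolev_derivative_def sobolev_norm_nrm F)
  have lv: "l2 (jwt (\<sigma> - 2) (fourier (v t)))" for t
    by (rule sobolevD(3)[OF sobolev_mono[OF v]]) simp
  show "l2 (jwt (\<sigma> - 2) (\<lambda>n. (fourier (v (t + h)) n - fourier (v t) n) / of_real h - bo_field (fourier (v t)) n))"
    unfolding jwt_linear f'[symmetric]
    by (rule l2_diff(1)[OF l2_scale[OF l2_diff(1)[OF lv lv]] sobolevD(3)[OF v']])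
qed

lemma smooth_potential_fourier:
  assumes "u \<in> sobolev 3" shows "smooth_potential (fourier u)"
proof -
  note D = sobolevD[OF assms]
  have 2: "l2 (jwt 2 (dd (fourier u)))" using jwt_dd[OF D(3)] by simp
  have 1: "l2 (jwt 1 (dd (dd (fourier u))))" using jwt_dd[OF 2] by simp
  show ?thesis
    unfolding smooth_potential_def
    using herm_fourier[OF D(1,2)] jwt_l1[OF D(3)] jwt_l1[OF 2] jwt_l1[OF 1] by simp
qed

text \<open>At regularity 3 the time derivative converges in H^1, which is stronger than l2, and
  after two derivatives the coefficients are still in H^1 and hence absolutely summable.\<close>

lemma classical_solution_bo_flow:
  assumes "bo_classical_solution 3 v0 v"
  shows "bo_flow (\<lambda>t. fourier (v t))"
  unfolding bo_flow_def
proof (intro conjI allI)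
  fix t
  have v: "v t \<in> sobolev 3" for t
    using assms unfolding bo_classical_solution_def sobolev_curve_def by blast
  have cont: "((\<lambda>r. sobolev_norm 3 (v r - v t)) \<longlongrightarrow> 0) (at t)"
    using assms unfolding bo_classical_solution_def sobolev_curve_def by blast
  show "smooth_potential (fourier (v t))"
    by (rule smooth_potential_fourier[OF v])
  have l: "l2 (jwt 3 (\<lambda>n. fourier (v r) n - fourier (v t) n))" for r
    unfolding jwt_linear by (intro l2_diff(1) sobolevD(3)[OF v])
  have F: "fourier (v r - v t) = (\<lambda>n. fourier (v r) n - fourier (v t) n)" for r
    by (simp add: fun_eq_iff fourier_def diff_divide_distrib)
  have "nrm (\<lambda>n. fourier (v r) n - fourier (v t) n) \<le> sobolev_norm 3 (v r - v t)" for r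
    using jwt_mono(2)[OF l, of 0 r] by (simp add: sobolev_norm_nrm F jwt_0)
  then have "norm (nrm (\<lambda>n. fourier (v r) n - fourier (v t) n)) \<le> sobolev_norm 3 (v r - v t)" for r
    by simp
  then show "((\<lambda>r. nrm (\<lambda>n. fourier (v r) n - fourier (v t) n)) \<longlongrightarrow> 0) (at t)"
    by (rule Lim_null_comparison[OF always_eventually[OF allI] cont])
  note d = classical_solution_derivative[OF assms, of t, simplified]
  have "norm (nrm (\<lambda>n. (fourier (v (t + h)) n - fourier (v t) n) / of_real h - bo_field (fourier (v t)) n))
      \<le> nrm (jwt 1 (\<lambda>n. (fourier (v (t + h)) n - fourier (v t) n) / of_real h - bo_field (fourier (v t)) n))" for h
    using jwt_mono(2)[OF d(1), of 0 h] by (simp add: jwt_0)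
  then show "((\<lambda>h. nrm (\<lambda>n. (fourier (v (t + h)) n - fourier (v t) n) / of_real h - bo_field (fourier (v t)) n)) \<longlongrightarrow> 0) (at 0)"
    by (rule Lim_null_comparison[OF always_eventually[OF allI] d(2)])
qed

text \<open>Along the wave, index n rotates as exp(i n \<kappa> t). Its derivative at 0 equals the
  vector field, and the factor i n cancels for n different from 0; so c is the speed
  \<kappa>.\<close>

lemma travelling_wave_fourier:
  assumes "travelling_wave_data v0"
  obtains \<sigma> c C where "\<sigma> > 3/2" "v0 \<in> sobolev \<sigma>"
    "\<forall>n. abs_dd (fourier v0) n = conv (fourier v0) (fourier v0) n + of_real c * fourier v0 n + of_real C * unit_vec 0 n"
proof -
  obtain \<sigma> \<kappa> where s: "\<sigma> > 3/2" and sol: "bo_classical_solution \<sigma> v0 (\<lambda>t. dshift (\<kappa> * t) v0)"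
    using assms unfolding travelling_wave_data_def by blast
  have "dshift (\<kappa> * 0) v0 \<in> sobolev \<sigma>" "dshift (\<kappa> * 0) v0 = v0"
    using sol unfolding bo_classical_solution_def sobolev_curve_def by blast+
  then have v: "v0 \<in> sobolev \<sigma>" by simp
  note D = sobolevD[OF v]
  define a where "a = fourier v0"
  have herm: "herm a" unfolding a_def by (rule herm_fourier[OF D(1,2)])
  have field: "\<i> * of_int n * of_real \<kappa> * a n = bo_field a n" for n
  proof -
    define f where "f h n = (exp (\<i> * of_int n * of_real (\<kappa> * h)) * a n - a n) / of_real h - bo_field a n" for h n
    have F: "f h = (\<lambda>n. (fourier (dshift (\<kappa> * (0 + h)) v0) n - fourier (dshift (\<kappa> * 0) v0) n) / of_real h
        - bo_field (fourier (dshift (\<kappa> * 0) v0)) n)" for h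
    proof -
      have "fourier (dshift 0 v0) = fourier v0" by (auto simp: fourier_dshift[OF D(1)])
      then show ?thesis by (intro ext) (simp add: f_def fourier_dshift[OF D(1)] a_def)
    qed
    have l: "l2 (jwt (\<sigma> - 2) (f h))" for h
      unfolding F by (rule classical_solution_derivative(1)[OF sol]) (use s in simp)
    have "((\<lambda>h. nrm (jwt (\<sigma> - 2) (f h))) \<longlongrightarrow> 0) (at 0)"
      unfolding F by (rule classical_solution_derivative(2)[OF sol]) (use s in simp)
    then have "((\<lambda>h. jbracket n powr (2 - \<sigma>) * nrm (jwt (\<sigma> - 2) (f h))) \<longlongrightarrow> 0) (at 0)"
      by (rule tendsto_mult_right_zero)
    moreover have "norm (f h n) \<le> jbracket n powr (2 - \<sigma>) * nrm (jwt (\<sigma> - 2) (f h))" for h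
    proof -
      have "jbracket n powr (2 - \<sigma>) * norm (jwt (\<sigma> - 2) (f h) n) \<le> jbracket n powr (2 - \<sigma>) * nrm (jwt (\<sigma> - 2) (f h))"
        by (intro mult_left_mono norm_le_nrm l) simp
      then show ?thesis
        using jbracket_ge_1[of n] by (simp add: norm_jwt mult.assoc[symmetric] powr_add[symmetric])
    qed
    ultimately have f0: "((\<lambda>h. f h n) \<longlongrightarrow> 0) (at 0)"
      by (rule Lim_null_comparison[OF always_eventually[OF allI], rotated])
    have "((\<lambda>z. exp (\<i> * of_int n * (of_real \<kappa> * z)) * a n) has_field_derivative \<i> * of_int n * of_real \<kappa> * a n) (at 0)"
      by (auto intro!: derivative_eq_intros)
    then have "((\<lambda>z. (exp (\<i> * of_int n * (of_real \<kappa> * z)) * a n - a n) / z) \<longlongrightarrow> \<i> * of_int n * of_real \<kappa> * a n) (at 0)"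
      by (simp add: DERIV_def)
    moreover have "filterlim complex_of_real (at 0) (at 0)"
      unfolding filterlim_at by (auto simp: eventually_at_filter intro!: tendsto_eq_intros)
    ultimately have "((\<lambda>h. (exp (\<i> * of_int n * (of_real \<kappa> * of_real h)) * a n - a n) / of_real h) \<longlongrightarrow> \<i> * of_int n * of_real \<kappa> * a n) (at 0)"
      by (rule filterlim_compose)
    then have "((\<lambda>h. f h n) \<longlongrightarrow> \<i> * of_int n * of_real \<kappa> * a n - bo_field a n) (at 0)"
      unfolding f_def of_real_mult by (rule tendsto_diff[OF _ tendsto_const])
    from LIM_unique[OF this f0] show ?thesis by simp
  qed
  \<comment> \<open>At n = 0 the equation says nothing; \<open>C\<close> is chosen so that the
    integrated equation holds there, and it is real by hermitian symmetry.\<close>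
  define C where "C = - Re (conv a a 0) - \<kappa> * Re (a 0)"
  have "abs_dd a n = conv a a n + of_real \<kappa> * a n + of_real C * unit_vec 0 n" for n
  proof (cases "n = 0")
    case True
    have "Im (w 0) = 0" if "herm w" for w
      using that[unfolded herm_def, rule_format, of 0] by (simp add: complex_eq_iff)
    note this[OF herm] this[OF herm_conv[OF herm herm]]
    then show ?thesis using True by (simp add: abs_dd_def complex_eq_iff C_def unit_vec_def)
  next
    case False
    have "\<i> * of_int n * (of_real \<kappa> * a n) = \<i> * of_int n * (abs_dd a n - conv a a n)"
      using field[of n] unfolding bo_field_def abs_dd_def mult.assoc .
    then have "of_real \<kappa> * a n = abs_dd a n - conv a a n"
      using False by simp
    then show ?thesis using False by (simp add: unit_vec_def)
  qed
  then show thesis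
    by (intro that[OF s v, of \<kappa> C] allI) (simp only: a_def)
qed

section \<open>Approximation by classical solutions and the contradiction\<close>

lemma fourier_diff: "fourier (u - w) = (\<lambda>n. fourier u n - fourier w n)"
  by (simp add: fun_eq_iff fourier_def diff_divide_distrib)

lemma sobolev_norm_diff: "sobolev_norm \<sigma> (u - w) = nrm (\<lambda>n. jwt \<sigma> (fourier u) n - jwt \<sigma> (fourier w) n)"
  by (simp add: sobolev_norm_nrm fourier_diff jwt_linear)

lemma sobolev_norm_diff_commute: "sobolev_norm \<sigma> (u - w) = sobolev_norm \<sigma> (w - u)"
  unfolding sobolev_norm_diff by (simp add: nrm_def norm_minus_commute)

lemma sobolev_norm_triangle:
  assumes "l2 (jwt \<sigma> (fourier u))" "l2 (jwt \<sigma> (fourier w))" "l2 (jwt \<sigma> (fourier z))"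
  shows "sobolev_norm \<sigma> (u - z) \<le> sobolev_norm \<sigma> (u - w) + sobolev_norm \<sigma> (w - z)"
  using nrm_triangle[OF l2_diff(1)[OF assms(1,2)] l2_diff(1)[OF assms(2,3)]]
  by (simp add: sobolev_norm_diff)

lemma nrm_weight_compare:
  assumes "0 \<le> s" "l2 (jwt (- s) a)"
  shows "neg_norm s 1 a \<le> nrm (jwt (- s) a)" "nrm (jwt (- s) a) \<le> 2 powr s * neg_norm s 1 a"
proof -
  have le1: "norm (wgt (- s) 1 a n) \<le> norm (jwt (- s) a n)" for n
    unfolding norm_wgt norm_jwt using jbracket_bounds[of n] jbracket_ge_1[of n] assms(1)
    by (intro mult_right_mono powr_mono2') auto
  show "neg_norm s 1 a \<le> nrm (jwt (- s) a)"
    unfolding neg_norm_def by (rule l2_mono(2)[OF assms(2) le1])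
  have "l2 (wgt (- s) 1 a)"
    by (rule l2_mono(1)[OF assms(2) le1])
  then have l: "l2 (\<lambda>n. of_real (2 powr s) * wgt (- s) 1 a n)"
    by (rule l2_scale)
  have le2: "norm (jwt (- s) a n) \<le> norm (of_real (2 powr s) * wgt (- s) 1 a n)" for n
  proof -
    have "(2 * jbracket n) powr (- s) \<le> (real_of_int \<bar>n\<bar> + 1) powr (- s)"
      using jbracket_bounds[of n] assms(1) by (intro powr_mono2') auto
    then have "2 powr s * (2 * jbracket n) powr (- s) \<le> 2 powr s * (real_of_int \<bar>n\<bar> + 1) powr (- s)"
      by (intro mult_left_mono) auto
    then have "jbracket n powr (- s) \<le> 2 powr s * (real_of_int \<bar>n\<bar> + 1) powr (- s)"
      using jbracket_ge_1[of n] by (simp add: powr_mult powr_minus mult.assoc[symmetric])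
    then have "jbracket n powr (- s) * norm (a n) \<le> 2 powr s * (real_of_int \<bar>n\<bar> + 1) powr (- s) * norm (a n)"
      by (rule mult_right_mono) simp
    then show ?thesis
      by (simp add: norm_jwt norm_wgt norm_mult mult.assoc)
  qed
  have "nrm (jwt (- s) a) \<le> nrm (\<lambda>n. of_real (2 powr s) * wgt (- s) 1 a n)"
    by (rule l2_mono(2)[OF l le2])
  then show "nrm (jwt (- s) a) \<le> 2 powr s * neg_norm s 1 a"
    by (simp add: nrm_scale neg_norm_def)
qed

lemma fser_herm_real:
  assumes "herm a" shows "fser a x \<in> \<real>"
proof -
  have "cnj (fser a x) = (\<Sum>\<^sub>\<infinity>n. a (- n) * chr (- n) x)"
    using assms by (simp add: fser_def herm_def cnj_chr flip: infsum_cnj)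
  also have "\<dots> = fser a x"
    unfolding fser_def by (rule infsum_reindex_bij_betw[of uminus]) (simp add: bij_uminus)
  finally show ?thesis by (simp add: Reals_cnj_iff)
qed

lemma real_valued_dist_of:
  assumes "continuous_on UNIV f" "\<And>x. f x \<in> \<real>"
  shows "real_valued (dist_of f)"
  unfolding real_valued_def
proof (intro allI impI)
  fix \<phi> assume \<phi>: "\<forall>x. tfun \<phi> x \<in> \<real>"
  have "f x * tfun \<phi> x = of_real (Re (f x * tfun \<phi> x))" for x
    using assms(2)[of x] \<phi> by (simp del: times_complex.sel)
  then have "dist_of f \<phi> = integral {0..2 * pi} (\<lambda>x. of_real (Re (f x * tfun \<phi> x)))"
    by (simp add: dist_of_def)
  also have "\<dots> = of_real (integral {0..2 * pi} (\<lambda>x. Re (f x * tfun \<phi> x)))"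
    by (intro integral_unique has_integral_of_real integrable_integral integrable_continuous_interval
        continuous_intros continuous_on_subset[OF assms(1)] subset_UNIV)
  finally show "dist_of f \<phi> \<in> \<real>" by simp
qed

lemma smooth_approximation:
  assumes w: "w \<in> sobolev \<rho>"
  obtains z :: "nat \<Rightarrow> functional"
    where "\<forall>M. z M \<in> sobolev \<sigma>" "(\<lambda>M. sobolev_norm \<rho> (z M - w)) \<longlonglongrightarrow> 0"
proof -
  define a where "a M n = (if \<bar>n\<bar> \<le> int M then fourier w n else 0)" for M n
  define z where "z M = dist_of (fser (a M))" for M
  note D = sobolevD[OF w]
  have fin: "finite {n. \<bar>n\<bar> \<le> int M}" for M
    by (rule finite_subset[of _ "{- int M..int M}"]) auto
  have l1: "l1 (a M)" for M
    unfolding l1_def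
    by (rule summable_on_cong_neutral[THEN iffD1, of _ "{n. \<bar>n\<bar> \<le> int M}" _ "\<lambda>n. norm (a M n)"])
      (use fin in \<open>auto simp: a_def\<close>)
  have f: "fourier (z M) = a M" for M
    unfolding z_def by (intro ext fourier_fser l1)
  have herm: "herm (a M)" for M
    using herm_fourier[OF D(1,2)] by (simp add: herm_def a_def)
  have zs: "z M \<in> sobolev \<sigma>" for M
  proof (rule sobolevI)
    show "real_valued (z M)"
      unfolding z_def by (intro real_valued_dist_of continuous_fser l1 fser_herm_real herm)
    show "distribution (z M)"
      unfolding z_def by (intro distribution_dist_of continuous_fser l1)
    show "l2 (jwt \<sigma> (fourier (z M)))"
      unfolding f by (rule l2_finite_support[OF fin[of M]]) (auto simp: a_def jwt_def)
  qed
  have "(\<lambda>M. sobolev_norm \<rho> (z M - w)) \<longlonglongrightarrow> 0"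
  proof -
    have sq: "(norm (jwt \<rho> (a M) n - jwt \<rho> (fourier w) n))\<^sup>2
        = (if \<bar>n\<bar> \<le> int M then 0 else (norm (jwt \<rho> (fourier w) n))\<^sup>2)" for M n
      by (simp add: a_def jwt_def)
    have "(\<lambda>M. sqrt (\<Sum>\<^sub>\<infinity>n. if \<bar>n\<bar> \<le> int M then 0 else (norm (jwt \<rho> (fourier w) n))\<^sup>2)) \<longlonglongrightarrow> sqrt 0"
      by (intro tendsto_real_sqrt tail_tendsto_0 D(3)[unfolded l2_def])
    then show ?thesis
      by (simp add: sobolev_norm_diff f nrm_def sq)
  qed
  with zs show thesis by (intro that allI)
qed

text \<open>The defining property of the global solution is applied to truncated Fourier series at
  regularity 3 and to the compact set consisting of the single time \<open>t\<close>.\<close>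

lemma classical_approximation:
  assumes w: "w \<in> sobolev (- s)" and S: "bo_global_solution s w S" and "\<eta> > 0"
  obtains z U where "z \<in> sobolev 3" "bo_classical_solution 3 z U"
    "sobolev_norm (- s) (z - w) < \<eta>" "sobolev_norm (- s) (U t - S t) < \<eta>"
proof -
  obtain z :: "nat \<Rightarrow> functional" where z: "\<forall>M. z M \<in> sobolev 3" "(\<lambda>M. sobolev_norm (- s) (z M - w)) \<longlonglongrightarrow> 0"
    by (rule smooth_approximation[OF w])
  have "\<exists>v. (\<forall>k. bo_classical_solution 3 (z k) (v k)) \<and>
        (\<forall>K. compact K \<longrightarrow> uniform_limit K (\<lambda>k t. sobolev_norm (- s) (v k t - S t)) (\<lambda>_. 0) sequentially)"
    using S z unfolding bo_global_solution_def by (elim conjE allE[of _ "3::real"] allE[of _ z]) simp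
  then obtain v where v: "\<forall>k. bo_classical_solution 3 (z k) (v k)"
    and unif: "\<forall>K. compact K \<longrightarrow> uniform_limit K (\<lambda>k t. sobolev_norm (- s) (v k t - S t)) (\<lambda>_. 0) sequentially"
    by blast
  from unif[rule_format, of "{t}"] have "(\<lambda>k. sobolev_norm (- s) (v k t - S t)) \<longlonglongrightarrow> 0"
    by simp
  then have "\<forall>\<^sub>F k in sequentially. sobolev_norm (- s) (v k t - S t) < \<eta>"
    by (rule order_tendstoD) fact
  moreover have "\<forall>\<^sub>F k in sequentially. sobolev_norm (- s) (z k - w) < \<eta>"
    by (rule order_tendstoD[OF z(2)]) fact
  ultimately have "\<forall>\<^sub>F k in sequentially. sobolev_norm (- s) (v k t - S t) < \<eta> \<and> sobolev_norm (- s) (z k - w) < \<eta>"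
    by (rule eventually_conj)
  then obtain k where "sobolev_norm (- s) (v k t - S t) < \<eta>" "sobolev_norm (- s) (z k - w) < \<eta>"
    by (auto dest: eventually_happens)
  then show thesis
    using that[of "z k" "v k"] z(1) v by blast
qed

lemma sobolev_dshift:
  assumes "v \<in> sobolev \<sigma>"
  shows "l2 (jwt \<sigma> (fourier (dshift \<tau> v)))"
proof -
  note D = sobolevD[OF assms]
  show ?thesis
    by (rule l2_mono(1)[OF D(3)]) (simp add: norm_jwt fourier_dshift[OF D(1)] norm_mult)
qed

theorem theorem3:
  fixes v\<^sub>0 :: functional and s :: real
  assumes "travelling_wave_data v\<^sub>0"
    and "0 \<le> s" and "s < 1/2"
  shows "\<forall>\<epsilon> > 0. \<exists>\<delta> > 0. \<forall>w\<^sub>0 \<in> sobolev (- s). sobolev_norm (- s) (w\<^sub>0 - v\<^sub>0) < \<delta> \<longrightarrow>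
    (\<forall>S. bo_global_solution s w\<^sub>0 S \<longrightarrow>
      (SUP t. INF \<tau>. ereal (sobolev_norm (- s) (S t - dshift \<tau> v\<^sub>0))) < ereal \<epsilon>)"
proof (rule ccontr)
  let ?d = "\<lambda>u w. sobolev_norm (- s) (u - w)"
  assume "\<not> ?thesis"
  then obtain \<epsilon> where e: "\<epsilon> > 0" and neg: "\<forall>\<delta>>0. \<exists>w\<in>sobolev (- s). ?d w v\<^sub>0 < \<delta> \<and>
      (\<exists>S. bo_global_solution s w S \<and> \<not> (SUP t. INF \<tau>. ereal (?d (S t) (dshift \<tau> v\<^sub>0))) < ereal \<epsilon>)"
    by (auto simp only: not_all not_ex not_imp bex_simps ball_simps Bex_def Ball_def de_Morgan_conj)
  obtain \<sigma> c C where \<sigma>: "\<sigma> > 3/2" and v0: "v\<^sub>0 \<in> sobolev \<sigma>" and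
    tw: "\<forall>n. abs_dd (fourier v\<^sub>0) n = conv (fourier v\<^sub>0) (fourier v\<^sub>0) n + of_real c * fourier v\<^sub>0 n + of_real C * unit_vec 0 n"
    by (rule travelling_wave_fourier[OF assms(1)])
  have v0s: "v\<^sub>0 \<in> sobolev (- s)"
    by (rule sobolev_mono[OF v0]) (use \<sigma> assms in simp)
  have "\<exists>t z U. z \<in> sobolev 3 \<and> bo_classical_solution 3 z U \<and> ?d z v\<^sub>0 < 2 / real (Suc k) \<and>
      (\<forall>\<tau>. ?d (U t) (dshift \<tau> v\<^sub>0) > \<epsilon> / 4)" for k
  proof -
    define \<delta> where "\<delta> = 1 / real (Suc k)"
    have \<delta>: "\<delta> > 0" by (simp add: \<delta>_def)
    obtain w S where w: "w \<in> sobolev (- s)" "?d w v\<^sub>0 < \<delta>" and S: "bo_global_solution s w S"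
      and not: "\<not> (SUP t. INF \<tau>. ereal (?d (S t) (dshift \<tau> v\<^sub>0))) < ereal \<epsilon>"
      using neg \<delta> by blast
    \<comment> \<open>A supremum at least \<epsilon> need not be attained, so the bad time is chosen
      with infimum above half of it.\<close>
    have "ereal (\<epsilon> / 2) < ereal \<epsilon>" using e by simp
    from less_le_trans[OF this leI[OF not]] obtain t
      where t: "ereal (\<epsilon> / 2) < (INF \<tau>. ereal (?d (S t) (dshift \<tau> v\<^sub>0)))"
      unfolding less_SUP_iff by blast
    have far: "\<epsilon> / 2 < ?d (S t) (dshift \<tau> v\<^sub>0)" for \<tau>
      using less_le_trans[OF t INF_lower[OF UNIV_I, of "\<lambda>\<tau>. ereal (?d (S t) (dshift \<tau> v\<^sub>0))" \<tau>]] by simp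
    \<comment> \<open>Half of the gap \<epsilon> / 2 may be spent on replacing the orbit by a
      classical one, which leaves \<epsilon> / 4; the bound by \<delta> keeps the initial data
      within 2 \<delta> of the wave.\<close>
    define \<eta> where "\<eta> = min \<delta> (\<epsilon> / 4)"
    have \<eta>: "\<eta> > 0" "\<eta> \<le> \<delta>" "\<eta> \<le> \<epsilon> / 4" using \<delta> e by (auto simp: \<eta>_def)
    obtain z U where z: "z \<in> sobolev 3" and U: "bo_classical_solution 3 z U"
      and near: "?d z w < \<eta>" "?d (U t) (S t) < \<eta>"
      by (rule classical_approximation[OF w(1) S \<eta>(1)])
    have "U t \<in> sobolev 3"
      using U by (auto simp: bo_classical_solution_def sobolev_curve_def)
    then have Us: "U t \<in> sobolev (- s)"
      by (rule sobolev_mono) (use assms in simp)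
    have zs: "z \<in> sobolev (- s)"
      by (rule sobolev_mono[OF z]) (use assms in simp)
    have Ss: "S t \<in> sobolev (- s)"
      using S by (auto simp: bo_global_solution_def sobolev_curve_def)
    have "?d z v\<^sub>0 < 2 / real (Suc k)"
    proof -
      have "?d z v\<^sub>0 \<le> ?d z w + ?d w v\<^sub>0"
        by (intro sobolev_norm_triangle sobolevD(3)[OF zs] sobolevD(3)[OF w(1)] sobolevD(3)[OF v0s])
      moreover have "2 / real (Suc k) = \<delta> + \<delta>" by (simp add: \<delta>_def)
      ultimately show ?thesis using near(1) w(2) \<eta>(2) by linarith
    qed
    moreover have "?d (U t) (dshift \<tau> v\<^sub>0) > \<epsilon> / 4" for \<tau>
    proof -
      have "?d (S t) (dshift \<tau> v\<^sub>0) \<le> ?d (S t) (U t) + ?d (U t) (dshift \<tau> v\<^sub>0)"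
        by (intro sobolev_norm_triangle sobolevD(3)[OF Ss] sobolevD(3)[OF Us] sobolev_dshift[OF v0s])
      then show ?thesis
        using far[of \<tau>] near(2) \<eta>(3) sobolev_norm_diff_commute[of "- s" "S t" "U t"] by linarith
    qed
    ultimately show ?thesis using z U by blast
  qed
  then obtain t z U where z: "\<And>k. z k \<in> sobolev 3" and U: "\<And>k. bo_classical_solution 3 (z k) (U k)"
    and near: "\<And>k. ?d (z k) v\<^sub>0 < 2 / real (Suc k)" and far: "\<And>k \<tau>. ?d (U k (t k)) (dshift \<tau> v\<^sub>0) > \<epsilon> / 4"
    by metis
  let ?v = "fourier v\<^sub>0"
  have Us: "U k t \<in> sobolev (- s)" for k t
  proof (rule sobolev_mono)
    show "U k t \<in> sobolev 3"
      using U[of k] by (auto simp: bo_classical_solution_def sobolev_curve_def)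
  qed (use assms in simp)
  have U0: "U k 0 = z k" for k
    using U[of k] by (simp add: bo_classical_solution_def)
  have l1: "l1 ?v" "l1 (dd ?v)"
    using jwt_l1[OF sobolevD(3)[OF v0]] jwt_l1[OF jwt_dd[OF sobolevD(3)[OF v0]]] \<sigma> by auto
  have herm: "herm ?v"
    by (rule herm_fourier[OF sobolevD(1,2)[OF v0]])
  have conv0: "(\<lambda>k. neg_norm s 1 (\<lambda>n. fourier (U k 0) n - ?v n)) \<longlonglongrightarrow> 0"
  proof -
    have N: "neg_norm s 1 (\<lambda>n. fourier (U k 0) n - ?v n) \<le> ?d (U k 0) v\<^sub>0" for k
      unfolding sobolev_norm_nrm fourier_diff
      by (rule nrm_weight_compare(1)[OF assms(2)])
        (unfold jwt_linear, intro l2_diff(1) sobolevD(3)[OF Us] sobolevD(3)[OF v0s])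
    have le: "norm (neg_norm s 1 (\<lambda>n. fourier (U k 0) n - ?v n)) \<le> 2 / real (Suc k)" for k
      using order_trans[OF N less_imp_le[OF near[of k, folded U0]]] by (simp add: neg_norm_def)
    have "(\<lambda>k. 2 / real (Suc k)) \<longlonglongrightarrow> 0"
      using LIMSEQ_Suc[OF lim_const_over_n[of 2]] by simp
    then show ?thesis
      by (rule Lim_null_comparison[OF always_eventually[OF allI[OF le]]])
  qed
  have flow: "bo_flow (\<lambda>t. fourier (U k t))" for k
    by (rule classical_solution_bo_flow[OF U])
  obtain r \<tau> where r: "strict_mono (r :: nat \<Rightarrow> nat)" and
    lim: "(\<lambda>k. neg_norm s 1 (\<lambda>n. fourier (U (r k) (t (r k))) n - exp (\<i> * of_int n * of_real \<tau>) * ?v n)) \<longlonglongrightarrow> 0"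
    by (rule orbit_compact[OF herm l1 tw[rule_format] assms(2,3) flow conv0, where t = t])
  have "(\<lambda>k. 2 powr s * neg_norm s 1 (\<lambda>n. fourier (U (r k) (t (r k))) n - exp (\<i> * of_int n * of_real \<tau>) * ?v n)) \<longlonglongrightarrow> 2 powr s * 0"
    by (rule tendsto_mult_left[OF lim])
  then have "\<forall>\<^sub>F k in sequentially. 2 powr s * neg_norm s 1 (\<lambda>n. fourier (U (r k) (t (r k))) n - exp (\<i> * of_int n * of_real \<tau>) * ?v n) < \<epsilon> / 4"
    by (rule order_tendstoD) (use e in simp)
  then obtain k where k: "2 powr s * neg_norm s 1 (\<lambda>n. fourier (U (r k) (t (r k))) n - exp (\<i> * of_int n * of_real \<tau>) * ?v n) < \<epsilon> / 4"
    by (auto dest: eventually_happens)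
  have "?d (U (r k) (t (r k))) (dshift \<tau> v\<^sub>0)
      \<le> 2 powr s * neg_norm s 1 (\<lambda>n. fourier (U (r k) (t (r k))) n - fourier (dshift \<tau> v\<^sub>0) n)"
    unfolding sobolev_norm_nrm fourier_diff
    by (rule nrm_weight_compare(2)[OF assms(2)])
      (unfold jwt_linear, intro l2_diff(1) sobolevD(3)[OF Us] sobolev_dshift[OF v0s])
  then show False
    using k far[of "r k" \<tau>] by (simp add: fourier_dshift[OF sobolevD(1)[OF v0s]])
qed

end
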